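(* Let $p\equiv 1 \mod 4$ be a prime number. Then (a) for every $\varepsilon>0$ we have $\mathrm{kiss}(X^{p,q}) \leq |X^{p,q}|^{4/3+\varepsilon}$ for all large enough prime numbers $q \equiv 1 \mod 4$ such that $\left(\frac{p}{q}\right)=-1$; and (b) there exists an infinite sequence of prime numbers $(q_k)_k$ satisfying $q_k\equiv 1 \mod 4$ and $\left(\frac{p}{q_k}\right)=-1$ for all $k$, such that for every $\varepsilon>0$ we have $\mathrm{kiss}(X^{p,q_k}) \geq |X^{p,q_k}|^{4/3-\varepsilon}$ for all large enough $k$.
   Context: Here $|X^{p,q}|$ denotes the number of vertices of $X^{p,q}$. Let $p\neq q$ be primes with $p\equiv q\equiv 1 \mod 4$ and Legendre symbol $\left(\frac{p}{q}\right)=-1$. Let $\mathbb{H}(\mathbb{Z})=\{x_0+x_1 i+x_2 j+x_3 k : x_i\in\mathbb{Z}\}$ be the integral Hamiltonian quaternions ($i^2=j^2=k^2=ijk=-1$), with norm $N(x)=x_0^2+x_1^2+x_2^2+x_3^2$. Let $\Lambda(2)$ be the set of $x\in\mathbb{H}(\mathbb{Z})$ with $x\equiv 1 \mod 2$ (i.e. $x_0$ odd and $x_1,x_2,x_3$ even) and $N(x)=p^m$ for some integer $m\geq 0$, modulo the equivalence $x\sim y \iff x=\pm p^m y$ for some $m\in\mathbb{Z}$; quaternion multiplication makes $\Lambda(2)$ a group. Let $S\subset\Lambda(2)$ be the set of classes of $x$ with $N(x)=p$, $x_0>0$, $x_0$ odd ($|S|=p+1$). Let $\Lambda(2q)$ be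 the normal subgroup of classes $[x_0+x_1i+x_2j+x_3k]\in\Lambda(2)$ with $2q\mid x_1,x_2,x_3$. Then $X^{p,q}=\mathrm{Cay}(\Lambda(2)/\Lambda(2q),S)$, a $(p+1)$-regular graph. The kissing number $\mathrm{kiss}(G)$ of a graph is the number of distinct shortest oriented cycles in $G$, i.e. oriented cycles whose length equals the girth (the smallest length of a non-backtracking closed walk). *)

theory Defs
  imports Complex_Main "HOL-Number_Theory.Number_Theory" "HOL-Algebra.Coset"
begin

text \<open>x0 + x1 i + x2 j + x3 k is represented by the tuple (x0, x1, x2, x3).\<close>
type_synonym quat = "int \<times> int \<times> int \<times> int"

fun qmul :: "quat \<Rightarrow> quat \<Rightarrow> quat" where
  "qmul (a0, a1, a2, a3) (b0, b1, b2, b3) =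
     (a0*b0 - a1*b1 - a2*b2 - a3*b3,
      a0*b1 + a1*b0 + a2*b3 - a3*b2,
      a0*b2 - a1*b3 + a2*b0 + a3*b1,
      a0*b3 + a1*b2 - a2*b1 + a3*b0)"

fun qscale :: "int \<Rightarrow> quat \<Rightarrow> quat" where
  "qscale c (a0, a1, a2, a3) = (c*a0, c*a1, c*a2, c*a3)"

fun qnorm :: "quat \<Rightarrow> int" where
  "qnorm (a0, a1, a2, a3) = a0^2 + a1^2 + a2^2 + a3^2"

fun qre :: "quat \<Rightarrow> int" where "qre (a0, a1, a2, a3) = a0"
fun qi :: "quat \<Rightarrow> int" where "qi (a0, a1, a2, a3) = a1"
fun qj :: "quat \<Rightarrow> int" where "qj (a0, a1, a2, a3) = a2"
fun qk :: "quat \<Rightarrow> int" where "qk (a0, a1, a2, a3) = a3"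

definition L2 :: "nat \<Rightarrow> quat set" where
  "L2 p = {x. odd (qre x) \<and> even (qi x) \<and> even (qj x) \<and> even (qk x)
              \<and> (\<exists>m::nat. qnorm x = int p ^ m)}"

text \<open>x ~ y iff x = +-p^m y for some integer m, i.e. p^a x = +- p^b y for naturals a, b.\<close>
definition lam_equiv :: "nat \<Rightarrow> quat \<Rightarrow> quat \<Rightarrow> bool" where
  "lam_equiv p x y \<longleftrightarrow> (\<exists>a b::nat. qscale (int p ^ a) x = qscale (int p ^ b) y
                                 \<or> qscale (int p ^ a) x = qscale (- (int p ^ b)) y)"

definition lam_class :: "nat \<Rightarrow> quat \<Rightarrow> quat set" where
  "lam_class p x = {y \<in> L2 p. lam_equiv p x y}"

definition Lambda2 :: "nat \<Rightarrow> quat set monoid" where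
  "Lambda2 p = \<lparr> carrier = lam_class p ` L2 p,
                 mult = (\<lambda>A B. lam_class p (qmul (SOME x. x \<in> A) (SOME y. y \<in> B))),
                 one = lam_class p (1, 0, 0, 0) \<rparr>"

definition Lambda2q :: "nat \<Rightarrow> nat \<Rightarrow> quat set set" where
  "Lambda2q p q = {A \<in> carrier (Lambda2 p). \<exists>x\<in>A.
      2 * int q dvd qi x \<and> 2 * int q dvd qj x \<and> 2 * int q dvd qk x}"

definition Sgen :: "nat \<Rightarrow> quat set set" where
  "Sgen p = lam_class p ` {x. qnorm x = int p \<and> qre x > 0 \<and> odd (qre x)
                              \<and> even (qi x) \<and> even (qj x) \<and> even (qk x)}"

definition XV :: "nat \<Rightarrow> nat \<Rightarrow> quat set set set" where
  "XV p q = rcosets\<^bsub>Lambda2 p\<^esub> (Lambda2q p q)"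

definition XE :: "nat \<Rightarrow> nat \<Rightarrow> quat set set \<Rightarrow> quat set set \<Rightarrow> bool" where
  "XE p q C D \<longleftrightarrow> (\<exists>a\<in>carrier (Lambda2 p). \<exists>s\<in>Sgen p.
      C = Lambda2q p q #>\<^bsub>Lambda2 p\<^esub> a \<and>
      D = Lambda2q p q #>\<^bsub>Lambda2 p\<^esub> (a \<otimes>\<^bsub>Lambda2 p\<^esub> s))"

definition nb_closed_walk :: "'a set \<Rightarrow> ('a \<Rightarrow> 'a \<Rightarrow> bool) \<Rightarrow> 'a list \<Rightarrow> bool" where
  "nb_closed_walk V E ws \<longleftrightarrow> length ws \<ge> 2 \<and> set ws \<subseteq> V \<and> hd ws = last ws
     \<and> (\<forall>i. i + 1 < length ws \<longrightarrow> E (ws ! i) (ws ! (i + 1)))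
     \<and> (\<forall>i. i + 2 < length ws \<longrightarrow> ws ! (i + 2) \<noteq> ws ! i)"

definition girth :: "'a set \<Rightarrow> ('a \<Rightarrow> 'a \<Rightarrow> bool) \<Rightarrow> nat" where
  "girth V E = (LEAST n. \<exists>ws. nb_closed_walk V E ws \<and> length ws = n + 1)"

text \<open>A closed walk [v0,...,v(n-1)] (returning to v0) which is non-backtracking also at the
  base point; an oriented cycle is such a walk up to the choice of starting point (rotation).\<close>
definition cyc_nb_walk :: "'a set \<Rightarrow> ('a \<Rightarrow> 'a \<Rightarrow> bool) \<Rightarrow> 'a list \<Rightarrow> bool" where
  "cyc_nb_walk V E xs \<longleftrightarrow> xs \<noteq> [] \<and> set xs \<subseteq> V
     \<and> (\<forall>i < length xs. E (xs ! i) (xs ! ((i + 1) mod length xs))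
          \<and> (length xs = 1 \<or> xs ! ((i + 2) mod length xs) \<noteq> xs ! i))"

definition oriented_cycle :: "'a list \<Rightarrow> 'a list set" where
  "oriented_cycle xs = {rotate k xs | k. True}"

definition kiss :: "'a set \<Rightarrow> ('a \<Rightarrow> 'a \<Rightarrow> bool) \<Rightarrow> nat" where
  "kiss V E = card (oriented_cycle ` {xs. cyc_nb_walk V E xs \<and> length xs = girth V E})"

end

theory Submission
  imports Complex_Main "HOL-Real_Asymp.Real_Asymp" "HOL-Number_Theory.Number_Theory" Defs
begin

text \<open>
  Elements of \<open>\<Lambda>(2)\<close> correspond to reduced words in \<open>S\<close>, that is, to quaternions primitive at \<open>p\<close>, and closed
  non-backtracking walks at a vertex to reduced words lying in \<open>\<Lambda>(2q)\<close>. Such a word has even length \<open>2m\<close>, and its real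
  part is \<open>\<plusminus>(p^m - 2 r q^2)\<close> with \<open>1 \<le> r < p^m/q^2\<close>; its imaginary part is \<open>2q\<close> times a representation of
  \<open>r (p^m - r q^2)\<close> as a sum of three squares. Since \<open>r_3(n) \<le> n^(1/2 + \<epsilon>)\<close>, there are at most
  \<open>(p^m)^2 q^(-3) (p^m)^\<epsilon>\<close> such words. Counting collisions of words of length \<open>m\<close> with \<open>p^m \<approx> q^3\<close> and
  Cauchy--Schwarz give \<open>|X| \<ge> q^(3 - \<epsilon>)\<close>, while \<open>|X| \<le> 2 q^3\<close> because a vertex is determined by a quaternion
  modulo \<open>q\<close> up to scalars. As \<open>2 (p^m - 2 q^2)\<close> is 2 modulo 4, it is a sum of three squares, so the girth is \<open>2m\<close>
  with \<open>p^m\<close> of size \<open>q^2\<close>; this proves (a).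

  For (b) one representation \<open>v\<close> has to be turned into \<open>n^(1/2 - \<epsilon>)\<close> many. If \<open>-n\<close> is a square modulo a prime \<open>l\<close>, then
  \<open>v\<close> can be conjugated by a quaternion \<open>b\<close> of norm \<open>l\<close> so that \<open>b^-1 v b\<close> is integral again. Products over
  different sets of such primes below a power of \<open>log q\<close> give different representations as long as the product of the
  primes stays below the square root of the primitive part of \<open>n\<close>. A second moment bound shows that for most \<open>q\<close> a
  quarter of the primes is available, and for most \<open>q\<close> the content of \<open>v\<close> is small. Admissible primes \<open>q\<close> are
  plentiful by a density theorem for primes with prescribed values of quadratic characters, for which non-vanishing of
  \<open>L(1, \<chi>)\<close> for real \<open>\<chi>\<close> suffices.
\<close>

section \<open>Primes prescribed by real characters\<close>

text \<open>The exponent comes from the scale of the girth: \<open>p^m\<close> of size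
  \<open>q^2\<close> turns the word count \<open>p^(2m) q^(-3)\<close> into \<open>q\<close>, and
  \<open>|X|\<close> of size \<open>q^3\<close> base points give \<open>q^4\<close>. The bound on
  \<open>r_3\<close> from above holds for every \<open>n\<close>, so (a) holds for every large
  \<open>q\<close>. A bound \<open>r_3(n) \<ge> n^(1/2 - \<epsilon>)\<close> for one given
  \<open>n\<close> amounts to a lower bound for a class number; this is the obstacle in (b). There
  new representations are made out of a known one while \<open>q\<close> varies, and the exceptional
  \<open>q\<close> only have to be fewer than the admissible ones. Since the exponent
  \<open>m\<close> of the girth depends on \<open>q\<close>, every property wanted from
  \<open>q\<close> is asked for all O(log q) possible \<open>m\<close>. Conjugating primes up to
  \<open>y = (log q)^a\<close> are enough: choosing \<open>t\<close> of about
  \<open>y / log y\<close> primes, with \<open>y^t\<close> near \<open>q\<close>, gives at least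
  \<open>(y / (t log y))^t\<close> sets, and as \<open>t log y\<close> is about \<open>log q\<close>
  the loss is only \<open>q^(O(1/a))\<close>.\<close>

lemma sum_divisors_swap:
  fixes h :: "nat \<Rightarrow> nat \<Rightarrow> 'a::comm_monoid_add"
  shows "(\<Sum>n=1..K. \<Sum>d | d dvd n. h d (n div d)) = (\<Sum>d=1..K. \<Sum>e=1..K div d. h d e)"
proof -
  have "(\<Sum>n=1..K. \<Sum>d | d dvd n. h d (n div d))
      = (\<Sum>(n,d)\<in>(SIGMA n:{1..K}. {d. d dvd n}). h d (n div d))"
    by (rule sum.Sigma) auto
  also have "\<dots> = (\<Sum>(d,e)\<in>(SIGMA d:{1..K}. {1..K div d}). h d e)"
  proof (rule sum.reindex_bij_witness[where i="\<lambda>(d,e). (d*e,d)" and j="\<lambda>(n,d). (d,n div d)"], goal_cases)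
    case (1 a) then show ?case by auto
  next
    case (2 a)
    then obtain n d where a: "a = (n,d)" "1 \<le> n" "n \<le> K" "d dvd n" by auto
    have "d \<le> n" using a by (auto intro: dvd_imp_le)
    moreover have "1 \<le> n div d" using a by (auto elim!: dvdE)
    moreover have "n div d \<le> K div d" using a by (simp add: div_le_mono)
    moreover have "1 \<le> d" using a by (cases d) auto
    ultimately show ?case using a by auto
  next
    case (3 b) then show ?case by auto
  next
    case (4 b)
    then obtain d e where b: "b = (d,e)" "1 \<le> d" "d \<le> K" "1 \<le> e" "e \<le> K div d" by auto
    have "d * e \<le> d * (K div d)" using b by simp
    also have "\<dots> \<le> K" by simp
    finally show ?case using b by auto
  next
    case (5 a) then show ?case by auto
  qed
  also have "\<dots> = (\<Sum>d=1..K. \<Sum>e=1..K div d. h d e)"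
    by (rule sum.Sigma[symmetric]) auto
  finally show ?thesis .
qed

text \<open>Summation by parts: the weights \<open>f\<close> decrease, so their differences
  telescope to \<open>f (Suc m)\<close>. Monotonicity is asked only beyond \<open>m\<close>, because
  a weight such as \<open>ln n / n\<close> decreases only from some point on.\<close>

lemma abel_summation_bound:
  fixes a f :: "nat \<Rightarrow> real"
  assumes S: "\<And>k. \<bar>\<Sum>n=Suc m..k. a n\<bar> \<le> B"
    and dec: "\<And>n. n > m \<Longrightarrow> f (Suc n) \<le> f n" and nn: "\<And>n. n > m \<Longrightarrow> 0 \<le> f n"
  shows "\<bar>\<Sum>n=Suc m..k. a n * f n\<bar> \<le> B * f (Suc m)"
proof (cases "k > m")
  case True
  define s where "s k = (\<Sum>n=Suc m..k. a n)" for k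
  have id: "(\<Sum>n=Suc m..Suc m + j. a n * f n)
      = s (Suc m + j) * f (Suc m + j) + (\<Sum>i<j. s (Suc m + i) * (f (Suc m + i) - f (Suc m + Suc i)))" for j
  proof (induction j)
    case 0 show ?case by (simp add: s_def)
  next
    case (Suc j)
    have "s (Suc m + Suc j) = s (Suc m + j) + a (Suc m + Suc j)"
      by (simp add: s_def)
    then show ?case using Suc by (simp add: algebra_simps)
  qed
  obtain j where j: "k = Suc m + j" using True less_iff_Suc_add by auto
  have sB: "\<bar>s i\<bar> \<le> B" for i using S by (simp add: s_def)
  have tel: "(\<Sum>i<j. f (Suc m + i) - f (Suc m + Suc i)) = f (Suc m) - f (Suc m + j)"
    by (induction j) auto
  have "\<bar>\<Sum>n=Suc m..k. a n * f n\<bar> \<le> \<bar>s (Suc m + j) * f (Suc m + j)\<bar>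
      + \<bar>\<Sum>i<j. s (Suc m + i) * (f (Suc m + i) - f (Suc m + Suc i))\<bar>"
    unfolding j id by (rule abs_triangle_ineq)
  also have "\<dots> \<le> B * f (Suc m + j) + (\<Sum>i<j. B * (f (Suc m + i) - f (Suc m + Suc i)))"
  proof (rule add_mono)
    show "\<bar>s (Suc m + j) * f (Suc m + j)\<bar> \<le> B * f (Suc m + j)"
      using sB[of "Suc m + j"] nn[of "Suc m + j"] by (simp add: abs_mult mult_right_mono)
    show "\<bar>\<Sum>i<j. s (Suc m + i) * (f (Suc m + i) - f (Suc m + Suc i))\<bar> \<le> (\<Sum>i<j. B * (f (Suc m + i) - f (Suc m + Suc i)))"
    proof (rule order_trans[OF sum_abs], rule sum_mono)
      fix i
      have "f (Suc m + Suc i) \<le> f (Suc m + i)" using dec[of "Suc m + i"] by simp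
      then show "\<bar>s (Suc m + i) * (f (Suc m + i) - f (Suc m + Suc i))\<bar> \<le> B * (f (Suc m + i) - f (Suc m + Suc i))"
        using sB[of "Suc m + i"] by (simp add: abs_mult mult_right_mono)
    qed
  qed
  also have "\<dots> = B * f (Suc m)"
    unfolding sum_distrib_left[symmetric] tel by (simp add: algebra_simps)
  finally show ?thesis .
next
  case False
  have "0 \<le> B" using S[of 0] by simp
  then show ?thesis using False nn[of "Suc m"] by simp
qed

lemma real_div_le: "real (n div d) \<le> real n / real d"
proof (cases "d = 0")
  case False
  have "d * (n div d) \<le> n" by simp
  then have "real d * real (n div d) \<le> real n" by (metis of_nat_le_iff of_nat_mult)
  then show ?thesis using False by (simp add: field_simps)
qed simp

lemma real_div_gt: "d > 0 \<Longrightarrow> real n / real d < real (n div d) + 1"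
proof -
  assume d: "d > 0"
  have "n < d * (n div d) + d" using d by (metis add_strict_left_mono mod_less_divisor mult_div_mod_eq)
  then have "real n < real d * real (n div d) + real d" by (metis of_nat_add of_nat_less_iff of_nat_mult)
  then show ?thesis using d by (simp add: field_simps)
qed

section \<open>Chebyshev and Mertens estimates\<close>

definition psi :: "nat \<Rightarrow> real" where "psi n = (\<Sum>d=1..n. mangoldt d)"

lemma mangoldt_nonneg' [simp]: "0 \<le> (mangoldt n :: real)"
  by (auto simp: mangoldt_def aprimedivisor_pos_nat primepow_gt_Suc_0 Suc_le_eq intro!: ln_ge_zero)

lemma sum_ln_eq_mangoldt: "(\<Sum>n=1..K. ln (real n)) = (\<Sum>d=1..K. mangoldt d * real (K div d))"
proof -
  have "(\<Sum>n=1..K. ln (real n)) = (\<Sum>n=1..K. \<Sum>d | d dvd n. mangoldt d)"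
    by (intro sum.cong refl) (subst mangoldt_sum, auto)
  also have "\<dots> = (\<Sum>d=1..K. \<Sum>e=1..K div d. mangoldt d)"
    by (rule sum_divisors_swap)
  finally show ?thesis by (simp add: mult.commute)
qed

lemma sum_ln_fact: "(\<Sum>n=1..K. ln (real n)) = ln (fact K)"
  by (induction K) (auto simp: ln_mult)

text \<open>Chebyshev's argument: \<open>mangoldt d\<close> enters \<open>ln (2m choose m)\<close>
  with weight \<open>2m div d - 2 (m div d)\<close>, which is nonnegative and at least 1 for
  \<open>m < d \<le> 2m\<close>, while the binomial coefficient is at most
  \<open>4^m\<close>.\<close>

lemma psi_double: "psi (2*m) \<le> psi m + 2 * real m * ln 2"
proof -
  have b: "((2*m) choose m) \<le> 4 ^ m"
  proof -
    have "((2*m) choose m) \<le> (\<Sum>k\<le>2*m. (2*m) choose k)"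
      by (rule member_le_sum[of m "{..2*m}" "\<lambda>k. (2*m) choose k"]) auto
    also have "\<dots> = 2 ^ (2*m)" by (rule choose_row_sum)
    finally show ?thesis by (simp add: power_mult)
  qed
  have f: "(fact (2*m) :: real) = fact m * fact m * real ((2*m) choose m)"
  proof -
    have "fact m * fact m * ((2*m) choose m) = fact (2*m)"
      using binomial_fact_lemma[of m "2*m"] by (simp add: mult_2)
    from arg_cong[OF this, of real] show ?thesis by (simp only: of_nat_mult of_nat_fact)
  qed
  have "(\<Sum>n=1..2*m. ln (real n)) - 2 * (\<Sum>n=1..m. ln (real n)) = ln (real ((2*m) choose m))"
  proof -
    have "real ((2*m) choose m) > 0" by simp
    then have "ln (fact m * fact m * real ((2*m) choose m)) = ln (fact m) + ln (fact m) + ln (real ((2*m) choose m))"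
      by (simp only: ln_mult) simp
    then show ?thesis unfolding sum_ln_fact f by linarith
  qed
  also have "\<dots> \<le> ln (4 ^ m)"
  proof -
    have "real ((2*m) choose m) \<le> real (4 ^ m)" using b by (simp only: of_nat_le_iff)
    moreover have "0 < real ((2*m) choose m)" by simp
    ultimately show ?thesis by (subst ln_le_cancel_iff) simp_all
  qed
  also have "\<dots> = 2 * real m * ln 2"
  proof -
    have "(4::real) ^ m = 2 ^ (2*m)" by (simp add: power_mult)
    then show ?thesis by (simp only: ln_realpow)
  qed
  finally have 1: "(\<Sum>n=1..2*m. ln (real n)) - 2 * (\<Sum>n=1..m. ln (real n)) \<le> 2 * real m * ln 2" .
  have e: "(\<Sum>d=1..m. mangoldt d * real (m div d)) = (\<Sum>d=1..2*m. mangoldt d * real (m div d))"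
    by (rule sum.mono_neutral_left) auto
  have e2: "psi m = (\<Sum>d=1..2*m. if d \<le> m then mangoldt d else 0)"
    unfolding psi_def by (rule sum.mono_neutral_cong_left) auto
  have "psi (2*m) - psi m = (\<Sum>d=1..2*m. mangoldt d * (1 - (if d \<le> m then 1 else 0)))"
    unfolding psi_def[of "2*m"] e2 sum_subtractf[symmetric] by (rule sum.cong) auto
  also have "\<dots> \<le> (\<Sum>d=1..2*m. mangoldt d * (real (2*m div d) - 2 * real (m div d)))"
  proof (intro sum_mono mult_left_mono)
    fix d assume d: "d \<in> {1..2*m}"
    show "1 - (if d \<le> m then 1 else 0) \<le> real (2*m div d) - 2 * real (m div d)"
    proof (cases "d \<le> m")
      case True
      have "d * (2 * (m div d)) \<le> 2 * m" using times_div_less_eq_dividend[of d m] by linarith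
      then have "2 * (m div d) \<le> 2*m div d" using d by (subst less_eq_div_iff_mult_less_eq) (auto simp: mult.commute)
      then show ?thesis using True by simp
    next
      case False
      then have "m div d = 0" by simp
      moreover have "1 \<le> 2*m div d" using d by (subst less_eq_div_iff_mult_less_eq) auto
      ultimately show ?thesis using False by simp
    qed
  qed auto
  also have "\<dots> = (\<Sum>n=1..2*m. ln (real n)) - 2 * (\<Sum>n=1..m. ln (real n))"
    unfolding sum_ln_eq_mangoldt e by (simp add: algebra_simps sum_subtractf sum_distrib_left)
  finally show ?thesis using 1 by simp
qed

lemma mangoldt_le_ln: "n \<ge> 1 \<Longrightarrow> (mangoldt n :: real) \<le> ln (real n)"
  using member_le_sum[of n "{d. d dvd n}" "mangoldt :: nat \<Rightarrow> real"] mangoldt_sum[of n, where 'a=real] by auto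

text \<open>Induction by halving. The constant 4 leaves room for the odd case
  \<open>n = 2 m + 1\<close>: \<open>6 m\<close> from doubling plus
  \<open>ln n \<le> n - 1 = 2 m\<close> stays below \<open>4 n\<close>.\<close>

lemma psi_le: "psi n \<le> 4 * real n"
proof (induction n rule: less_induct)
  case (less n)
  have l2: "ln 2 \<le> (1::real)" using ln_2_less_1 by simp
  show ?case
  proof (cases "n \<le> 1")
    case True
    then have "n = 0 \<or> n = 1" by auto
    then show ?thesis by (auto simp: psi_def)
  next
    case False
    define m where "m = n div 2"
    have m: "m < n" "1 \<le> m" using False by (auto simp: m_def)
    have IH: "psi m \<le> 4 * real m" using less m by blast
    have d: "psi (2*m) \<le> 6 * real m"
      using psi_double[of m] IH mult_left_mono[OF l2, of "2 * real m"] by simp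
    show ?thesis
    proof (cases "even n")
      case True
      then have "n = 2*m" by (simp add: m_def)
      then show ?thesis using d by simp
    next
      case False
      then have n: "n = Suc (2*m)" by (simp add: m_def)
      have "psi n = psi (2*m) + mangoldt n" by (simp add: psi_def n)
      also have "mangoldt n \<le> ln (real n)" by (rule mangoldt_le_ln) (simp add: n)
      also have "ln (real n) \<le> real n - 1" by (rule ln_le_minus_one) (simp add: n)
      finally show ?thesis using d n by simp
    qed
  qed
qed

text \<open>Two evaluations of \<open>ln (K!)\<close> are compared: \<open>K ln K\<close> up to an
  error \<open>K\<close>, and the sum of \<open>mangoldt d\<close> times \<open>K div d\<close>.
  Removing the floors costs at most \<open>psi K \<le> 4 K\<close>, which is the source of the
  4.\<close>

lemma mertens_mangoldt:
  assumes "K \<ge> 1"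
  shows "\<bar>(\<Sum>d=1..K. mangoldt d / real d) - ln (real K)\<bar> \<le> 4"
proof -
  define T where "T = (\<Sum>d=1..K. mangoldt d / real d)"
  have up: "(\<Sum>n=1..K. ln (real n)) \<le> real K * ln (real K)"
    using sum_bounded_above[of "{1..K}" "\<lambda>n. ln (real n)" "ln (real K)"] by simp
  have "real (Suc n) * ln (real (Suc n)) - real (Suc n) \<le> real n * ln (real n) - real n + ln (real (Suc n))" if "n \<ge> 1" for n
  proof -
    have "ln (real (Suc n) / real n) \<le> real (Suc n) / real n - 1" by (rule ln_le_minus_one) (use that in auto)
    then have "ln (real (Suc n)) - ln (real n) \<le> 1 / real n" using that by (simp add: ln_div field_simps)
    then have "real n * (ln (real (Suc n)) - ln (real n)) \<le> 1" using that by (simp add: field_simps)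
    then show ?thesis by (simp add: algebra_simps)
  qed
  note step1 = this
  have low: "n \<ge> 1 \<Longrightarrow> real n * ln (real n) - real n \<le> (\<Sum>n=1..n. ln (real n))" for n
  proof (induction n rule: dec_induct)
    case base show ?case by simp
  next
    case (step n)
    then show ?case using step1[of n] by simp
  qed
  have "(\<Sum>n=1..K. ln (real n)) \<le> real K * T"
    unfolding sum_ln_eq_mangoldt T_def sum_distrib_left
  proof (rule sum_mono)
    fix d assume "d \<in> {1..K}"
    have "real (K div d) \<le> real K / real d" by (rule real_div_le)
    then show "mangoldt d * real (K div d) \<le> real K * (mangoldt d / real d)"
      using mult_left_mono[of "real (K div d)" "real K / real d" "mangoldt d"] by (simp add: mult.commute)
  qed
  then have "real K * (ln (real K) - 1) \<le> real K * T" using low[OF assms] by (simp add: algebra_simps)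
  then have 1: "ln (real K) - 1 \<le> T" using assms by simp
  have "real K * T - psi K \<le> (\<Sum>n=1..K. ln (real n))"
    unfolding sum_ln_eq_mangoldt T_def sum_distrib_left psi_def sum_subtractf[symmetric]
  proof (rule sum_mono)
    fix d assume d: "d \<in> {1..K}"
    have "real K / real d - 1 \<le> real (K div d)" using real_div_gt[of d K] d by simp
    then have "mangoldt d * (real K / real d - 1) \<le> mangoldt d * real (K div d)"
      by (rule mult_left_mono) simp
    then show "real K * (mangoldt d / real d) - mangoldt d \<le> mangoldt d * real (K div d)"
      by (simp add: algebra_simps)
  qed
  then have "real K * T \<le> real K * (ln (real K) + 4)" using up psi_le[of K] by (simp add: algebra_simps)
  then have "T \<le> ln (real K) + 4" using assms by simp
  with 1 show ?thesis by (simp add: T_def)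
qed


lemma sum_divisors_coprime:
  fixes f g :: "nat \<Rightarrow> 'a::comm_semiring_0"
  assumes "coprime a b" "a > 0" "b > 0" and "\<And>d e. d dvd a \<Longrightarrow> e dvd b \<Longrightarrow> h (d * e) = f d * g e"
  shows "(\<Sum>d | d dvd a * b. h d) = (\<Sum>d | d dvd a. f d) * (\<Sum>e | e dvd b. g e)"
proof -
  have *: "(\<Sum>d | d dvd a. f d) * (\<Sum>e | e dvd b. g e) = (\<Sum>(d,e)\<in>{d. d dvd a} \<times> {e. e dvd b}. f d * g e)"
    by (simp add: sum_product sum.cartesian_product)
  have gcd: "gcd (d*e) a = d \<and> gcd (d*e) b = e" if "d dvd a" "e dvd b" for d e
  proof -
    have "coprime e a" "coprime d b" using assms(1) that
      by (meson coprime_commute coprime_divisors dvd_refl)+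
    then show ?thesis using that
      by (metis coprime_commute gcd_mult_left_right_cancel gcd_mult_left_left_cancel gcd_nat.absorb1)
  qed
  have "(\<Sum>(d,e)\<in>{d. d dvd a} \<times> {e. e dvd b}. f d * g e) = (\<Sum>d | d dvd a * b. h d)"
  proof (rule sum.reindex_bij_witness[where j="\<lambda>(d,e). d*e" and i="\<lambda>x. (gcd x a, gcd x b)"], goal_cases)
    case (1 x)
    then obtain d e where x: "x = (d,e)" "d dvd a" "e dvd b" by auto
    then show ?case using gcd[of d e] by simp
  next
    case (3 x)
    then obtain d e where "x = d * e" "d dvd a" "e dvd b" using division_decomp[of x a b] by auto
    then show ?case using gcd[of d e] by simp
  qed (use assms in \<open>auto intro: mult_dvd_mono\<close>)
  with * show ?thesis by simp
qed

lemma sqrt_Suc_diff_lower: "1 / sqrt (real (Suc k)) \<le> 2 * (sqrt (real (Suc k)) - sqrt (real k))"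
proof -
  define a b where "a = sqrt (real k)" and "b = sqrt (real (Suc k))"
  have b: "b > 0" and le: "a \<le> b" by (auto simp: a_def b_def)
  have "1 = (b - a) * (b + a)" by (simp add: a_def b_def algebra_simps)
  also have "\<dots> \<le> (b - a) * (2 * b)" using le by (intro mult_left_mono) auto
  finally have "1 / b \<le> 2 * (b - a)" using b by (simp add: field_simps)
  then show ?thesis by (simp add: a_def b_def)
qed

lemma sqrt_Suc_diff_upper:
  assumes "k \<ge> 1" shows "2 * (sqrt (real (Suc k)) - sqrt (real k)) \<le> 1 / sqrt (real k)"
proof -
  define a b where "a = sqrt (real k)" and "b = sqrt (real (Suc k))"
  have a: "a > 0" and le: "a \<le> b" using assms by (auto simp: a_def b_def)
  have "(b - a) * (2 * a) \<le> (b - a) * (b + a)" using le by (intro mult_left_mono) auto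
  also have "\<dots> = 1" by (simp add: a_def b_def algebra_simps)
  finally have "2 * (b - a) \<le> 1 / a" using a by (simp add: field_simps)
  then show ?thesis by (simp add: a_def b_def)
qed

lemma sum_inverse_sqrt_le: "(\<Sum>e=1..n. 1 / sqrt (real e)) \<le> 2 * sqrt (real n)"
proof (induction n)
  case (Suc n)
  then show ?case using sqrt_Suc_diff_lower[of n] by simp
qed simp

text \<open>With \<open>h n\<close> the sum minus \<open>2 sqrt n\<close>, the sequence
  \<open>h n\<close> decreases and \<open>h n - 1 / sqrt n\<close> increases. Two finite indices are
  compared instead of introducing the limit constant; later \<open>m = K^2\<close> is the reference
  point.\<close>

lemma sum_inverse_sqrt_asymp:
  assumes "1 \<le> n" "n \<le> m"
  shows "\<bar>((\<Sum>e=1..n. 1 / sqrt (real e)) - 2 * sqrt (real n)) - ((\<Sum>e=1..m. 1 / sqrt (real e)) - 2 * sqrt (real m))\<bar> \<le> 1 / sqrt (real n)"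
proof -
  define h where "h n = (\<Sum>e=1..n. 1 / sqrt (real e)) - 2 * sqrt (real n)" for n
  have "h m \<le> h n \<and> h n - 1 / sqrt (real n) \<le> h m - 1 / sqrt (real m)" using assms(2)
  proof (induction m rule: dec_induct)
    case base show ?case by simp
  next
    case (step k)
    have "k \<ge> 1" using assms step by linarith
    moreover have "h (Suc k) = h k + 1 / sqrt (real (Suc k)) - 2 * (sqrt (real (Suc k)) - sqrt (real k))"
      by (simp add: h_def)
    ultimately show ?case using step.IH sqrt_Suc_diff_lower[of k] sqrt_Suc_diff_upper[of k] by linarith
  qed
  moreover have "0 \<le> 1 / sqrt (real m)" by simp
  ultimately show ?thesis unfolding h_def by linarith
qed

lemma sum_inverse_ge_ln: "ln (real (Suc n)) \<le> (\<Sum>j=1..n. 1 / real j)"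
proof (induction n)
  case (Suc n)
  have "ln (real (Suc (Suc n)) / real (Suc n)) \<le> real (Suc (Suc n)) / real (Suc n) - 1"
    by (rule ln_le_minus_one) auto
  then have "ln (real (Suc (Suc n))) - ln (real (Suc n)) \<le> 1 / real (Suc n)"
    by (simp add: ln_div field_simps)
  then show ?case using Suc by simp
qed simp


section \<open>Real characters, their value L(1, chi), and sums over primes\<close>

lemma sum_split: "m \<le> k \<Longrightarrow> (\<Sum>d=1..k. f d) = (\<Sum>d=1..m. f d) + (\<Sum>d=Suc m..k. f d)" for f :: "nat \<Rightarrow> real"
  using sum.ub_add_nat[of 1 m f "k-m"] by simp

text \<open>Bounded partial sums stand for "non-principal": they carry the whole analysis below, and
  they make sense for a product of characters of different moduli without naming a
  conductor.\<close>

locale real_character =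
  fixes chi :: "nat \<Rightarrow> real" and B :: real
  assumes mult: "chi (m * n) = chi m * chi n" and one: "chi (Suc 0) = 1"
    and vals: "chi n \<in> {-1,0,1}" and bounded: "\<bar>\<Sum>n=1..k. chi n\<bar> \<le> B"
begin

lemma abs_chi_le: "\<bar>chi n\<bar> \<le> 1" using vals[of n] by auto

lemma chi_power: "chi (n ^ k) = chi n ^ k"
  by (induction k) (auto simp: one mult)

lemma partial_sum: "\<bar>\<Sum>n=Suc m..k. chi n\<bar> \<le> 2 * B"
proof (cases "m \<le> k")
  case True
  have "(\<Sum>n=1..k. chi n) = (\<Sum>n=1..m. chi n) + (\<Sum>n=Suc m..k. chi n)"
    using sum.ub_add_nat[of 1 m chi "k-m"] True by simp
  then show ?thesis using bounded[of k] bounded[of m] by linarith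
next
  case False
  then show ?thesis using bounded[of 0] by simp
qed

lemma B_nonneg: "0 \<le> B" using bounded[of 0] by simp

lemma chi_abel:
  assumes "\<And>n. n > m \<Longrightarrow> f (Suc n) \<le> f n" "\<And>n. n > m \<Longrightarrow> 0 \<le> f n"
  shows "\<bar>\<Sum>n=Suc m..k. chi n * f n\<bar> \<le> 2 * B * f (Suc m)"
  using assms by (intro abel_summation_bound partial_sum)

text \<open>The coefficients of \<open>zeta(s) L(s, chi)\<close>; for the character of a quadratic
  field they count ideals of norm \<open>n\<close>.\<close>

definition R :: "nat \<Rightarrow> real" where "R n = (\<Sum>d | d dvd n. chi d)"

text \<open>The divisor sum is the geometric sum of the powers of \<open>chi l\<close>, which for
  \<open>chi l = -1\<close> is 1 or 0 according to the parity of \<open>k\<close>.\<close>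

lemma R_prime_power: "prime l \<Longrightarrow> R (l ^ k) \<ge> 0 \<and> (even k \<longrightarrow> R (l ^ k) \<ge> 1)"
proof -
  assume l: "prime l"
  have "{d. d dvd l ^ k} = (\<lambda>i. l ^ i) ` {..k}"
    using divides_primepow_nat[OF l] by auto
  moreover have "inj_on (\<lambda>i. l ^ i) {..k}"
    using prime_gt_1_nat[OF l] by (auto simp: inj_on_def)
  ultimately have "R (l ^ k) = (\<Sum>i\<le>k. chi l ^ i)"
    by (simp add: R_def sum.reindex chi_power)
  moreover have "(\<Sum>i\<le>k. (-1::real) ^ i) = (if even k then 1 else 0)" by (induction k) auto
  moreover have "(\<Sum>i\<le>k. (0::real) ^ i) = 1" by (induction k) auto
  ultimately show ?thesis using vals[of l] by auto
qed

lemma R_mult: "coprime a b \<Longrightarrow> a > 0 \<Longrightarrow> b > 0 \<Longrightarrow> R (a * b) = R a * R b"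
  unfolding R_def by (rule sum_divisors_coprime) (auto simp: mult)

lemma R_nonneg_square: "n > 0 \<Longrightarrow> R n \<ge> 0 \<and> R (n\<^sup>2) \<ge> 1"
proof (induction n rule: less_induct)
  case (less n)
  show ?case
  proof (cases "n = 1")
    case True then show ?thesis by (simp add: R_def one)
  next
    case False
    then obtain l where l: "prime l" "l dvd n" using prime_factor_nat by blast
    obtain m where "n = l ^ multiplicity l n * m" "\<not> l dvd m"
      by (rule multiplicity_decompose'[of n l]) (use less.prems l in auto)
    moreover define k where "k = multiplicity l n"
    ultimately have m: "n = l ^ k * m" "\<not> l dvd m" by simp_all
    have k: "k > 0" using l less.prems by (simp add: k_def prime_multiplicity_gt_zero_iff)
    have "m > 0" using m less.prems by (cases m) auto
    moreover have "1 < l ^ k" using prime_gt_1_nat[OF l(1)] k by (metis one_less_power)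
    ultimately have "m < n" unfolding m(1) by simp
    then have IH: "R m \<ge> 0" "R (m\<^sup>2) \<ge> 1" using less.IH \<open>m > 0\<close> by auto
    have cop: "coprime (l^j) m" for j using l m by (simp add: prime_imp_coprime)
    have "R n = R (l^k) * R m" unfolding m(1) by (rule R_mult) (use cop \<open>m > 0\<close> l in \<open>auto simp: prime_gt_0_nat\<close>)
    moreover have "n\<^sup>2 = l ^ (2*k) * m\<^sup>2"
      by (subst m(1)) (simp add: power_mult_distrib power_mult[symmetric] mult.commute)
    moreover have "R (l ^ (2*k) * m\<^sup>2) = R (l^(2*k)) * R (m\<^sup>2)"
      by (rule R_mult) (use cop[of "2*k"] \<open>m > 0\<close> l in \<open>auto simp: prime_gt_0_nat\<close>)
    moreover have "R (l^k) \<ge> 0" "R (l^(2*k)) \<ge> 1" using R_prime_power[OF l(1)] by auto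
    moreover have "1 * 1 \<le> R (l^(2*k)) * R (m\<^sup>2)"
      using IH R_prime_power[OF l(1), of "2*k"] by (intro mult_mono) auto
    ultimately show ?thesis using IH by (metis mult_nonneg_nonneg mult_1)
  qed
qed


lemma chi_over_n_tail: "\<bar>\<Sum>d=Suc m..k. chi d / real d\<bar> \<le> 2 * B / real (Suc m)"
  using chi_abel[of m "\<lambda>n. 1 / real n" k] by (simp add: frac_le)

lemma chi_over_sqrt_tail: "\<bar>\<Sum>d=Suc m..k. chi d / sqrt (real d)\<bar> \<le> 2 * B / sqrt (real (Suc m))"
  using chi_abel[of m "\<lambda>n. 1 / sqrt (real n)" k] by (simp add: frac_le)

definition Lval :: real where "Lval = lim (\<lambda>k. \<Sum>d=1..k. chi d / real d)"

lemma Lval_tendsto: "(\<lambda>k. \<Sum>d=1..k. chi d / real d) \<longlonglongrightarrow> Lval"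
proof -
  have "Cauchy (\<lambda>k. \<Sum>d=1..k. chi d / real d)"
  proof (rule CauchyI')
    fix e :: real assume e: "e > 0"
    obtain M :: nat where M: "2 * B / e < real M" using reals_Archimedean2 by blast
    show "\<exists>M. \<forall>m\<ge>M. \<forall>n>m. dist (\<Sum>d=1..m. chi d / real d) (\<Sum>d=1..n. chi d / real d) < e"
    proof (intro exI[of _ M] allI impI)
      fix m n assume m: "M \<le> m" "m < n"
      have "dist (\<Sum>d=1..m. chi d / real d) (\<Sum>d=1..n. chi d / real d) \<le> 2 * B / real (Suc m)"
        using sum_split[of m n "\<lambda>d. chi d / real d"] chi_over_n_tail[of m n] m by (simp add: dist_real_def)
      also have "\<dots> < e"
      proof -
        have "2 * B < real M * e" using M e by (simp add: field_simps)
        also have "\<dots> \<le> real (Suc m) * e" using m e by (intro mult_right_mono) auto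
        finally show ?thesis by (simp add: field_simps)
      qed
      finally show "dist (\<Sum>d=1..m. chi d / real d) (\<Sum>d=1..n. chi d / real d) < e" .
    qed
  qed
  then show ?thesis unfolding Lval_def by (simp add: Cauchy_convergent_iff convergent_LIMSEQ_iff)
qed

lemma Lval_approx: "\<bar>(\<Sum>d=1..m. chi d / real d) - Lval\<bar> \<le> 2 * B / real (Suc m)"
proof -
  have "(\<lambda>k. \<bar>(\<Sum>d=1..m. chi d / real d) - (\<Sum>d=1..k. chi d / real d)\<bar>) \<longlonglongrightarrow> \<bar>(\<Sum>d=1..m. chi d / real d) - Lval\<bar>"
    by (intro tendsto_intros Lval_tendsto)
  moreover have "\<forall>\<^sub>F k in sequentially. \<bar>(\<Sum>d=1..m. chi d / real d) - (\<Sum>d=1..k. chi d / real d)\<bar> \<le> 2 * B / real (Suc m)"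
    using eventually_ge_at_top[of m]
  proof eventually_elim
    case (elim k)
    then show ?case using sum_split[of m k "\<lambda>d. chi d / real d"] chi_over_n_tail[of m k] by simp
  qed
  ultimately show ?thesis by (rule tendsto_upperbound) simp
qed

text \<open>If \<^term>\<open>Lval\<close> vanished, the hyperbola method would bound \<open>\<Sum>R(n)/\<surd>n\<close>, which
  diverges because \<^term>\<open>R\<close> is nonnegative and at least 1 on squares.\<close>
lemma Lval_nonzero: "Lval \<noteq> 0"
proof
  assume L0: "Lval = 0"
  \<comment> \<open>Any bound above \<open>12 B + 4\<close> would do: the range \<open>d > K\<close>
    contributes \<open>4 B\<close>, the range \<open>d \<le> K\<close> contributes
    \<open>8 B + 4\<close>.\<close>
  define C where "C = 13 + 20 * B"
  have main: "ln (real (Suc K)) \<le> C" if K: "K \<ge> 1" for K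
  proof -
    have KK: "K \<le> K * K" using K by simp
    define A where "A n = (\<Sum>e=1..n. 1 / sqrt (real e))" for n
    define c where "c = A (K*K) - 2 * sqrt (real (K*K))"
    have c: "\<bar>c\<bar> \<le> 2"
      using sum_inverse_sqrt_asymp[of 1 "K*K"] K by (simp add: c_def A_def)
    have "ln (real (Suc K)) \<le> (\<Sum>j=1..K. 1 / real j)" by (rule sum_inverse_ge_ln)
    also have "\<dots> = (\<Sum>n\<in>(\<lambda>j. j\<^sup>2) ` {1..K}. 1 / sqrt (real n))"
      by (subst sum.reindex) (auto simp: inj_on_def)
    also have "\<dots> \<le> (\<Sum>n\<in>(\<lambda>j. j\<^sup>2) ` {1..K}. R n / sqrt (real n))"
      by (intro sum_mono divide_right_mono) (auto simp: R_nonneg_square)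
    also have "\<dots> \<le> (\<Sum>n=1..K*K. R n / sqrt (real n))"
    proof (rule sum_mono2)
      show "(\<lambda>j. j\<^sup>2) ` {1..K} \<subseteq> {1..K*K}" by (auto simp: power2_eq_square mult_le_mono)
    qed (auto simp: R_nonneg_square)
    also have "\<dots> = (\<Sum>n=1..K*K. \<Sum>d | d dvd n. chi d / sqrt (real d) * (1 / sqrt (real (n div d))))"
      unfolding R_def sum_divide_distrib
      by (intro sum.cong refl) (auto elim!: dvdE simp: real_sqrt_mult)
    also have "\<dots> = (\<Sum>d=1..K*K. \<Sum>e=1..K*K div d. chi d / sqrt (real d) * (1 / sqrt (real e)))"
      by (rule sum_divisors_swap)
    \<comment> \<open>The hyperbola \<open>d e \<le> K^2\<close> is cut at \<open>d = K\<close>.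
      Beyond the cut \<open>e \<le> K\<close> is forced, so the order can be exchanged and the sum
      over \<open>d\<close> becomes a character tail of size \<open>B / sqrt K\<close>.\<close>
    also have "\<dots> = (\<Sum>d=1..K. \<Sum>e=1..K*K div d. chi d / sqrt (real d) * (1 / sqrt (real e)))
        + (\<Sum>d=Suc K..K*K. \<Sum>e=1..K*K div d. chi d / sqrt (real d) * (1 / sqrt (real e)))"
      by (rule sum_split[OF KK])
    also have "(\<Sum>d=Suc K..K*K. \<Sum>e=1..K*K div d. chi d / sqrt (real d) * (1 / sqrt (real e)))
        = (\<Sum>(d,e)\<in>(SIGMA d:{Suc K..K*K}. {1..K*K div d}). chi d / sqrt (real d) * (1 / sqrt (real e)))"
      by (rule sum.Sigma) auto
    also have "\<dots> = (\<Sum>(e,d)\<in>(SIGMA e:{1..K}. {Suc K..K*K div e}). chi d / sqrt (real d) * (1 / sqrt (real e)))"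
    proof (rule sum.reindex_bij_witness[where i="\<lambda>(d,e). (e,d)" and j="\<lambda>(d,e). (e,d)"], goal_cases)
      case (2 a)
      then obtain d e where a: "a = (d,e)" "Suc K \<le> d" "d \<le> K*K" "1 \<le> e" "e \<le> K*K div d" by auto
      have ed: "e * d \<le> K * K" using a less_eq_div_iff_mult_less_eq[of d e "K*K"] by simp
      have "e \<le> K"
      proof (rule ccontr)
        assume "\<not> e \<le> K"
        then have "K * K < e * d" using a by (intro mult_strict_mono) auto
        then show False using ed by simp
      qed
      moreover have "d \<le> K*K div e" using ed a less_eq_div_iff_mult_less_eq[of e d "K*K"] by (simp add: mult.commute)
      ultimately show ?case using a by auto
    next
      case (4 b)
      then obtain d e where b: "b = (e,d)" "Suc K \<le> d" "1 \<le> e" "e \<le> K" "d \<le> K*K div e" by auto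
      have ed: "d * e \<le> K * K" using b less_eq_div_iff_mult_less_eq[of e d "K*K"] by simp
      have "d \<le> d * e" using b by simp
      then have "d \<le> K*K" using ed by linarith
      moreover have "e \<le> K*K div d" using ed b less_eq_div_iff_mult_less_eq[of d e "K*K"] by (simp add: mult.commute)
      ultimately show ?case using b by auto
    qed auto
    also have "\<dots> = (\<Sum>e=1..K. \<Sum>d=Suc K..K*K div e. chi d / sqrt (real d) * (1 / sqrt (real e)))"
      by (rule sum.Sigma[symmetric]) auto
    also have "\<dots> = (\<Sum>e=1..K. (\<Sum>d=Suc K..K*K div e. chi d / sqrt (real d)) * (1 / sqrt (real e)))"
      by (simp only: sum_distrib_right)
    also have "\<dots> \<le> (\<Sum>e=1..K. (2 * B / sqrt (real (Suc K))) * (1 / sqrt (real e)))"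
      using chi_over_sqrt_tail[of K] by (intro sum_mono mult_right_mono) (auto intro: order_trans[OF abs_ge_self])
    also have "\<dots> = (2 * B / sqrt (real (Suc K))) * A K"
      unfolding A_def sum_distrib_left ..
    also have "\<dots> \<le> (2 * B / sqrt (real (Suc K))) * (2 * sqrt (real (Suc K)))"
    proof (rule mult_left_mono)
      have "A K \<le> 2 * sqrt (real K)" unfolding A_def by (rule sum_inverse_sqrt_le)
      also have "\<dots> \<le> 2 * sqrt (real (Suc K))" by simp
      finally show "A K \<le> 2 * sqrt (real (Suc K))" .
    qed (use B_nonneg in auto)
    also have "\<dots> = 4 * B" by simp
    finally have 1: "ln (real (Suc K)) \<le> (\<Sum>d=1..K. \<Sum>e=1..K*K div d. chi d / sqrt (real d) * (1 / sqrt (real e))) + 4 * B"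
      by simp
    \<comment> \<open>The inner sum has main term \<open>2 K / sqrt d\<close>. Multiplied by
      \<open>chi d / sqrt d\<close> it produces \<open>2 K\<close> times a partial sum of
      \<open>L(1, chi)\<close>, and this is bounded precisely because the limit is assumed to
      vanish.\<close>
    have appr: "\<bar>A (K*K div d) - (2 * real K / sqrt (real d) + c)\<bar> \<le> 4 * (sqrt (real d) / real K)" if d: "1 \<le> d" "d \<le> K" for d
    proof -
      define n where "n = K*K div d"
      have "K \<le> n" unfolding n_def using d by (subst less_eq_div_iff_mult_less_eq) auto
      then have n: "1 \<le> n" "n \<le> K*K" using K by (auto simp: n_def div_le_dividend)
      have 1: "\<bar>(A n - 2 * sqrt (real n)) - c\<bar> \<le> 1 / sqrt (real n)"
        unfolding c_def A_def using sum_inverse_sqrt_asymp[OF n] by simp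
      define x where "x = real K * real K / real d"
      have nx: "real n \<le> x" "x < real n + 1"
        using real_div_le[of "K*K" d] real_div_gt[of d "K*K"] d by (auto simp: n_def x_def)
      have sx: "sqrt x = real K / sqrt (real d)" by (simp add: x_def real_sqrt_divide)
      have snp: "sqrt (real n) > 0" using n by simp
      have le: "sqrt (real n) \<le> sqrt x" using nx by simp
      have "(sqrt x - sqrt (real n)) * (sqrt x + sqrt (real n)) = x - real n"
        using nx by (simp add: algebra_simps)
      also have "\<dots> \<le> 1" using nx by simp
      finally have "(sqrt x - sqrt (real n)) * (sqrt x + sqrt (real n)) \<le> 1" .
      moreover have "(sqrt x - sqrt (real n)) * sqrt x \<le> (sqrt x - sqrt (real n)) * (sqrt x + sqrt (real n))"
        using le snp by (intro mult_left_mono) auto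
      ultimately have "(sqrt x - sqrt (real n)) * sqrt x \<le> 1" by linarith
      then have 2: "sqrt x - sqrt (real n) \<le> 1 / sqrt x" using le snp by (simp add: field_simps)
      have x4: "x \<le> 4 * real n" using nx n by simp
      have "sqrt x \<le> 2 * sqrt (real n)" using real_sqrt_le_mono[OF x4] by (simp add: real_sqrt_mult)
      then have 3: "1 / sqrt (real n) \<le> 2 / sqrt x" using le snp by (simp add: field_simps)
      define s where "s = 1 / sqrt x"
      have "\<bar>A n - (2 * sqrt x + c)\<bar> \<le> 4 * s"
      proof -
        have "1 / sqrt (real n) \<le> 2 * s" using 3 by (simp add: s_def)
        moreover have "sqrt x - sqrt (real n) \<le> s" using 2 by (simp add: s_def)
        ultimately show ?thesis using 1 le unfolding abs_le_iff by linarith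
      qed
      moreover have "s = sqrt (real d) / real K" "2 * real K / sqrt (real d) = 2 * sqrt x" by (simp_all add: sx s_def)
      ultimately show ?thesis unfolding n_def[symmetric] by simp
    qed
    have "(\<Sum>d=1..K. \<Sum>e=1..K*K div d. chi d / sqrt (real d) * (1 / sqrt (real e)))
        = (\<Sum>d=1..K. chi d / sqrt (real d) * A (K*K div d))"
      by (simp only: A_def sum_distrib_left)
    also have "\<dots> \<le> (\<Sum>d=1..K. 2 * real K * (chi d / real d) + c * (chi d / sqrt (real d)) + 4 / real K)"
    proof (rule sum_mono)
      fix d assume d: "d \<in> {1..K}"
      define r where "r = A (K*K div d) - (2 * real K / sqrt (real d) + c)"
      have r: "\<bar>r\<bar> \<le> 4 * (sqrt (real d) / real K)" using appr[of d] d unfolding r_def by (auto intro: order_trans)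
      have "chi d / sqrt (real d) * r \<le> \<bar>chi d / sqrt (real d) * r\<bar>" by (rule abs_ge_self)
      also have "\<dots> = \<bar>chi d\<bar> * (\<bar>r\<bar> / sqrt (real d))" by (simp add: abs_mult)
      also have "\<dots> \<le> 1 * (4 * (sqrt (real d) / real K) / sqrt (real d))"
        using r abs_chi_le by (intro mult_mono divide_right_mono) auto
      also have "\<dots> = 4 / real K" using d by simp
      finally have "chi d / sqrt (real d) * r \<le> 4 / real K" .
      moreover have "chi d / sqrt (real d) * A (K*K div d) = 2 * real K * (chi d / real d) + c * (chi d / sqrt (real d)) + chi d / sqrt (real d) * r"
        using d by (simp add: r_def field_simps)
      ultimately show "chi d / sqrt (real d) * A (K*K div d) \<le> 2 * real K * (chi d / real d) + c * (chi d / sqrt (real d)) + 4 / real K"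
        by linarith
    qed
    also have "\<dots> = 2 * real K * (\<Sum>d=1..K. chi d / real d) + c * (\<Sum>d=1..K. chi d / sqrt (real d)) + 4"
      using K by (simp add: sum.distrib sum_distrib_left)
    also have "\<dots> \<le> 4 * B + 2 * (2 * B) + 4"
    proof (intro add_mono order.refl)
      have "2 * real K * (\<Sum>d=1..K. chi d / real d) \<le> 2 * real K * (2 * B / real (Suc K))"
        using Lval_approx[of K] unfolding L0 by (intro mult_left_mono) auto
      also have "\<dots> = 4 * B * (real K / real (Suc K))" by simp
      also have "\<dots> \<le> 4 * B * 1" using B_nonneg by (intro mult_left_mono) auto
      finally show "2 * real K * (\<Sum>d=1..K. chi d / real d) \<le> 4 * B" by simp
      have "c * (\<Sum>d=1..K. chi d / sqrt (real d)) \<le> \<bar>c\<bar> * \<bar>\<Sum>d=1..K. chi d / sqrt (real d)\<bar>"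
        by (metis abs_ge_self abs_mult)
      also have "\<dots> \<le> 2 * (2 * B)"
        using c chi_over_sqrt_tail[of 0 K] by (intro mult_mono) auto
      finally show "c * (\<Sum>d=1..K. chi d / sqrt (real d)) \<le> 2 * (2 * B)" .
    qed
    finally show ?thesis using 1 B_nonneg by (simp add: C_def)
  qed
  obtain K :: nat where "exp C < real K" using reals_Archimedean2 by blast
  then have "K \<ge> 1" using exp_gt_zero[of C] by (cases K) (auto simp del: exp_gt_zero)
  have "ln (exp C) < ln (real (Suc K))"
    using \<open>exp C < real K\<close> by (subst ln_less_cancel_iff) auto
  with \<open>K \<ge> 1\<close> show False using main[of K] by simp
qed


text \<open>The weight \<open>ln n / n\<close> decreases only from \<open>n = 3\<close>, so two
  terms, each at most 1 in absolute value, are split off before summation by parts.\<close>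

lemma sum_chi_ln_bounded: "\<bar>\<Sum>n=1..K. chi n * (ln (real n) / real n)\<bar> \<le> 3 * B + 2"
proof -
  have dec: "ln (real (Suc n)) / real (Suc n) \<le> ln (real n) / real n" if "n \<ge> 3" for n
  proof -
    have "exp 1 \<le> real n" using exp_le that by linarith
    then have l1: "1 \<le> ln (real n)" using that by (subst ln_ge_iff) auto
    have "ln (real (Suc n) / real n) \<le> real (Suc n) / real n - 1" using that by (intro ln_le_minus_one) auto
    then have "ln (real (Suc n)) - ln (real n) \<le> 1 / real n" using that by (simp add: ln_div field_simps)
    then have "real n * (ln (real (Suc n)) - ln (real n)) \<le> 1" using that by (simp add: field_simps)
    then have "real n * ln (real (Suc n)) \<le> real (Suc n) * ln (real n)" using l1 by (simp add: algebra_simps)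
    then show ?thesis using that by (simp add: divide_simps mult.commute)
  qed
  have l: "ln (real n) / real n \<le> 1" if "n \<ge> 1" for n
    using ln_le_minus_one[of "real n"] that by (simp add: field_simps)
  have t: "\<bar>\<Sum>n=Suc 2..K. chi n * (ln (real n) / real n)\<bar> \<le> 2 * B * (ln (real (Suc 2)) / real (Suc 2))"
    by (rule chi_abel) (use dec in auto)
  also have "\<dots> \<le> 2 * B * 1" using l[of "Suc 2"] B_nonneg by (intro mult_left_mono) auto
  finally have t: "\<bar>\<Sum>n=Suc 2..K. chi n * (ln (real n) / real n)\<bar> \<le> 2 * B" by simp
  have h: "\<bar>\<Sum>n=1..k. chi n * (ln (real n) / real n)\<bar> \<le> real k" for k
  proof -
    have "\<bar>\<Sum>n=1..k. chi n * (ln (real n) / real n)\<bar> \<le> (\<Sum>n=1..k. \<bar>chi n * (ln (real n) / real n)\<bar>)" by (rule sum_abs)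
    also have "\<dots> \<le> (\<Sum>n=1..k. 1)"
    proof (rule sum_mono)
      fix n assume n: "n \<in> {1..k}"
      have "\<bar>chi n * (ln (real n) / real n)\<bar> = \<bar>chi n\<bar> * (ln (real n) / real n)" using n by (simp add: abs_mult)
      also have "\<dots> \<le> 1 * 1" using l[of n] n abs_chi_le[of n] by (intro mult_mono) auto
      finally show "\<bar>chi n * (ln (real n) / real n)\<bar> \<le> 1" by simp
    qed
    finally show ?thesis by simp
  qed
  show ?thesis
  proof (cases "2 \<le> K")
    case True
    then show ?thesis using sum_split[OF True, of "\<lambda>n. chi n * (ln (real n) / real n)"] h[of 2] t B_nonneg by linarith
  next
    case False
    then show ?thesis using h[of K] B_nonneg by linarith
  qed
qed

text \<open>As \<open>ln\<close> is the divisor sum of \<open>mangoldt\<close>, the bounded sum of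
  \<open>chi n ln n / n\<close> equals \<open>Lval\<close> times the wanted sum up to an error of
  size \<open>psi K / K\<close>. Division by \<open>Lval \<noteq> 0\<close> finishes.\<close>

lemma sum_chi_mangoldt_bounded:
  obtains C where "\<And>K. \<bar>\<Sum>d=1..K. chi d * mangoldt d / real d\<bar> \<le> C"
proof -
  define T where "T K = (\<Sum>d=1..K. chi d * mangoldt d / real d)" for K
  have main: "\<bar>Lval\<bar> * \<bar>T K\<bar> \<le> 11 * B + 2" if K: "K \<ge> 1" for K
  proof -
    have "(\<Sum>n=1..K. chi n * (ln (real n) / real n)) =
        (\<Sum>n=1..K. \<Sum>d | d dvd n. (chi d * mangoldt d / real d) * (chi (n div d) / real (n div d)))"
    proof (rule sum.cong[OF refl])
      fix n assume n: "n \<in> {1..K}"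
      have "chi n * (ln (real n) / real n) = (\<Sum>d | d dvd n. chi n * (mangoldt d / real n))"
      proof -
        have "(\<Sum>d | d dvd n. mangoldt d) = ln (real n)" using n mangoldt_sum[of n, where 'a=real] by simp
        then show ?thesis by (simp only: sum_distrib_left[symmetric] sum_divide_distrib[symmetric])
      qed
      also have "\<dots> = (\<Sum>d | d dvd n. (chi d * mangoldt d / real d) * (chi (n div d) / real (n div d)))"
      proof (rule sum.cong[OF refl])
        fix d assume "d \<in> {d. d dvd n}"
        then obtain k where k: "n = d * k" by auto
        then have "d > 0" "n div d = k" using n by (auto intro: gr0I)
        then show "chi n * (mangoldt d / real n) = (chi d * mangoldt d / real d) * (chi (n div d) / real (n div d))"
          unfolding \<open>n div d = k\<close> unfolding k by (simp only: mult of_nat_mult times_divide_times_eq times_divide_eq_right divide_divide_eq_left mult.assoc mult.commute mult.left_commute)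
      qed
      finally show "chi n * (ln (real n) / real n) = (\<Sum>d | d dvd n. (chi d * mangoldt d / real d) * (chi (n div d) / real (n div d)))" .
    qed
    also have "\<dots> = (\<Sum>d=1..K. \<Sum>e=1..K div d. (chi d * mangoldt d / real d) * (chi e / real e))"
      by (rule sum_divisors_swap)
    also have "\<dots> = (\<Sum>d=1..K. (chi d * mangoldt d / real d) * (\<Sum>e=1..K div d. chi e / real e))"
      by (simp only: sum_distrib_left)
    finally have e: "(\<Sum>n=1..K. chi n * (ln (real n) / real n)) = (\<Sum>d=1..K. (chi d * mangoldt d / real d) * (\<Sum>e=1..K div d. chi e / real e))" .
    have "\<bar>(\<Sum>n=1..K. chi n * (ln (real n) / real n)) - Lval * T K\<bar>
        = \<bar>\<Sum>d=1..K. (chi d * mangoldt d / real d) * ((\<Sum>e=1..K div d. chi e / real e) - Lval)\<bar>"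
      unfolding e T_def by (simp only: sum_distrib_left right_diff_distrib sum_subtractf mult.commute[of Lval])
    also have "\<dots> \<le> (\<Sum>d=1..K. \<bar>(chi d * mangoldt d / real d) * ((\<Sum>e=1..K div d. chi e / real e) - Lval)\<bar>)"
      by (rule sum_abs)
    also have "\<dots> \<le> (\<Sum>d=1..K. 2 * B / real K * mangoldt d)"
    proof (rule sum_mono)
      fix d assume d: "d \<in> {1..K}"
      have "real K / real d < real (Suc (K div d))" using real_div_gt[of d K] d by simp
      then have "2 * B / real (Suc (K div d)) \<le> 2 * B / (real K / real d)"
        using d K B_nonneg by (intro divide_left_mono) auto
      then have a: "\<bar>(\<Sum>e=1..K div d. chi e / real e) - Lval\<bar> \<le> 2 * B * real d / real K"
        using Lval_approx[of "K div d"] by simp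
      have "\<bar>(chi d * mangoldt d / real d) * ((\<Sum>e=1..K div d. chi e / real e) - Lval)\<bar>
          = \<bar>chi d\<bar> * ((mangoldt d / real d) * \<bar>(\<Sum>e=1..K div d. chi e / real e) - Lval\<bar>)"
        by (simp add: abs_mult)
      also have "\<dots> \<le> 1 * ((mangoldt d / real d) * (2 * B * real d / real K))"
        by (intro mult_mono abs_chi_le mult_left_mono a) auto
      also have "\<dots> = 2 * B / real K * mangoldt d" using d by simp
      finally show "\<bar>(chi d * mangoldt d / real d) * ((\<Sum>e=1..K div d. chi e / real e) - Lval)\<bar> \<le> 2 * B / real K * mangoldt d" .
    qed
    also have "\<dots> = 2 * B / real K * psi K" unfolding psi_def sum_distrib_left ..
    also have "\<dots> \<le> 2 * B / real K * (4 * real K)" using psi_le[of K] B_nonneg by (intro mult_left_mono) auto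
    also have "\<dots> = 8 * B" using K by simp
    finally have "\<bar>Lval * T K\<bar> \<le> 8 * B + \<bar>\<Sum>n=1..K. chi n * (ln (real n) / real n)\<bar>" by linarith
    also have "\<dots> \<le> 11 * B + 2" using sum_chi_ln_bounded[of K] by simp
    finally show ?thesis by (simp add: abs_mult)
  qed
  have "\<bar>T K\<bar> \<le> (11 * B + 2) / \<bar>Lval\<bar>" for K
  proof (cases "K \<ge> 1")
    case True
    then show ?thesis using main[OF True] Lval_nonzero by (simp add: field_simps)
  next
    case False
    then have "K = 0" by simp
    then show ?thesis using B_nonneg by (simp add: T_def)
  qed
  then show ?thesis using that unfolding T_def by blast
qed

end

text \<open>A nonprime prime power is \<open>l ^ k\<close> with \<open>k \<ge> 2\<close>. The sum is
  extended to all \<open>l \<ge> 2\<close> and dominated by a telescoping series in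
  \<open>1 / sqrt l\<close>, using \<open>ln l \<le> 2 sqrt l\<close>.\<close>

lemma sum_mangoldt_nonprime_bounded: "(\<Sum>n | n \<in> {1..K} \<and> \<not> prime n. mangoldt n / real n) \<le> (16::real)"
proof -
  define f where "f = (\<lambda>(l,k). ln (real l) / real l ^ k)"
  let ?A = "{n. n \<in> {1..K} \<and> \<not> prime n \<and> primepow n}"
  let ?D = "{2..K} \<times> {2..K}"
  have sub: "?A \<subseteq> (\<lambda>(l,k). l ^ k) ` {x\<in>?D. prime (fst x)}"
  proof
    fix n assume n: "n \<in> ?A"
    then obtain l k where lk: "prime l" "k > 0" "n = l ^ k" by (auto simp: primepow_def)
    have "k \<noteq> 1" using lk n by auto
    then have k2: "k \<ge> 2" using lk by simp
    have l2: "l \<ge> 2" using lk prime_ge_2_nat by blast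
    have "k < 2 ^ k" by simp
    also have "\<dots> \<le> n" unfolding lk(3) using l2 by (intro power_mono) auto
    finally have "k \<le> K" using n by simp
    moreover have "l \<le> n" unfolding lk(3) using self_le_power[of l k] l2 lk(2) by simp
    ultimately show "n \<in> (\<lambda>(l,k). l ^ k) ` {x\<in>?D. prime (fst x)}"
      using n k2 l2 lk by (intro image_eqI[of _ _ "(l,k)"]) auto
  qed
  have "(\<Sum>n | n \<in> {1..K} \<and> \<not> prime n. mangoldt n / real n) = (\<Sum>n\<in>?A. mangoldt n / real n)"
    by (rule sum.mono_neutral_right) (auto simp: mangoldt_def)
  also have "\<dots> \<le> (\<Sum>n\<in>(\<lambda>(l,k). l ^ k) ` {x\<in>?D. prime (fst x)}. mangoldt n / real n)"
    by (rule sum_mono2[OF _ sub]) auto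
  also have "\<dots> \<le> (\<Sum>x\<in>{x\<in>?D. prime (fst x)}. ((\<lambda>n. mangoldt n / real n) \<circ> (\<lambda>(l,k). l ^ k)) x)"
    by (rule sum_image_le) auto
  also have "\<dots> = (\<Sum>x\<in>{x\<in>?D. prime (fst x)}. f x)"
    by (rule sum.cong) (auto simp: f_def mangoldt_def primepow_prime_power aprimedivisor_prime_power)
  also have "\<dots> \<le> (\<Sum>x\<in>?D. f x)"
    by (rule sum_mono2) (auto simp: f_def)
  also have "\<dots> = (\<Sum>l=2..K. \<Sum>k=2..K. ln (real l) / real l ^ k)"
    by (simp add: f_def sum.cartesian_product)
  also have "\<dots> \<le> (\<Sum>l=2..K. 8 * (1 / sqrt (real (l-1)) - 1 / sqrt (real l)))"
  proof (rule sum_mono)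
    fix l assume l: "l \<in> {2..K}"
    define q where "q = 1 / real l"
    have q: "0 < q" "q \<le> 1/2" using l by (auto simp: q_def field_simps)
    have geo: "(\<Sum>k=2..n. q ^ k) \<le> 2 * q\<^sup>2 - q ^ n" if "n \<ge> 2" for n
      using that
    proof (induction n rule: dec_induct)
      case base
      then show ?case using q by simp
    next
      case (step n)
      have "2 * q ^ Suc n \<le> q ^ n" using q mult_right_mono[of "2 * q" 1 "q ^ n"] by simp
      moreover have "(\<Sum>k=2..Suc n. q ^ k) = (\<Sum>k=2..n. q ^ k) + q ^ Suc n" using step by simp
      ultimately show ?case using step.IH by linarith
    qed
    define a b where "a = sqrt (real (l - 1))" and "b = sqrt (real l)"
    have ab: "0 < a" "0 < b" "a \<le> b" "b * b = real l" using l by (auto simp: a_def b_def)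
    have d: "1 / b \<le> 2 * (b - a)" using sqrt_Suc_diff_lower[of "l-1"] l by (simp add: a_def b_def)
    have "ln (real l) = 2 * ln b" using ab by (simp add: ab(4)[symmetric] ln_mult)
    also have "\<dots> \<le> 2 * b" using ln_le_minus_one[OF ab(2)] by simp
    finally have lnb: "ln (real l) \<le> 2 * b" .
    have "(\<Sum>k=2..K. ln (real l) / real l ^ k) = ln (real l) * (\<Sum>k=2..K. q ^ k)"
      by (simp add: q_def sum_distrib_left power_one_over field_simps)
    also have "\<dots> \<le> 2 * b * (2 * q\<^sup>2)"
      using geo[of K] l lnb q ab by (intro mult_mono) (auto intro: sum_nonneg order_trans[of _ "2 * q\<^sup>2 - q ^ K"])
    also have "\<dots> = 4 * (1 / b) / (b * b)" using ab by (simp add: q_def ab(4)[symmetric] power2_eq_square field_simps)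
    also have "\<dots> \<le> 4 * (2 * (b - a)) / (b * a)"
      using ab d by (intro frac_le mult_left_mono) auto
    also have "\<dots> = 8 * (1 / a - 1 / b)" using ab by (simp add: field_simps)
    finally show "(\<Sum>k=2..K. ln (real l) / real l ^ k) \<le> 8 * (1 / sqrt (real (l-1)) - 1 / sqrt (real l))"
      by (simp only: a_def b_def)
  qed
  also have "\<dots> \<le> 16"
  proof (cases "K \<ge> 1")
    case True
    have "(\<Sum>l=2..K. 8 * (1 / sqrt (real (l-1)) - 1 / sqrt (real l))) = 8 * (1 - 1 / sqrt (real K))"
      using True by (induction K rule: dec_induct) (auto simp: algebra_simps)
    also have "\<dots> \<le> 16" by (simp add: field_simps)
    finally show ?thesis .
  qed simp
  finally show ?thesis .
qed

text \<open>The weight, a product of factors \<open>1 + e i * chi i l\<close>, vanishes as soon as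
  one sign is wrong. Expanded over subsets \<open>T\<close> of \<open>I\<close>, the empty set gives
  the Mertens term \<open>ln K\<close>, and every other \<open>T\<close> gives a character with
  nonzero \<open>L(1, chi)\<close>, hence a bounded sum.\<close>

lemma dirichlet_real_characters:
  fixes chi :: "'i \<Rightarrow> nat \<Rightarrow> real" and e :: "'i \<Rightarrow> real"
  assumes fin: "finite I" and char: "\<And>T. T \<subseteq> I \<Longrightarrow> T \<noteq> {} \<Longrightarrow> \<exists>B. real_character (\<lambda>n. \<Prod>i\<in>T. chi i n) B"
    and e: "\<And>i. i \<in> I \<Longrightarrow> \<bar>e i\<bar> = 1" 
  obtains C where "\<And>K. K \<ge> 1 \<Longrightarrow>
    \<bar>(\<Sum>l | l \<in> {1..K} \<and> prime l. (\<Prod>i\<in>I. 1 + e i * chi i l) * (ln (real l) / real l)) - ln (real K)\<bar> \<le> C"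
proof -
  have ex: "\<exists>c. \<forall>K. \<bar>\<Sum>d=1..K. (\<Prod>i\<in>T. chi i d) * mangoldt d / real d\<bar> \<le> c" if T: "T \<in> Pow I - {{}}" for T
  proof -
    obtain B where "real_character (\<lambda>n. \<Prod>i\<in>T. chi i n) B" using char[of T] T by auto
    from real_character.sum_chi_mangoldt_bounded[OF this] show ?thesis by metis
  qed
  define c where "c T = (SOME c. \<forall>K. \<bar>\<Sum>d=1..K. (\<Prod>i\<in>T. chi i d) * mangoldt d / real d\<bar> \<le> c)" for T
  have c: "\<bar>\<Sum>d=1..K. (\<Prod>i\<in>T. chi i d) * mangoldt d / real d\<bar> \<le> c T" if "T \<in> Pow I - {{}}" for T K
    using someI_ex[OF ex[OF that]] unfolding c_def by (rule spec)
  define w where "w n = (\<Prod>i\<in>I. 1 + e i * chi i n)" for n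
  have abs_chi: "\<bar>chi i n\<bar> \<le> 1" if i: "i \<in> I" for i n
  proof -
    obtain B where "real_character (\<lambda>n. \<Prod>i\<in>{i}. chi i n) B" using char[of "{i}"] i by auto
    from real_character.abs_chi_le[OF this, of n] show ?thesis by simp
  qed
  have w: "0 \<le> w n" "w n \<le> 2 ^ card I" for n
  proof -
    have "\<bar>e i * chi i n\<bar> \<le> 1" if "i \<in> I" for i using e[OF that] abs_chi[OF that] by (simp add: abs_mult)
    then have b: "0 \<le> 1 + e i * chi i n \<and> 1 + e i * chi i n \<le> 2" if "i \<in> I" for i
      using that by (smt (verit))
    then show "0 \<le> w n" unfolding w_def by (intro prod_nonneg) auto
    have "w n \<le> (\<Prod>i\<in>I. 2)" unfolding w_def by (rule prod_mono) (use b in auto)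
    then show "w n \<le> 2 ^ card I" by simp
  qed
  have wexp: "w n = (\<Sum>T\<in>Pow I. (\<Prod>i\<in>T. e i) * (\<Prod>i\<in>T. chi i n))" for n
  proof -
    have "w n = (\<Prod>i\<in>I. e i * chi i n + 1)" by (simp add: w_def add.commute)
    also have "\<dots> = (\<Sum>T\<in>Pow I. (\<Prod>i\<in>T. e i * chi i n) * (\<Prod>i\<in>I-T. 1))"
      by (rule prod_add[OF fin])
    finally show ?thesis by (simp add: prod.distrib)
  qed
  define C where "C = 4 + (\<Sum>T\<in>Pow I - {{}}. c T) + 2 ^ card I * 16"
  show ?thesis
  proof (rule that[of C])
    fix K :: nat assume K: "K \<ge> 1"
    let ?S = "\<lambda>T. \<Sum>n=1..K. (\<Prod>i\<in>T. chi i n) * mangoldt n / real n"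
    have "(\<Sum>n=1..K. w n * (mangoldt n / real n)) = (\<Sum>T\<in>Pow I. (\<Prod>i\<in>T. e i) * ?S T)"
      unfolding wexp sum_distrib_left sum_distrib_right
      by (subst sum.swap) (simp add: mult.assoc)
    also have "\<dots> = (\<Sum>n=1..K. mangoldt n / real n) + (\<Sum>T\<in>Pow I - {{}}. (\<Prod>i\<in>T. e i) * ?S T)"
      using fin by (subst sum.remove[of _ "{}"]) auto
    finally have 1: "(\<Sum>n=1..K. w n * (mangoldt n / real n)) = (\<Sum>n=1..K. mangoldt n / real n) + (\<Sum>T\<in>Pow I - {{}}. (\<Prod>i\<in>T. e i) * ?S T)" .
    have "\<bar>\<Sum>T\<in>Pow I - {{}}. (\<Prod>i\<in>T. e i) * ?S T\<bar> \<le> (\<Sum>T\<in>Pow I - {{}}. c T)"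
    proof (rule order_trans[OF sum_abs], rule sum_mono)
      fix T assume T: "T \<in> Pow I - {{}}"
      have "\<bar>\<Prod>i\<in>T. e i\<bar> = 1" unfolding abs_prod using T e by (intro prod.neutral) auto
      then show "\<bar>(\<Prod>i\<in>T. e i) * ?S T\<bar> \<le> c T" using c[OF T, of K] by (simp add: abs_mult)
    qed
    with 1 mertens_mangoldt[OF K] have 2: "\<bar>(\<Sum>n=1..K. w n * (mangoldt n / real n)) - ln (real K)\<bar> \<le> 4 + (\<Sum>T\<in>Pow I - {{}}. c T)"
      by linarith
    have "(\<Sum>n=1..K. w n * (mangoldt n / real n)) = (\<Sum>n | n \<in> {1..K} \<and> prime n. w n * (mangoldt n / real n))
        + (\<Sum>n | n \<in> {1..K} \<and> \<not> prime n. w n * (mangoldt n / real n))"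
      by (subst sum.union_disjoint[symmetric]) (auto intro!: sum.cong)
    moreover have "(\<Sum>n | n \<in> {1..K} \<and> prime n. w n * (mangoldt n / real n)) = (\<Sum>n | n \<in> {1..K} \<and> prime n. w n * (ln (real n) / real n))"
      by (rule sum.cong) (auto simp: mangoldt_def primepow_prime aprimedivisor_prime_power[of _ 1, simplified])
    moreover have "0 \<le> (\<Sum>n | n \<in> {1..K} \<and> \<not> prime n. w n * (mangoldt n / real n))"
      using w by (intro sum_nonneg mult_nonneg_nonneg) auto
    moreover have "(\<Sum>n | n \<in> {1..K} \<and> \<not> prime n. w n * (mangoldt n / real n)) \<le> 2 ^ card I * 16"
    proof -
      have "(\<Sum>n | n \<in> {1..K} \<and> \<not> prime n. w n * (mangoldt n / real n)) \<le> (\<Sum>n | n \<in> {1..K} \<and> \<not> prime n. 2 ^ card I * (mangoldt n / real n))"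
        using w by (intro sum_mono mult_right_mono) auto
      also have "\<dots> = 2 ^ card I * (\<Sum>n | n \<in> {1..K} \<and> \<not> prime n. mangoldt n / real n)" by (simp only: sum_distrib_left)
      also have "\<dots> \<le> 2 ^ card I * 16" by (intro mult_left_mono sum_mangoldt_nonprime_bounded) auto
      finally show ?thesis .
    qed
    ultimately show "\<bar>(\<Sum>l | l \<in> {1..K} \<and> prime l. (\<Prod>i\<in>I. 1 + e i * chi i l) * (ln (real l) / real l)) - ln (real K)\<bar> \<le> C"
      using 2 unfolding w_def[symmetric] C_def by linarith
  qed
qed


text \<open>The estimate is subtracted at \<open>M x\<close> and \<open>x\<close>: with
  \<open>ln M\<close> at least twice the error plus 1, the primes in between carry total weight at
  least 1, and each carries at most \<open>2 ^ card I\<close> times \<open>ln (M x) / x\<close>. The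
  condition is \<open>\<noteq> -1\<close> because a prime where a character takes the value 0 keeps
  a positive factor.\<close>

lemma prime_density_real_characters:
  fixes chi :: "'i \<Rightarrow> nat \<Rightarrow> real" and e :: "'i \<Rightarrow> real"
  assumes fin: "finite I" and char: "\<And>T. T \<subseteq> I \<Longrightarrow> T \<noteq> {} \<Longrightarrow> \<exists>B. real_character (\<lambda>n. \<Prod>i\<in>T. chi i n) B"
    and e: "\<And>i. i \<in> I \<Longrightarrow> \<bar>e i\<bar> = 1"
  obtains M :: nat and c :: real where "M \<ge> 2" "c > 0"
    "\<And>x. x \<ge> 1 \<Longrightarrow> c * real x / ln (real (M * x)) \<le> real (card {l \<in> {x<..M * x}. prime l \<and> (\<forall>i\<in>I. e i * chi i l \<noteq> -1)})"
proof -
  define w where "w n = (\<Prod>i\<in>I. 1 + e i * chi i n)" for n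
  obtain C where C: "\<And>K. K \<ge> 1 \<Longrightarrow> \<bar>(\<Sum>l | l \<in> {1..K} \<and> prime l. w l * (ln (real l) / real l)) - ln (real K)\<bar> \<le> C"
    unfolding w_def by (rule dirichlet_real_characters[OF fin char e]; assumption?) auto
  have w_le: "w n \<le> 2 ^ card I" for n
  proof -
    have "0 \<le> 1 + e i * chi i n \<and> 1 + e i * chi i n \<le> 2" if i: "i \<in> I" for i
    proof -
      obtain B where "real_character (\<lambda>n. \<Prod>i\<in>{i}. chi i n) B" using char[of "{i}"] i by auto
      from real_character.abs_chi_le[OF this, of n] have "\<bar>e i * chi i n\<bar> \<le> 1" using e[OF i] by (simp add: abs_mult)
      then show ?thesis by (simp add: abs_le_iff)
    qed
    then have "w n \<le> (\<Prod>i\<in>I. 2)" unfolding w_def by (intro prod_mono) auto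
    then show ?thesis by simp
  qed
  obtain M0 :: nat where M0: "exp (2 * C + 1) < real M0" using reals_Archimedean2 by blast
  define M where "M = max 2 M0"
  have M2: "M \<ge> 2" by (simp add: M_def)
  have "ln (exp (2 * C + 1)) < ln (real M)"
    using M0 by (subst ln_less_cancel_iff) (auto simp: M_def)
  then have lnM: "2 * C + 1 \<le> ln (real M)" by simp
  show ?thesis
  proof (rule that[of M "1 / 2 ^ card I"])
    show "M \<ge> 2" by (rule M2)
    show "(0::real) < 1 / 2 ^ card I" by simp
    fix x :: nat assume x: "x \<ge> 1"
    let ?P = "{l \<in> {x<..M * x}. prime l \<and> (\<forall>i\<in>I. e i * chi i l \<noteq> -1)}"
    let ?g = "\<lambda>l. w l * (ln (real l) / real l)"
    have Mx: "M * x \<ge> 1" "x \<le> M * x" using x M2 by auto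
    have "{l. l \<in> {1..M*x} \<and> prime l} = {l. l \<in> {1..x} \<and> prime l} \<union> {l. l \<in> {x<..M*x} \<and> prime l}"
      using x by (auto intro: order_trans[OF _ Mx(2)])
    moreover have "sum ?g ({l. l \<in> {1..x} \<and> prime l} \<union> {l. l \<in> {x<..M*x} \<and> prime l}) = sum ?g {l. l \<in> {1..x} \<and> prime l} + sum ?g {l. l \<in> {x<..M*x} \<and> prime l}"
      by (rule sum.union_disjoint) auto
    ultimately have "sum ?g {l. l \<in> {1..M*x} \<and> prime l} = sum ?g {l. l \<in> {1..x} \<and> prime l} + sum ?g {l. l \<in> {x<..M*x} \<and> prime l}"
      by metis
    then have "ln (real (M*x)) - ln (real x) - 2 * C \<le> sum ?g {l. l \<in> {x<..M*x} \<and> prime l}"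
      using C[OF Mx(1)] C[OF x] by linarith
    moreover have "ln (real (M*x)) = ln (real M) + ln (real x)" using x M2 by (simp add: ln_mult)
    ultimately have "1 \<le> sum ?g {l. l \<in> {x<..M*x} \<and> prime l}" using lnM by linarith
    also have "\<dots> = sum ?g ?P"
    proof (rule sum.mono_neutral_right)
      show "\<forall>l\<in>{l. l \<in> {x<..M*x} \<and> prime l} - ?P. ?g l = 0"
      proof
        fix l assume "l \<in> {l. l \<in> {x<..M*x} \<and> prime l} - ?P"
        then obtain i where i: "i \<in> I" "e i * chi i l = -1" by auto
        then have "\<exists>i\<in>I. 1 + e i * chi i l = 0" by (intro bexI[of _ i]) auto
        then have "w l = 0" unfolding w_def using fin by (simp add: prod_zero_iff)
        then show "?g l = 0" by simp
      qed
    qed auto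
    also have "\<dots> \<le> (\<Sum>l\<in>?P. 2 ^ card I * (ln (real (M*x)) / real x))"
    proof (rule sum_mono)
      fix l assume l: "l \<in> ?P"
      have "ln (real l) / real l \<le> ln (real (M*x)) / real x"
        using l x Mx by (intro frac_le) (auto simp del: of_nat_mult)
      then show "?g l \<le> 2 ^ card I * (ln (real (M*x)) / real x)"
        using l x by (intro mult_mono w_le) auto
    qed
    also have "\<dots> = real (card ?P) * (2 ^ card I * (ln (real (M*x)) / real x))" by simp
    finally have 1: "1 \<le> real (card ?P) * (2 ^ card I * (ln (real (M*x)) / real x))" .
    have "1 < real (M * x)" using M2 x by (metis Mx(2) One_nat_def Suc_1 le_antisym le_trans linorder_not_le mult_le_mono nat_mult_1_right not_less_eq_eq of_nat_1 of_nat_less_iff)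
    then have "ln (real (M*x)) > 0" by (rule ln_gt_zero)
    then show "1 / 2 ^ card I * real x / ln (real (M*x)) \<le> real (card ?P)"
      using 1 x by (simp add: field_simps)
  qed
qed

text \<open>Multiplication by a unit \<open>a\<close> with \<open>f a = -1\<close> permutes the
  residues and negates the sum over a period, which is therefore 0; only one incomplete period
  remains.\<close>

lemma real_character_periodic:
  fixes f :: "nat \<Rightarrow> real"
  assumes "\<And>m n. f (m * n) = f m * f n" "f 1 = 1" "\<And>n. f n \<in> {-1,0,1}"
    and per: "\<And>n. f (n + N) = f n" and N: "N > 0" and a: "coprime a N" "f a = -1"
  shows "real_character f (real N)"
proof
  have perk: "f (n + k * N) = f n" for n k
  proof (induction k)
    case (Suc k)
    have "n + Suc k * N = (n + k * N) + N" by simp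
    then show ?case by (simp only: per Suc)
  qed simp
  have fmod: "f (n mod N) = f n" for n
    using perk[of "n mod N" "n div N"] by simp
  have z: "(\<Sum>n<N. f n) = 0"
  proof -
    have "bij_betw (\<lambda>n. a * n mod N) {..<N} {..<N}"
    proof -
      have "inj_on (\<lambda>n. a * n mod N) {..<N}"
      proof (rule inj_onI)
        fix x y assume "x \<in> {..<N}" "y \<in> {..<N}" "a * x mod N = a * y mod N"
        then have "[a * x = a * y] (mod N)" by (simp add: cong_def)
        then have "[x = y] (mod N)" using a(1) by (simp add: cong_mult_lcancel_nat coprime_commute)
        then show "x = y" using \<open>x \<in> _\<close> \<open>y \<in> _\<close> by (simp add: cong_def)
      qed
      moreover from this have "(\<lambda>n. a * n mod N) ` {..<N} = {..<N}"
        by (intro endo_inj_surj) (use N in auto)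
      ultimately show ?thesis by (simp add: bij_betw_def)
    qed
    then have "(\<Sum>n<N. f (a * n mod N)) = (\<Sum>n<N. f n)" by (rule sum.reindex_bij_betw)
    then have "- (\<Sum>n<N. f n) = (\<Sum>n<N. f n)" using assms(1) a(2) by (simp add: fmod sum_negf)
    then show ?thesis by simp
  qed
  have zk: "(\<Sum>n<k*N. f n) = 0" for k
  proof (induction k)
    case (Suc k)
    have "(\<Sum>n<Suc k * N. f n) = (\<Sum>n<k*N. f n) + (\<Sum>n<N. f (n + k*N))"
    proof -
      have e: "{..<Suc k * N} = {..<k*N} \<union> {k*N..<k*N+N}" by auto
      have "(\<Sum>n<Suc k * N. f n) = (\<Sum>n<k*N. f n) + (\<Sum>n=k*N..<k*N+N. f n)"
        unfolding e by (rule sum.union_disjoint) auto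
      moreover have "(\<Sum>n=k*N..<k*N+N. f n) = (\<Sum>n<N. f (n + k*N))"
        using sum.shift_bounds_nat_ivl[of f 0 "k*N" N] by (simp add: atLeast0LessThan add.commute)
      ultimately show ?thesis by simp
    qed
    then show ?case using Suc z by (simp add: perk)
  qed simp
  have f0: "f 0 = 0"
    using assms(1)[of a 0] a(2) by simp
  have fa: "\<bar>f n\<bar> \<le> 1" for n using assms(3)[of n] by auto
  fix k
  show "\<bar>\<Sum>n=1..k. f n\<bar> \<le> real N"
  proof -
    define q r where "q = Suc k div N" and "r = Suc k mod N"
    have k: "Suc k = q * N + r" "r < N" using N by (auto simp: q_def r_def)
    have "(\<Sum>n=1..k. f n) = (\<Sum>n<Suc k. f n)"
    proof -
      have "{..<Suc k} = insert 0 {1..k}" by auto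
      then show ?thesis using f0 by simp
    qed
    also have "\<dots> = (\<Sum>n<q*N. f n) + (\<Sum>n=q*N..<q*N+r. f n)"
    proof -
      have e: "{..<Suc k} = {..<q*N} \<union> {q*N..<q*N+r}" using k by auto
      show ?thesis unfolding e by (rule sum.union_disjoint) auto
    qed
    also have "\<dots> = (\<Sum>n=q*N..<q*N+r. f n)" by (simp add: zk)
    finally have "\<bar>\<Sum>n=1..k. f n\<bar> \<le> (\<Sum>n=q*N..<q*N+r. \<bar>f n\<bar>)" by simp
    also have "\<dots> \<le> (\<Sum>n=q*N..<q*N+r. 1)" by (rule sum_mono) (rule fa)
    also have "\<dots> \<le> real N" using k by simp
    finally show ?thesis .
  qed
qed (use assms in auto)

section \<open>Legendre symbols as characters\<close>

lemma Legendre_cases: "Legendre a p \<in> {-1,0,1}"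
  by (simp add: Legendre_def)

lemma Legendre_cong: "[a = b] (mod p) \<Longrightarrow> Legendre a p = Legendre b p"
proof -
  assume ab: "[a = b] (mod p)"
  have "[a = 0] (mod p) \<longleftrightarrow> [b = 0] (mod p)" using ab by (meson cong_sym cong_trans)
  moreover have "QuadRes p a \<longleftrightarrow> QuadRes p b" unfolding QuadRes_def using ab by (meson cong_sym cong_trans)
  ultimately show ?thesis by (simp add: Legendre_def)
qed

text \<open>By Euler's criterion the two sides agree modulo \<open>p\<close>; both lie in {-1, 0,
  1}, so they differ by at most \<open>2 < p\<close>.\<close>

lemma Legendre_mult:
  assumes "prime p" "p > 2"
  shows "Legendre (a * b) (int p) = Legendre a (int p) * Legendre b (int p)"
proof -
  define k where "k = (p - 1) div 2"
  have "[Legendre (a * b) (int p) = (a * b) ^ k] (mod int p)" unfolding k_def by (rule euler_criterion[OF assms])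
  also have "(a * b) ^ k = a ^ k * b ^ k" by (rule power_mult_distrib)
  also have "[a ^ k * b ^ k = Legendre a (int p) * Legendre b (int p)] (mod int p)"
    unfolding k_def by (intro cong_mult cong_sym[OF euler_criterion[OF assms]])
  finally have "int p dvd Legendre (a * b) (int p) - Legendre a (int p) * Legendre b (int p)"
    by (simp add: cong_iff_dvd_diff)
  moreover have "\<bar>Legendre (a * b) (int p) - Legendre a (int p) * Legendre b (int p)\<bar> \<le> 2"
    using Legendre_cases[of a "int p"] Legendre_cases[of b "int p"] Legendre_cases[of "a*b" "int p"] by auto
  ultimately have "Legendre (a * b) (int p) - Legendre a (int p) * Legendre b (int p) = 0"
    using dvd_imp_le_int[of "Legendre (a * b) (int p) - Legendre a (int p) * Legendre b (int p)" "int p"] assms(2)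
    by linarith
  then show ?thesis by simp
qed

lemma Legendre_one: "p > 1 \<Longrightarrow> Legendre 1 p = 1"
  by (auto simp: Legendre_def QuadRes_def cong_def intro: exI[of _ 1])

text \<open>Squaring takes the same value at 1 and \<open>p - 1\<close>, so it is not injective on
  the residues, hence not surjective.\<close>

lemma nonresidue_exists:
  assumes "prime p" "p > 2"
  obtains a :: nat where "Legendre (int a) (int p) = -1"
proof -
  have "\<exists>a<p. \<not> (\<exists>y<p. y\<^sup>2 mod p = a)"
  proof (rule ccontr)
    assume c: "\<not> (\<exists>a<p. \<not> (\<exists>y<p. y\<^sup>2 mod p = a))"
    let ?f = "\<lambda>y. y\<^sup>2 mod p"
    have "?f ` {..<p} = {..<p}" using c assms by auto
    then have "inj_on ?f {..<p}" by (intro eq_card_imp_inj_on) auto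
    moreover have "?f 1 = ?f (p - 1)"
    proof -
      obtain k where k: "p = Suc k" using assms by (cases p) auto
      have "k\<^sup>2 = 1 + (k - 1) * p" using assms k by (cases k) (auto simp: power2_eq_square algebra_simps)
      then have "k\<^sup>2 mod p = 1 mod p" by (metis mod_mult_self1)
      then show ?thesis using k by simp
    qed
    ultimately have "1 = p - 1" using assms inj_onD[of ?f "{..<p}" 1 "p-1"] by simp
    then show False using assms by simp
  qed
  then obtain a where a: "a < p" "\<And>y. y < p \<Longrightarrow> y\<^sup>2 mod p \<noteq> a" by auto
  have "a \<noteq> 0" using a(2)[of 0] assms by auto
  then have 1: "\<not> [int a = 0] (mod int p)" using a(1) by (simp add: cong_def)
  have 2: "\<not> QuadRes (int p) (int a)"
  proof
    assume "QuadRes (int p) (int a)"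
    then obtain y where y: "[y\<^sup>2 = int a] (mod int p)" by (auto simp: QuadRes_def)
    define z where "z = nat (y mod int p)"
    have z: "int z = y mod int p" "z < p" using assms by (auto simp: z_def nat_less_iff)
    have "int (z\<^sup>2 mod p) = (y mod int p)\<^sup>2 mod int p" by (simp add: z(1) zmod_int)
    also have "\<dots> = y\<^sup>2 mod int p" by (simp add: power_mod)
    also have "\<dots> = int a" using y a(1) by (simp add: cong_def)
    finally show False using a(2)[OF z(2)] by simp
  qed
  show ?thesis by (rule that[of a]) (simp add: Legendre_def 1 2)
qed

text \<open>Gauss's lemma with \<open>p = 4 k + 1\<close>: the doubles \<open>2 x\<close> for
  \<open>x \<le> 2 k\<close> stay below \<open>p\<close>, and those exceeding
  \<open>(p - 1) / 2\<close> come from the \<open>k\<close> values \<open>x > k\<close>.\<close>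

lemma Legendre_two:
  assumes "prime p" "p mod 4 = 1"
  shows "Legendre 2 (int p) = (if p mod 8 = 1 then 1 else -1)"
proof -
  obtain k where k: "p = 4 * k + 1" using assms(2) by (metis mod_div_decomp mult.commute)
  have p2: "2 < p" using assms k prime_gt_1_nat[OF assms(1)] by auto
  interpret GAUSS p 2
    using assms p2 by unfold_locales (auto simp: cong_def)
  have "Legendre 2 p = (-1) ^ card E" by (rule gauss_lemma)
  moreover have "E = (\<lambda>x. 2 * x) ` {int k + 1 .. 2 * int k}"
  proof -
    have C: "C = (\<lambda>x. 2 * x) ` {1..2 * int k}"
    proof -
      have "A = {1..2 * int k}" unfolding A_def using k by auto
      then have "C = (\<lambda>x. (x * 2) mod int p) ` {1..2 * int k}" unfolding C_def B_def by (auto simp: image_image)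
      also have "\<dots> = (\<lambda>x. 2 * x) ` {1..2 * int k}"
        by (rule image_cong) (auto simp: k)
      finally show ?thesis .
    qed
    show ?thesis unfolding E_def C using k by auto
  qed
  then have "card E = k" by (simp add: card_image inj_on_def)
  moreover have "p mod 8 = 1 \<longleftrightarrow> even k" unfolding k by presburger
  ultimately show ?thesis by auto
qed

lemma Legendre_swap:
  assumes "prime p" "p mod 4 = 1" "prime q" "q > 2" "p \<noteq> q"
  shows "Legendre (int p) (int q) = Legendre (int q) (int p)"
proof -
  have p2: "p > 2" using assms(1,2) prime_gt_1_nat[OF assms(1)] by (cases "p = 2") auto
  have "even ((p - 1) div 2)" using assms(2) by presburger
  then have 1: "Legendre (int p) (int q) * Legendre (int q) (int p) = 1"
    using Quadratic_Reciprocity[OF assms(1) p2 assms(3,4,5)] by simp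
  then show ?thesis using Legendre_cases[of p q] Legendre_cases[of q p] by auto
qed

text \<open>The index names the character: 4 stands for the symbol of -1, 8 for the symbol of 2, an
  odd prime for its Legendre symbol. As 4 and 8 are not prime the codes do not clash, and a finite
  set of indices describes a product of independent characters.\<close>

definition rchar :: "nat \<Rightarrow> nat \<Rightarrow> real" where
  "rchar i n = (if i = 4 then (if even n then 0 else if n mod 4 = 1 then 1 else -1)
     else if i = 8 then (if even n then 0 else if n mod 8 \<in> {1,7} then 1 else -1)
     else real_of_int (Legendre (int n) (int i)))"

lemma rchar_4 [simp]: "rchar 4 n = (if even n then 0 else if n mod 4 = 1 then 1 else -1)"
  and rchar_8 [simp]: "rchar 8 n = (if even n then 0 else if n mod 8 \<in> {1,7} then 1 else -1)"
  by (simp_all add: rchar_def)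

lemma rchar_prime: "prime i \<Longrightarrow> rchar i n = real_of_int (Legendre (int n) (int i))"
proof -
  assume "prime i"
  then have "i \<noteq> 4" "i \<noteq> 8"
    using prime_nat_not_dvd[of 4 2] prime_nat_not_dvd[of 8 2] by fastforce+
  then show ?thesis by (simp add: rchar_def)
qed

lemma rchar_vals: "rchar i n \<in> {-1,0,1}"
  using Legendre_cases[of "int n" "int i"] by (auto simp: rchar_def)

lemma rchar_mult:
  assumes "i \<in> {4,8} \<or> prime i \<and> i > 2"
  shows "rchar i (m * n) = rchar i m * rchar i n"
proof -
  consider "i = 4" | "i = 8" | "prime i" "i > 2" using assms by auto
  then show ?thesis
  proof cases
    case 1
    show ?thesis
    proof (cases "even m \<or> even n")
      case False
      then have "m mod 4 = 1 \<or> m mod 4 = 3" "n mod 4 = 1 \<or> n mod 4 = 3" by presburger+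
      moreover have "(m * n) mod 4 = (m mod 4) * (n mod 4) mod 4" by (simp add: mod_mult_eq)
      ultimately show ?thesis using False unfolding 1 rchar_4 by (elim disjE) simp_all
    qed (auto simp: 1)
  next
    case 2
    show ?thesis
    proof (cases "even m \<or> even n")
      case False
      then have "m mod 8 = 1 \<or> m mod 8 = 3 \<or> m mod 8 = 5 \<or> m mod 8 = 7"
        "n mod 8 = 1 \<or> n mod 8 = 3 \<or> n mod 8 = 5 \<or> n mod 8 = 7" by presburger+
      moreover have "(m * n) mod 8 = (m mod 8) * (n mod 8) mod 8" by (simp add: mod_mult_eq)
      ultimately show ?thesis using False unfolding 2 rchar_8 by (elim disjE) simp_all
    qed (auto simp: 2)
  next
    case 3
    then show ?thesis by (simp add: rchar_prime Legendre_mult)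
  qed
qed

lemma rchar_one: "i \<in> {4,8} \<or> prime i \<and> i > 2 \<Longrightarrow> rchar i 1 = 1"
  by (auto simp: rchar_prime Legendre_one)

lemma rchar_cong:
  assumes "i \<in> {4,8} \<or> prime i \<and> i > 2" "[m = n] (mod i)"
  shows "rchar i m = rchar i n"
proof -
  consider "i = 4" | "i = 8" | "prime i" "i > 2" using assms by auto
  then show ?thesis
  proof cases
    case 1
    have "m mod 4 = n mod 4" using assms(2) 1 by (simp add: cong_def)
    moreover from this have "even m = even n" by presburger
    ultimately show ?thesis unfolding 1 by simp
  next
    case 2
    have "m mod 8 = n mod 8" using assms(2) 2 by (simp add: cong_def)
    moreover from this have "even m = even n" by presburger
    ultimately show ?thesis unfolding 2 by simp
  next
    case 3
    then show ?thesis using assms(2) by (simp add: rchar_prime) (metis Legendre_cong cong_int_iff)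
  qed
qed

text \<open>Independence means that some unit has value -1. If an odd prime \<open>l\<close> occurs
  in \<open>T\<close>, the Chinese remainder theorem gives a number that is a non-residue modulo
  \<open>l\<close> and 1 modulo all the rest; otherwise 5 or 7 serves.\<close>

lemma rchar_product_character:
  assumes fin: "finite T" and T: "T \<noteq> {}" "\<And>i. i \<in> T \<Longrightarrow> i \<in> {4,8} \<or> prime i \<and> i > 2"
  shows "\<exists>B. real_character (\<lambda>n. \<Prod>i\<in>T. rchar i n) B"
proof -
  define P where "P = {i \<in> T. prime i \<and> i > 2}"
  define N where "N = 8 * \<Prod>P"
  have finP: "finite P" using fin by (simp add: P_def)
  have Ppos: "\<Prod>P > 0" using finP by (intro prod_pos) (auto simp: P_def)
  then have N: "N > 0" by (simp add: N_def)
  have idvd: "i dvd N" if "i \<in> T" for i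
  proof (cases "i \<in> {4,8}")
    case True then show ?thesis by (auto simp: N_def)
  next
    case False
    then have "i \<in> P" using T(2)[OF that] that by (auto simp: P_def)
    then show ?thesis using finP by (auto simp: N_def intro: dvd_mult dvd_prodI)
  qed
  have per: "(\<Prod>i\<in>T. rchar i (n + N)) = (\<Prod>i\<in>T. rchar i n)" for n
    by (intro prod.cong refl rchar_cong T(2)) (use idvd in \<open>auto simp: cong_def mod_add_eq[symmetric] elim!: dvdE\<close>)
  have mult: "(\<Prod>i\<in>T. rchar i (m * n)) = (\<Prod>i\<in>T. rchar i m) * (\<Prod>i\<in>T. rchar i n)" for m n
    unfolding prod.distrib[symmetric] by (intro prod.cong refl rchar_mult T(2))
  have one: "(\<Prod>i\<in>T. rchar i 1) = 1" by (intro prod.neutral ballI rchar_one T(2))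
  have vals: "(\<Prod>i\<in>T. rchar i n) \<in> {-1,0,1}" for n
    using fin
  proof (induction T rule: finite_induct)
    case (insert x F)
    then show ?case using rchar_vals[of x n] by auto
  qed simp
  have "\<exists>a. coprime a N \<and> (\<Prod>i\<in>T. rchar i a) = -1"
  proof (cases "P = {}")
    case True
    then have "T \<subseteq> {4,8}" using T(2) by (auto simp: P_def)
    then have "T = {4} \<or> T = {8} \<or> T = {4,8}" using T(1) by blast
    moreover have "coprime (5::nat) 8" "coprime (7::nat) 8" by (simp_all add: coprime_iff_gcd_eq_1 gcd_nat.simps)
    ultimately show ?thesis using True by (auto simp: N_def intro: exI[of _ 5] exI[of _ 7])
  next
    case False
    then obtain l where l: "l \<in> P" by auto
    define M where "M = 8 * \<Prod>(P - {l})"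
    have NM: "N = l * M" unfolding N_def M_def using prod.remove[OF finP l, of "\<lambda>x. x"] by (simp add: algebra_simps)
    have lp: "prime l" "l > 2" using l by (auto simp: P_def)
    have cop: "coprime l M"
    proof -
      have "coprime l 8"
      proof -
        have "coprime l 2" using lp prime_odd_nat[of l] by simp
        then have "coprime l (2^3)" unfolding coprime_power_right_iff by simp
        moreover have "(8::nat) = 2^3" by simp
        ultimately show ?thesis by metis
      qed
      moreover have "coprime l (\<Prod>(P - {l}))"
        by (rule prod_coprime_right) (use lp in \<open>auto simp: P_def intro: primes_coprime\<close>)
      ultimately show ?thesis by (simp add: M_def)
    qed
    obtain b where b: "Legendre (int b) (int l) = -1" using nonresidue_exists lp by blast
    obtain a where a: "[a = b] (mod l)" "[a = 1] (mod M)"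
      using binary_chinese_remainder_nat[OF cop] by blast
    have rl: "rchar l a = -1" using b rchar_cong[of l a b] a lp by (simp add: rchar_prime)
    have r1: "rchar i a = 1" if "i \<in> T - {l}" for i
    proof -
      have "i dvd M"
      proof (cases "i \<in> {4,8}")
        case True then show ?thesis by (auto simp: M_def)
      next
        case False
        then have "i \<in> P - {l}" using T(2)[of i] that by (auto simp: P_def)
        then show ?thesis using finP by (auto simp: M_def intro: dvd_mult dvd_prodI)
      qed
      then have "[a = 1] (mod i)" using a(2) cong_dvd_modulus_nat by blast
      then show ?thesis using rchar_cong[of i a 1] rchar_one[of i] T(2)[of i] that by auto
    qed
    have "l \<in> T" using l by (simp add: P_def)
    then have "(\<Prod>i\<in>T. rchar i a) = -1" using prod.remove[OF fin, of l "\<lambda>i. rchar i a"] rl r1 by simp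
    moreover have "coprime a N"
    proof -
      have "coprime a M" using a(2) by (metis cong_imp_coprime cong_sym coprime_1_left)
      moreover have "\<not> l dvd a"
      proof
        assume "l dvd a"
        then have "[int a = 0] (mod int l)" by (simp add: cong_0_iff)
        then show False using rl lp by (simp add: rchar_prime Legendre_def)
      qed
      then have "coprime a l" using lp by (meson coprime_commute prime_imp_coprime)
      ultimately show ?thesis by (simp add: NM)
    qed
    ultimately show ?thesis by blast
  qed
  then obtain a where a: "coprime a N" "(\<Prod>i\<in>T. rchar i a) = -1" by blast
  show ?thesis
    using real_character_periodic[of "\<lambda>n. \<Prod>i\<in>T. rchar i n" N a, OF mult one vals per N a] by blast
qed

section \<open>Ternary forms and sums of three squares\<close>

text \<open>The six numbers are the Gram matrix of three integer vectors: \<open>a\<close>,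
  \<open>b\<close>, \<open>c\<close> are the norms of \<open>x\<close>, \<open>y\<close>,
  \<open>z\<close>, and \<open>u\<close>, \<open>v\<close>, \<open>w\<close> the products
  \<open>yz\<close>, \<open>xz\<close>, \<open>xy\<close>. Changes of basis of a ternary form become
  operations on the vectors.\<close>

definition gram :: "int \<Rightarrow> int \<Rightarrow> int \<Rightarrow> int \<Rightarrow> int \<Rightarrow> int \<Rightarrow> bool" where
  "gram a b c u v w \<longleftrightarrow> (\<exists>x1 x2 x3 y1 y2 y3 z1 z2 z3.
     a = x1*x1 + x2*x2 + x3*x3 \<and> b = y1*y1 + y2*y2 + y3*y3 \<and> c = z1*z1 + z2*z2 + z3*z3 \<and>
     u = y1*z1 + y2*z2 + y3*z3 \<and> v = x1*z1 + x2*z2 + x3*z3 \<and> w = x1*y1 + x2*y2 + x3*y3)"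

lemma gram_swap12:
  assumes "gram b a c v u w" shows "gram a b c u v w"
proof -
  obtain x1 x2 x3 y1 y2 y3 z1 z2 z3 where g: "b = x1*x1 + x2*x2 + x3*x3" "a = y1*y1 + y2*y2 + y3*y3" "c = z1*z1 + z2*z2 + z3*z3"
    "v = y1*z1 + y2*z2 + y3*z3" "u = x1*z1 + x2*z2 + x3*z3" "w = x1*y1 + x2*y2 + x3*y3"
    using assms unfolding gram_def by blast
  show ?thesis unfolding gram_def
    by (rule exI[of _ y1], rule exI[of _ y2], rule exI[of _ y3], rule exI[of _ x1], rule exI[of _ x2],
        rule exI[of _ x3], rule exI[of _ z1], rule exI[of _ z2], rule exI[of _ z3]) (simp add: g mult.commute)
qed

lemma gram_swap23:
  assumes "gram a c b u w v" shows "gram a b c u v w"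
proof -
  obtain x1 x2 x3 y1 y2 y3 z1 z2 z3 where g: "a = x1*x1 + x2*x2 + x3*x3" "c = y1*y1 + y2*y2 + y3*y3" "b = z1*z1 + z2*z2 + z3*z3"
    "u = y1*z1 + y2*z2 + y3*z3" "w = x1*z1 + x2*z2 + x3*z3" "v = x1*y1 + x2*y2 + x3*y3"
    using assms unfolding gram_def by blast
  show ?thesis unfolding gram_def
    by (rule exI[of _ x1], rule exI[of _ x2], rule exI[of _ x3], rule exI[of _ z1], rule exI[of _ z2],
        rule exI[of _ z3], rule exI[of _ y1], rule exI[of _ y2], rule exI[of _ y3]) (simp add: g mult.commute)
qed

text \<open>The hypothesis is the matrix after replacing \<open>y\<close> by \<open>y + t x\<close>;
  given vectors for it, the substitution is undone on the vectors.\<close>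

lemma gram_add12:
  assumes "gram a (b + 2*t*w + t*t*a) c (u + t*v) v (w + t*a)"
  shows "gram a b c u v w"
proof -
  obtain x1 x2 x3 y1 y2 y3 z1 z2 z3 where g:
    "a = x1*x1 + x2*x2 + x3*x3" "b + 2*t*w + t*t*a = y1*y1 + y2*y2 + y3*y3" "c = z1*z1 + z2*z2 + z3*z3"
    "u + t*v = y1*z1 + y2*z2 + y3*z3" "v = x1*z1 + x2*z2 + x3*z3" "w + t*a = x1*y1 + x2*y2 + x3*y3"
    using assms unfolding gram_def by blast
  show ?thesis unfolding gram_def
  proof (intro exI conjI)
    have w: "w = x1*(y1 - t*x1) + x2*(y2 - t*x2) + x3*(y3 - t*x3)" using g(1,6) by Groebner_Basis.algebra
    then show "w = x1*(y1 - t*x1) + x2*(y2 - t*x2) + x3*(y3 - t*x3)" .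
    show "b = (y1 - t*x1)*(y1 - t*x1) + (y2 - t*x2)*(y2 - t*x2) + (y3 - t*x3)*(y3 - t*x3)"
      using g(1,2,6) by Groebner_Basis.algebra
    show "u = (y1 - t*x1)*z1 + (y2 - t*x2)*z2 + (y3 - t*x3)*z3" using g(4,5) by Groebner_Basis.algebra
  qed (use g in auto)
qed

lemma gram_add13: "gram a b (c + 2*t*v + t*t*a) (u + t*w) (v + t*a) w \<Longrightarrow> gram a b c u v w"
  by (rule gram_swap23, rule gram_add12[where t=t], rule gram_swap23)

lemma gram_add23: "gram a b (c + 2*t*u + t*t*b) (u + t*b) (v + t*w) w \<Longrightarrow> gram a b c u v w"
  by (rule gram_swap12, rule gram_add13[where t=t], rule gram_swap12)

lemma balanced_residue: "a > 0 \<Longrightarrow> \<exists>t. 2 * \<bar>w + t * a\<bar> \<le> (a::int)"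
proof -
  assume a: "a > 0"
  define t where "t = (2*w + a) div (2*a)"
  have "2*a*t + (2*w + a) mod (2*a) = 2*w + a" unfolding t_def by (rule mult_div_mod_eq)
  moreover have "0 \<le> (2*w + a) mod (2*a)" "(2*w + a) mod (2*a) < 2*a" using a by simp_all
  ultimately have "2*a*t \<le> 2*w + a" "2*w + a < 2*a*t + 2*a" by linarith+
  then have "2 * (w + (-t) * a) \<le> a" "- (2 * (w + (-t) * a)) \<le> a" by (simp_all add: algebra_simps)
  then have "2 * \<bar>w + (-t) * a\<bar> \<le> a" by (simp only: abs_if split: if_split) simp
  then show ?thesis by blast
qed

text \<open>The determinant of the symmetric matrix with rows \<open>(a, w, v)\<close>,
  \<open>(w, b, u)\<close>, \<open>(v, u, c)\<close>.\<close>

definition tdet :: "int \<Rightarrow> int \<Rightarrow> int \<Rightarrow> int \<Rightarrow> int \<Rightarrow> int \<Rightarrow> int" where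
  "tdet a b c u v w = a*b*c + 2*u*v*w - a*u*u - b*v*v - c*w*w"

text \<open>Two-step reduction: first minimise the leading coefficient, then the leading coefficient
  of the binary form induced on the quotient by the first basis vector.\<close>
lemma gram_unimodular:
  assumes "a > 0" "a*b - w*w > 0" "tdet a b c u v w = 1"
  shows "gram a b c u v w"
  using assms
proof (induction "nat a" arbitrary: a b c u v w rule: less_induct)
  case (less a b c u v w)
  note outer = less(1)
  show ?case using less.prems
  proof (induction "nat (a*b - w*w)" arbitrary: b c u v w rule: less_induct)
    case (less b w c u v)
    note inner = less(1) and pos = less.prems
    obtain t where t: "2 * \<bar>w + t*a\<bar> \<le> a" using balanced_residue[OF pos(1)] by blast
    define b1 u1 w1 where "b1 = b + 2*t*w + t*t*a" and "u1 = u + t*v" and "w1 = w + t*a"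
    have D1: "a*b1 - w1*w1 = a*b - w*w" by (simp add: b1_def w1_def algebra_simps)
    have det1: "tdet a b1 c u1 v w1 = 1" using pos(3) unfolding tdet_def b1_def u1_def w1_def by Groebner_Basis.algebra
    have w1: "2 * \<bar>w1\<bar> \<le> a" using t by (simp add: w1_def)
    have "gram a b1 c u1 v w1"
    proof (cases "b1 < a")
      case True
      have "a * b1 > 0" using D1 pos(2) zero_le_square[of w1] by linarith
      then have b1: "b1 > 0" using pos(1) by (simp add: zero_less_mult_iff)
      have "gram b1 a c v u1 w1"
        by (rule outer) (use True b1 D1 pos det1 in \<open>auto simp: tdet_def algebra_simps\<close>)
      then show ?thesis by (rule gram_swap12)
    next
      case False
      define D where "D = a*b1 - w1*w1"
      have D: "D > 0" using D1 pos by (simp add: D_def)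
      obtain s where s: "2 * \<bar>(a*u1 - v*w1) + s*D\<bar> \<le> D" using balanced_residue[OF D] by blast
      define c2 u2 v2 where "c2 = c + 2*s*u1 + s*s*b1" and "u2 = u1 + s*b1" and "v2 = v + s*w1"
      obtain r where r: "2 * \<bar>v2 + r*a\<bar> \<le> a" using balanced_residue[OF pos(1)] by blast
      define c3 u3 v3 where "c3 = c2 + 2*r*v2 + r*r*a" and "u3 = u2 + r*w1" and "v3 = v2 + r*a"
      have g23: "a*u3 - v3*w1 = (a*u1 - v*w1) + s*D"
        by (simp add: u3_def v3_def u2_def v2_def D_def algebra_simps)
      have det3: "tdet a b1 c3 u3 v3 w1 = 1"
        using det1 unfolding tdet_def c3_def u3_def v3_def c2_def u2_def v2_def by Groebner_Basis.algebra
      have v3: "2 * \<bar>v3\<bar> \<le> a" using r by (simp add: v3_def)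
      \<comment> \<open>The binary form induced on the quotient by the first vector has coefficients
        \<open>D\<close>, \<open>a u3 - v3 w1\<close> and \<open>a c3 - v3^2\<close>; its
        determinant is \<open>a\<close> times the ternary determinant, which is 1.\<close>
      have key: "D * (a*c3 - v3*v3) - (a*u3 - v3*w1) * (a*u3 - v3*w1) = a"
        using det3 unfolding tdet_def D_def by Groebner_Basis.algebra
      have "gram a b1 c3 u3 v3 w1"
      proof (cases "a*c3 - v3*v3 < D")
        case True
        have "D * (a*c3 - v3*v3) > 0" using key pos(1) zero_le_square[of "a*u3 - v3*w1"] by linarith
        then have "a*c3 - v3*v3 > 0" using D by (simp add: zero_less_mult_iff)
        then have "gram a c3 b1 u3 w1 v3"
          by (intro inner) (use True D1 D pos det3 in \<open>auto simp: tdet_def D_def algebra_simps\<close>)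
        then show ?thesis by (rule gram_swap23)
      next
        case False2: False
        define h where "h = a*u3 - v3*w1"
        have h: "2 * \<bar>h\<bar> \<le> D" using s g23 by (simp add: h_def)
        have sq: "4 * (x * x) \<le> y * y" if "2 * \<bar>x\<bar> \<le> y" for x y :: int
          using mult_mono[OF that that] that by (simp add: abs_mult_self_eq)
        have "D * D \<le> D * (a*c3 - v3*v3)" using False2 D by (intro mult_left_mono) auto
        then have 1: "3 * (D * D) \<le> 4 * a" using key sq[OF h] unfolding h_def by linarith
        have "a * a \<le> a * b1" using False pos(1) by (intro mult_left_mono) auto
        then have 2: "3 * (a * a) \<le> 4 * D" using sq[OF w1] D_def by linarith
        \<comment> \<open>Neither reduction applies any more, which gives Hermite's inequalities
          \<open>3 a^2 \<le> 4 D\<close> and \<open>3 D^2 \<le> 4 a\<close>; for positive integers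
          only \<open>a = D = 1\<close> satisfies both.\<close>
        have a1: "a = 1"
        proof (rule ccontr)
          assume "a \<noteq> 1"
          then have a2: "a \<ge> 2" using pos(1) by simp
          then have "2 * a \<le> a * a" by (intro mult_right_mono) auto
          then have "6 * a \<le> 4 * D" using 2 by linarith
          then have D3: "D \<ge> 3" using a2 by linarith
          then have "3 * D \<le> D * D" by (intro mult_right_mono) auto
          then show False using 1 \<open>6 * a \<le> 4 * D\<close> D3 by linarith
        qed
        have z: "w1 = 0" "v3 = 0" using w1 v3 a1 by auto
        have "D = 1"
        proof (rule ccontr)
          assume "D \<noteq> 1"
          then have "D \<ge> 2" using D by simp
          then have "2 * D \<le> D * D" by (intro mult_right_mono) auto
          then show False using 1 a1 \<open>D \<ge> 2\<close> by linarith
        qed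
        then have b1: "b1 = 1" "u3 = 0" using h z a1 by (auto simp: D_def h_def)
        have "c3 = 1" using b1 det3 z a1 by (simp add: tdet_def)
        have "gram 1 1 1 0 0 0" unfolding gram_def
          by (rule exI[of _ 1], rule exI[of _ 0], rule exI[of _ 0], rule exI[of _ 0], rule exI[of _ 1],
              rule exI[of _ 0], rule exI[of _ 0], rule exI[of _ 0], rule exI[of _ 1]) simp
        then show ?thesis by (simp only: a1 b1 z \<open>c3 = 1\<close>)
      qed
      then have "gram a b1 c2 u2 v2 w1" unfolding c3_def u3_def v3_def by (rule gram_add13)
      then show ?thesis unfolding c2_def u2_def v2_def by (rule gram_add23)
    qed
    then show ?case unfolding b1_def u1_def w1_def by (rule gram_add12)
  qed
qed

text \<open>The three vectors have determinant \<plusminus>1, and a common divisor of the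
  coordinates of \<open>z\<close> divides that determinant.\<close>

lemma gram_unimodular_primitive:
  assumes "a > 0" "a*b - w*w > 0" "tdet a b c u v w = 1"
  obtains z1 z2 z3 where "c = z1*z1 + z2*z2 + z3*z3" "\<And>d. d dvd z1 \<Longrightarrow> d dvd z2 \<Longrightarrow> d dvd z3 \<Longrightarrow> is_unit d"
proof -
  obtain x1 x2 x3 y1 y2 y3 z1 z2 z3 where g:
    "a = x1*x1 + x2*x2 + x3*x3" "b = y1*y1 + y2*y2 + y3*y3" "c = z1*z1 + z2*z2 + z3*z3"
    "u = y1*z1 + y2*z2 + y3*z3" "v = x1*z1 + x2*z2 + x3*z3" "w = x1*y1 + x2*y2 + x3*y3"
    using gram_unimodular[OF assms] unfolding gram_def by blast
  define dt where "dt = (x2*y3 - x3*y2)*z1 + (x3*y1 - x1*y3)*z2 + (x1*y2 - x2*y1)*z3"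
  have "dt * dt = tdet a b c u v w" unfolding tdet_def g dt_def by Groebner_Basis.algebra
  then have "dt * dt = 1" using assms by simp
  then have "is_unit dt" by (metis dvd_triv_left)
  show ?thesis
  proof (rule that[OF g(3)])
    fix d assume "d dvd z1" "d dvd z2" "d dvd z3"
    then have "d dvd dt" unfolding dt_def by (intro dvd_add dvd_mult)
    then show "is_unit d" using \<open>is_unit dt\<close> by (rule dvd_trans)
  qed
qed

text \<open>A positive form with determinant 1 and \<open>n\<close> on its diagonal is built: the
  rows are \<open>(a, w, \<alpha>)\<close>, \<open>(w, b, \<beta>)\<close>,
  \<open>(\<alpha>, \<beta>, n)\<close>, arranged so that \<open>n a - \<alpha>^2\<close>,
  \<open>n w - \<alpha> \<beta>\<close>, \<open>n b - \<beta>^2\<close> equal \<open>Q\<close>,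
  \<open>B\<close>, \<open>C\<close>. Since \<open>Q C - B^2 = n\<close>, the determinant is
  1.\<close>

lemma three_squares_of_residues:
  fixes n Q :: int
  assumes n: "n > 0" and Q: "Q > 0" and cop: "coprime Q n" and B: "Q dvd B\<^sup>2 + n" and al: "n dvd \<alpha>\<^sup>2 + Q"
  obtains z1 z2 z3 where "n = z1\<^sup>2 + z2\<^sup>2 + z3\<^sup>2" "\<And>d. d dvd z1 \<Longrightarrow> d dvd z2 \<Longrightarrow> d dvd z3 \<Longrightarrow> is_unit d"
proof -
  obtain C where C: "B\<^sup>2 + n = Q * C" using B by blast
  have copa: "coprime \<alpha> n"
  proof (rule coprimeI)
    fix d assume d: "d dvd \<alpha>" "d dvd n"
    then have "d dvd \<alpha>\<^sup>2 + Q" using al dvd_trans by blast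
    moreover have "d dvd \<alpha>\<^sup>2" using d(1) by (simp add: power2_eq_square)
    ultimately have "d dvd Q" by (simp add: dvd_add_right_iff)
    then show "is_unit d" using cop d(2) by (simp add: coprime_def)
  qed
  obtain i where i: "[\<alpha> * i = 1] (mod n)" using cong_solve_coprime_int[OF copa] by blast
  \<comment> \<open>Forced by \<open>\<alpha> \<beta> = -B\<close> modulo \<open>n\<close>. That
    \<open>n\<close> also divides \<open>\<beta>^2 + C\<close> follows after multiplication by
    \<open>Q\<close>, which is coprime to \<open>n\<close>.\<close>
  define \<beta> where "\<beta> = - B * i"
  have "[\<alpha> * \<beta> = - B] (mod n)"
    using cong_mult[OF i cong_refl[of "-B" n]] by (simp add: \<beta>_def algebra_simps)
  then have ab: "n dvd \<alpha> * \<beta> + B" by (simp add: cong_iff_dvd_diff)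
  have bC: "n dvd \<beta>\<^sup>2 + C"
  proof -
    have "Q * (\<beta>\<^sup>2 + C) = (\<alpha>\<^sup>2 + Q) * \<beta>\<^sup>2 - (\<alpha> * \<beta> + B) * (\<alpha> * \<beta> - B) + n"
    proof -
      have "Q * C = B\<^sup>2 + n" using C by simp
      then show ?thesis by (simp add: algebra_simps power2_eq_square)
    qed
    moreover have "n dvd (\<alpha>\<^sup>2 + Q) * \<beta>\<^sup>2 - (\<alpha> * \<beta> + B) * (\<alpha> * \<beta> - B) + n"
      using al ab by (intro dvd_add dvd_diff) auto
    ultimately have "n dvd Q * (\<beta>\<^sup>2 + C)" by simp
    then show ?thesis using cop by (simp add: coprime_dvd_mult_right_iff coprime_commute)
  qed
  have nC: "n = Q * C - B\<^sup>2" using C by simp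
  obtain a where a: "\<alpha>\<^sup>2 + Q = n * a" using al by blast
  obtain b where b: "\<beta>\<^sup>2 + C = n * b" using bC by blast
  obtain w where w: "\<alpha> * \<beta> + B = n * w" using ab by blast
  have "n * a > 0" using Q a[symmetric] zero_le_power2[of \<alpha>] by linarith
  then have a0: "a > 0" using n by (simp add: zero_less_mult_iff)
  have D: "n\<^sup>2 * (a*b - w*w) = \<alpha>\<^sup>2 * C + Q * \<beta>\<^sup>2 - 2*\<alpha>*\<beta>*B + n"
  proof -
    have "n\<^sup>2 * (a*b - w*w) = (n*a) * (n*b) - (n*w) * (n*w)" by (simp add: algebra_simps power2_eq_square)
    also have "\<dots> = \<alpha>\<^sup>2 * C + Q * \<beta>\<^sup>2 - 2*\<alpha>*\<beta>*B + (Q * C - B\<^sup>2)"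
      unfolding a[symmetric] b[symmetric] w[symmetric] by (simp add: algebra_simps power2_eq_square)
    finally show ?thesis using nC by simp
  qed
  have "Q * (\<alpha>\<^sup>2 * C + Q * \<beta>\<^sup>2 - 2*\<alpha>*\<beta>*B) = (Q*\<beta> - B*\<alpha>)\<^sup>2 + \<alpha>\<^sup>2 * n"
    unfolding nC by (simp add: algebra_simps power2_eq_square)
  also have "\<dots> \<ge> 0" using n by simp
  finally have "\<alpha>\<^sup>2 * C + Q * \<beta>\<^sup>2 - 2*\<alpha>*\<beta>*B \<ge> 0" using Q by (simp add: zero_le_mult_iff)
  then have "n\<^sup>2 * (a*b - w*w) > 0" using D n by linarith
  then have D0: "a*b - w*w > 0" using n by (simp add: zero_less_mult_iff)
  have "n\<^sup>2 * tdet a b n \<beta> \<alpha> w = n\<^sup>2 * 1"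
  proof -
    have "n\<^sup>2 * tdet a b n \<beta> \<alpha> w
        = n * ((n*a) * (n*b) - (n*w) * (n*w) + 2*\<alpha>*\<beta>*(n*w) - (n*a)*\<beta>\<^sup>2 - (n*b)*\<alpha>\<^sup>2)"
      unfolding tdet_def by (simp add: algebra_simps power2_eq_square)
    also have "\<dots> = n * (Q * C - B\<^sup>2)"
      unfolding a[symmetric] b[symmetric] w[symmetric] by (simp add: algebra_simps power2_eq_square)
    also have "\<dots> = n\<^sup>2 * 1" using nC by (simp add: power2_eq_square)
    finally show ?thesis .
  qed
  then have "tdet a b n \<beta> \<alpha> w = 1" using n by simp
  from gram_unimodular_primitive[OF a0 D0 this] show ?thesis
    using that by (metis power2_eq_square)
qed

text \<open>An odd prime is peeled off: by a Hensel step if it still divides the cofactor, otherwise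
  by the Chinese remainder theorem. As 4 does not divide \<open>n\<close>, the induction ends at 1
  or 2, where a root always exists.\<close>

lemma square_root_lift:
  fixes D :: int and n :: nat
  assumes "n > 0" "\<not> 4 dvd n" "\<And>l. prime l \<Longrightarrow> l dvd n \<Longrightarrow> l > 2 \<Longrightarrow> Legendre D (int l) = 1"
  shows "\<exists>x. int n dvd x\<^sup>2 - D"
  using assms
proof (induction n rule: less_induct)
  case (less n)
  show ?case
  proof (cases "\<exists>l. prime l \<and> l dvd n \<and> l > 2")
    case False
    have "n = 1 \<or> n = 2"
    proof (rule ccontr)
      assume n: "\<not> (n = 1 \<or> n = 2)"
      then obtain l where l: "prime l" "l dvd n" using prime_factor_nat by blast
      have only2: "k = 2" if "prime k" "k dvd n" for k
        using False that prime_ge_2_nat[OF that(1)] by (metis le_neq_implies_less)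
      have l2: "l = 2" using only2 l by blast
      then obtain m where m: "n = 2 * m" using l by blast
      then have "m \<noteq> 1" using n by auto
      then obtain k where k: "prime k" "k dvd m" using prime_factor_nat by blast
      then have "k = 2" using only2 m by (metis dvd_mult)
      then have "4 dvd n" using k m by auto
      then show False using less.prems by blast
    qed
    then show ?thesis by (auto intro: exI[of _ 0] exI[of _ D])
  next
    case True
    then obtain l where l: "prime l" "l dvd n" "l > 2" by blast
    then obtain m where m: "n = l * m" by blast
    have m0: "m > 0" "m < n" using m less.prems(1) l by (auto intro!: gr0I)
    have "\<not> 4 dvd m" using less.prems(2) m by auto
    then obtain x where x: "int m dvd x\<^sup>2 - D" using less.IH[OF m0(2,1)] less.prems(3) m by auto
    have leg: "Legendre D (int l) = 1" using less.prems(3) l by blast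
    have lD: "\<not> int l dvd D" using leg by (auto simp: Legendre_def cong_0_iff split: if_splits)
    have pl: "prime (int l)" using l by simp
    show ?thesis
    proof (cases "l dvd m")
      case True
      obtain k where k: "x\<^sup>2 - D = int m * k" using x by blast
      have "int l dvd x\<^sup>2 - D" using True x by (meson dvd_trans int_dvd_int_iff)
      then have "\<not> int l dvd x" using lD by (metis dvd_diff_right_iff dvd_mult power2_eq_square dvd_diff_commute dvd_diff_left_iff)
      then have "\<not> int l dvd 2 * x" using pl l by (auto simp: prime_dvd_mult_iff dest: zdvd_imp_le)
      then have "coprime (2 * x) (int l)" using pl by (metis coprime_commute prime_imp_coprime)
      then obtain j where j: "[2 * x * j = 1] (mod int l)" using cong_solve_coprime_int by blast
      \<comment> \<open>The Newton correction; \<open>j\<close> inverts the derivative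
        \<open>2 x\<close> modulo \<open>l\<close>.\<close>
      define t where "t = - k * j"
      obtain e where e: "2 * x * j - 1 = int l * e" using j by (auto simp: cong_iff_dvd_diff)
      obtain h where h: "m = l * h" using True by blast
      have "(x + int m * t)\<^sup>2 - D = (x\<^sup>2 - D) - int m * k - int m * k * (2 * x * j - 1) + int m * int m * t\<^sup>2"
        unfolding t_def by (simp add: algebra_simps power2_eq_square)
      also have "\<dots> = int m * (- k * (int l * e)) + int m * (int l * int h) * t\<^sup>2"
        unfolding k e by (simp add: h)
      also have "\<dots> = int n * (- k * e + int h * t\<^sup>2)"
        unfolding m by (simp add: algebra_simps)
      finally have "(x + int m * t)\<^sup>2 - D = int n * (- k * e + int h * t\<^sup>2)" .
      then show ?thesis by (metis dvd_triv_left)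
    next
      case False
      obtain y where y: "[y\<^sup>2 = D] (mod int l)" using leg by (auto simp: Legendre_def QuadRes_def split: if_splits)
      have cop: "coprime (int m) (int l)" using False l(1) by (metis coprime_commute coprime_int_iff prime_imp_coprime)
      obtain z where z: "[z = x] (mod int m)" "[z = y] (mod int l)"
        using binary_chinese_remainder_int[OF cop] by blast
      have "[z\<^sup>2 = x\<^sup>2] (mod int m)" "[z\<^sup>2 = y\<^sup>2] (mod int l)" using z by (simp_all add: cong_pow)
      then have "[z\<^sup>2 = D] (mod int m)" "[z\<^sup>2 = D] (mod int l)"
        using x y cong_trans by (auto simp: cong_iff_dvd_diff[of "x\<^sup>2"] intro: cong_trans)
      then have "int m dvd z\<^sup>2 - D" "int l dvd z\<^sup>2 - D" by (simp_all add: cong_iff_dvd_diff)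
      then have "int m * int l dvd z\<^sup>2 - D" using cop by (rule divides_mult)
      then show ?thesis by (auto simp: m mult.commute)
    qed
  qed
qed

lemma Legendre_minus_one:
  assumes "prime p" "p > 2" shows "Legendre (-1) (int p) = (if p mod 4 = 1 then 1 else -1)"
proof -
  have "[Legendre (-1) (int p) = (-1) ^ ((p - 1) div 2)] (mod int p)" by (rule euler_criterion[OF assms])
  moreover have "(-1::int) ^ ((p - 1) div 2) = (if p mod 4 = 1 then 1 else -1)"
  proof -
    have "odd p" using assms prime_odd_nat by auto
    then have "even ((p - 1) div 2) \<longleftrightarrow> p mod 4 = 1" by presburger
    then show ?thesis by simp
  qed
  ultimately have d: "int p dvd Legendre (-1) (int p) - (if p mod 4 = 1 then 1 else -1)" by (simp add: cong_iff_dvd_diff)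
  have "Legendre (-1) (int p) - (if p mod 4 = 1 then 1 else -1) = 0"
    using dvd_imp_le_int[OF _ d] Legendre_cases[of "-1" "int p"] assms(2) by (auto split: if_splits)
  then show ?thesis by simp
qed

lemma rchar4_minus_one: "prime p \<Longrightarrow> p > 2 \<Longrightarrow> real_of_int (Legendre (-1) (int p)) = rchar 4 p"
  using prime_odd_nat[of p] by (auto simp: Legendre_minus_one)

lemma Legendre_eq_rchar4:
  fixes m Q :: nat
  assumes Q: "prime Q" "Q > 2" and "odd m" and "\<And>l. prime l \<Longrightarrow> l dvd m \<Longrightarrow> real_of_int (Legendre (int l) (int Q)) = rchar 4 l"
  shows "real_of_int (Legendre (int m) (int Q)) = rchar 4 m"
  using assms(3,4)
proof (induction m rule: less_induct)
  case (less m)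
  show ?case
  proof (cases "m = 1")
    case True then show ?thesis using Q by (simp add: Legendre_one)
  next
    case False
    then obtain l where l: "prime l" "l dvd m" using prime_factor_nat by blast
    then obtain k where k: "m = l * k" by blast
    have "k > 0" using less.prems(1) k by (auto intro!: gr0I)
    then have "k < m" using k l prime_gt_1_nat[of l] by simp
    moreover have "odd k" using less.prems(1) k by simp
    ultimately have "real_of_int (Legendre (int k) (int Q)) = rchar 4 k"
      using less.IH less.prems(2) k by (metis dvd_mult)
    then show ?thesis using less.prems(2)[OF l] rchar_mult[of 4 l k] by (simp only: k of_nat_mult Legendre_mult[OF Q] of_int_mult) simp
  qed
qed

text \<open>The auxiliary prime \<open>Q\<close> is 1 modulo 4, and its symbol at each odd prime
  \<open>l\<close> dividing \<open>n\<close> is that of -1, so \<open>-Q\<close> is a square modulo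
  \<open>n\<close>. By reciprocity the symbol of \<open>m\<close> modulo \<open>Q\<close> is then
  \<open>rchar 4 m\<close>; prescribing the same value for the symbol of 2 makes \<open>-n\<close> a
  square modulo \<open>Q\<close>.\<close>

theorem three_squares_2mod4:
  fixes n :: nat
  assumes "n mod 4 = 2"
  obtains a b c :: int where "int n = a\<^sup>2 + b\<^sup>2 + c\<^sup>2" "\<And>d. d dvd a \<Longrightarrow> d dvd b \<Longrightarrow> d dvd c \<Longrightarrow> is_unit d"
proof -
  define m where "m = n div 2"
  have n: "n = 2 * m" "odd m" using assms by (auto simp: m_def) presburger+
  have n0: "n > 0" using assms by (cases n) auto
  define P where "P = {l. prime l \<and> l dvd n \<and> l > 2}"
  define I where "I = {4,8} \<union> P"
  define e where "e i = (if i = 4 then 1 else if i = 8 then rchar 4 m else rchar 4 i)" for i :: nat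
  have finP: "finite P" unfolding P_def using n0 by (auto intro: finite_subset[of _ "{..n}"] dvd_imp_le)
  have I: "i \<in> {4,8} \<or> prime i \<and> i > 2" if "i \<in> I" for i using that by (auto simp: I_def P_def)
  have oddP: "odd l" if "l \<in> P" for l using that prime_odd_nat by (auto simp: P_def)
  have e1: "\<bar>e i\<bar> = 1" if "i \<in> I" for i
    using that n(2) oddP by (auto simp: e_def I_def)
  have finI: "finite I" using finP by (simp add: I_def)
  have char: "\<exists>B. real_character (\<lambda>n. \<Prod>i\<in>T. rchar i n) B" if "T \<subseteq> I" "T \<noteq> {}" for T
    using rchar_product_character[of T] finite_subset[OF that(1) finI] that I by blast
  obtain M :: nat and c :: real where Mc: "M \<ge> 2" "c > 0"
    "\<And>x. x \<ge> 1 \<Longrightarrow> c * real x / ln (real (M * x)) \<le> real (card {l \<in> {x<..M * x}. prime l \<and> (\<forall>i\<in>I. e i * rchar i l \<noteq> -1)})"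
    by (rule prime_density_real_characters[OF finI char e1]; assumption?) auto
  \<comment> \<open>\<open>Q > n\<close> keeps \<open>Q\<close> coprime to \<open>n\<close>, so none
    of the prescribed symbols is 0; \<open>Q > 8\<close> makes it odd.\<close>
  define x where "x = n + 8"
  have "1 < M * x" using Mc(1) mult_le_mono[of 2 M 8 x] by (simp add: x_def)
  then have "1 < real (M * x)" by (metis of_nat_1 of_nat_less_iff)
  then have "ln (real (M * x)) > 0" by (rule ln_gt_zero)
  then have "c * real x / ln (real (M * x)) > 0" using Mc(2) by (intro divide_pos_pos mult_pos_pos) (auto simp: x_def)
  then have "card {l \<in> {x<..M * x}. prime l \<and> (\<forall>i\<in>I. e i * rchar i l \<noteq> -1)} > 0"
    using Mc(3)[of x] by (simp add: x_def)
  then obtain Q where Q: "Q > x" "prime Q" "\<And>i. i \<in> I \<Longrightarrow> e i * rchar i Q \<noteq> -1"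
    by (auto simp: card_gt_0_iff)
  have Q2: "Q > 2" using Q(1) by (simp add: x_def)
  have nQ: "\<not> Q dvd n" using Q(1) n0 by (auto simp: x_def dest: dvd_imp_le)
  have oQ: "odd Q" using Q(2) Q2 prime_odd_nat by blast
  have Qe: "rchar i Q = e i" if "i \<in> I" for i
  proof -
    have "rchar i Q \<noteq> 0"
    proof (cases "i \<in> {4,8}")
      case True then show ?thesis using oQ by (auto split: if_splits)
    next
      case False
      then have iP: "i \<in> P" using that by (auto simp: I_def)
      have "\<not> i dvd Q" using iP Q(2) nQ by (metis P_def mem_Collect_eq prime_nat_iff prime_nat_not_dvd primes_dvd_imp_eq)
      then show ?thesis using iP by (auto simp: P_def rchar_prime Legendre_def cong_0_iff)
    qed
    then show ?thesis using Q(3)[OF that] e1[OF that] rchar_vals[of i Q] by (auto simp: abs_if split: if_splits)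
  qed
  have Q4: "Q mod 4 = 1" using Qe[of 4] oQ by (auto simp: I_def e_def split: if_splits)
  have l1: "Legendre (- int Q) (int l) = 1" if "prime l" "l dvd n" "l > 2" for l
  proof -
    have lP: "l \<in> P" using that by (auto simp: P_def)
    have "l \<noteq> 4" "l \<noteq> 8" using oddP[OF lP] by auto
    then have "rchar l Q = rchar 4 l" using Qe[of l] lP by (simp add: I_def e_def del: rchar_4)
    then have "real_of_int (Legendre (int Q) (int l)) = real_of_int (Legendre (-1) (int l))"
      using rchar4_minus_one[OF that(1,3)] that(1) by (simp add: rchar_prime del: rchar_4)
    then have "Legendre (int Q) (int l) = Legendre (-1) (int l)" by simp
    moreover have "Legendre (-1 * int Q) (int l) = Legendre (-1) (int l) * Legendre (int Q) (int l)"
      by (rule Legendre_mult[OF that(1,3)])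
    ultimately show ?thesis using Legendre_minus_one[OF that(1,3)] by (simp split: if_splits)
  qed
  have "\<exists>\<alpha>. int n dvd \<alpha>\<^sup>2 - (- int Q)"
    by (rule square_root_lift) (use n0 n l1 in \<open>auto simp: mult_dvd_mono\<close>)
  then obtain \<alpha> where al: "int n dvd \<alpha>\<^sup>2 + int Q" by auto
  have lQ: "real_of_int (Legendre (int l) (int Q)) = rchar 4 l" if "prime l" "l dvd m" for l
  proof -
    have "odd l" using n(2) that by auto
    then have l2: "l > 2" using prime_ge_2_nat[OF that(1)] by (cases "l = 2") auto
    have lP: "l \<in> P" using that l2 n(1) by (auto simp: P_def)
    have "l \<noteq> 4" "l \<noteq> 8" using \<open>odd l\<close> by auto
    then have "rchar l Q = rchar 4 l" using Qe[of l] lP by (simp add: I_def e_def del: rchar_4)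
    moreover have "Q \<noteq> l" using that nQ n(1) by auto
    then have "Legendre (int Q) (int l) = Legendre (int l) (int Q)"
      by (intro Legendre_swap) (use Q(2) Q4 that l2 in auto)
    ultimately show ?thesis using that(1) by (simp add: rchar_prime del: rchar_4)
  qed
  have "real_of_int (Legendre (int m) (int Q)) = rchar 4 m"
    by (rule Legendre_eq_rchar4[OF Q(2) Q2 n(2) lQ])
  moreover have "real_of_int (Legendre 2 (int Q)) = rchar 4 m"
  proof -
    have "rchar 8 Q = rchar 4 m" using Qe[of 8] by (simp add: I_def e_def del: rchar_4 rchar_8)
    moreover have "Q mod 8 = 7 \<Longrightarrow> False" using Q4 by presburger
    ultimately show ?thesis using Legendre_two[OF Q(2) Q4] oQ by (auto simp del: rchar_4 split: if_splits)
  qed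
  ultimately have "real_of_int (Legendre (int n) (int Q)) = rchar 4 m * rchar 4 m"
    by (simp only: n(1) of_nat_mult of_nat_numeral Legendre_mult[OF Q(2) Q2] of_int_mult)
  then have "real_of_int (Legendre (int n) (int Q)) = 1" using n(2) by (auto split: if_splits)
  then have "Legendre (int n) (int Q) = 1" by linarith
  moreover have "Legendre (-1 * int n) (int Q) = Legendre (-1) (int Q) * Legendre (int n) (int Q)"
    by (rule Legendre_mult[OF Q(2) Q2])
  ultimately have "Legendre (- int n) (int Q) = 1" using Legendre_minus_one[OF Q(2) Q2] Q4 by simp
  then obtain B where "[B\<^sup>2 = - int n] (mod int Q)" by (auto simp: Legendre_def QuadRes_def split: if_splits)
  then have B: "int Q dvd B\<^sup>2 + int n" by (simp add: cong_iff_dvd_diff)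
  have "coprime (int Q) (int n)" using nQ Q(2) by (simp add: prime_imp_coprime)
  then show ?thesis
    using three_squares_of_residues[of "int n" "int Q" B \<alpha>] n0 Q2 B al that by auto
qed

section \<open>Divisor bounds and numbers of representations\<close>

abbreviation ndiv :: "nat \<Rightarrow> nat" where "ndiv n \<equiv> card {d. d dvd n}"

lemma ndiv_mult_coprime: "coprime a b \<Longrightarrow> a > 0 \<Longrightarrow> b > 0 \<Longrightarrow> ndiv (a * b) = ndiv a * ndiv b"
  using sum_divisors_coprime[of a b "\<lambda>_. 1::nat" "\<lambda>_. 1" "\<lambda>_. 1"] by simp

lemma ndiv_prime_power: "prime l \<Longrightarrow> ndiv (l ^ a) = a + 1"
proof -
  assume l: "prime l"
  have "{d. d dvd l ^ a} = (\<lambda>i. l ^ i) ` {..a}"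
    using divides_primepow_nat[OF l] by auto
  moreover have "inj_on (\<lambda>i. l ^ i) {..a}"
    using prime_gt_1_nat[OF l] by (auto simp: inj_on_def)
  ultimately show ?thesis by (simp add: card_image)
qed

lemma ndiv_mono_dvd: "m dvd n \<Longrightarrow> n > 0 \<Longrightarrow> ndiv m \<le> ndiv n"
  by (rule card_mono) (auto intro: dvd_trans)

text \<open>Multiplicativity reduces the claim to comparing \<open>a + 1\<close> with
  \<open>l^(a \<epsilon>)\<close>. Primes with \<open>l^\<epsilon> \<ge> 2\<close> cost nothing; all
  others lie below \<open>L\<close> and cost a factor \<open>K\<close> each, whence
  \<open>K ^ L\<close>.\<close>

lemma ndiv_bound:
  fixes \<epsilon> :: real assumes e: "\<epsilon> > 0"
  obtains C where "C > 0" "\<And>n. n > 0 \<Longrightarrow> real (ndiv n) \<le> C * real n powr \<epsilon>"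
proof -
  define K where "K = max 1 (1 / (\<epsilon> * ln 2))"
  obtain L :: nat where L: "2 powr (1 / \<epsilon>) < real L" using reals_Archimedean2 by blast
  have K1: "K \<ge> 1" by (simp add: K_def)
  have small: "real (a + 1) \<le> K * real (l ^ a) powr \<epsilon>" if "prime l" for l a
  proof -
    have l2: "l \<ge> 2" using that prime_ge_2_nat by blast
    have "real (l ^ a) \<ge> 2 ^ a" using l2 power_mono[of 2 l a] by (metis of_nat_le_iff of_nat_numeral of_nat_power zero_le)
    then have "(2 ^ a) powr \<epsilon> \<le> real (l ^ a) powr \<epsilon>" using e by (intro powr_mono2) auto
    moreover have "(2 ^ a) powr \<epsilon> = exp (\<epsilon> * (real a * ln 2))" by (simp add: powr_def ln_realpow)
    moreover have "1 + \<epsilon> * (real a * ln 2) \<le> exp (\<epsilon> * (real a * ln 2))" by (rule exp_ge_add_one_self)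
    ultimately have "1 + \<epsilon> * (real a * ln 2) \<le> real (l ^ a) powr \<epsilon>" by linarith
    then have 1: "1 + real a * (\<epsilon> * ln 2) \<le> real (l ^ a) powr \<epsilon>" by (simp only: mult.left_commute)
    have "K * (\<epsilon> * ln 2) \<ge> 1 / (\<epsilon> * ln 2) * (\<epsilon> * ln 2)"
      unfolding K_def using e by (intro mult_right_mono) auto
    then have "real a * 1 \<le> real a * (K * (\<epsilon> * ln 2))" using e by (intro mult_left_mono) auto
    then have "real (a + 1) \<le> K * (1 + real a * (\<epsilon> * ln 2))" using K1 by (simp add: algebra_simps)
    also have "\<dots> \<le> K * real (l ^ a) powr \<epsilon>" using 1 K1 by (intro mult_left_mono) auto
    finally show ?thesis .
  qed
  have large: "real (a + 1) \<le> real (l ^ a) powr \<epsilon>" if "L \<le> l" for l a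
  proof -
    have "(2 powr (1 / \<epsilon>)) powr \<epsilon> \<le> real l powr \<epsilon>" using e L that by (intro powr_mono2) auto
    then have 1: "2 \<le> real l powr \<epsilon>" using e by (simp add: powr_powr)
    have l0: "real l > 0" using L that powr_gt_zero[of 2 "1/\<epsilon>"] by linarith
    have "a + 1 \<le> 2 ^ a" by (induction a) auto
    then have "real (a + 1) \<le> 2 ^ a" by (metis of_nat_le_iff of_nat_numeral of_nat_power)
    also have "\<dots> \<le> (real l powr \<epsilon>) ^ a" using 1 by (intro power_mono) auto
    also have "\<dots> = real (l ^ a) powr \<epsilon>" using l0 by (simp add: powr_def exp_of_nat_mult[symmetric] ln_realpow mult.left_commute)
    finally show ?thesis .
  qed
  have main: "real (ndiv n) \<le> K ^ card {l. prime l \<and> l < L \<and> l dvd n} * real n powr \<epsilon>" if "n > 0" for n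
    using that
  proof (induction n rule: less_induct)
    case (less n)
    show ?case
    proof (cases "n = 1")
      case True then show ?thesis by (simp add: K1)
    next
      case False
      then obtain l where l: "prime l" "l dvd n" using prime_factor_nat by blast
      obtain m where "n = l ^ multiplicity l n * m" "\<not> l dvd m"
        by (rule multiplicity_decompose'[of n l]) (use less.prems l in auto)
      moreover define k where "k = multiplicity l n"
      ultimately have m: "n = l ^ k * m" "\<not> l dvd m" by simp_all
      have k: "k > 0" using l less.prems by (simp add: k_def prime_multiplicity_gt_zero_iff)
      have m0: "m > 0" using m less.prems by (cases m) auto
      have "1 < l ^ k" using prime_gt_1_nat[OF l(1)] k by (metis one_less_power)
      then have "m < n" unfolding m(1) using m0 by simp
      then have IH: "real (ndiv m) \<le> K ^ card {j. prime j \<and> j < L \<and> j dvd m} * real m powr \<epsilon>" using less.IH m0 by blast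
      have cop: "coprime (l^k) m" using l m by (simp add: prime_imp_coprime)
      have "ndiv n = (k + 1) * ndiv m"
        unfolding m(1) using ndiv_mult_coprime[OF cop] ndiv_prime_power[OF l(1)] m0 l by (simp add: prime_gt_0_nat)
      then have e1: "real (ndiv n) = real (k + 1) * real (ndiv m)" by (simp only: of_nat_mult)
      have e2: "real n powr \<epsilon> = real (l ^ k) powr \<epsilon> * real m powr \<epsilon>" unfolding m(1) by (simp add: powr_mult)
      have dv: "j dvd n \<longleftrightarrow> j = l \<or> j dvd m" if "prime j" for j
        unfolding m(1) using that l k by (auto simp: prime_dvd_mult_iff prime_dvd_power_iff primes_dvd_imp_eq)
      have fin: "finite {j. prime j \<and> j < L \<and> j dvd m}" by (rule finite_subset[of _ "{..<L}"]) auto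
      show ?thesis
      proof (cases "l < L")
        case True
        have "{j. prime j \<and> j < L \<and> j dvd n} = insert l {j. prime j \<and> j < L \<and> j dvd m}" using dv True l by auto
        then have c: "card {j. prime j \<and> j < L \<and> j dvd n} = Suc (card {j. prime j \<and> j < L \<and> j dvd m})"
          using fin m(2) by simp
        have "real (k + 1) * real (ndiv m) \<le> (K * real (l ^ k) powr \<epsilon>) * (K ^ card {j. prime j \<and> j < L \<and> j dvd m} * real m powr \<epsilon>)"
          using small[OF l(1), of k] IH K1 by (intro mult_mono) auto
        then show ?thesis unfolding e1 e2 c by (simp add: algebra_simps)
      next
        case False
        then have "{j. prime j \<and> j < L \<and> j dvd n} = {j. prime j \<and> j < L \<and> j dvd m}" using dv by auto
        moreover have "real (k + 1) * real (ndiv m) \<le> (real (l ^ k) powr \<epsilon>) * (K ^ card {j. prime j \<and> j < L \<and> j dvd m} * real m powr \<epsilon>)"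
          using large[of l k] IH K1 False by (intro mult_mono) auto
        ultimately show ?thesis unfolding e1 e2 by (simp add: algebra_simps)
      qed
    qed
  qed
  show ?thesis
  proof (rule that[of "K ^ L"])
    show "K ^ L > 0" using K1 by simp
    fix n :: nat assume n: "n > 0"
    have "card {l. prime l \<and> l < L \<and> l dvd n} \<le> card {..<L}" by (rule card_mono) auto
    then have "K ^ card {l. prime l \<and> l < L \<and> l dvd n} \<le> K ^ L" using K1 by (intro power_increasing) auto
    then show "real (ndiv n) \<le> K ^ L * real n powr \<epsilon>"
      using main[OF n] by (meson mult_right_mono order_trans powr_ge_zero)
  qed
qed

lemma card_fibers_le:
  assumes "finite B" "f ` A \<subseteq> B" "\<And>b. b \<in> B \<Longrightarrow> finite {a \<in> A. f a = b} \<and> card {a \<in> A. f a = b} \<le> k"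
  shows "finite A" "card A \<le> k * card B"
proof -
  have A: "A = (\<Union>b\<in>B. {a \<in> A. f a = b})" using assms(2) by auto
  show "finite A" by (subst A) (use assms in auto)
  have "card A \<le> (\<Sum>b\<in>B. card {a \<in> A. f a = b})" by (subst A) (rule card_UN_le[OF assms(1)])
  also have "\<dots> \<le> (\<Sum>b\<in>B. k)" by (rule sum_mono) (use assms in auto)
  finally show "card A \<le> k * card B" by (simp add: mult.commute)
qed

text \<open>Two roots with the same \<open>gcd(z - z0, n)\<close> agree modulo \<open>n/2\<close>, because the
  gcd of \<open>z - z0\<close> and \<open>z + z0\<close> meets \<open>n\<close> only in divisors of 2.\<close>
lemma card_square_roots_le:
  fixes D :: int and n :: nat
  assumes n: "n > 0" and cop: "coprime D (int n)"
  shows "card {z \<in> {0..<int n}. int n dvd z\<^sup>2 - D} \<le> 3 * ndiv n"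
proof (cases "{z \<in> {0..<int n}. int n dvd z\<^sup>2 - D} = {}")
  case True show ?thesis unfolding True by simp
next
  case False
  then obtain z0 where z0: "int n dvd z0\<^sup>2 - D" by auto
  let ?A = "{z \<in> {0..<int n}. int n dvd z\<^sup>2 - D}"
  have c0: "coprime z0 (int n)"
  proof (rule coprimeI)
    fix d assume d: "d dvd z0" "d dvd int n"
    then have "d dvd z0\<^sup>2 - D" using z0 dvd_trans by blast
    then have "d dvd D" using d(1) by (metis dvd_diff_right_iff dvd_mult power2_eq_square dvd_diff_left_iff)
    then show "is_unit d" using cop d(2) by (simp add: coprime_def)
  qed
  have key: "int n dvd 2 * (z - z')" if "z \<in> ?A" "z' \<in> ?A" "gcd (z - z0) (int n) = gcd (z' - z0) (int n)" for z z'
  proof -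
    define d where "d = gcd (z - z0) (int n)"
    have d0: "d > 0" using n by (simp add: d_def)
    obtain e where e: "int n = d * e" unfolding d_def by (meson dvd_def gcd_dvd2)
    have ed: "e dvd y + z0" if y: "y \<in> ?A" "gcd (y - z0) (int n) = d" for y
    proof -
      obtain k where k: "y - z0 = d * k" using y(2) by (metis dvd_def gcd_dvd1)
      have "gcd (d * k) (d * e) = d" using y(2) k e by simp
      then have "d * gcd k e = d" using d0 by (simp add: gcd_mult_distrib_int[symmetric])
      then have "coprime k e" using d0 by (simp add: coprime_iff_gcd_eq_1)
      have "int n dvd (y\<^sup>2 - D) - (z0\<^sup>2 - D)" using dvd_diff[of "int n" "y\<^sup>2 - D" "z0\<^sup>2 - D"] y(1) z0 by simp
      moreover have "(y\<^sup>2 - D) - (z0\<^sup>2 - D) = d * (k * (y + z0))"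
      proof -
        have "(y\<^sup>2 - D) - (z0\<^sup>2 - D) = (y - z0) * (y + z0)" by (simp add: power2_eq_square algebra_simps)
        then show ?thesis using k by (simp only: mult.assoc)
      qed
      ultimately have "e dvd k * (y + z0)" using e d0 by simp
      then show ?thesis using \<open>coprime k e\<close> by (simp add: coprime_dvd_mult_right_iff coprime_commute)
    qed
    have dz: "d dvd z - z0" "d dvd z' - z0" using that(3) unfolding d_def by (metis gcd_dvd1)+
    have ez: "e dvd z + z0" "e dvd z' + z0" using ed[OF that(1)] ed[OF that(2)] that(3) by (auto simp: d_def)
    have "gcd d e dvd (z + z0) - (z - z0)" using dz(1) ez(1) by (meson dvd_diff dvd_trans gcd_dvd1 gcd_dvd2)
    then have "gcd d e dvd z0 * 2" by (simp add: mult.commute)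
    moreover have "coprime (gcd d e) z0"
    proof -
      have "gcd d e dvd int n" unfolding e by simp
      then show ?thesis using c0 by (meson coprime_commute coprime_divisors dvd_refl)
    qed
    ultimately have g2: "gcd d e dvd 2" by (simp add: coprime_dvd_mult_right_iff)
    have "d dvd (z - z0) - (z' - z0)" "e dvd (z + z0) - (z' + z0)" using dz ez by (blast intro: dvd_diff)+
    then have "lcm d e dvd z - z'" by (simp add: lcm_least)
    then have "gcd d e * lcm d e dvd 2 * (z - z')" using g2 by (rule mult_dvd_mono[rotated])
    moreover have "gcd d e * lcm d e = int n"
    proof -
      have "d * e > 0" using e n by simp
      then have "e > 0" using d0 by (simp add: zero_less_mult_iff)
      then show ?thesis using d0 e by (simp add: prod_gcd_lcm_int)
    qed
    ultimately show ?thesis by simp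
  qed
  have "card ?A \<le> 3 * card {d. d dvd int n \<and> d > 0}"
  proof (rule card_fibers_le(2))
    have "{d. d dvd int n \<and> d > 0} \<subseteq> {1..int n}" using n by (auto dest: zdvd_imp_le)
    then show "finite {d. d dvd int n \<and> d > 0}" by (rule finite_subset) simp
    show "(\<lambda>z. gcd (z - z0) (int n)) ` ?A \<subseteq> {d. d dvd int n \<and> d > 0}" using n by auto
    fix d
    let ?F = "{z \<in> ?A. gcd (z - z0) (int n) = d}"
    show "finite ?F \<and> card ?F \<le> 3"
    proof (cases "?F = {}")
      case True show ?thesis unfolding True by simp
    next
      case False
      then obtain y where y: "y \<in> ?F" by auto
      define h where "h = int n div 2"
      have "?F \<subseteq> {y, y - h, y + h}"
      proof
        fix z assume z: "z \<in> ?F"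
        then have "int n dvd 2 * (z - y)" using key[of z y] y by auto
        then obtain j where j: "2 * (z - y) = int n * j" by blast
        have "\<bar>z - y\<bar> < int n" using y z by auto
        moreover have "int n * \<bar>j\<bar> = 2 * \<bar>z - y\<bar>"
        proof -
          have "\<bar>int n * j\<bar> = \<bar>2 * (z - y)\<bar>" using j by simp
          then show ?thesis by (simp only: abs_mult abs_numeral abs_of_nat)
        qed
        ultimately have "int n * \<bar>j\<bar> < int n * 2" by simp
        then have "\<bar>j\<bar> < 2" using n by simp
        then have "j = 0 \<or> j = 1 \<or> j = -1" by auto
        then show "z \<in> {y, y - h, y + h}" using j by (auto simp: h_def)
      qed
      then have "finite ?F" "card ?F \<le> card {y, y - h, y + h}" by (auto intro: finite_subset card_mono)
      moreover have "card {y, y - h, y + h} \<le> 3" using card_length[of "[y, y - h, y + h]"] by simp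
      ultimately show ?thesis by linarith
    qed
  qed
  also have "{d. d dvd int n \<and> d > 0} = int ` {d. d dvd n}"
  proof (intro equalityI subsetI)
    fix d assume "d \<in> {d. d dvd int n \<and> d > 0}"
    then have "d = int (nat d)" "nat d dvd n" by (auto simp: nat_dvd_iff)
    then show "d \<in> int ` {d. d dvd n}" by blast
  qed (use n in \<open>auto intro: gr0I\<close>)
  finally show ?thesis by (simp add: card_image)
qed


text \<open>A representation determines the root \<open>z = a / b\<close> of \<open>-D\<close>
  modulo \<open>N\<close>. For two representations with the same root the composition identity reads
  \<open>t^2 + D (N s)^2 = N^2\<close>, so \<open>D s^2 \<le> 1\<close>: they agree up to sign, or
  \<open>D = 1\<close> and they differ by a quarter turn. This gives at most 4 per root, and there
  are at most \<open>3 ndiv N\<close> roots.\<close>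

lemma card_binary_reps_le:
  fixes D :: int and N :: nat
  assumes N: "N > 0" and D: "D > 0" and cop: "coprime D (int N)"
  shows "finite {(a,b). a\<^sup>2 + D * b\<^sup>2 = int N \<and> coprime b (int N)} \<and>
    card {(a,b). a\<^sup>2 + D * b\<^sup>2 = int N \<and> coprime b (int N)} \<le> 12 * ndiv N"
proof -
  let ?A = "{(a,b). a\<^sup>2 + D * b\<^sup>2 = int N \<and> coprime b (int N)}"
  let ?B = "{z \<in> {0..<int N}. int N dvd z\<^sup>2 - (- D)}"
  have "\<exists>f. \<forall>x\<in>?A. f x \<in> ?B \<and> int N dvd f x * snd x - fst x"
  proof (rule bchoice, rule ballI)
    fix x assume "x \<in> ?A"
    then obtain a b where x: "x = (a,b)" "a\<^sup>2 + D * b\<^sup>2 = int N" "coprime b (int N)" by auto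
    obtain i where "[b * i = 1] (mod int N)" using cong_solve_coprime_int[OF x(3)] by blast
    then obtain e where e: "b * i - 1 = int N * e" by (auto simp: cong_iff_dvd_diff)
    define z where "z = (a * i) mod int N"
    obtain k where k: "a * i = z + int N * k" unfolding z_def by (metis mod_mult_div_eq)
    have "z * b - a = (z + int N * k) * b - a - int N * (k * b)" by (simp add: algebra_simps)
    also have "\<dots> = a * (b * i - 1) - int N * (k * b)" unfolding k[symmetric] by (simp add: algebra_simps)
    finally have "z * b - a = a * (b * i - 1) - int N * (k * b)" .
    then have zb: "int N dvd z * b - a" using e by (simp add: dvd_diff)
    then obtain m where m: "z * b = a + int N * m" by (metis diff_add_cancel add.commute dvd_def)
    have "b\<^sup>2 * (z\<^sup>2 + D) = (z * b)\<^sup>2 + D * b\<^sup>2" by (simp add: power2_eq_square algebra_simps)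
    also have "\<dots> = int N * (1 + 2 * a * m + int N * m\<^sup>2)"
      unfolding m using x(2) by (simp add: power2_eq_square algebra_simps)
    finally have "int N dvd b\<^sup>2 * (z\<^sup>2 + D)" by simp
    then have "int N dvd z\<^sup>2 + D" using x(3)
      by (simp add: coprime_dvd_mult_right_iff coprime_commute)
    moreover have "z \<in> {0..<int N}" using N by (simp add: z_def)
    ultimately show "\<exists>y. y \<in> ?B \<and> int N dvd y * snd x - fst x" using zb x(1) by auto
  qed
  then obtain f where f0: "\<forall>x\<in>?A. f x \<in> ?B \<and> int N dvd f x * snd x - fst x" ..
  have f: "f x \<in> ?B \<and> int N dvd f x * snd x - fst x" if "x \<in> ?A" for x using f0 that by (rule bspec)
  have fib: "finite {x \<in> ?A. f x = z} \<and> card {x \<in> ?A. f x = z} \<le> 4" for z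
  proof (cases "{x \<in> ?A. f x = z} = {}")
    case True show ?thesis unfolding True by simp
  next
    case False
    then obtain a b where ab: "(a,b) \<in> ?A" "f (a,b) = z" by auto
    have "{x \<in> ?A. f x = z} \<subseteq> {(a,b), (-a,-b), (-b,a), (b,-a)}"
    proof
      fix x assume "x \<in> {x \<in> ?A. f x = z}"
      then obtain a' b' where x: "x = (a',b')" "(a',b') \<in> ?A" "f (a',b') = z" by auto
      have e: "a\<^sup>2 + D * b\<^sup>2 = int N" "a'\<^sup>2 + D * b'\<^sup>2 = int N" using ab x by auto
      have "int N dvd z * b - a" "int N dvd z * b' - a'" using f[OF ab(1)] f[OF x(2)] ab x by auto
      then have "int N dvd (z * b' - a') * b - (z * b - a) * b'" by (blast intro: dvd_diff[OF dvd_mult2 dvd_mult2])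
      also have "(z * b' - a') * b - (z * b - a) * b' = a * b' - a' * b" by (simp add: algebra_simps)
      finally obtain s where s: "a * b' - a' * b = int N * s" by blast
      define t where "t = a * a' + D * b * b'"
      have id: "t\<^sup>2 + D * (int N * s)\<^sup>2 = (int N)\<^sup>2"
      proof -
        have "(int N)\<^sup>2 = (a\<^sup>2 + D * b\<^sup>2) * (a'\<^sup>2 + D * b'\<^sup>2)" using e by (simp add: power2_eq_square)
        also have "\<dots> = t\<^sup>2 + D * (a * b' - a' * b)\<^sup>2" unfolding t_def by (simp add: power2_eq_square algebra_simps)
        finally show ?thesis using s by simp
      qed
      have NN: "(int N)\<^sup>2 > 0" using N by simp
      have Ds: "D * s\<^sup>2 \<le> 1"
      proof -
        have "(int N)\<^sup>2 * (D * s\<^sup>2) = D * (int N * s)\<^sup>2" by (simp add: power_mult_distrib algebra_simps)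
        also have "\<dots> \<le> (int N)\<^sup>2 * 1" using id zero_le_power2[of t] by linarith
        finally show ?thesis using NN by (simp only: mult_le_cancel_left_pos)
      qed
      show "x \<in> {(a,b), (-a,-b), (-b,a), (b,-a)}"
      proof (cases "s = 0")
        case True
        then have "t\<^sup>2 = (int N)\<^sup>2" using id by simp
        then have t: "t = int N \<or> t = - int N" by (simp add: power2_eq_iff)
        have c: "a * b' = a' * b" using s True by simp
        have "a' * int N = a * t + D * b * (a' * b - a * b')" unfolding e(1)[symmetric] t_def by (simp add: power2_eq_square algebra_simps)
        then have 1: "a' * int N = a * t" using c by simp
        have "b' * int N = b * t + a * (a * b' - a' * b)" unfolding e(1)[symmetric] t_def by (simp add: power2_eq_square algebra_simps)
        then have 2: "b' * int N = b * t" using c by simp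
        show ?thesis using t
        proof
          assume "t = int N"
          then show ?thesis using 1 2 N x(1) by auto
        next
          assume "t = - int N"
          then have "(a' + a) * int N = 0" "(b' + b) * int N = 0" using 1 2 by (simp_all add: algebra_simps)
          then have "a' + a = 0" "b' + b = 0" using N by simp_all
          then show ?thesis using x(1) by simp
        qed
      next
        case False
        have "s\<^sup>2 > 0" using False by simp
        then have "s\<^sup>2 \<ge> 1" by linarith
        then have "D * 1 \<le> D * s\<^sup>2" using D by (intro mult_left_mono) auto
        then have D1: "D = 1" using Ds D by linarith
        then have "s\<^sup>2 = 1" using Ds \<open>s\<^sup>2 \<ge> 1\<close> by (simp only: mult_1)
        then have s1: "s = 1 \<or> s = -1" by (simp add: power2_eq_1_iff)
        have t0: "t = 0" using id D1 \<open>s\<^sup>2 = 1\<close> by (simp add: power_mult_distrib)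
        have "a' * int N = a * t - b * (a * b' - a' * b)" unfolding e(1)[symmetric] t_def D1 by (simp add: power2_eq_square algebra_simps)
        then have 1: "(a' + b * s) * int N = 0" using t0 s by (simp add: algebra_simps)
        have "b' * int N = b * t + a * (a * b' - a' * b)" unfolding e(1)[symmetric] t_def D1 by (simp add: power2_eq_square algebra_simps)
        then have 2: "(b' - a * s) * int N = 0" using t0 s by (simp add: algebra_simps)
        have "a' + b * s = 0" "b' - a * s = 0" using 1 2 N by simp_all
        then have "a' = - b * s" "b' = a * s" by linarith+
        then show ?thesis using s1 x(1) by auto
      qed
    qed
    then have "finite {x \<in> ?A. f x = z}" "card {x \<in> ?A. f x = z} \<le> card {(a,b), (-a,-b), (-b,a), (b,-a)}"
      by (auto intro: finite_subset card_mono)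
    moreover have "card {(a,b), (-a,-b), (-b,a), (b,-a)} \<le> 4" using card_length[of "[(a,b), (-a,-b), (-b,a), (b,-a)]"] by simp
    ultimately show ?thesis by linarith
  qed
  have finB: "finite ?B" by (rule finite_subset[of _ "{0..<int N}"]) auto
  have im: "f ` ?A \<subseteq> ?B" using f by blast
  have cA: "finite ?A" "card ?A \<le> 4 * card ?B"
    by (rule card_fibers_le[OF finB im, of 4], rule fib)+
  moreover have "card ?B \<le> 3 * ndiv N" by (rule card_square_roots_le) (use N cop in auto)
  ultimately show ?thesis by simp
qed

text \<open>Representations are sorted by their gcd \<open>g\<close>. Then \<open>g^2\<close>
  divides \<open>n\<close>, and dividing by \<open>g\<close> leaves a primitive representation of
  the cofactor, to which the binary bound with \<open>D = 1\<close> applies.\<close>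

lemma card_two_squares_le:
  assumes n: "n > 0"
  shows "finite {(a,b). a\<^sup>2 + b\<^sup>2 = int n} \<and> card {(a,b). a\<^sup>2 + b\<^sup>2 = int n} \<le> 12 * ndiv n * ndiv n"
proof -
  let ?A = "{(a,b). a\<^sup>2 + b\<^sup>2 = int n}"
  let ?f = "\<lambda>(a,b). nat (gcd a b)"
  have fib: "finite {x \<in> ?A. ?f x = g} \<and> card {x \<in> ?A. ?f x = g} \<le> 12 * ndiv n" if g: "g dvd n" for g
  proof (cases "{x \<in> ?A. ?f x = g} = {}")
    case True show ?thesis unfolding True by simp
  next
    case False
    then obtain a b where ab: "a\<^sup>2 + b\<^sup>2 = int n" "gcd a b = int g" by force
    have g0: "g > 0" using g n by (auto intro: gr0I)
    have "(int g)\<^sup>2 dvd a\<^sup>2 + b\<^sup>2" using ab(2) by (intro dvd_add) (metis gcd_dvd1 dvd_power_same, metis gcd_dvd2 dvd_power_same)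
    then have "g\<^sup>2 dvd n" using ab(1) by (metis int_dvd_int_iff of_nat_power)
    then obtain N where N: "n = g\<^sup>2 * N" by blast
    have N0: "N > 0" using n N by (auto intro: gr0I)
    let ?B = "{(a,b). a\<^sup>2 + 1 * b\<^sup>2 = int N \<and> coprime b (int N)}"
    have B: "finite ?B" "card ?B \<le> 12 * ndiv N" using card_binary_reps_le[OF N0, of 1] by auto
    have "{x \<in> ?A. ?f x = g} \<subseteq> (\<lambda>(a,b). (int g * a, int g * b)) ` ?B"
    proof
      fix x assume "x \<in> {x \<in> ?A. ?f x = g}"
      then obtain c d where x: "x = (c,d)" "c\<^sup>2 + d\<^sup>2 = int n" "gcd c d = int g" by force
      obtain c' d' where cd: "c = int g * c'" "d = int g * d'" using x(3) by (metis dvd_def gcd_dvd1 gcd_dvd2)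
      have "int g * gcd c' d' = int g" using x(3) cd g0 by (simp add: gcd_mult_distrib_int[symmetric])
      then have cop: "coprime c' d'" using g0 by (simp add: coprime_iff_gcd_eq_1)
      have "(int g)\<^sup>2 * (c'\<^sup>2 + d'\<^sup>2) = (int g)\<^sup>2 * int N" using x(2) cd N by (simp add: power_mult_distrib algebra_simps)
      then have e: "c'\<^sup>2 + d'\<^sup>2 = int N" using g0 by simp
      have "coprime d' (int N)"
      proof -
        have "coprime d' (c'\<^sup>2)" using cop by (simp add: coprime_commute)
        then have "coprime d' (c'\<^sup>2 + d' * d')"
          by (metis coprime_iff_gcd_eq_1 gcd_add_mult add.commute)
        then show ?thesis using e by (simp add: power2_eq_square)
      qed
      then have "(c',d') \<in> ?B" using e by simp
      then show "x \<in> (\<lambda>(a,b). (int g * a, int g * b)) ` ?B" using x(1) cd by force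
    qed
    then have "finite {x \<in> ?A. ?f x = g}" "card {x \<in> ?A. ?f x = g} \<le> card ?B"
      using B(1) by (auto intro: finite_subset surj_card_le)
    moreover have "ndiv N \<le> ndiv n" using N n by (intro ndiv_mono_dvd) auto
    ultimately show ?thesis using B(2) by linarith
  qed
  have im: "?f ` ?A \<subseteq> {d. d dvd n}"
  proof
    fix g assume "g \<in> ?f ` ?A"
    then obtain a b where ab: "a\<^sup>2 + b\<^sup>2 = int n" "g = nat (gcd a b)" by auto
    then have "int g dvd a" "int g dvd b" by auto
    then have "int g dvd int n" unfolding ab(1)[symmetric] by (simp add: power2_eq_square)
    then show "g \<in> {d. d dvd n}" by simp
  qed
  have fin: "finite {d. d dvd n}" using n by simp
  show ?thesis
    by (rule conjI; rule card_fibers_le[OF fin im, of "12 * ndiv n"], rule fib, simp)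
qed

text \<open>One coordinate is fixed, in at most \<open>3 sqrt n\<close> ways, and the other two are
  counted as a sum of two squares.\<close>

lemma card_three_squares_le:
  fixes \<epsilon> :: real assumes e: "\<epsilon> > 0"
  obtains C where "C > 0"
    "\<And>n::nat. n > 0 \<Longrightarrow> finite {(a,b,c). a\<^sup>2 + b\<^sup>2 + c\<^sup>2 = int n}"
    "\<And>n::nat. n > 0 \<Longrightarrow> real (card {(a,b,c). a\<^sup>2 + b\<^sup>2 + c\<^sup>2 = int n}) \<le> C * real n powr (1/2 + \<epsilon>)"
proof -
  obtain K where K: "K > 0" "\<And>n. n > 0 \<Longrightarrow> real (ndiv n) \<le> K * real n powr (\<epsilon>/2)"
    using ndiv_bound[of "\<epsilon>/2"] e by auto
  \<comment> \<open>The summand 1 covers \<open>a^2 = n\<close>, where the remaining number is 0 and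
    has exactly one representation.\<close>
  define M where "M n = (1 + 12 * K\<^sup>2) * real n powr \<epsilon>" for n :: nat
  have r2: "finite {(b,c). b\<^sup>2 + c\<^sup>2 = int n - a\<^sup>2} \<and> real (card {(b,c). b\<^sup>2 + c\<^sup>2 = int n - a\<^sup>2}) \<le> M n"
    if n: "n > 0" "a\<^sup>2 \<le> int n" for n :: nat and a
  proof (cases "int n - a\<^sup>2 = 0")
    case True
    then have "{(b,c). b\<^sup>2 + c\<^sup>2 = int n - a\<^sup>2} = {(0,0)}" by (auto simp: sum_power2_eq_zero_iff)
    moreover have "1 \<le> M n"
    proof -
      have "1 \<le> real n powr \<epsilon>" using n(1) e by (intro ge_one_powr_ge_zero) auto
      then show ?thesis unfolding M_def by (metis add_increasing2 mult_nonneg_nonneg mult_mono' mult_1 zero_le_numeral zero_le_one zero_le_power2 order_refl)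
    qed
    ultimately show ?thesis by simp
  next
    case False
    define k where "k = nat (int n - a\<^sup>2)"
    have k: "int k = int n - a\<^sup>2" "k > 0" "k \<le> n" using False n by (auto simp: k_def nat_le_iff)
    have "real (card {(b,c). b\<^sup>2 + c\<^sup>2 = int k}) \<le> real (12 * ndiv k * ndiv k)"
      using card_two_squares_le[OF k(2)] by (simp only: of_nat_le_iff)
    also have "\<dots> \<le> 12 * (K * real n powr (\<epsilon>/2)) * (K * real n powr (\<epsilon>/2))"
    proof -
      have "real (ndiv k) \<le> K * real k powr (\<epsilon>/2)" by (rule K(2)[OF k(2)])
      also have "\<dots> \<le> K * real n powr (\<epsilon>/2)" using k e K(1) by (intro mult_left_mono powr_mono2) auto
      finally have "real (ndiv k) \<le> K * real n powr (\<epsilon>/2)" .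
      then show ?thesis unfolding of_nat_mult of_nat_numeral using K(1) by (intro mult_mono) auto
    qed
    also have "\<dots> = 12 * K\<^sup>2 * (real n powr (\<epsilon>/2) * real n powr (\<epsilon>/2))" by (simp add: power2_eq_square)
    also have "\<dots> = 12 * K\<^sup>2 * real n powr \<epsilon>" by (simp add: powr_add[symmetric])
    also have "\<dots> \<le> M n" by (simp add: M_def algebra_simps)
    finally show ?thesis using card_two_squares_le[OF k(2)] k(1) by simp
  qed
  show ?thesis
  proof (rule that[of "3 * (1 + 12 * K\<^sup>2)"])
    show "3 * (1 + 12 * K\<^sup>2) > 0" by (simp add: add_pos_nonneg)
    fix n :: nat assume n: "n > 0"
    let ?A = "{(a,b,c). a\<^sup>2 + b\<^sup>2 + c\<^sup>2 = int n}"
    define s where "s = nat \<lfloor>sqrt (real n)\<rfloor>"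
    have s: "real s \<le> sqrt (real n)" by (simp add: s_def)
    have as: "a \<in> {- int s..int s}" if "a\<^sup>2 \<le> int n" for a
    proof -
      have "(real_of_int \<bar>a\<bar>)\<^sup>2 \<le> real n" using that by (metis of_int_le_iff of_int_of_nat_eq of_int_power power2_abs)
      then have "real_of_int \<bar>a\<bar> \<le> sqrt (real n)" by (rule real_le_rsqrt)
      then have "\<bar>a\<bar> \<le> int s" by (simp add: s_def le_floor_iff)
      then show ?thesis by auto
    qed
    let ?J = "{a \<in> {- int s..int s}. a\<^sup>2 \<le> int n}"
    have A: "?A = (\<Union>a\<in>?J. Pair a ` {(b,c). b\<^sup>2 + c\<^sup>2 = int n - a\<^sup>2})" (is "_ = ?U")
    proof (intro equalityI subsetI)
      fix x assume "x \<in> ?A"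
      then obtain a b c where x: "x = (a,b,c)" "a\<^sup>2 + b\<^sup>2 + c\<^sup>2 = int n" by auto
      have "a\<^sup>2 \<le> int n" using x(2) zero_le_power2[of b] zero_le_power2[of c] by linarith
      then have "a \<in> ?J" using as[of a] by simp
      moreover have "(b,c) \<in> {(b,c). b\<^sup>2 + c\<^sup>2 = int n - a\<^sup>2}" using x(2) by simp
      ultimately show "x \<in> ?U" using x(1) by blast
    qed auto
    have finJ: "finite ?J" by (rule finite_subset[of _ "{- int s..int s}"]) auto
    show "finite ?A" unfolding A using r2[OF n] finJ by (intro finite_UN_I finite_imageI) auto
    have "real (card ?A) \<le> real (\<Sum>a\<in>?J. card (Pair a ` {(b,c). b\<^sup>2 + c\<^sup>2 = int n - a\<^sup>2}))"
      unfolding A of_nat_le_iff by (rule card_UN_le[OF finJ])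
    also have "\<dots> = (\<Sum>a\<in>?J. real (card {(b,c). b\<^sup>2 + c\<^sup>2 = int n - a\<^sup>2}))"
      by (simp add: card_image inj_on_def)
    also have "\<dots> \<le> (\<Sum>a\<in>?J. M n)" by (rule sum_mono) (use r2[OF n] in auto)
    also have "\<dots> = real (card ?J) * M n" by simp
    also have "\<dots> \<le> (3 * sqrt (real n)) * M n"
    proof (rule mult_right_mono)
      have "card ?J \<le> card {- int s..int s}" by (rule card_mono) auto
      also have "\<dots> = 2 * s + 1" by simp
      finally have "real (card ?J) \<le> 2 * real s + 1" by linarith
      moreover have "1 \<le> sqrt (real n)" using n by simp
      ultimately show "real (card ?J) \<le> 3 * sqrt (real n)" using s by linarith
      show "0 \<le> M n" unfolding M_def by (intro mult_nonneg_nonneg add_nonneg_nonneg) auto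
    qed
    also have "\<dots> = 3 * (1 + 12 * K\<^sup>2) * (real n powr (1/2) * real n powr \<epsilon>)"
      using n by (simp add: M_def powr_half_sqrt)
    also have "\<dots> = 3 * (1 + 12 * K\<^sup>2) * real n powr (1/2 + \<epsilon>)" by (simp add: powr_add)
    finally show "real (card ?A) \<le> 3 * (1 + 12 * K\<^sup>2) * real n powr (1/2 + \<epsilon>)" .
  qed
qed

section \<open>Integral quaternions and reduced words\<close>

declare split_paired_All [simp del] split_paired_Ex [simp del]

fun qconj :: "quat \<Rightarrow> quat" where "qconj (a0,a1,a2,a3) = (a0,-a1,-a2,-a3)"
fun qadd :: "quat \<Rightarrow> quat \<Rightarrow> quat" where "qadd (a0,a1,a2,a3) (b0,b1,b2,b3) = (a0+b0,a1+b1,a2+b2,a3+b3)"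
abbreviation qone :: quat where "qone \<equiv> (1,0,0,0)"
definition qdvd :: "int \<Rightarrow> quat \<Rightarrow> bool" where "qdvd c x \<longleftrightarrow> (\<exists>y. x = qscale c y)"

lemma qdvd_iff: "qdvd c (a0,a1,a2,a3) \<longleftrightarrow> c dvd a0 \<and> c dvd a1 \<and> c dvd a2 \<and> c dvd a3"
  unfolding qdvd_def by (auto simp: split_paired_Ex elim!: dvdE)

lemma qmul_assoc: "qmul (qmul x y) z = qmul x (qmul y z)"
  by (cases x rule: prod_cases4, cases y rule: prod_cases4, cases z rule: prod_cases4) (simp add: algebra_simps)
lemma qmul_one [simp]: "qmul qone x = x" "qmul x qone = x"
  by (cases x rule: prod_cases4, simp)+
lemma qconj_qconj [simp]: "qconj (qconj x) = x"
  by (cases x rule: prod_cases4) simp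
lemma qconj_mul: "qconj (qmul x y) = qmul (qconj y) (qconj x)"
  by (cases x rule: prod_cases4, cases y rule: prod_cases4) (simp add: algebra_simps)
lemma qnorm_mul [simp]: "qnorm (qmul x y) = qnorm x * qnorm y"
  by (cases x rule: prod_cases4, cases y rule: prod_cases4) (simp add: algebra_simps power2_eq_square)
lemma qnorm_conj [simp]: "qnorm (qconj x) = qnorm x"
  by (cases x rule: prod_cases4) simp
lemma qnorm_scale [simp]: "qnorm (qscale c x) = c\<^sup>2 * qnorm x"
  by (cases x rule: prod_cases4) (simp add: algebra_simps power_mult_distrib)
lemma qmul_conj: "qmul x (qconj x) = qscale (qnorm x) qone" "qmul (qconj x) x = qscale (qnorm x) qone"
  by (cases x rule: prod_cases4, simp add: algebra_simps power2_eq_square)+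
lemma qmul_scale: "qmul (qscale c x) y = qscale c (qmul x y)" "qmul x (qscale c y) = qscale c (qmul x y)"
  by (cases x rule: prod_cases4, cases y rule: prod_cases4, simp add: algebra_simps)+
lemma qscale_scale [simp]: "qscale c (qscale d x) = qscale (c * d) x"
  by (cases x rule: prod_cases4) (simp add: algebra_simps)
lemma qscale_one [simp]: "qscale 1 x = x" by (cases x rule: prod_cases4) simp
lemma qscale_inj: "c \<noteq> 0 \<Longrightarrow> qscale c x = qscale c y \<longleftrightarrow> x = y"
  by (cases x rule: prod_cases4, cases y rule: prod_cases4) simp
lemma qmul_add: "qmul x (qadd y z) = qadd (qmul x y) (qmul x z)" "qmul (qadd x y) z = qadd (qmul x z) (qmul y z)"
  by (cases x rule: prod_cases4, cases y rule: prod_cases4, cases z rule: prod_cases4, simp add: algebra_simps)+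
lemma qscale_add: "qscale c (qadd x y) = qadd (qscale c x) (qscale c y)"
  by (cases x rule: prod_cases4, cases y rule: prod_cases4) (simp add: algebra_simps)
lemma qnorm_nonneg [simp]: "qnorm x \<ge> 0" by (cases x rule: prod_cases4) simp
lemma qnorm_eq_0: "qnorm x = 0 \<longleftrightarrow> x = (0,0,0,0)"
proof (cases x rule: prod_cases4)
  case (fields a b c d)
  have "a\<^sup>2 + b\<^sup>2 + c\<^sup>2 + d\<^sup>2 = 0 \<longleftrightarrow> a = 0 \<and> b = 0 \<and> c = 0 \<and> d = 0"
    using zero_le_power2[of a] zero_le_power2[of b] zero_le_power2[of c] zero_le_power2[of d]
    by (smt (verit) power2_eq_iff_nonneg power_eq_0_iff zero_power2)
  then show ?thesis by (simp add: fields)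
qed

lemma qmul_left_cancel: "qnorm x \<noteq> 0 \<Longrightarrow> qmul x y = qmul x z \<longleftrightarrow> y = z"
proof
  assume n: "qnorm x \<noteq> 0" and "qmul x y = qmul x z"
  then have "qmul (qmul (qconj x) x) y = qmul (qmul (qconj x) x) z" by (simp add: qmul_assoc)
  then show "y = z" using n by (simp add: qmul_conj qmul_scale qscale_inj del: qscale.simps)
qed simp

lemma qdvd_mul: "qdvd c x \<Longrightarrow> qdvd c (qmul x y)" "qdvd c y \<Longrightarrow> qdvd c (qmul x y)"
  unfolding qdvd_def by (auto simp: qmul_scale simp del: qscale.simps)

section \<open>Euclidean division and right ideals of odd prime norm\<close>

lemma odd_balanced_residue: "j > 0 \<Longrightarrow> odd j \<Longrightarrow> \<exists>e. 2 * \<bar>x - j * e\<bar> < (j::int)"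
proof -
  assume j: "j > 0" "odd j"
  define e where "e = (2 * x + j) div (2 * j)"
  have "2*j*e + (2*x + j) mod (2*j) = 2*x + j" unfolding e_def by (rule mult_div_mod_eq)
  moreover have "0 \<le> (2*x + j) mod (2*j)" "(2*x + j) mod (2*j) < 2*j" using j by simp_all
  ultimately have 1: "- j \<le> 2 * (x - j * e)" "2 * (x - j * e) < j" by (simp_all add: algebra_simps)
  moreover have "2 * (x - j * e) \<noteq> - j" using j(2) by presburger
  ultimately have "2 * (x - j * e) < j" "- (2 * (x - j * e)) < j" by linarith+
  then have "2 * \<bar>x - j * e\<bar> < j" by (simp only: abs_if split: if_split) simp
  then show ?thesis by blast
qed

text \<open>For odd \<open>j\<close> each coordinate of the remainder is strictly below
  \<open>j / 2\<close> in absolute value, so the four squares add up to less than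
  \<open>j^2\<close>. For even \<open>j\<close> equality can occur, and division is replaced by
  halving.\<close>

lemma odd_balanced_quat:
  assumes "j > 0" "odd j"
  obtains \<epsilon> \<rho> where "x = qadd (qscale j \<epsilon>) \<rho>" "qnorm \<rho> < j\<^sup>2"
proof (cases x rule: prod_cases4)
  case (fields a b c d)
  obtain ea eb ec ed where e: "2 * \<bar>a - j * ea\<bar> < j" "2 * \<bar>b - j * eb\<bar> < j" "2 * \<bar>c - j * ec\<bar> < j" "2 * \<bar>d - j * ed\<bar> < j"
    using odd_balanced_residue[OF assms] by metis
  have sq: "4 * y\<^sup>2 < j\<^sup>2" if "2 * \<bar>y\<bar> < j" for y
    using power_strict_mono[OF that, of 2] by (simp add: power_mult_distrib)
  show ?thesis
    by (rule that[of "(ea,eb,ec,ed)" "(a - j*ea, b - j*eb, c - j*ec, d - j*ed)"])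
       (use sq[OF e(1)] sq[OF e(2)] sq[OF e(3)] sq[OF e(4)] fields in auto)
qed

text \<open>The coordinates split into two pairs of equal parity, and the matching one of
  \<open>1 + i\<close>, \<open>1 + j\<close>, \<open>1 + k\<close> makes all coordinates of the
  product even. It is multiplied on the right in order to stay inside a right ideal.\<close>

lemma even_norm_halve:
  assumes "even (qnorm x)"
  obtains u \<eta> where "qscale 2 \<eta> = qmul x u" "2 * qnorm \<eta> = qnorm x"
proof (cases x rule: prod_cases4)
  note main = that
  case (fields a b c d)
  have ev: "even (a + b + c + d)" using assms fields by simp
  have half: thesis if u: "qnorm u = 2" "qdvd 2 (qmul x u)" for u
  proof -
    obtain \<eta> where h: "qmul x u = qscale 2 \<eta>" using u by (auto simp: qdvd_def)
    from arg_cong[OF h, of qnorm] have "2 * qnorm \<eta> = qnorm x" using u(1) by simp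
    with h show thesis using main by metis
  qed
  have "(even (a + b) \<and> even (c + d)) \<or> (even (a + c) \<and> even (b + d)) \<or> (even (a + d) \<and> even (b + c))"
    using ev by auto
  then show thesis
  proof (elim disjE conjE)
    assume "even (a + b)" "even (c + d)"
    then show thesis by (intro half[of "(1,1,0,0)"]) (auto simp: fields qdvd_iff)
  next
    assume "even (a + c)" "even (b + d)"
    then show thesis by (intro half[of "(1,0,1,0)"]) (auto simp: fields qdvd_iff)
  next
    assume "even (a + d)" "even (b + c)"
    then show thesis by (intro half[of "(1,0,0,1)"]) (auto simp: fields qdvd_iff)
  qed
qed

definition right_ideal :: "int \<Rightarrow> quat \<Rightarrow> quat set" where
  "right_ideal l \<alpha> = {qadd (qmul \<alpha> a) (qscale l b) | a b. True}"

lemma right_ideal_closed: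
  assumes "x \<in> right_ideal l \<alpha>"
  shows "qmul x y \<in> right_ideal l \<alpha>" "qscale c x \<in> right_ideal l \<alpha>"
proof -
  obtain a b where x: "x = qadd (qmul \<alpha> a) (qscale l b)" using assms by (auto simp: right_ideal_def)
  have "qmul x y = qadd (qmul \<alpha> (qmul a y)) (qscale l (qmul b y))" by (simp only: x qmul_add qmul_assoc qmul_scale)
  then show "qmul x y \<in> right_ideal l \<alpha>" unfolding right_ideal_def by blast
  have "qscale c x = qadd (qmul \<alpha> (qscale c a)) (qscale l (qscale c b))"
    by (simp only: x qscale_add qmul_scale qscale_scale mult.commute)
  then show "qscale c x \<in> right_ideal l \<alpha>" unfolding right_ideal_def by blast
qed

lemma right_ideal_add:
  assumes "x \<in> right_ideal l \<alpha>" "y \<in> right_ideal l \<alpha>"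
  shows "qadd x y \<in> right_ideal l \<alpha>"
proof -
  obtain a b c d where "x = qadd (qmul \<alpha> a) (qscale l b)" "y = qadd (qmul \<alpha> c) (qscale l d)"
    using assms by (auto simp: right_ideal_def)
  then have "qadd x y = qadd (qmul \<alpha> (qadd a c)) (qscale l (qadd b d))"
    by (cases \<alpha> rule: prod_cases4, cases a rule: prod_cases4, cases b rule: prod_cases4, cases c rule: prod_cases4, cases d rule: prod_cases4)
       (simp add: algebra_simps)
  then show ?thesis unfolding right_ideal_def by blast
qed

lemma right_ideal_scale: "qscale l x \<in> right_ideal l \<alpha>"
  unfolding right_ideal_def
  by (rule CollectI, rule exI[of _ "(0,0,0,0)"], rule exI[of _ x]) (cases \<alpha> rule: prod_cases4, cases x rule: prod_cases4, simp)

lemma right_ideal_self: "\<alpha> \<in> right_ideal l \<alpha>"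
  unfolding right_ideal_def
  by (rule CollectI, rule exI[of _ "(1,0,0,0)"], rule exI[of _ "(0,0,0,0)"]) (cases \<alpha> rule: prod_cases4, simp)

lemma right_ideal_norm_dvd:
  assumes "l dvd qnorm \<alpha>" "x \<in> right_ideal l \<alpha>" shows "l dvd qnorm x"
proof -
  obtain a b where x: "x = qadd (qmul \<alpha> a) (qscale l b)" using assms by (auto simp: right_ideal_def)
  have "l dvd qnorm (qadd z (qscale l b)) - qnorm z" for z
  proof (cases z rule: prod_cases4, cases b rule: prod_cases4)
    fix z0 z1 z2 z3 b0 b1 b2 b3 assume "z = (z0,z1,z2,z3)" "b = (b0,b1,b2,b3)"
    then have "qnorm (qadd z (qscale l b)) - qnorm z
       = l * (2*z0*b0 + 2*z1*b1 + 2*z2*b2 + 2*z3*b3 + l * qnorm b)"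
      by (simp add: algebra_simps power2_eq_square)
    then show ?thesis by simp
  qed
  from this[of "qmul \<alpha> a"] show ?thesis using assms(1)
    by (simp add: x) (metis diff_add_cancel dvd_add dvd_mult2)
qed

text \<open>Infinite descent: an element of the ideal of minimal norm \<open>j l\<close> must have \<open>j = 1\<close>,
  by halving when \<open>j\<close> is even and by Euclidean division by \<open>j\<close> when it is odd.\<close>
lemma right_ideal_generator:
  assumes l: "prime l" "l \<noteq> (2::int)" and dvd: "l dvd qnorm \<alpha>" and prim: "\<not> qdvd l \<alpha>"
  obtains \<beta> where "\<beta> \<in> right_ideal l \<alpha>" "qnorm \<beta> = l"
proof -
  let ?I = "right_ideal l \<alpha>"
  have l0: "l > 1" using l prime_gt_1_int by blast
  have oddl: "odd l" using l primes_dvd_imp_eq[of 2 l] by auto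
  define P where "P n \<longleftrightarrow> n > 0 \<and> (\<exists>x\<in>?I. qnorm x = int n)" for n
  have "\<exists>n. P n"
  proof -
    have "qnorm \<alpha> \<noteq> 0" using prim by (auto simp: qnorm_eq_0 qdvd_iff)
    then have "qnorm \<alpha> > 0" using qnorm_nonneg[of \<alpha>] by linarith
    then show ?thesis using right_ideal_self[of \<alpha> l]
      by (intro exI[of _ "nat (qnorm \<alpha>)"]) (auto simp: P_def intro!: bexI[of _ \<alpha>])
  qed
  then have Pn: "P (LEAST n. P n)" by (rule LeastI_ex)
  then obtain \<delta> where d: "\<delta> \<in> ?I" "qnorm \<delta> = int (LEAST n. P n)" by (auto simp: P_def)
  have d0: "qnorm \<delta> > 0" using Pn d by (simp add: P_def)
  have min: "qnorm \<delta> \<le> qnorm x" if "x \<in> ?I" "qnorm x > 0" for x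
  proof -
    have "P (nat (qnorm x))" using that by (auto simp: P_def)
    then have "(LEAST n. P n) \<le> nat (qnorm x)" by (rule Least_le)
    then show ?thesis using d that by linarith
  qed
  obtain j where j: "qnorm \<delta> = l * j" using right_ideal_norm_dvd[OF dvd d(1)] by blast
  have j0: "j > 0" using d0 l0 unfolding j by (simp add: zero_less_mult_iff)
  have "j = 1"
  proof (cases "even j")
    case True
    then have "even (qnorm \<delta>)" by (simp add: j)
    then obtain u \<eta> where h: "qscale 2 \<eta> = qmul \<delta> u" "2 * qnorm \<eta> = qnorm \<delta>" by (rule even_norm_halve)
    \<comment> \<open>As \<open>l\<close> is odd,
      \<open>\<eta> = l \<eta> - ((l - 1) / 2) (2 \<eta>)\<close>, so halving does not leave the
      ideal.\<close>
    have "qscale (- ((l - 1) div 2)) (qscale 2 \<eta>) \<in> ?I" unfolding h(1) by (intro right_ideal_closed d(1))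
    then have "qadd (qscale l \<eta>) (qscale (- ((l - 1) div 2)) (qscale 2 \<eta>)) \<in> ?I"
      by (intro right_ideal_add right_ideal_scale)
    moreover have "qadd (qscale l \<eta>) (qscale (- ((l - 1) div 2)) (qscale 2 \<eta>)) = \<eta>"
    proof -
      obtain k where k: "l = 2 * k + 1" using oddl by (rule oddE)
      show ?thesis unfolding k by (cases \<eta> rule: prod_cases4) (simp add: algebra_simps)
    qed
    ultimately have "\<eta> \<in> ?I" by simp
    moreover have "qnorm \<eta> > 0" "qnorm \<eta> < qnorm \<delta>" using h(2) d0 by linarith+
    ultimately show ?thesis using min[of \<eta>] by linarith
  next
    case False
    obtain \<epsilon> \<rho> where er: "\<delta> = qadd (qscale j \<epsilon>) \<rho>" "qnorm \<rho> < j\<^sup>2" using odd_balanced_quat[OF j0 False] by blast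
    \<comment> \<open>This is \<open>\<delta>\<close> times the conjugate of \<open>\<rho>\<close>,
      divided by \<open>j\<close>. Its norm \<open>l N(\<rho>) / j\<close> is below
      \<open>l j\<close>, so the minimality of \<open>\<delta>\<close> forces
      \<open>\<rho> = 0\<close>.\<close>
    define \<eta> where "\<eta> = qadd (qscale l qone) (qscale (-1) (qmul \<delta> (qconj \<epsilon>)))"
    have etaI: "\<eta> \<in> ?I" unfolding \<eta>_def by (intro right_ideal_add right_ideal_scale right_ideal_closed d(1))
    have "\<rho> = qadd \<delta> (qscale (-j) \<epsilon>)"
      unfolding er(1) by (cases \<epsilon> rule: prod_cases4, cases \<rho> rule: prod_cases4) simp
    then have "qmul \<delta> (qconj \<rho>) = qadd (qmul \<delta> (qconj \<delta>)) (qscale (-j) (qmul \<delta> (qconj \<epsilon>)))"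
      by (cases \<epsilon> rule: prod_cases4, cases \<delta> rule: prod_cases4) (simp add: algebra_simps)
    also have "\<dots> = qscale j \<eta>"
      unfolding qmul_conj j \<eta>_def by (simp add: qscale_add mult.commute del: qscale.simps)
    finally have e: "qmul \<delta> (qconj \<rho>) = qscale j \<eta>" .
    from arg_cong[OF this, of qnorm] have "l * j * qnorm \<rho> = j\<^sup>2 * qnorm \<eta>" by (simp add: j)
    then have n: "l * qnorm \<rho> = j * qnorm \<eta>" using j0 by (simp add: power2_eq_square)
    show ?thesis
    proof (cases "qnorm \<rho> = 0")
      case False
      then have r0: "qnorm \<rho> > 0" using qnorm_nonneg[of \<rho>] by linarith
      have "j * qnorm \<eta> > 0" using n r0 l0 by (metis mult_pos_pos order.strict_trans zero_less_one)
      then have "qnorm \<eta> > 0" using j0 by (simp add: zero_less_mult_iff)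
      then have "l * j \<le> qnorm \<eta>" using min[OF etaI] j by simp
      then have "j * (l * j) \<le> j * qnorm \<eta>" using j0 by simp
      also have "\<dots> = l * qnorm \<rho>" using n by simp
      also have "\<dots> < l * j\<^sup>2" using er(2) l0 by simp
      finally show ?thesis by (simp add: power2_eq_square algebra_simps)
    next
      case True
      then have "\<rho> = (0,0,0,0)" by (simp add: qnorm_eq_0)
      then have "\<delta> = qscale j \<epsilon>" using er(1) by (cases \<epsilon> rule: prod_cases4) simp
      then have "l * j = j\<^sup>2 * qnorm \<epsilon>" using j by simp
      then have "l = j * qnorm \<epsilon>" using j0 by (simp add: power2_eq_square)
      then have "j dvd l" by simp
      then have jl: "j = 1 \<or> j = l" using l(1) j0 by (simp add: prime_int_iff)
      \<comment> \<open>With \<open>\<rho> = 0\<close> the number \<open>j\<close> divides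
        \<open>l\<close>. To exclude \<open>j = l\<close>, the generator \<open>\<alpha>\<close> is
        itself reduced modulo \<open>l\<close>: the remainder lies in the ideal, is nonzero by
        primitivity, and has norm below \<open>l^2\<close>.\<close>
      obtain \<epsilon>' \<rho>' where er': "\<alpha> = qadd (qscale l \<epsilon>') \<rho>'" "qnorm \<rho>' < l\<^sup>2"
        using odd_balanced_quat[of l \<alpha>, OF _ oddl] l0 by (metis order.strict_trans zero_less_one)
      have r: "\<rho>' = qadd \<alpha> (qscale l (qscale (-1) \<epsilon>'))"
        unfolding er'(1) by (cases \<epsilon>' rule: prod_cases4, cases \<rho>' rule: prod_cases4) simp
      have "\<rho>' \<in> ?I" unfolding r by (intro right_ideal_add right_ideal_self right_ideal_scale)
      moreover have "qnorm \<rho>' > 0"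
      proof (rule ccontr)
        assume "\<not> qnorm \<rho>' > 0"
        then have "\<rho>' = (0,0,0,0)" using qnorm_nonneg[of \<rho>'] by (simp add: qnorm_eq_0[symmetric])
        then have "\<alpha> = qscale l \<epsilon>'" using er'(1) by (cases \<epsilon>' rule: prod_cases4) simp
        then show False using prim by (auto simp: qdvd_def)
      qed
      ultimately have "l * j < l\<^sup>2" using min[of \<rho>'] j er'(2) by simp
      then have "j < l" using l0 by (simp add: power2_eq_square)
      then show ?thesis using jl by simp
    qed
  qed
  then show ?thesis using that d(1) j by simp
qed

text \<open>Writing \<open>\<beta> = \<alpha> a + l b\<close>, the conjugate of
  \<open>\<beta>\<close> times \<open>\<alpha>\<close> is divisible by \<open>l\<close>. Multiplying
  back by \<open>\<beta>\<close>, whose norm is \<open>l\<close>, and cancelling \<open>l\<close>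
  gives the quotient.\<close>

lemma right_ideal_factor:
  assumes "\<beta> \<in> right_ideal l \<alpha>" "qnorm \<beta> = l" "l dvd qnorm \<alpha>" "l \<noteq> 0"
  obtains \<gamma> where "\<alpha> = qmul \<beta> \<gamma>"
proof -
  obtain a b where b: "\<beta> = qadd (qmul \<alpha> a) (qscale l b)" using assms by (auto simp: right_ideal_def)
  have "qconj \<beta> = qadd (qmul (qconj a) (qconj \<alpha>)) (qscale l (qconj b))"
    unfolding b by (cases \<alpha> rule: prod_cases4, cases a rule: prod_cases4, cases b rule: prod_cases4) (simp add: algebra_simps)
  then have "qmul (qconj \<beta>) \<alpha> = qadd (qmul (qconj a) (qmul (qconj \<alpha>) \<alpha>)) (qscale l (qmul (qconj b) \<alpha>))"
    by (simp only: qmul_add qmul_assoc qmul_scale)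
  moreover obtain k where "qnorm \<alpha> = l * k" using assms(3) by blast
  ultimately have "qmul (qconj \<beta>) \<alpha> = qscale l (qadd (qscale k (qconj a)) (qmul (qconj b) \<alpha>))"
    by (simp only: qmul_conj qmul_scale qmul_one qscale_add qscale_scale)
  then obtain \<gamma> where g: "qmul (qconj \<beta>) \<alpha> = qscale l \<gamma>" by blast
  have "qmul \<beta> (qmul (qconj \<beta>) \<alpha>) = qscale l \<alpha>"
    using assms(2) by (simp only: qmul_assoc[symmetric] qmul_conj qmul_scale qmul_one)
  then have "qscale l \<alpha> = qscale l (qmul \<beta> \<gamma>)" unfolding g by (simp only: qmul_scale)
  then have "\<alpha> = qmul \<beta> \<gamma>" using assms(4) qscale_inj by blast
  then show ?thesis by (rule that)
qed

text \<open>Every left factor of norm \<open>l\<close> divides an ideal element of the same norm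
  \<open>l\<close> on the left, so it differs from that element by a unit; this element links the
  two factors.\<close>

lemma right_factor_unique:
  assumes l: "prime l" "l \<noteq> (2::int)" and a: "\<alpha> = qmul \<beta>1 \<gamma>1" "\<alpha> = qmul \<beta>2 \<gamma>2"
    and n: "qnorm \<beta>1 = l" "qnorm \<beta>2 = l" and prim: "\<not> qdvd l \<alpha>"
  obtains u where "qnorm u = 1" "\<beta>2 = qmul \<beta>1 u"
proof -
  have l0: "l > 1" using l prime_gt_1_int by blast
  have "l dvd qnorm \<alpha>" using a(1) n by simp
  then obtain \<beta> where b: "\<beta> \<in> right_ideal l \<alpha>" "qnorm \<beta> = l" using right_ideal_generator[OF l _ prim] by blast
  have "\<exists>u. qnorm u = 1 \<and> \<beta> = qmul \<beta>' u" if "\<alpha> = qmul \<beta>' \<gamma>" "qnorm \<beta>' = l" for \<beta>' \<gamma>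
  proof -
    obtain x y where "\<beta> = qadd (qmul \<alpha> x) (qscale l y)" using b by (auto simp: right_ideal_def)
    also have "qscale l y = qmul \<beta>' (qmul (qconj \<beta>') y)"
      using that(2) by (simp only: qmul_assoc[symmetric] qmul_conj qmul_scale qmul_one)
    finally have e: "\<beta> = qmul \<beta>' (qadd (qmul \<gamma> x) (qmul (qconj \<beta>') y))"
      using that(1) by (simp only: qmul_add qmul_assoc)
    from arg_cong[OF this, of qnorm] have "l * 1 = l * qnorm (qadd (qmul \<gamma> x) (qmul (qconj \<beta>') y))"
      using b(2) that(2) by (simp only: qnorm_mul mult_1_right)
    then have "qnorm (qadd (qmul \<gamma> x) (qmul (qconj \<beta>') y)) = 1" using l0 by simp
    with e show ?thesis by blast
  qed
  from this[OF a(1) n(1)] this[OF a(2) n(2)] obtain u v where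
    uv: "qnorm u = 1" "\<beta> = qmul \<beta>1 u" "qnorm v = 1" "\<beta> = qmul \<beta>2 v" by blast
  have "\<beta>2 = qmul \<beta>2 (qmul v (qconj v))" using uv(3) by (simp add: qmul_conj)
  also have "\<dots> = qmul \<beta>1 (qmul u (qconj v))" using uv by (simp only: qmul_assoc[symmetric])
  finally show ?thesis using uv by (intro that[of "qmul u (qconj v)"]) auto
qed

section \<open>Generators, reduced words and unique factorisation\<close>

definition oddq :: "quat \<Rightarrow> bool" where
  "oddq x \<longleftrightarrow> odd (qre x) \<and> even (qi x) \<and> even (qj x) \<and> even (qk x)"

definition gens :: "nat \<Rightarrow> quat set" where
  "gens p = {x. qnorm x = int p \<and> qre x > 0 \<and> odd (qre x) \<and> even (qi x) \<and> even (qj x) \<and> even (qk x)}"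

lemma oddq_simp: "oddq (a,b,c,d) \<longleftrightarrow> odd a \<and> even b \<and> even c \<and> even d" by (simp add: oddq_def)
lemma oddq_one [simp]: "oddq qone" by (simp add: oddq_def)
lemma oddq_mul: "oddq x \<Longrightarrow> oddq y \<Longrightarrow> oddq (qmul x y)"
  by (cases x rule: prod_cases4, cases y rule: prod_cases4) (simp add: oddq_simp)
lemma oddq_conj [simp]: "oddq (qconj x) = oddq x"
  by (cases x rule: prod_cases4) (simp add: oddq_simp)
lemma oddq_scale: "odd c \<Longrightarrow> oddq (qscale c x) = oddq x"
  by (cases x rule: prod_cases4) (simp add: oddq_simp)
lemma gens_oddq: "x \<in> gens p \<Longrightarrow> oddq x" by (simp add: gens_def oddq_def)
lemma gens_norm: "x \<in> gens p \<Longrightarrow> qnorm x = int p" by (simp add: gens_def)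
lemma gens_conj: "x \<in> gens p \<Longrightarrow> qconj x \<in> gens p"
  by (cases x rule: prod_cases4) (simp add: gens_def)

lemma norm_one_oddq:
  assumes "qnorm u = 1" "oddq u" shows "u = qone \<or> u = qscale (-1) qone"
proof (cases u rule: prod_cases4)
  case (fields a b c d)
  have n: "a\<^sup>2 + b\<^sup>2 + c\<^sup>2 + d\<^sup>2 = 1" and o: "odd a" using assms fields by (auto simp: oddq_simp)
  have "a\<^sup>2 \<noteq> 0" using o by auto
  then have "a\<^sup>2 = 1" "b\<^sup>2 = 0" "c\<^sup>2 = 0" "d\<^sup>2 = 0"
    using n zero_le_power2[of a] zero_le_power2[of b] zero_le_power2[of c] zero_le_power2[of d] by linarith+
  then show ?thesis by (auto simp: fields power2_eq_1_iff)
qed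

lemma finite_qnorm: "finite {x. qnorm x = k}"
proof (rule finite_subset)
  have le: "\<bar>a\<bar> \<le> a\<^sup>2" for a :: int
  proof (cases "a = 0")
    case False
    then have "1 * \<bar>a\<bar> \<le> \<bar>a\<bar> * \<bar>a\<bar>" by (intro mult_right_mono) auto
    then show ?thesis by (simp add: power2_eq_square abs_mult_self_eq)
  qed simp
  show "{x. qnorm x = k} \<subseteq> {-k..k} \<times> {-k..k} \<times> {-k..k} \<times> {-k..k}"
  proof
    fix x assume x: "x \<in> {x. qnorm x = k}"
    obtain a b c d where f: "x = (a,b,c,d)" by (cases x rule: prod_cases4)
    have "a\<^sup>2 + b\<^sup>2 + c\<^sup>2 + d\<^sup>2 = k" using x f by simp
    then have "\<bar>a\<bar> \<le> k" "\<bar>b\<bar> \<le> k" "\<bar>c\<bar> \<le> k" "\<bar>d\<bar> \<le> k"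
      using le[of a] le[of b] le[of c] le[of d] zero_le_power2[of a] zero_le_power2[of b] zero_le_power2[of c] zero_le_power2[of d]
      by linarith+
    then show "x \<in> {-k..k} \<times> {-k..k} \<times> {-k..k} \<times> {-k..k}" using f by auto
  qed
qed simp

lemma finite_gens: "finite (gens p)"
  by (rule finite_subset[OF _ finite_qnorm[of "int p"]]) (auto simp: gens_def)

definition qprod :: "quat list \<Rightarrow> quat" where "qprod ws = foldr qmul ws qone"
lemma qprod_simps [simp]: "qprod [] = qone" "qprod (x # xs) = qmul x (qprod xs)"
  by (simp_all add: qprod_def)
lemma qprod_append: "qprod (xs @ ys) = qmul (qprod xs) (qprod ys)"
  by (induction xs) (simp_all add: qmul_assoc)

definition words :: "nat \<Rightarrow> nat \<Rightarrow> quat list set" where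
  "words p n = {ws. length ws = n \<and> set ws \<subseteq> gens p \<and> successively (\<lambda>x y. y \<noteq> qconj x) ws}"

lemma finite_words: "finite (words p n)"
  by (rule finite_subset[OF _ finite_lists_length_eq[OF finite_gens[of p], of n]]) (auto simp: words_def)

lemma gens_list_norm: "set ws \<subseteq> gens p \<Longrightarrow> qnorm (qprod ws) = int p ^ length ws"
  by (induction ws) (auto simp: gens_norm)
lemma gens_list_oddq: "set ws \<subseteq> gens p \<Longrightarrow> oddq (qprod ws)"
  by (induction ws) (auto simp: gens_oddq oddq_mul)

lemma words_rev_conj: assumes "ws \<in> words p n" shows "map qconj (rev ws) \<in> words p n"
proof -
  note ws = assms
  have "successively (\<lambda>x y. qconj x \<noteq> y) ws" using ws unfolding words_def successively_conv_nth by fastforce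
  then have "successively (\<lambda>x y. y \<noteq> qconj x) (map qconj (rev ws))"
    by (simp add: successively_map successively_rev)
  moreover have "set (map qconj (rev ws)) \<subseteq> gens p" using ws gens_conj unfolding words_def set_map set_rev by blast
  ultimately show ?thesis using ws by (simp add: words_def)
qed

lemma qprod_rev_conj: "qprod (map qconj (rev ws)) = qconj (qprod ws)"
  by (induction ws) (simp_all add: qprod_append qconj_mul)

lemma qscale_minus_mul: "qmul x (qscale (-1) y) = qscale (-1) (qmul x y)" "qmul (qscale (-1) x) y = qscale (-1) (qmul x y)"
  by (simp_all only: qmul_scale)
context
  fixes p :: nat
  assumes p: "prime p" "p mod 4 = 1"
begin

lemma p_odd: "odd (int p)" "odd p" using p(2) by presburger+
lemma p_gt_2: "p > 2" using p prime_gt_1_nat[OF p(1)] by (cases "p = 2") auto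
lemma p_int: "prime (int p)" "int p \<noteq> 2" using p p_gt_2 by auto

text \<open>As \<open>p = 1\<close> modulo 4, exactly one coordinate is odd. One of the units 1, i,
  j, k moves it to the real place, and a sign makes it positive.\<close>

lemma unit_to_gens:
  assumes "qnorm \<beta> = int p"
  obtains u where "qnorm u = 1" "qmul \<beta> u \<in> gens p"
proof (cases \<beta> rule: prod_cases4)
  note main = that
  case (fields a b c d)
  have n: "a\<^sup>2 + b\<^sup>2 + c\<^sup>2 + d\<^sup>2 = int p" using assms fields by simp
  have sq: "\<exists>k. x\<^sup>2 = 4 * k + (if even x then 0 else 1)" for x :: int
  proof (cases "even x")
    case True then obtain y where "x = 2 * y" by blast
    then show ?thesis by (simp add: power_mult_distrib)
  next
    case False then obtain y where "x = 2 * y + 1" by (rule oddE)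
    then have "x\<^sup>2 = 4 * (y\<^sup>2 + y) + 1" by (simp add: power2_eq_square algebra_simps)
    then show ?thesis using False by (intro exI[of _ "y\<^sup>2 + y"]) simp
  qed
  obtain ka kb kc kd where k: "a\<^sup>2 = 4 * ka + (if even a then 0 else 1)" "b\<^sup>2 = 4 * kb + (if even b then 0 else 1)"
    "c\<^sup>2 = 4 * kc + (if even c then 0 else 1)" "d\<^sup>2 = 4 * kd + (if even d then 0 else 1)"
    using sq by metis
  obtain t where t: "int p = 4 * t + 1"
    using p(2) by (metis mult.commute mod_div_decomp of_nat_1 of_nat_add of_nat_mult of_nat_numeral)
  have "4 * ka + 4 * kb + 4 * kc + 4 * kd + (if even a then 0 else 1) + (if even b then 0 else 1)
      + (if even c then 0 else 1) + (if even d then 0 else 1) = 4 * t + 1"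
    using n unfolding t k by linarith
  then have cases: "(odd a \<and> even b \<and> even c \<and> even d) \<or> (even a \<and> odd b \<and> even c \<and> even d) \<or>
     (even a \<and> even b \<and> odd c \<and> even d) \<or> (even a \<and> even b \<and> even c \<and> odd d)"
    by (cases "even a"; cases "even b"; cases "even c"; cases "even d"; simp only: if_True if_False simp_thms; presburger?)
  have fin: thesis if u: "qnorm u = 1" "oddq (qmul \<beta> u)" for u
  proof -
    have o: "odd (qre (qmul \<beta> u))" using u by (simp add: oddq_def)
    then have "qre (qmul \<beta> u) \<noteq> 0" by auto
    then consider "qre (qmul \<beta> u) > 0" | "qre (qmul \<beta> u) < 0" by linarith
    then show thesis
    proof cases
      case 1
      then show ?thesis using main[OF u(1)] u assms by (simp add: gens_def oddq_def)
    next
      case 2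
      have "qmul \<beta> (qscale (-1) u) \<in> gens p"
        using u assms 2 unfolding qmul_scale by (cases "qmul \<beta> u" rule: prod_cases4) (auto simp: gens_def oddq_def dest!: arg_cong[of _ _ qnorm])
      moreover have "qnorm (qscale (-1) u) = 1" using u(1) by (simp only: qnorm_scale) simp
      ultimately show ?thesis using main by blast
    qed
  qed
  from cases show thesis
  proof (elim disjE conjE)
    assume "odd a" "even b" "even c" "even d"
    then show thesis by (intro fin[of "(1,0,0,0)"]) (auto simp: fields oddq_simp)
  next
    assume "even a" "odd b" "even c" "even d"
    then show thesis by (intro fin[of "(0,1,0,0)"]) (auto simp: fields oddq_simp)
  next
    assume "even a" "even b" "odd c" "even d"
    then show thesis by (intro fin[of "(0,0,1,0)"]) (auto simp: fields oddq_simp)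
  next
    assume "even a" "even b" "even c" "odd d"
    then show thesis by (intro fin[of "(0,0,0,1)"]) (auto simp: fields oddq_simp)
  qed
qed

lemma gens_left_divisor:
  assumes "int p dvd qnorm x" "\<not> qdvd (int p) x"
  obtains \<beta> \<gamma> where "\<beta> \<in> gens p" "x = qmul \<beta> \<gamma>"
proof -
  obtain \<delta> where d: "\<delta> \<in> right_ideal (int p) x" "qnorm \<delta> = int p"
    using right_ideal_generator[OF p_int assms] by blast
  have "int p \<noteq> 0" using p_gt_2 by simp
  from right_ideal_factor[OF d assms(1) this] obtain \<gamma> where g: "x = qmul \<delta> \<gamma>" by blast
  obtain u where u: "qnorm u = 1" "qmul \<delta> u \<in> gens p" using unit_to_gens[OF d(2)] by blast
  have "x = qmul (qmul \<delta> u) (qmul (qconj u) \<gamma>)"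
  proof -
    have "qmul (qmul \<delta> u) (qmul (qconj u) \<gamma>) = qmul \<delta> (qmul (qmul u (qconj u)) \<gamma>)" by (simp only: qmul_assoc)
    also have "\<dots> = x" using u(1) g by (simp only: qmul_conj qscale_one qmul_one)
    finally show ?thesis by simp
  qed
  then show ?thesis using u(2) that by blast
qed

lemma oddq_cancel_left:
  assumes "\<beta> \<in> gens p" "oddq (qmul \<beta> \<gamma>)" shows "oddq \<gamma>"
proof -
  have "oddq (qmul (qconj \<beta>) (qmul \<beta> \<gamma>))" using assms by (simp add: oddq_mul gens_oddq)
  also have "qmul (qconj \<beta>) (qmul \<beta> \<gamma>) = qscale (int p) \<gamma>"
    using assms by (simp only: qmul_assoc[symmetric] qmul_conj gens_norm qmul_scale qmul_one)
  finally show ?thesis using p_odd oddq_scale by blast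
qed

text \<open>The unit linking the two left factors is again odd in the real place and even elsewhere,
  hence \<plusminus>1, and the positive real parts exclude -1.\<close>

lemma gens_unique:
  assumes "\<beta>1 \<in> gens p" "\<beta>2 \<in> gens p" "qmul \<beta>1 \<gamma>1 = qmul \<beta>2 \<gamma>2" "\<not> qdvd (int p) (qmul \<beta>1 \<gamma>1)"
  shows "\<beta>1 = \<beta>2 \<and> \<gamma>1 = \<gamma>2"
proof -
  obtain u where u: "qnorm u = 1" "\<beta>2 = qmul \<beta>1 u"
    using right_factor_unique[OF p_int refl assms(3) _ _ assms(4)] gens_norm assms by metis
  have "oddq u" using oddq_cancel_left[OF assms(1), of u] gens_oddq[OF assms(2)] u(2) by simp
  then have "u = qone \<or> u = qscale (-1) qone" using norm_one_oddq u(1) by blast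
  moreover have False if "u = qscale (-1) qone"
  proof -
    have "\<beta>2 = qscale (-1) \<beta>1" using u(2) that by (simp only: qmul_scale qmul_one)
    then show False using assms(1,2) by (cases \<beta>1 rule: prod_cases4) (simp add: gens_def)
  qed
  ultimately have e: "\<beta>2 = \<beta>1" using u(2) by auto
  then show ?thesis using assms(3) qmul_left_cancel[of \<beta>1 \<gamma>1 \<gamma>2] gens_norm[OF assms(1)] p_gt_2 by auto
qed

text \<open>If \<open>p\<close> divided \<open>b\<close> times the rest, the rest would be left
  divisible by the conjugate of \<open>b\<close>. By uniqueness this conjugate would be the next
  letter, which reducedness forbids.\<close>

lemma words_primitive: "ws \<in> words p n \<Longrightarrow> \<not> qdvd (int p) (qprod ws)"
proof (induction ws arbitrary: n)
  case Nil
  then show ?case using p_gt_2 by (simp add: qdvd_iff)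
next
  case (Cons b vs)
  have b: "b \<in> gens p" and vs: "vs \<in> words p (n - 1)" using Cons.prems by (auto simp: words_def successively_Cons)
  show ?case
  proof
    assume "qdvd (int p) (qprod (b # vs))"
    then obtain Y where Y: "qmul b (qprod vs) = qscale (int p) Y" unfolding qdvd_def qprod_simps by blast
    have "qscale (int p) (qprod vs) = qmul (qconj b) (qmul b (qprod vs))"
      using b by (simp only: qmul_assoc[symmetric] qmul_conj gens_norm qmul_scale qmul_one)
    also have "\<dots> = qscale (int p) (qmul (qconj b) Y)" unfolding Y by (simp only: qmul_scale)
    finally have V: "qprod vs = qmul (qconj b) Y" using p_gt_2 qscale_inj[of "int p"] by auto
    show False
    proof (cases vs)
      case Nil
      from arg_cong[OF V, of qnorm] have "1 = int p * qnorm Y" using Nil b by (simp add: gens_norm)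
      then have "int p dvd 1" by (metis dvd_triv_left)
      then show False using p_gt_2 by auto
    next
      case c: (Cons c vs')
      have cg: "c \<in> gens p" "c \<noteq> qconj b" using Cons.prems c by (auto simp: words_def)
      have "\<not> qdvd (int p) (qprod vs)" by (rule Cons.IH[OF vs])
      then have "qconj b = c" using gens_unique[of "qconj b" c Y "qprod vs'"] V c gens_conj[OF b] cg by simp
      then show False using cg by simp
    qed
  qed
qed

text \<open>First letters agree by \<open>gens_unique\<close> and are cancelled. The sign is carried
  through the induction since \<plusminus>x are identified in the group.\<close>

lemma words_inj:
  assumes "ws \<in> words p n" "vs \<in> words p n" "qprod ws = qprod vs \<or> qprod ws = qscale (-1) (qprod vs)"
  shows "ws = vs"
  using assms
proof (induction ws arbitrary: vs n)
  case Nil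
  then show ?case by (auto simp: words_def)
next
  case (Cons b ws')
  then obtain c vs' where vs: "vs = c # vs'" by (cases vs) (auto simp: words_def)
  have bc: "b \<in> gens p" "c \<in> gens p" "ws' \<in> words p (n - 1)" "vs' \<in> words p (n - 1)"
    using Cons.prems vs by (auto simp: words_def successively_Cons)
  have prim: "\<not> qdvd (int p) (qmul b (qprod ws'))" using words_primitive[OF Cons.prems(1)] by simp
  have "qmul b (qprod ws') = qmul c (qprod vs') \<or> qmul b (qprod ws') = qmul c (qscale (-1) (qprod vs'))"
    using Cons.prems(3) unfolding vs qprod_simps qscale_minus_mul .
  then have "b = c \<and> (qprod ws' = qprod vs' \<or> qprod ws' = qscale (-1) (qprod vs'))"
    using gens_unique[OF bc(1,2) _ prim] by blast
  then show ?case using Cons.IH[OF bc(3,4)] vs by simp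
qed

text \<open>Generators are split off on the left. If the new letter were followed by its conjugate,
  their product \<open>p\<close> would divide \<open>x\<close>.\<close>

lemma words_surj:
  assumes "oddq x" "qnorm x = int p ^ n" "\<not> qdvd (int p) x"
  shows "\<exists>ws\<in>words p n. x = qprod ws \<or> x = qscale (-1) (qprod ws)"
  using assms
proof (induction n arbitrary: x)
  case 0
  then show ?case using norm_one_oddq[of x] by (auto simp: words_def)
next
  case (Suc n)
  obtain \<beta> \<gamma> where bg: "\<beta> \<in> gens p" "x = qmul \<beta> \<gamma>"
  proof -
    have "int p dvd qnorm x" using Suc.prems(2) by simp
    from gens_left_divisor[OF this Suc.prems(3)] show ?thesis using that by blast
  qed
  have "int p * qnorm \<gamma> = int p * int p ^ n" using Suc.prems(2) bg gens_norm[OF bg(1)] by simp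
  then have ng: "qnorm \<gamma> = int p ^ n" using p_gt_2 by simp
  have pg: "\<not> qdvd (int p) \<gamma>" using Suc.prems(3) bg(2) qdvd_mul(2) by blast
  have og: "oddq \<gamma>" using oddq_cancel_left[OF bg(1)] Suc.prems(1) bg(2) by simp
  obtain vs where vs: "vs \<in> words p n" "\<gamma> = qprod vs \<or> \<gamma> = qscale (-1) (qprod vs)" using Suc.IH[OF og ng pg] by blast
  have "\<beta> # vs \<in> words p (Suc n)"
  proof -
    have "hd vs \<noteq> qconj \<beta>" if ne: "vs \<noteq> []"
    proof
      assume h: "hd vs = qconj \<beta>"
      obtain vs' where v: "vs = qconj \<beta> # vs'" using ne h by (cases vs) auto
      have "qmul \<beta> (qprod vs) = qscale (int p) (qprod vs')"
        unfolding v qprod_simps using bg(1) by (simp only: qmul_assoc[symmetric] qmul_conj gens_norm qmul_scale qmul_one)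
      then have "x = qscale (int p) (qprod vs') \<or> x = qscale (int p) (qscale (-1) (qprod vs'))"
        using vs(2) unfolding bg(2) by (elim disjE) (simp_all only: qscale_minus_mul qscale_scale mult.commute simp_thms)
      then have "qdvd (int p) x" unfolding qdvd_def by blast
      then show False using Suc.prems(3) by simp
    qed
    then show ?thesis using vs(1) bg(1) by (auto simp: words_def successively_Cons)
  qed
  moreover have "x = qprod (\<beta> # vs) \<or> x = qscale (-1) (qprod (\<beta> # vs))"
    using bg(2) vs(2) by (auto simp: qscale_minus_mul simp del: qscale.simps)
  ultimately show ?case by blast
qed

text \<open>The \<open>p+1\<close> isotropic vectors \<open>(1+tj)(1+ei)\<close> and \<open>j(1+ei)\<close>, where \<open>e^2 = -1\<close> modulo \<open>p\<close>,
  generate pairwise different right ideals modulo \<open>p\<close>.\<close>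
lemma card_gens_ge: "card (gens p) \<ge> p + 1"
proof -
  have "Legendre (-1) (int p) = 1" using Legendre_minus_one[OF p(1) p_gt_2] p(2) by simp
  then obtain e where "[e\<^sup>2 = -1] (mod int p)" by (auto simp: Legendre_def QuadRes_def split: if_splits)
  then have e: "int p dvd e\<^sup>2 + 1" by (simp add: cong_iff_dvd_diff)
  define v :: "nat \<Rightarrow> quat" where "v t = (if t < p then (1, e, int t, - int t * e) else (0, 0, 1, - e))" for t :: nat
  have nv: "int p dvd qnorm (v t)" for t
  proof -
    have "qnorm (v t) = (e\<^sup>2 + 1) * (if t < p then 1 + int t ^ 2 else 1)"
      by (simp add: v_def algebra_simps power_mult_distrib)
    then show ?thesis using e by simp
  qed
  have pv: "\<not> qdvd (int p) (v t)" for t using p_gt_2 by (auto simp: v_def qdvd_iff)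
  have "\<exists>\<beta>. \<beta> \<in> gens p \<and> (\<exists>\<gamma>. v t = qmul \<beta> \<gamma>)" for t
    using gens_left_divisor[OF nv pv] by metis
  then obtain f where f: "\<And>t. f t \<in> gens p" "\<And>t. \<exists>\<gamma>. v t = qmul (f t) \<gamma>" by metis
  have "inj_on f {..p}"
  proof (rule inj_onI, rule ccontr)
    fix s t assume st: "s \<in> {..p}" "t \<in> {..p}" "f s = f t" "s \<noteq> t"
    \<comment> \<open>A common left factor of \<open>v s\<close> and \<open>v t\<close> makes
      \<open>p\<close> divide the conjugate of \<open>v s\<close> times \<open>v t\<close>. The
      \<open>j\<close> coordinate of this product is \<open>1 - e^2\<close>, which is 2 modulo
      \<open>p\<close>, times a number prime to \<open>p\<close> when
      \<open>s \<noteq> t\<close>.\<close>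
    obtain g h where gh: "v s = qmul (f s) g" "v t = qmul (f s) h" using f(2) st(3) by metis
    have "qmul (qconj (v s)) (v t) = qmul (qconj g) (qmul (qmul (qconj (f s)) (f s)) h)"
      unfolding gh qconj_mul by (simp only: qmul_assoc)
    also have "\<dots> = qscale (int p) (qmul (qconj g) h)"
      using gens_norm[OF f(1)[of s]] by (simp only: qmul_conj qmul_scale qmul_one)
    finally have "qdvd (int p) (qmul (qconj (v s)) (v t))" unfolding qdvd_def by blast
    then have "int p dvd qj (qmul (qconj (v s)) (v t))"
      by (cases "qmul (qconj (v s)) (v t)" rule: prod_cases4) (simp add: qdvd_iff)
    moreover have "qj (qmul (qconj (v s)) (v t)) = (1 - e\<^sup>2) * (if s < p then (if t < p then int t - int s else 1) else (if t < p then -1 else 0))"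
      by (simp add: v_def algebra_simps power2_eq_square)
    moreover have "\<not> int p dvd 1 - e\<^sup>2"
    proof
      assume "int p dvd 1 - e\<^sup>2"
      then have "int p dvd (1 - e\<^sup>2) + (e\<^sup>2 + 1)" using e by (rule dvd_add)
      then show False using p_gt_2 by (auto dest: zdvd_imp_le)
    qed
    ultimately have "int p dvd (if s < p then (if t < p then int t - int s else 1) else (if t < p then -1 else 0))"
      using prime_dvd_multD[OF p_int(1)] by metis
    then show False using st p_gt_2 dvd_imp_le_int[of "int t - int s" "int p"] by (auto split: if_splits)
  qed
  then have "card (f ` {..p}) = p + 1" by (simp add: card_image)
  moreover have "card (f ` {..p}) \<le> card (gens p)" using f(1) by (intro card_mono finite_gens) auto
  ultimately show ?thesis by simp
qed

end

section \<open>The Cayley graph\<close>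

lemma L2_iff: "x \<in> L2 p \<longleftrightarrow> oddq x \<and> (\<exists>m. qnorm x = int p ^ m)"
  by (auto simp: L2_def oddq_def)

lemma L2_mul: "x \<in> L2 p \<Longrightarrow> y \<in> L2 p \<Longrightarrow> qmul x y \<in> L2 p"
  unfolding L2_iff by (metis oddq_mul power_add qnorm_mul)
lemma L2_conj: "x \<in> L2 p \<Longrightarrow> qconj x \<in> L2 p"
  unfolding L2_iff by simp
lemma L2_one: "qone \<in> L2 p"
  unfolding L2_iff by (simp add: exI[of _ 0])
lemma gens_L2: "x \<in> gens p \<Longrightarrow> x \<in> L2 p"
  unfolding L2_iff using gens_oddq gens_norm by (metis power_one_right)
lemma qprod_L2: "set ws \<subseteq> gens p \<Longrightarrow> qprod ws \<in> L2 p"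
  unfolding L2_iff using gens_list_norm gens_list_oddq by blast

lemma lam_equiv_alt: "lam_equiv p x y \<longleftrightarrow> (\<exists>a b s. s \<in> {1,-1} \<and> qscale (int p ^ a) x = qscale (s * int p ^ b) y)"
  unfolding lam_equiv_def by (metis insert_iff mult_1 mult_minus1 singletonD)

lemma lam_equiv_refl: "lam_equiv p x x"
  unfolding lam_equiv_def by blast

lemma lam_equiv_sym: "lam_equiv p x y \<Longrightarrow> lam_equiv p y x"
proof -
  assume "lam_equiv p x y"
  then obtain a b s where s: "s \<in> {1,-1}" "qscale (int p ^ a) x = qscale (s * int p ^ b) y" unfolding lam_equiv_alt by blast
  then have "qscale s (qscale (int p ^ a) x) = qscale s (qscale (s * int p ^ b) y)" by (simp only:)
  then have "qscale (s * int p ^ a) x = qscale (int p ^ b) y" using s(1) by auto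
  then show ?thesis using s(1) unfolding lam_equiv_alt by metis
qed

lemma lam_equiv_trans: "lam_equiv p x y \<Longrightarrow> lam_equiv p y z \<Longrightarrow> lam_equiv p x z"
proof -
  assume "lam_equiv p x y" "lam_equiv p y z"
  then obtain a b s c d t where
    s: "s \<in> {1,-1}" "qscale (int p ^ a) x = qscale (s * int p ^ b) y" and
    t: "t \<in> {1,-1}" "qscale (int p ^ c) y = qscale (t * int p ^ d) z" unfolding lam_equiv_alt by blast
  have "qscale (int p ^ (c + a)) x = qscale (int p ^ c) (qscale (int p ^ a) x)" by (simp only: qscale_scale power_add)
  also have "\<dots> = qscale (s * int p ^ b) (qscale (int p ^ c) y)" unfolding s(2) by (simp only: qscale_scale mult.commute)
  also have "\<dots> = qscale ((s * t) * int p ^ (b + d)) z" unfolding t(2) by (simp only: qscale_scale power_add mult.assoc mult.left_commute)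
  finally show ?thesis using s(1) t(1) unfolding lam_equiv_alt by fastforce
qed

lemma lam_equiv_mul: "lam_equiv p x x' \<Longrightarrow> lam_equiv p y y' \<Longrightarrow> lam_equiv p (qmul x y) (qmul x' y')"
proof -
  assume "lam_equiv p x x'" "lam_equiv p y y'"
  then obtain a b s c d t where
    s: "s \<in> {1,-1}" "qscale (int p ^ a) x = qscale (s * int p ^ b) x'" and
    t: "t \<in> {1,-1}" "qscale (int p ^ c) y = qscale (t * int p ^ d) y'" unfolding lam_equiv_alt by blast
  have "qscale (int p ^ (a + c)) (qmul x y) = qmul (qscale (int p ^ a) x) (qscale (int p ^ c) y)"
    by (simp only: qmul_scale qscale_scale power_add mult.commute)
  also have "\<dots> = qscale ((s * t) * int p ^ (b + d)) (qmul x' y')"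
    unfolding s t by (simp only: qmul_scale qscale_scale power_add mult.assoc mult.left_commute mult.commute)
  finally show ?thesis using s(1) t(1) unfolding lam_equiv_alt by fastforce
qed

lemma lam_class_self: "x \<in> L2 p \<Longrightarrow> x \<in> lam_class p x"
  by (simp add: lam_class_def lam_equiv_refl)

lemma lam_class_eqI: "lam_equiv p x y \<Longrightarrow> lam_class p x = lam_class p y"
  unfolding lam_class_def using lam_equiv_sym lam_equiv_trans by blast

lemma lam_equiv_scale: "lam_equiv p (qscale (int p ^ m) x) x"
  unfolding lam_equiv_def by (rule exI[of _ 0], rule exI[of _ m]) (simp del: qscale.simps)

lemma Lambda2_simps: "carrier (Lambda2 p) = lam_class p ` L2 p" "\<one>\<^bsub>Lambda2 p\<^esub> = lam_class p qone"
  by (simp_all add: Lambda2_def)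

lemma Lambda2_mult:
  assumes "x \<in> L2 p" "y \<in> L2 p"
  shows "lam_class p x \<otimes>\<^bsub>Lambda2 p\<^esub> lam_class p y = lam_class p (qmul x y)"
proof -
  have r: "lam_equiv p x (SOME z. z \<in> lam_class p x)" if "x \<in> L2 p" for x
    using someI[of "\<lambda>z. z \<in> lam_class p x", OF lam_class_self[OF that]] by (simp add: lam_class_def)
  have "lam_equiv p (qmul x y) (qmul (SOME z. z \<in> lam_class p x) (SOME z. z \<in> lam_class p y))"
    by (intro lam_equiv_mul r assms)
  then show ?thesis unfolding Lambda2_def using lam_class_eqI by fastforce
qed

lemma lam_class_conj_mul:
  assumes "x \<in> L2 p" shows "lam_class p (qmul (qconj x) x) = lam_class p qone" "lam_class p (qmul x (qconj x)) = lam_class p qone"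
proof -
  obtain m where "qnorm x = int p ^ m" using assms by (auto simp: L2_iff)
  then show "lam_class p (qmul (qconj x) x) = lam_class p qone" "lam_class p (qmul x (qconj x)) = lam_class p qone"
    unfolding qmul_conj using lam_class_eqI[OF lam_equiv_scale] by metis+
qed

lemma group_Lambda2: "group (Lambda2 p)"
proof (rule groupI)
  fix x y assume "x \<in> carrier (Lambda2 p)" "y \<in> carrier (Lambda2 p)"
  then show "x \<otimes>\<^bsub>Lambda2 p\<^esub> y \<in> carrier (Lambda2 p)"
    unfolding Lambda2_simps by (elim imageE) (simp only: Lambda2_mult L2_mul imageI)
next
  show "\<one>\<^bsub>Lambda2 p\<^esub> \<in> carrier (Lambda2 p)" unfolding Lambda2_simps by (rule imageI[OF L2_one])
next
  fix x y z assume "x \<in> carrier (Lambda2 p)" "y \<in> carrier (Lambda2 p)" "z \<in> carrier (Lambda2 p)"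
  then show "x \<otimes>\<^bsub>Lambda2 p\<^esub> y \<otimes>\<^bsub>Lambda2 p\<^esub> z = x \<otimes>\<^bsub>Lambda2 p\<^esub> (y \<otimes>\<^bsub>Lambda2 p\<^esub> z)"
    unfolding Lambda2_simps by (elim imageE) (simp only: Lambda2_mult L2_mul qmul_assoc)
next
  fix x assume "x \<in> carrier (Lambda2 p)"
  then show "\<one>\<^bsub>Lambda2 p\<^esub> \<otimes>\<^bsub>Lambda2 p\<^esub> x = x"
    unfolding Lambda2_simps by (elim imageE) (simp only: Lambda2_mult L2_one qmul_one)
next
  fix x assume "x \<in> carrier (Lambda2 p)"
  then obtain y where y: "y \<in> L2 p" "x = lam_class p y" unfolding Lambda2_simps by blast
  show "\<exists>y\<in>carrier (Lambda2 p). y \<otimes>\<^bsub>Lambda2 p\<^esub> x = \<one>\<^bsub>Lambda2 p\<^esub>"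
  proof (rule bexI)
    show "lam_class p (qconj y) \<otimes>\<^bsub>Lambda2 p\<^esub> x = \<one>\<^bsub>Lambda2 p\<^esub>"
      unfolding y(2) Lambda2_simps using y(1) by (simp only: Lambda2_mult L2_conj lam_class_conj_mul)
    show "lam_class p (qconj y) \<in> carrier (Lambda2 p)" unfolding Lambda2_simps using y(1) L2_conj by blast
  qed
qed

lemma Lambda2_inv: "x \<in> L2 p \<Longrightarrow> inv\<^bsub>Lambda2 p\<^esub> (lam_class p x) = lam_class p (qconj x)"
proof (rule group.inv_equality[OF group_Lambda2])
  assume x: "x \<in> L2 p"
  show "lam_class p (qconj x) \<otimes>\<^bsub>Lambda2 p\<^esub> lam_class p x = \<one>\<^bsub>Lambda2 p\<^esub>"
    unfolding Lambda2_simps using x by (simp only: Lambda2_mult L2_conj lam_class_conj_mul)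
qed (auto simp: Lambda2_simps L2_conj)

definition scalar_mod :: "int \<Rightarrow> quat \<Rightarrow> bool" where
  "scalar_mod c x \<longleftrightarrow> c dvd qi x \<and> c dvd qj x \<and> c dvd qk x"

lemma scalar_mod_simp: "scalar_mod c (x0,x1,x2,x3) \<longleftrightarrow> c dvd x1 \<and> c dvd x2 \<and> c dvd x3"
  by (simp add: scalar_mod_def)

lemma scalar_mod_mul: "scalar_mod c x \<Longrightarrow> scalar_mod c y \<Longrightarrow> scalar_mod c (qmul x y)"
  by (cases x rule: prod_cases4, cases y rule: prod_cases4) (simp add: scalar_mod_simp)
lemma scalar_mod_conj: "scalar_mod c x \<Longrightarrow> scalar_mod c (qconj x)"
  by (cases x rule: prod_cases4) (simp add: scalar_mod_simp)
lemma scalar_mod_one: "scalar_mod c (qscale k qone)" by (simp add: scalar_mod_simp)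

text \<open>Conjugation multiplies the scalar part by the norm of \<open>x\<close> and acts linearly
  on the rest; for \<open>c = 2 q\<close> this is the normality of
  \<open>\<Lambda>(2q)\<close>.\<close>

lemma scalar_mod_conjugate: "scalar_mod c z \<Longrightarrow> scalar_mod c (qmul (qmul x z) (qconj x))"
proof -
  assume "scalar_mod c z"
  then obtain z0 v1 v2 v3 where "z = (z0, c * v1, c * v2, c * v3)"
    by (cases z rule: prod_cases4) (auto simp: scalar_mod_simp elim!: dvdE)
  then have z: "z = qadd (qscale z0 qone) (qscale c (0, v1, v2, v3))" by simp
  have "qmul (qmul x z) (qconj x) = qadd (qscale (z0 * qnorm x) qone) (qscale c (qmul (qmul x (0,v1,v2,v3)) (qconj x)))"
    unfolding z by (simp only: qmul_add qmul_scale qmul_one qmul_conj qscale_scale)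
  then show ?thesis by (cases "qmul (qmul x (0,v1,v2,v3)) (qconj x)" rule: prod_cases4) (simp add: scalar_mod_simp)
qed

lemma scalar_mod_scale: "coprime k c \<Longrightarrow> scalar_mod c (qscale k x) \<longleftrightarrow> scalar_mod c x"
  by (cases x rule: prod_cases4) (simp add: scalar_mod_simp coprime_dvd_mult_right_iff coprime_commute)

lemma scalar_mod_conjugate_iff:
  assumes "coprime (qnorm x) c"
  shows "scalar_mod c (qmul (qmul x z) (qconj x)) \<longleftrightarrow> scalar_mod c z"
proof
  assume "scalar_mod c (qmul (qmul x z) (qconj x))"
  then have "scalar_mod c (qmul (qmul (qconj x) (qmul (qmul x z) (qconj x))) (qconj (qconj x)))"
    by (rule scalar_mod_conjugate)
  also have "qmul (qmul (qconj x) (qmul (qmul x z) (qconj x))) (qconj (qconj x)) = qmul (qmul (qmul (qconj x) x) z) (qmul (qconj x) x)"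
    by (simp only: qmul_assoc qconj_qconj)
  also have "\<dots> = qscale (qnorm x * qnorm x) z" by (simp only: qmul_conj qmul_scale qmul_one qscale_scale)
  finally show "scalar_mod c z" using assms by (simp add: scalar_mod_scale)
qed (rule scalar_mod_conjugate)

lemma Sgen_eq: "Sgen p = lam_class p ` gens p"
  by (simp add: Sgen_def gens_def)

definition vert :: "nat \<Rightarrow> nat \<Rightarrow> quat \<Rightarrow> quat set set" where
  "vert p q x = Lambda2q p q #>\<^bsub>Lambda2 p\<^esub> lam_class p x"

context
  fixes p q :: nat
  assumes cop: "coprime p (2 * q)"
begin

lemma cop_pow: "coprime (int p ^ m) (2 * int q)"
  using cop by (metis coprime_int_iff coprime_power_left_iff of_nat_mult of_nat_numeral)

text \<open>Powers of \<open>p\<close> are invertible modulo \<open>2 q\<close>, so membership in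
  \<open>\<Lambda>(2q)\<close>, which is defined through some representative, can be tested on
  any.\<close>

lemma scalar_mod_equiv: "lam_equiv p x y \<Longrightarrow> scalar_mod (2 * int q) y \<Longrightarrow> scalar_mod (2 * int q) x"
proof -
  assume "lam_equiv p x y" and y: "scalar_mod (2 * int q) y"
  then obtain a b s where s: "s \<in> {1,-1}" "qscale (int p ^ a) x = qscale (s * int p ^ b) y" unfolding lam_equiv_alt by blast
  have "coprime (s * int p ^ b) (2 * int q)" using s(1) cop_pow by auto
  then have "scalar_mod (2 * int q) (qscale (int p ^ a) x)" unfolding s(2) using y scalar_mod_scale by blast
  then show ?thesis using scalar_mod_scale[OF cop_pow] by blast
qed

lemma Lambda2q_iff: "x \<in> L2 p \<Longrightarrow> lam_class p x \<in> Lambda2q p q \<longleftrightarrow> scalar_mod (2 * int q) x"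
proof
  assume x: "x \<in> L2 p" and "lam_class p x \<in> Lambda2q p q"
  then obtain y where "y \<in> lam_class p x" "scalar_mod (2 * int q) y" unfolding Lambda2q_def scalar_mod_def by blast
  then show "scalar_mod (2 * int q) x" using scalar_mod_equiv unfolding lam_class_def by blast
next
  assume x: "x \<in> L2 p" and s: "scalar_mod (2 * int q) x"
  have "lam_class p x \<in> carrier (Lambda2 p)" unfolding Lambda2_simps using x by (rule imageI)
  then show "lam_class p x \<in> Lambda2q p q"
    using lam_class_self[OF x] s unfolding Lambda2q_def scalar_mod_def by blast
qed

lemma Lambda2q_subset: "Lambda2q p q \<subseteq> carrier (Lambda2 p)" by (auto simp: Lambda2q_def)

lemma Lambda2q_obtain:
  assumes "A \<in> Lambda2q p q"
  obtains x where "x \<in> L2 p" "A = lam_class p x" "scalar_mod (2 * int q) x"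
proof -
  obtain x where x: "x \<in> L2 p" "A = lam_class p x" using assms Lambda2q_subset unfolding Lambda2_simps by blast
  then show ?thesis using that assms Lambda2q_iff by blast
qed

lemma subgroup_Lambda2q: "subgroup (Lambda2q p q) (Lambda2 p)"
proof (rule group.subgroupI[OF group_Lambda2])
  show "Lambda2q p q \<subseteq> carrier (Lambda2 p)" by (rule Lambda2q_subset)
  have "lam_class p qone \<in> Lambda2q p q" using Lambda2q_iff[OF L2_one] by (simp add: scalar_mod_simp)
  then show "Lambda2q p q \<noteq> {}" by blast
next
  fix a assume "a \<in> Lambda2q p q"
  then obtain x where x: "x \<in> L2 p" "a = lam_class p x" "scalar_mod (2 * int q) x" by (rule Lambda2q_obtain)
  show "inv\<^bsub>Lambda2 p\<^esub> a \<in> Lambda2q p q"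
    unfolding x(2) Lambda2_inv[OF x(1)] using Lambda2q_iff[OF L2_conj[OF x(1)]] scalar_mod_conj[OF x(3)] by blast
next
  fix a b assume "a \<in> Lambda2q p q" "b \<in> Lambda2q p q"
  then obtain x y where xy: "x \<in> L2 p" "a = lam_class p x" "scalar_mod (2 * int q) x"
    "y \<in> L2 p" "b = lam_class p y" "scalar_mod (2 * int q) y" by (metis Lambda2q_obtain)
  show "a \<otimes>\<^bsub>Lambda2 p\<^esub> b \<in> Lambda2q p q"
    unfolding xy(2,5) Lambda2_mult[OF xy(1,4)] using Lambda2q_iff[OF L2_mul[OF xy(1,4)]] scalar_mod_mul[OF xy(3,6)] by blast
qed

lemma XV_eq: "XV p q = vert p q ` L2 p"
  unfolding XV_def RCOSETS_def vert_def Lambda2_simps by blast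

lemma vert_eq_iff:
  assumes "x \<in> L2 p" "y \<in> L2 p"
  shows "vert p q x = vert p q y \<longleftrightarrow> scalar_mod (2 * int q) (qmul x (qconj y))"
proof -
  interpret group "Lambda2 p" by (rule group_Lambda2)
  interpret H: subgroup "Lambda2q p q" "Lambda2 p" by (rule subgroup_Lambda2q)
  have c: "lam_class p x \<in> carrier (Lambda2 p)" "lam_class p y \<in> carrier (Lambda2 p)"
    unfolding Lambda2_simps using assms by blast+
  have "vert p q x = vert p q y \<longleftrightarrow> lam_class p x \<in> Lambda2q p q #>\<^bsub>Lambda2 p\<^esub> lam_class p y"
    unfolding vert_def using repr_independence[OF _ c(2) subgroup_Lambda2q] rcos_self[OF c(1) subgroup_Lambda2q] by metis
  also have "\<dots> \<longleftrightarrow> lam_class p x \<otimes>\<^bsub>Lambda2 p\<^esub> inv\<^bsub>Lambda2 p\<^esub> lam_class p y \<in> Lambda2q p q"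
    by (rule H.rcos_module[OF is_group c(2,1)])
  also have "\<dots> \<longleftrightarrow> scalar_mod (2 * int q) (qmul x (qconj y))"
    using assms by (simp only: Lambda2_inv Lambda2_mult L2_conj Lambda2q_iff L2_mul)
  finally show ?thesis .
qed

lemma vert_mul_right:
  assumes "x \<in> L2 p" "y \<in> L2 p" "z \<in> L2 p"
  shows "vert p q (qmul x z) = vert p q (qmul y z) \<longleftrightarrow> vert p q x = vert p q y"
proof -
  obtain m where m: "qnorm z = int p ^ m" using assms(3) by (auto simp: L2_iff)
  have "qmul (qmul x z) (qconj (qmul y z)) = qmul (qmul x (qmul z (qconj z))) (qconj y)" by (simp only: qconj_mul qmul_assoc)
  also have "\<dots> = qscale (int p ^ m) (qmul x (qconj y))" by (simp only: qmul_conj m qmul_scale qmul_one)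
  finally show ?thesis using assms by (simp only: vert_eq_iff L2_mul scalar_mod_scale[OF cop_pow])
qed

text \<open>Vertices are right cosets, so invariance under multiplication from the left rests on
  normality; it enters through \<open>scalar_mod_conjugate_iff\<close>.\<close>

lemma vert_mul_left:
  assumes "x \<in> L2 p" "y \<in> L2 p" "z \<in> L2 p"
  shows "vert p q (qmul z x) = vert p q (qmul z y) \<longleftrightarrow> vert p q x = vert p q y"
proof -
  obtain m where m: "qnorm z = int p ^ m" using assms(3) by (auto simp: L2_iff)
  have "qmul (qmul z x) (qconj (qmul z y)) = qmul (qmul z (qmul x (qconj y))) (qconj z)" by (simp only: qconj_mul qmul_assoc)
  then show ?thesis using assms cop_pow m by (simp only: vert_eq_iff L2_mul scalar_mod_conjugate_iff)
qed

lemma XE_vert_iff: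
  assumes "x \<in> L2 p"
  shows "XE p q (vert p q x) D \<longleftrightarrow> (\<exists>\<beta>\<in>gens p. D = vert p q (qmul x \<beta>))"
proof
  assume "XE p q (vert p q x) D"
  then obtain y \<beta> where yb: "y \<in> L2 p" "\<beta> \<in> gens p" "vert p q x = vert p q y" "D = vert p q (qmul y \<beta>)"
    unfolding XE_def Sgen_eq Lambda2_simps vert_def using Lambda2_mult gens_L2 by fastforce
  have "vert p q (qmul x \<beta>) = vert p q (qmul y \<beta>)" using vert_mul_right assms yb gens_L2 by blast
  then show "\<exists>\<beta>\<in>gens p. D = vert p q (qmul x \<beta>)" using yb by metis
next
  assume "\<exists>\<beta>\<in>gens p. D = vert p q (qmul x \<beta>)"
  then obtain \<beta> where b: "\<beta> \<in> gens p" "D = vert p q (qmul x \<beta>)" by blast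
  show "XE p q (vert p q x) D"
    unfolding XE_def Sgen_eq Lambda2_simps
  proof (rule bexI[of _ "lam_class p x"], rule bexI[of _ "lam_class p \<beta>"], intro conjI)
    show "vert p q x = Lambda2q p q #>\<^bsub>Lambda2 p\<^esub> lam_class p x" by (rule vert_def)
    show "D = Lambda2q p q #>\<^bsub>Lambda2 p\<^esub> (lam_class p x \<otimes>\<^bsub>Lambda2 p\<^esub> lam_class p \<beta>)"
      unfolding b(2) vert_def Lambda2_mult[OF assms gens_L2[OF b(1)]] ..
  qed (use b assms in auto)
qed

end

section \<open>Closed words and walks in the graph\<close>

definition closed_words :: "nat \<Rightarrow> nat \<Rightarrow> nat \<Rightarrow> quat list set" where
  "closed_words p q n = {ws \<in> words p n. scalar_mod (2 * int q) (qprod ws)}"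

definition path_of :: "nat \<Rightarrow> nat \<Rightarrow> quat \<Rightarrow> quat list \<Rightarrow> quat set set list" where
  "path_of p q x ws = map (\<lambda>i. vert p q (qmul x (qprod (take i ws)))) [0..<Suc (length ws)]"

lemma length_path_of [simp]: "length (path_of p q x ws) = Suc (length ws)"
  by (simp add: path_of_def)
lemma path_of_nth: "i \<le> length ws \<Longrightarrow> path_of p q x ws ! i = vert p q (qmul x (qprod (take i ws)))"
  unfolding path_of_def by (subst nth_map) (auto simp del: upt_Suc)

lemma take_Suc_qprod: "i < length ws \<Longrightarrow> qprod (take (Suc i) ws) = qmul (qprod (take i ws)) (ws ! i)"
  by (simp add: take_Suc_conv_app_nth qprod_append)

lemma words_take: "ws \<in> words p n \<Longrightarrow> i \<le> n \<Longrightarrow> take i ws \<in> words p i"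
  unfolding words_def successively_conv_nth by (auto dest: in_set_takeD)

lemma words_drop: "ws \<in> words p n \<Longrightarrow> drop i ws \<in> words p (n - i)"
  unfolding words_def successively_conv_nth by (auto dest: in_set_dropD simp: add.commute)

text \<open>The condition \<open>p < q\<close> makes distinct generators lead to distinct
  neighbours, since a nontrivial closed word of length 2 would need \<open>q^2 < p\<close>. It is
  met by all large \<open>q\<close>, which is the range of both assertions.\<close>

locale lps_graph =
  fixes p q :: nat
  assumes p: "prime p" "p mod 4 = 1" and q: "prime q" "q mod 4 = 1" and leg: "Legendre (int p) (int q) = -1"
    and qp: "p < q"
begin

lemma q_gt_2: "q > 2" using q prime_gt_1_nat[OF q(1)] by (cases "q = 2") auto
lemma q_odd: "odd q" using q(2) by presburger
lemma cop: "coprime p (2 * q)"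
proof -
  have "coprime p q" using p(1) q(1) qp by (simp add: primes_coprime)
  moreover have "coprime p 2" using p_odd[OF p] by simp
  ultimately show ?thesis by simp
qed

abbreviation "V \<equiv> XV p q"
abbreviation "E \<equiv> XE p q"
abbreviation "vt \<equiv> vert p q"
abbreviation "Kq \<equiv> scalar_mod (2 * int q)"
abbreviation "Wq \<equiv> closed_words p q"

lemma vt_eq: "x \<in> L2 p \<Longrightarrow> y \<in> L2 p \<Longrightarrow> vt x = vt y \<longleftrightarrow> Kq (qmul x (qconj y))"
  by (rule vert_eq_iff[OF cop])

lemma vt_mul_scalar:
  assumes "x \<in> L2 p" "z \<in> L2 p"
  shows "vt (qmul x z) = vt x \<longleftrightarrow> Kq z"
proof -
  have "vt (qmul x z) = vt (qmul x qone) \<longleftrightarrow> vt z = vt qone"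
    by (rule vert_mul_left[OF cop assms(2) L2_one assms(1)])
  then show ?thesis using vt_eq[OF assms(2) L2_one] by simp
qed

lemma words_L2: "ws \<in> words p n \<Longrightarrow> qprod ws \<in> L2 p"
  by (auto simp: words_def qprod_L2)

lemma words_take_L2: "ws \<in> words p n \<Longrightarrow> qprod (take i ws) \<in> L2 p"
  by (rule qprod_L2) (auto simp: words_def dest: in_set_takeD)

lemma finite_closed_words: "finite (Wq n)"
  unfolding closed_words_def using finite_words[of p n] by simp

lemma words_nonscalar:
  assumes "ws \<in> words p n" "n \<ge> 1"
  shows "\<not> (qi (qprod ws) = 0 \<and> qj (qprod ws) = 0 \<and> qk (qprod ws) = 0)"
proof
  assume z: "qi (qprod ws) = 0 \<and> qj (qprod ws) = 0 \<and> qk (qprod ws) = 0"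
  obtain a b c d where f: "qprod ws = (a,b,c,d)" by (cases "qprod ws" rule: prod_cases4)
  have "qnorm (qprod ws) = int p ^ n" using gens_list_norm assms(1) by (auto simp: words_def)
  then have "a\<^sup>2 = int p ^ n" using z f by simp
  then have "int p dvd a\<^sup>2" using assms(2) by (simp add: dvd_power)
  then have "int p dvd a" using p(1) by (simp add: prime_dvd_power_iff)
  then have "qdvd (int p) (qprod ws)" using z f by (simp add: qdvd_iff)
  then show False using words_primitive[OF p assms(1)] by simp
qed

text \<open>Hypotheses \<open>q^2 | (P-x)(P+x)\<close> and parity locate \<open>x\<close> as \<open>\<plusminus>(P - 2 q^2 r)\<close>.\<close>
lemma scalar_norm_structure:
  assumes "odd x0" and n: "x0\<^sup>2 + (2 * int q)\<^sup>2 * s = P\<^sup>2" and s: "s > 0" and P: "P > 0" "odd P" "\<not> int q dvd P"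
  shows "\<exists>r. r \<ge> 1 \<and> r * (int q)\<^sup>2 < P \<and> s = r * (P - (int q)\<^sup>2 * r)"
proof -
  have q0: "int q > 0" using q_gt_2 by simp
  have pq: "prime (int q)" using q by simp
  have key: "\<exists>r. r \<ge> 1 \<and> r * (int q)\<^sup>2 < P \<and> s = r * (P - (int q)\<^sup>2 * r)"
    if x: "(int q)\<^sup>2 dvd P - x" "odd x" "x\<^sup>2 + (2 * int q)\<^sup>2 * s = P\<^sup>2" for x
  proof -
    have "even (P - x)" using x(2) P(2) by simp
    moreover have "coprime 2 ((int q)\<^sup>2)" using q_odd by simp
    ultimately have "2 * (int q)\<^sup>2 dvd P - x" using x(1) by (intro divides_mult)
    then obtain r where r: "P - x = 2 * (int q)\<^sup>2 * r" by blast
    have prod: "(P - x) * (P + x) = 4 * (int q)\<^sup>2 * s" using x(3) by (simp add: power2_eq_square algebra_simps)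
    have "x\<^sup>2 < P\<^sup>2" using x(3) s q0 by (smt (verit) mult_pos_pos zero_less_power)
    then have "\<bar>x\<bar> < P" using P(1) by (metis abs_le_square_iff abs_of_pos linorder_not_le)
    then have lt: "P - x > 0" "P + x > 0" by auto
    have "r > 0" using lt(1) q0 unfolding r by (simp add: zero_less_mult_iff)
    moreover have "P + x = 2 * (P - (int q)\<^sup>2 * r)" using r by simp
    moreover from this have "(int q)\<^sup>2 * r < P" using lt(2) by simp
    moreover have "4 * (int q)\<^sup>2 * s = 4 * (int q)\<^sup>2 * (r * (P - (int q)\<^sup>2 * r))"
    proof -
      have "4 * (int q)\<^sup>2 * s = (2 * (int q)\<^sup>2 * r) * (2 * (P - (int q)\<^sup>2 * r))"
        using prod r \<open>P + x = 2 * (P - (int q)\<^sup>2 * r)\<close> by metis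
      then show ?thesis by (simp add: algebra_simps)
    qed
    then have "s = r * (P - (int q)\<^sup>2 * r)" using q0 by simp
    ultimately show ?thesis by (intro exI[of _ r]) (auto simp: mult.commute)
  qed
  have prod: "(P - x0) * (P + x0) = (int q)\<^sup>2 * (4 * s)" using n by (simp add: power2_eq_square algebra_simps)
  then have dv: "(int q)\<^sup>2 dvd (P - x0) * (P + x0)" by simp
  show ?thesis
  proof (cases "int q dvd P - x0")
    case True
    \<comment> \<open>The odd prime \<open>q\<close> cannot divide both \<open>P - x0\<close> and
      \<open>P + x0\<close>, as it would divide \<open>2 P\<close>. So \<open>q^2\<close> divides
      one of the two factors, and replacing \<open>x0\<close> by its negative exchanges
      them.\<close>
    have "\<not> int q dvd P + x0"
    proof
      assume "int q dvd P + x0"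
      then have "int q dvd (P - x0) + (P + x0)" using True by (rule dvd_add[rotated])
      then have "int q dvd 2 * P" by simp
      then have "int q dvd 2 \<or> int q dvd P" using pq prime_dvd_multD by blast
      then show False using P(3) q_gt_2 by (auto dest: zdvd_imp_le)
    qed
    then have "coprime ((int q)\<^sup>2) (P + x0)" using prime_imp_coprime[OF pq] by (simp only: coprime_power_left_iff) simp
    then have "(int q)\<^sup>2 dvd P - x0" using dv by (simp add: coprime_dvd_mult_left_iff)
    then show ?thesis by (rule key[OF _ assms(1) n])
  next
    case False
    then have "coprime ((int q)\<^sup>2) (P - x0)" using prime_imp_coprime[OF pq] by (simp only: coprime_power_left_iff) simp
    then have "(int q)\<^sup>2 dvd P - (- x0)" using dv by (simp add: coprime_dvd_mult_right_iff)
    then show ?thesis using key[of "- x0"] assms(1) n by simp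
  qed
qed

lemma q_not_dvd_p_pow: "\<not> int q dvd int p ^ m"
proof
  assume "int q dvd int p ^ m"
  then have "int q dvd int p" using q(1) by (metis prime_dvd_power prime_nat_int_transfer)
  then have "q dvd p" by simp
  then show False using qp p prime_gt_1_nat[OF p(1)] by (auto dest: dvd_imp_le)
qed

text \<open>Modulo \<open>q\<close> the norm is the square of the real part, whereas an odd power of
  the non-residue \<open>p\<close> is not a square.\<close>

lemma closed_words_even:
  assumes "ws \<in> Wq n" "n \<ge> 1"
  obtains m where "n = 2 * m"
proof (rule ccontr)
  assume "\<not> thesis"
  then have "odd n" using that by blast
  then obtain m where m: "n = 2 * m + 1" by (rule oddE)
  have ws: "ws \<in> words p n" "Kq (qprod ws)" using assms by (auto simp: closed_words_def)
  obtain a b c d where f: "qprod ws = (a,b,c,d)" by (cases "qprod ws" rule: prod_cases4)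
  have nrm: "a\<^sup>2 + b\<^sup>2 + c\<^sup>2 + d\<^sup>2 = int p ^ n" using gens_list_norm[of ws p] ws(1) f by (auto simp: words_def)
  have "int q dvd b" "int q dvd c" "int q dvd d" using ws(2) f by (auto simp: scalar_mod_simp dest: dvd_mult_right)
  then have "int q dvd b\<^sup>2 + c\<^sup>2 + d\<^sup>2" by (simp add: power2_eq_square)
  then have "[a\<^sup>2 = int p ^ n] (mod int q)" unfolding nrm[symmetric] cong_iff_dvd_diff
    by (metis (no_types, opaque_lifting) add.assoc add_diff_cancel_left' dvd_diff_commute)
  then have 1: "Legendre (a\<^sup>2) (int q) = Legendre (int p ^ n) (int q)" by (rule Legendre_cong)
  have sq: "Legendre (y\<^sup>2) (int q) = 1 \<or> Legendre (y\<^sup>2) (int q) = 0" for y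
    unfolding power2_eq_square Legendre_mult[OF q(1) q_gt_2] using Legendre_cases[of y "int q"] by auto
  have "Legendre (int p ^ n) (int q) = Legendre ((int p ^ m)\<^sup>2) (int q) * Legendre (int p) (int q)"
    unfolding m by (simp add: Legendre_mult[OF q(1) q_gt_2, symmetric] power_mult power2_eq_square power_add[symmetric] mult.commute mult_2)
  moreover have "Legendre ((int p ^ m)\<^sup>2) (int q) \<noteq> 0"
  proof -
    have "\<not> int q dvd (int p ^ m)\<^sup>2" using q_not_dvd_p_pow[of "m*2"] by (simp add: power_mult)
    then show ?thesis by (simp add: Legendre_def cong_0_iff)
  qed
  ultimately have "Legendre (int p ^ n) (int q) = -1" using sq[of "int p ^ m"] leg by auto
  then show False using 1 sq[of a] by simp
qed

lemma scalar_mod_imag: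
  assumes "Kq x"
  obtains x0 a b c where "x = (x0, 2 * int q * a, 2 * int q * b, 2 * int q * c)"
  using assms by (cases x rule: prod_cases4) (auto simp: scalar_mod_simp elim!: dvdE)

lemma scalar_elem_structure:
  assumes "oddq x" "Kq x" "qnorm x = int p ^ (2 * m)" "x = (x0, 2 * int q * a, 2 * int q * b, 2 * int q * c)" "\<not> (a = 0 \<and> b = 0 \<and> c = 0)"
  shows "\<exists>r. r \<ge> 1 \<and> r * (int q)\<^sup>2 < int p ^ m \<and> a\<^sup>2 + b\<^sup>2 + c\<^sup>2 = r * (int p ^ m - (int q)\<^sup>2 * r)"
proof (rule scalar_norm_structure)
  show "odd x0" using assms(1,4) by (simp add: oddq_simp)
  show "x0\<^sup>2 + (2 * int q)\<^sup>2 * (a\<^sup>2 + b\<^sup>2 + c\<^sup>2) = (int p ^ m)\<^sup>2"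
    using assms(3,4) by (simp add: power_mult_distrib algebra_simps power_mult[symmetric])
  have "a\<^sup>2 + b\<^sup>2 + c\<^sup>2 \<noteq> 0" using assms(5) by (smt (verit) power2_eq_iff_nonneg power_eq_0_iff zero_le_power2)
  then show "a\<^sup>2 + b\<^sup>2 + c\<^sup>2 > 0" by (smt (verit) zero_le_power2)
  show "int p ^ m > 0" "odd (int p ^ m)" using p p_odd[OF p] prime_gt_0_nat by auto
  show "\<not> int q dvd int p ^ m" by (rule q_not_dvd_p_pow)
qed

text \<open>The parameter \<open>r\<close> of a closed word is at least 1, so
  \<open>q^2 \<le> r q^2 < p^m\<close>; this is the lower bound \<open>4 log_p q\<close> for the
  girth.\<close>

lemma closed_words_large:
  assumes "ws \<in> Wq n" "n \<ge> 1"
  obtains m where "n = 2 * m" "q\<^sup>2 < p ^ m"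
proof -
  obtain m where m: "n = 2 * m" using closed_words_even assms by blast
  have ws: "ws \<in> words p n" "Kq (qprod ws)" using assms by (auto simp: closed_words_def)
  obtain x0 a b c where x: "qprod ws = (x0, 2 * int q * a, 2 * int q * b, 2 * int q * c)"
    using scalar_mod_imag[OF ws(2)] by blast
  have ns: "\<not> (a = 0 \<and> b = 0 \<and> c = 0)" using words_nonscalar[OF ws(1) assms(2)] x by auto
  have od: "oddq (qprod ws)" using gens_list_oddq ws(1) by (auto simp: words_def)
  have nm: "qnorm (qprod ws) = int p ^ (2 * m)" using gens_list_norm[of ws p] ws(1) m by (auto simp: words_def)
  obtain r where r: "r \<ge> 1" "r * (int q)\<^sup>2 < int p ^ m" using scalar_elem_structure[OF od ws(2) nm x ns] by blast
  have "1 * (int q)\<^sup>2 \<le> r * (int q)\<^sup>2" using r(1) by (intro mult_right_mono) auto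
  then have "(int q)\<^sup>2 < int p ^ m" using r(2) by linarith
  then have "q\<^sup>2 < p ^ m" by (metis of_nat_less_iff of_nat_power)
  then show ?thesis using that m by blast
qed

lemma no_closed_2: "ws \<in> words p 2 \<Longrightarrow> \<not> Kq (qprod ws)"
proof
  assume "ws \<in> words p 2" "Kq (qprod ws)"
  then have "ws \<in> Wq 2" by (simp add: closed_words_def)
  then obtain m where m: "2 = 2 * m" "q\<^sup>2 < p ^ m" using closed_words_large[of ws 2] by auto
  then have "q\<^sup>2 < p" by simp
  moreover have "q \<le> q\<^sup>2" by (simp add: power2_eq_square)
  ultimately show False using qp by linarith
qed

lemma no_closed_pair: "a \<in> gens p \<Longrightarrow> b \<in> gens p \<Longrightarrow> b \<noteq> qconj a \<Longrightarrow> \<not> Kq (qmul a b)"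
  using no_closed_2[of "[a,b]"] by (simp add: words_def)

lemma vt_gens_inj:
  assumes "x \<in> L2 p" "a \<in> gens p" "b \<in> gens p" "vt (qmul x a) = vt (qmul x b)"
  shows "a = b"
proof -
  have "vt a = vt b" using assms vert_mul_left[OF cop] gens_L2 by blast
  then have "Kq (qmul a (qconj b))" using vt_eq assms gens_L2 by blast
  then have "qconj b = qconj a" using no_closed_pair assms(2,3) gens_conj by blast
  then show ?thesis by (metis qconj_qconj)
qed

text \<open>A fixed representative \<open>x\<close> of the starting vertex turns each edge into a
  generator multiplied on the right, so a walk is spelled by a word that need not be
  reduced.\<close>

lemma walk_lift:
  assumes "us \<noteq> []" "\<And>i. Suc i < length us \<Longrightarrow> E (us ! i) (us ! Suc i)" "hd us = vt x" "x \<in> L2 p"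
  shows "\<exists>bs. set bs \<subseteq> gens p \<and> us = path_of p q x bs"
  using assms
proof (induction us rule: rev_induct)
  case Nil then show ?case by simp
next
  case (snoc u us)
  show ?case
  proof (cases "us = []")
    case True
    then have "[u] = path_of p q x []" using snoc.prems by (simp add: path_of_def)
    then show ?thesis using True by (intro exI[of _ "[]"]) simp
  next
    case False
    have "E (us ! i) (us ! Suc i)" if "Suc i < length us" for i
      using snoc.prems(2)[of i] that by (simp add: nth_append)
    then obtain bs where bs: "set bs \<subseteq> gens p" "us = path_of p q x bs"
      using snoc.IH[OF False] snoc.prems(3,4) False by auto
    have len: "length us = Suc (length bs)" using bs(2) by simp
    have "E (us ! length bs) u" using snoc.prems(2)[of "length bs"] len by (simp add: nth_append)
    moreover have "us ! length bs = vt (qmul x (qprod bs))" unfolding bs(2) by (simp add: path_of_nth)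
    ultimately obtain \<beta> where b: "\<beta> \<in> gens p" "u = vt (qmul (qmul x (qprod bs)) \<beta>)"
      using XE_vert_iff[OF cop L2_mul[OF snoc.prems(4) qprod_L2[OF bs(1)]]] by metis
    have "us @ [u] = path_of p q x (bs @ [\<beta>])"
    proof (rule nth_equalityI)
      fix i assume i: "i < length (us @ [u])"
      show "(us @ [u]) ! i = path_of p q x (bs @ [\<beta>]) ! i"
      proof (cases "i < length us")
        case True
        then show ?thesis using len by (simp add: nth_append path_of_nth bs(2))
      next
        case False
        then have "i = Suc (length bs)" using i len by simp
        then show ?thesis using len b(2) by (simp add: nth_append path_of_nth qprod_append qmul_assoc)
      qed
    qed (use len in simp)
    then show ?thesis using bs(1) b(1) by (intro exI[of _ "bs @ [\<beta>]"]) auto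
  qed
qed

text \<open>Returning after two steps means that the product of the two letters lies in
  \<open>\<Lambda>(2q)\<close>. Two letters that are not inverse would form a closed reduced word of
  length 2, which is too short.\<close>

lemma path_backtrack:
  assumes "set bs \<subseteq> gens p" "x \<in> L2 p" "Suc (Suc i) \<le> length bs"
  shows "path_of p q x bs ! Suc (Suc i) = path_of p q x bs ! i \<longleftrightarrow> bs ! Suc i = qconj (bs ! i)"
proof -
  let ?y = "qmul x (qprod (take i bs))"
  have y: "?y \<in> L2 p" using assms by (intro L2_mul qprod_L2) (auto dest: in_set_takeD)
  have g: "bs ! i \<in> gens p" "bs ! Suc i \<in> gens p" using assms nth_mem by (metis Suc_le_lessD less_imp_le_nat order_less_le_trans subsetD lessI Suc_lessD)+
  have "path_of p q x bs ! Suc (Suc i) = vt (qmul ?y (qmul (bs ! i) (bs ! Suc i)))"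
    using assms by (simp add: path_of_nth take_Suc_qprod qmul_assoc)
  moreover have "path_of p q x bs ! i = vt ?y" using assms by (simp add: path_of_nth)
  ultimately have "path_of p q x bs ! Suc (Suc i) = path_of p q x bs ! i \<longleftrightarrow> Kq (qmul (bs ! i) (bs ! Suc i))"
    using vt_mul_scalar[OF y] g gens_L2 L2_mul by metis
  also have "\<dots> \<longleftrightarrow> bs ! Suc i = qconj (bs ! i)"
  proof
    assume "Kq (qmul (bs ! i) (bs ! Suc i))"
    then show "bs ! Suc i = qconj (bs ! i)" using no_closed_pair g by blast
  next
    assume "bs ! Suc i = qconj (bs ! i)"
    then show "Kq (qmul (bs ! i) (bs ! Suc i))" by (simp only: qmul_conj scalar_mod_one)
  qed
  finally show ?thesis .
qed

lemma path_closed: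
  assumes "set bs \<subseteq> gens p" "x \<in> L2 p"
  shows "path_of p q x bs ! length bs = path_of p q x bs ! 0 \<longleftrightarrow> Kq (qprod bs)"
  using vt_mul_scalar[OF assms(2) qprod_L2[OF assms(1)]] by (simp add: path_of_nth)

lemma path_edge:
  assumes "set bs \<subseteq> gens p" "x \<in> L2 p" "i < length bs"
  shows "E (path_of p q x bs ! i) (path_of p q x bs ! Suc i)"
proof -
  have y: "qmul x (qprod (take i bs)) \<in> L2 p" using assms by (intro L2_mul qprod_L2) (auto dest: in_set_takeD)
  have "bs ! i \<in> gens p" using assms by auto
  then show ?thesis using assms XE_vert_iff[OF cop y] by (auto simp: path_of_nth take_Suc_qprod qmul_assoc)
qed

lemma path_vertices:
  assumes "set bs \<subseteq> gens p" "x \<in> L2 p" "i \<le> length bs"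
  shows "path_of p q x bs ! i \<in> V"
proof -
  have "qmul x (qprod (take i bs)) \<in> L2 p" using assms by (intro L2_mul qprod_L2) (auto dest: in_set_takeD)
  then show ?thesis using assms by (simp add: path_of_nth XV_eq[OF cop])
qed

text \<open>Avoiding backtracking corresponds to a reduced word and closing up to the scalar
  condition modulo \<open>2 q\<close>. As \<open>nb_closed_walk\<close> does not test the base
  point, the words need not be cyclically reduced.\<close>

lemma nb_closed_walk_iff:
  "(\<exists>us. nb_closed_walk V E us \<and> length us = n + 1) \<longleftrightarrow> n \<ge> 1 \<and> Wq n \<noteq> {}"
proof
  assume "\<exists>us. nb_closed_walk V E us \<and> length us = n + 1"
  then obtain us where us: "nb_closed_walk V E us" "length us = n + 1" by blast
  have ne: "us \<noteq> []" using us by auto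
  have "hd us \<in> V" using us ne unfolding nb_closed_walk_def by (meson hd_in_set subsetD)
  then obtain x where x: "x \<in> L2 p" "hd us = vt x" unfolding XV_eq[OF cop] by blast
  have "E (us ! i) (us ! Suc i)" if "Suc i < length us" for i
    using us(1) that by (simp add: nb_closed_walk_def)
  then obtain bs where bs: "set bs \<subseteq> gens p" "us = path_of p q x bs" using walk_lift[OF ne _ x(2,1)] by blast
  have len: "length bs = n" using us(2) bs(2) by simp
  have "n \<ge> 1" using us by (simp add: nb_closed_walk_def)
  moreover have "bs \<in> words p n"
  proof -
    have "bs ! Suc i \<noteq> qconj (bs ! i)" if "Suc i < length bs" for i
    proof -
      have "us ! (i + 2) \<noteq> us ! i" using us that len by (simp add: nb_closed_walk_def)
      then show ?thesis using path_backtrack[OF bs(1) x(1), of i] that bs(2) by simp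
    qed
    then show ?thesis using bs(1) len by (simp add: words_def successively_conv_nth)
  qed
  moreover have "Kq (qprod bs)"
  proof -
    have "us ! 0 = us ! n" using us ne by (simp add: nb_closed_walk_def hd_conv_nth last_conv_nth)
    then show ?thesis using path_closed[OF bs(1) x(1)] bs(2) len by simp
  qed
  ultimately show "n \<ge> 1 \<and> Wq n \<noteq> {}" by (auto simp: closed_words_def)
next
  assume n: "n \<ge> 1 \<and> Wq n \<noteq> {}"
  then obtain bs where bs: "bs \<in> words p n" "Kq (qprod bs)" by (auto simp: closed_words_def)
  have g: "set bs \<subseteq> gens p" and len: "length bs = n" using bs by (auto simp: words_def)
  let ?us = "path_of p q qone bs"
  have "nb_closed_walk V E ?us"
    unfolding nb_closed_walk_def
  proof (intro conjI allI impI)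
    show "length ?us \<ge> 2" using n len by simp
    show "set ?us \<subseteq> V"
    proof
      fix u assume "u \<in> set ?us"
      then obtain i where "i < length ?us" "u = ?us ! i" by (auto simp: in_set_conv_nth)
      then show "u \<in> V" using path_vertices[OF g L2_one, of i] by simp
    qed
    have "?us ! 0 = ?us ! length bs" using path_closed[OF g L2_one] bs(2) by simp
    moreover have "?us \<noteq> []" by (metis length_path_of list.size(3) nat.distinct(1))
    ultimately show "hd ?us = last ?us" by (simp add: hd_conv_nth last_conv_nth)
    fix i
    show "E (?us ! i) (?us ! (i + 1))" if "i + 1 < length ?us" using path_edge[OF g L2_one, of i] that by simp
    show "?us ! (i + 2) \<noteq> ?us ! i" if "i + 2 < length ?us"
      using path_backtrack[OF g L2_one, of i] that bs(1) by (simp add: words_def successively_conv_nth)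
  qed
  then show "\<exists>us. nb_closed_walk V E us \<and> length us = n + 1" using len by (intro exI[of _ ?us]) simp
qed

lemma girth_eq: "girth V E = (LEAST n. n \<ge> 1 \<and> Wq n \<noteq> {})"
  unfolding girth_def nb_closed_walk_iff ..

end

section \<open>Many representations as a sum of three squares\<close>

definition sumsq3 :: "int \<Rightarrow> (int \<times> int \<times> int) set" where
  "sumsq3 n = {(a,b,c). a\<^sup>2 + b\<^sup>2 + c\<^sup>2 = n}"

text \<open>Conjugating a pure quaternion \<open>v\<close> with \<open>v^2 = -n\<close> by a generator of the right ideal
  \<open>(v - z, l)\<close>, where \<open>z^2 = -n\<close> modulo \<open>l\<close>, yields another integral pure quaternion of norm \<open>n\<close>.\<close>
lemma conjugate_by_split_prime:
  assumes l: "prime l" "l \<noteq> (2::int)" and z: "l dvd z\<^sup>2 + n" and ln: "\<not> l dvd n"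
    and v: "qre v = 0" "qnorm v = n"
  obtains \<beta> v' where "qnorm \<beta> = l" "qmul v \<beta> = qmul \<beta> v'" "qre v' = 0" "qnorm v' = n"
proof -
  define \<alpha> where "\<alpha> = qadd v (qscale (-z) qone)"
  obtain a b c where vf: "v = (0,a,b,c)" using v(1) by (cases v rule: prod_cases4) auto
  have n: "n = a\<^sup>2 + b\<^sup>2 + c\<^sup>2" using v(2) vf by simp
  have af: "\<alpha> = (-z, a, b, c)" by (simp add: \<alpha>_def vf)
  have na: "qnorm \<alpha> = z\<^sup>2 + n" by (simp add: af n)
  have prim: "\<not> qdvd l \<alpha>"
  proof
    assume "qdvd l \<alpha>"
    then have "l dvd a" "l dvd b" "l dvd c" by (auto simp: af qdvd_iff)
    then have "l dvd n" unfolding n power2_eq_square by (intro dvd_add dvd_mult)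
    then show False using ln by simp
  qed
  obtain \<beta> where b: "\<beta> \<in> right_ideal l \<alpha>" "qnorm \<beta> = l"
    using right_ideal_generator[OF l _ prim] z na by metis
  have l0: "l \<noteq> 0" using l by auto
  have "l dvd qnorm \<alpha>" using z na by simp
  from right_ideal_factor[OF b this l0] obtain \<gamma> where g: "\<alpha> = qmul \<beta> \<gamma>" by blast
  define v' where "v' = qadd (qmul \<gamma> \<beta>) (qscale z qone)"
  have "v = qadd \<alpha> (qscale z qone)" by (simp add: af vf)
  then have "qmul v \<beta> = qmul \<beta> v'"
    unfolding v'_def g by (simp only: qmul_add qmul_assoc qmul_scale qmul_one)
  moreover from arg_cong[OF this, of qnorm] have "qnorm v' = n" using v(2) b(2) l0 by simp
  moreover have "qre v' = 0"
  proof -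
    have "qmul (qconj \<beta>) (qmul v \<beta>) = qscale l v'"
      unfolding calculation(1) by (simp only: qmul_assoc[symmetric] qmul_conj b(2) qmul_scale qmul_one)
    then have "l * qre v' = qre (qmul (qconj \<beta>) (qmul v \<beta>))" by (cases v' rule: prod_cases4) simp
    also have "\<dots> = 0" by (cases \<beta> rule: prod_cases4) (simp add: vf algebra_simps)
    finally show ?thesis using l0 by simp
  qed
  ultimately show ?thesis using that b(2) by blast
qed

text \<open>The odd primes not dividing \<open>n\<close> that split in the field generated by
  \<open>sqrt (-n)\<close>; these are the primes that act on representations of \<open>n\<close> by
  conjugation.\<close>

definition split_prime :: "int \<Rightarrow> nat \<Rightarrow> bool" where
  "split_prime n l \<longleftrightarrow> prime l \<and> l > 2 \<and> \<not> int l dvd n \<and> (\<exists>z. int l dvd z\<^sup>2 + n)"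

lemma conjugate_by_split_primes:
  assumes "finite T" "\<And>l. l \<in> T \<Longrightarrow> split_prime n l" and v: "qre v = 0" "qnorm v = n"
  shows "\<exists>\<beta> v'. qnorm \<beta> = int (\<Prod>T) \<and> qmul v \<beta> = qmul \<beta> v' \<and> qre v' = 0 \<and> qnorm v' = n"
  using assms(1,2)
proof (induction T rule: finite_induct)
  case empty
  show ?case using v by (intro exI[of _ qone] exI[of _ v]) simp
next
  case (insert l T)
  then obtain \<beta> v' where b: "qnorm \<beta> = int (\<Prod>T)" "qmul v \<beta> = qmul \<beta> v'" "qre v' = 0" "qnorm v' = n" by blast
  have "split_prime n l" using insert by simp
  then obtain z where l: "prime (int l)" "int l \<noteq> 2" "int l dvd z\<^sup>2 + n" "\<not> int l dvd n" by (auto simp: split_prime_def)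
  obtain \<beta>' v'' where b': "qnorm \<beta>' = int l" "qmul v' \<beta>' = qmul \<beta>' v''" "qre v'' = 0" "qnorm v'' = n"
    using conjugate_by_split_prime[OF l b(3,4)] by blast
  have "qmul v (qmul \<beta> \<beta>') = qmul (qmul \<beta> \<beta>') v''"
    using b(2) b'(2) by (metis qmul_assoc)
  moreover have "qnorm (qmul \<beta> \<beta>') = int (\<Prod>(insert l T))" using b b' insert by simp
  ultimately show ?case using b' by blast
qed

text \<open>A prime in \<open>T\<close> but not in \<open>T'\<close> would divide the product
  exactly once.\<close>

lemma squarefree_products_square:
  fixes T T' :: "nat set"
  assumes fin: "finite T" "finite T'" and pr: "\<And>l. l \<in> T \<union> T' \<Longrightarrow> prime l" and sq: "\<Prod>T * \<Prod>T' = k\<^sup>2"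
  shows "T \<subseteq> T'"
proof (rule ccontr)
  assume "\<not> T \<subseteq> T'"
  then obtain l where l: "l \<in> T" "l \<notin> T'" by auto
  have pl: "prime l" using pr l by blast
  have nd: "\<not> l dvd \<Prod>S" if fS: "finite S" and pS: "\<And>j. j \<in> S \<Longrightarrow> prime j" and lS: "l \<notin> S" for S
  proof
    assume "l dvd \<Prod>S"
    then obtain j where "j \<in> S" "l dvd j" using prime_dvd_prod_iff[OF fS pl] by auto
    then show False using pS lS pl primes_dvd_imp_eq by blast
  qed
  have e: "\<Prod>T = l * \<Prod>(T - {l})" using prod.remove[OF fin(1) l(1), of "\<lambda>x. x"] by simp
  then have "l dvd k\<^sup>2" using sq[symmetric] by simp
  then have "l dvd k" using pl by (simp add: prime_dvd_power_iff)
  then obtain m where "k = l * m" by blast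
  then have "l * (\<Prod>(T - {l}) * \<Prod>T') = l * (l * m\<^sup>2)" using sq e by (simp add: power2_eq_square algebra_simps)
  then have "\<Prod>(T - {l}) * \<Prod>T' = l * m\<^sup>2" using pl by (simp add: prime_gt_0_nat)
  then have "l dvd \<Prod>(T - {l}) * \<Prod>T'" by simp
  then have "l dvd \<Prod>(T - {l}) \<or> l dvd \<Prod>T'" using pl prime_dvd_multD by blast
  then show False using nd[of "T - {l}"] nd[of T'] fin pr l by auto
qed

text \<open>The Bezout coefficients of the primitive vector \<open>(a, b, c)\<close>, applied to
  \<open>(x, y, z)\<close>, give the factor \<open>t\<close>.\<close>

lemma primitive_parallel:
  fixes a b c :: int
  assumes g: "gcd a (gcd b c) = 1" and cr: "x * b = y * a" "x * c = z * a" "y * c = z * b"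
  obtains t where "x = t * a" "y = t * b" "z = t * c"
proof -
  obtain u w where 1: "u * a + w * gcd b c = 1" using bezout_int[of a "gcd b c"] g by auto
  obtain s r where 2: "s * b + r * c = gcd b c" using bezout_int[of b c] by auto
  have e: "u * a + (w * s) * b + (w * r) * c = 1" using 1 2[symmetric] by (simp add: algebra_simps)
  define t where "t = u * x + (w * s) * y + (w * r) * z"
  have "t * a = u * (x * a) + (w * s) * (y * a) + (w * r) * (z * a)" unfolding t_def by (simp add: algebra_simps)
  then have "t * a = x * (u * a + (w * s) * b + (w * r) * c)"
    unfolding cr(1)[symmetric] cr(2)[symmetric] by (simp add: algebra_simps)
  moreover have "t * b = u * (x * b) + (w * s) * (y * b) + (w * r) * (z * b)" unfolding t_def by (simp add: algebra_simps)
  then have "t * b = y * (u * a + (w * s) * b + (w * r) * c)"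
    unfolding cr(1) cr(3)[symmetric] by (simp add: algebra_simps)
  moreover have "t * c = u * (x * c) + (w * s) * (y * c) + (w * r) * (z * c)" unfolding t_def by (simp add: algebra_simps)
  then have "t * c = z * (u * a + (w * s) * b + (w * r) * c)"
    unfolding cr(2) cr(3) by (simp add: algebra_simps)
  ultimately have "x = t * a" "y = t * b" "z = t * c" using e by simp_all
  then show ?thesis by (rule that)
qed

text \<open>Equal images make \<open>w\<close>, the product of \<open>\<beta>'\<close> with the
  conjugate of \<open>\<beta>\<close>, commute with \<open>v\<close>; hence the imaginary part of
  \<open>w\<close> is \<open>t\<close> times the primitive vector \<open>(a, b, c)\<close>. The size
  condition on the norm of \<open>w\<close> forces \<open>t = 0\<close>, and then a product of two
  squarefree numbers is a square.\<close>

lemma conjugates_distinct: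
  assumes fin: "finite T" "finite T'" and pr: "\<And>l. l \<in> T \<union> T' \<Longrightarrow> prime l"
    and v: "v = (0, h * a, h * b, h * c)" "h \<noteq> 0" "gcd a (gcd b c) = 1"
    and b: "qnorm \<beta> = int (\<Prod>T)" "qmul v \<beta> = qmul \<beta> v'"
    and b': "qnorm \<beta>' = int (\<Prod>T')" "qmul v \<beta>' = qmul \<beta>' v'" and v': "qre v' = 0"
    and small: "int (\<Prod>T) * int (\<Prod>T') < a\<^sup>2 + b\<^sup>2 + c\<^sup>2"
  shows "T = T'"
proof -
  define w where "w = qmul \<beta>' (qconj \<beta>)"
  have cv: "qconj v = qscale (-1) v" by (simp add: v(1))
  have cv': "qconj v' = qscale (-1) v'" using v' by (cases v' rule: prod_cases4) simp
  have "qmul (qconj \<beta>) v = qmul v' (qconj \<beta>)"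
    using arg_cong[OF b(2), of qconj] unfolding qconj_mul cv cv' qmul_scale by (simp add: qscale_inj del: qscale.simps)
  then have com: "qmul v w = qmul w v" unfolding w_def using b'(2) by (metis qmul_assoc)
  obtain x0 x y z where wf: "w = (x0,x,y,z)" by (cases w rule: prod_cases4)
  have "2 * h * (b * z - c * y) = 0" "2 * h * (c * x - a * z) = 0" "2 * h * (a * y - b * x) = 0"
    using com unfolding wf v(1) by (simp_all add: algebra_simps)
  then have "x * b = y * a" "x * c = z * a" "y * c = z * b" using v(2) by (simp_all add: algebra_simps)
  then obtain t where t: "x = t * a" "y = t * b" "z = t * c" using primitive_parallel[OF v(3)] by blast
  have nw: "qnorm w = int (\<Prod>T) * int (\<Prod>T')" using b(1) b'(1) by (simp add: w_def)
  define m where "m = a\<^sup>2 + b\<^sup>2 + c\<^sup>2"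
  have m0: "m \<ge> 0" by (simp add: m_def)
  have nw2: "qnorm w = x0\<^sup>2 + t\<^sup>2 * m" by (simp add: wf t m_def power_mult_distrib algebra_simps)
  have "t = 0"
  proof (rule ccontr)
    assume "t \<noteq> 0"
    then have "t\<^sup>2 > 0" by simp
    then have "1 \<le> t\<^sup>2" by linarith
    then have "1 * m \<le> t\<^sup>2 * m" using m0 by (intro mult_right_mono)
    then have "m \<le> qnorm w" using nw2 zero_le_power2[of x0] by linarith
    then show False using small nw by (simp add: m_def)
  qed
  then have "int (\<Prod>T * \<Prod>T') = x0\<^sup>2" using nw nw2 by simp
  then have "int (\<Prod>T * \<Prod>T') = int ((nat \<bar>x0\<bar>)\<^sup>2)" by simp
  then have e: "\<Prod>T * \<Prod>T' = (nat \<bar>x0\<bar>)\<^sup>2" by (simp only: of_nat_eq_iff)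
  have "T \<subseteq> T'" by (rule squarefree_products_square[OF fin pr e])
  moreover have "T' \<subseteq> T"
    by (rule squarefree_products_square[OF fin(2,1), of "nat \<bar>x0\<bar>"]) (use pr e in \<open>auto simp: mult.commute\<close>)
  ultimately show ?thesis by blast
qed

text \<open>Every \<open>t\<close>-subset of the split primes conjugates \<open>v\<close> into
  another representation. Two subsets have products of norm at most \<open>y ^ (2 t)\<close>. This
  is compared with \<open>n / h^2\<close> and not with \<open>n\<close>, because commuting with
  \<open>v\<close> sees only the primitive direction.\<close>

lemma card_sumsq3_ge:
  fixes n :: int and S :: "nat set"
  assumes S: "finite S" "\<And>l. l \<in> S \<Longrightarrow> split_prime n l" "\<And>l. l \<in> S \<Longrightarrow> l \<le> y"
    and n: "n = (h * a)\<^sup>2 + (h * b)\<^sup>2 + (h * c)\<^sup>2" "h \<noteq> 0" "gcd a (gcd b c) = 1"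
    and small: "int y ^ (2 * t) < a\<^sup>2 + b\<^sup>2 + c\<^sup>2" and fin: "finite (sumsq3 n)"
  shows "card S choose t \<le> card (sumsq3 n)"
proof -
  define v :: quat where "v = (0, h * a, h * b, h * c)"
  have v: "qre v = 0" "qnorm v = n" by (simp_all add: v_def n)
  let ?F = "{T. T \<subseteq> S \<and> card T = t}"
  have "\<exists>f. \<forall>T\<in>?F. \<exists>\<beta>. qnorm \<beta> = int (\<Prod>T) \<and> qmul v \<beta> = qmul \<beta> (f T) \<and> qre (f T) = 0 \<and> qnorm (f T) = n"
  proof (rule bchoice, rule ballI)
    fix T assume "T \<in> ?F"
    then have "finite T" "\<And>l. l \<in> T \<Longrightarrow> split_prime n l" using S finite_subset by auto
    from conjugate_by_split_primes[OF this v]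
    show "\<exists>y \<beta>. qnorm \<beta> = int (\<Prod>T) \<and> qmul v \<beta> = qmul \<beta> y \<and> qre y = 0 \<and> qnorm y = n" by blast
  qed
  then obtain f where f: "\<forall>T\<in>?F. \<exists>\<beta>. qnorm \<beta> = int (\<Prod>T) \<and> qmul v \<beta> = qmul \<beta> (f T) \<and> qre (f T) = 0 \<and> qnorm (f T) = n" ..
  have le: "\<Prod>T \<le> y ^ t" if "T \<in> ?F" for T
  proof -
    have "(\<Prod>l\<in>T. l) \<le> (\<Prod>l\<in>T. y)" by (rule prod_mono) (use that S in auto)
    then show ?thesis using that by simp
  qed
  have i: "inj_on f ?F"
  proof (rule inj_onI)
    fix T T' assume T: "T \<in> ?F" "T' \<in> ?F" "f T = f T'"
    obtain \<beta> where b: "qnorm \<beta> = int (\<Prod>T)" "qmul v \<beta> = qmul \<beta> (f T)" "qre (f T) = 0" using f T(1) by blast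
    obtain \<beta>' where b': "qnorm \<beta>' = int (\<Prod>T')" "qmul v \<beta>' = qmul \<beta>' (f T)" using f T(2,3) by metis
    have "\<Prod>T * \<Prod>T' \<le> y ^ t * y ^ t" by (intro mult_mono le T) auto
    then have "int (\<Prod>T * \<Prod>T') \<le> int (y ^ t * y ^ t)" by (simp only: of_nat_le_iff)
    then have "int (\<Prod>T) * int (\<Prod>T') \<le> int y ^ (2 * t)" by (simp add: power_add[symmetric] mult_2)
    then have sm: "int (\<Prod>T) * int (\<Prod>T') < a\<^sup>2 + b\<^sup>2 + c\<^sup>2" using small by linarith
    have fT: "finite T" "finite T'" using T S(1) finite_subset by auto
    have pT: "prime l" if "l \<in> T \<union> T'" for l using that T S(2)[of l] by (auto simp: split_prime_def)
    show "T = T'" by (rule conjugates_distinct[OF fT pT v_def n(2,3) b(1,2) b' b(3) sm])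
  qed
  have "inj_on (\<lambda>T. (qi (f T), qj (f T), qk (f T))) ?F"
  proof (rule inj_onI)
    fix T T' assume T: "T \<in> ?F" "T' \<in> ?F"
      and e: "(qi (f T), qj (f T), qk (f T)) = (qi (f T'), qj (f T'), qk (f T'))"
    have "qre (f T) = 0" "qre (f T') = 0" using f T by blast+
    then have "f T = f T'" using e by (cases "f T" rule: prod_cases4, cases "f T'" rule: prod_cases4) simp
    then show "T = T'" using i T by (meson inj_onD)
  qed
  moreover have "(\<lambda>T. (qi (f T), qj (f T), qk (f T))) ` ?F \<subseteq> sumsq3 n"
  proof
    fix u assume "u \<in> (\<lambda>T. (qi (f T), qj (f T), qk (f T))) ` ?F"
    then obtain T where T: "T \<in> ?F" "u = (qi (f T), qj (f T), qk (f T))" by blast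
    have "qre (f T) = 0" "qnorm (f T) = n" using f T(1) by blast+
    then show "u \<in> sumsq3 n" using T(2) by (cases "f T" rule: prod_cases4) (simp add: sumsq3_def)
  qed
  ultimately have "card ?F \<le> card (sumsq3 n)" using fin by (rule card_inj_on_le)
  then show ?thesis using n_subsets[OF S(1), of t] by simp
qed

lemma content_decomp:
  fixes a b c :: int
  assumes "a\<^sup>2 + b\<^sup>2 + c\<^sup>2 > 0"
  obtains h a' b' c' where "h > 0" "a = h * a'" "b = h * b'" "c = h * c'" "gcd a' (gcd b' c') = 1"
proof -
  define h where "h = gcd a (gcd b c)"
  have h0: "h > 0" using assms by (auto simp: h_def)
  obtain a' b' c' where abc: "a = h * a'" "b = h * b'" "c = h * c'"
    unfolding h_def by (metis dvd_def gcd_dvd1 gcd_dvd2 dvd_trans)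
  have "h * gcd a' (gcd b' c') = gcd (h * a') (gcd (h * b') (h * c'))" using gcd_mult_distrib_int[of h b' c'] gcd_mult_distrib_int[of h a' "gcd b' c'"] h0 by simp
  also have "\<dots> = h" by (simp only: abc[symmetric]) (simp only: h_def)
  finally have "gcd a' (gcd b' c') = 1" using h0 by simp
  then show ?thesis by (rule that[OF h0 abc])
qed

section \<open>Closed words and the kissing number\<close>

context lps_graph
begin

definition rep :: "quat set set \<Rightarrow> quat" where "rep C = (SOME x. x \<in> L2 p \<and> vt x = C)"

lemma rep: "C \<in> V \<Longrightarrow> rep C \<in> L2 p \<and> vt (rep C) = C"
  unfolding rep_def XV_eq[OF cop] by (rule someI_ex) blast

text \<open>Multiplying by the conjugate of \<open>y\<close> turns proportionality modulo
  \<open>q\<close> into a scalar modulo \<open>q\<close>; modulo 2 the product is a scalar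
  anyway.\<close>

lemma proportional_mod_q:
  assumes x: "x \<in> L2 p" and y: "y \<in> L2 p" and l: "coprime l (int q)"
    and e: "qscale l x = qadd (qscale k y) (qscale (int q) w)"
  shows "vt x = vt y"
proof -
  have "qscale l (qmul x (qconj y)) = qadd (qscale (k * qnorm y) qone) (qscale (int q) (qmul w (qconj y)))"
    using arg_cong[OF e, of "\<lambda>z. qmul z (qconj y)"] by (simp only: qmul_scale qmul_add qmul_conj qscale_scale)
  then have "scalar_mod (int q) (qscale l (qmul x (qconj y)))"
    by (cases "qmul w (qconj y)" rule: prod_cases4) (simp add: scalar_mod_simp)
  then have 1: "scalar_mod (int q) (qmul x (qconj y))" using scalar_mod_scale[OF l] by blast
  have "oddq (qmul x (qconj y))" using x y by (simp add: L2_iff oddq_mul)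
  then have 2: "scalar_mod 2 (qmul x (qconj y))" by (simp add: oddq_def scalar_mod_def)
  have "coprime 2 (int q)" using q_odd by simp
  then have "Kq (qmul x (qconj y))" using 1 2 by (simp add: scalar_mod_def divides_mult)
  then show ?thesis using vt_eq[OF x y] by simp
qed

lemma q_not_dvd_L2: "x \<in> L2 p \<Longrightarrow> \<not> qdvd (int q) x"
proof
  assume "x \<in> L2 p" "qdvd (int q) x"
  then obtain m y where "qnorm x = int p ^ m" "x = qscale (int q) y" by (auto simp: L2_iff qdvd_def simp del: qscale.simps)
  then have "int p ^ m = (int q)\<^sup>2 * qnorm y" using qnorm_scale by metis
  then have "int q dvd int p ^ m" by (metis dvd_mult2 dvd_triv_left power2_eq_square)
  then show False using q_not_dvd_p_pow by blast
qed

text \<open>Pairs of a vertex and a nonzero scalar inject into the quaternions modulo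
  \<open>q\<close>, so \<open>(q - 1) card V \<le> q^4\<close>; the factor 2 absorbs
  \<open>q / (q - 1)\<close>.\<close>

lemma card_V: "finite V \<and> card V \<le> 2 * q ^ 3"
proof -
  define md where "md l x = (l * qre x mod int q, l * qi x mod int q, l * qj x mod int q, l * qk x mod int q)" for l and x :: quat
  let ?T = "{0..<int q} \<times> {0..<int q} \<times> {0..<int q} \<times> {0..<int q}"
  let ?f = "\<lambda>(C,l). md l (rep C)"
  have q0: "int q > 0" using q_gt_2 by simp
  have diff: "\<exists>w. qscale l x = qadd (qscale k y) (qscale (int q) w)" if "md l x = md k y" for l k x y
  proof -
    obtain x0 x1 x2 x3 where fx: "x = (x0,x1,x2,x3)" by (cases x rule: prod_cases4)
    obtain y0 y1 y2 y3 where fy: "y = (y0,y1,y2,y3)" by (cases y rule: prod_cases4)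
    have step: "\<exists>w. l * a = k * b + int q * w" if "l * a mod int q = k * b mod int q" for a b
    proof -
      have "int q dvd l * a - k * b" using that by (simp add: mod_eq_dvd_iff)
      then obtain w where "l * a - k * b = int q * w" by blast
      then show ?thesis by (intro exI[of _ w]) simp
    qed
    have md: "l * x0 mod int q = k * y0 mod int q" "l * x1 mod int q = k * y1 mod int q"
      "l * x2 mod int q = k * y2 mod int q" "l * x3 mod int q = k * y3 mod int q"
      using that unfolding md_def fx fy by simp_all
    obtain w0 w1 w2 w3 where "l * x0 = k * y0 + int q * w0" "l * x1 = k * y1 + int q * w1"
      "l * x2 = k * y2 + int q * w2" "l * x3 = k * y3 + int q * w3"
      using step[OF md(1)] step[OF md(2)] step[OF md(3)] step[OF md(4)] by blast
    then show ?thesis by (intro exI[of _ "(w0,w1,w2,w3)"]) (simp add: fx fy)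
  qed
  have inj: "inj_on ?f (V \<times> {1..<int q})"
  proof (rule inj_onI, clarify)
    fix C l D k assume h: "C \<in> V" "l \<in> {1..<int q}" "D \<in> V" "k \<in> {1..<int q}" "md l (rep C) = md k (rep D)"
    have copl: "coprime l (int q)"
    proof -
      have "\<not> int q dvd l" using h(2) by (auto dest: zdvd_imp_le)
      then show ?thesis using q(1) prime_imp_coprime[of "int q" l] by (simp add: coprime_commute)
    qed
    obtain w where w: "qscale l (rep C) = qadd (qscale k (rep D)) (qscale (int q) w)" using diff[OF h(5)] by blast
    have "vt (rep C) = vt (rep D)" by (rule proportional_mod_q[OF _ _ copl w]) (use rep h in auto)
    then have CD: "C = D" using rep h by metis
    have "l = k"
    proof (rule ccontr)
      assume "l \<noteq> k"
      then have "\<not> int q dvd l - k" using h dvd_imp_le_int[of "l - k" "int q"] by auto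
      then have c: "coprime (int q) (l - k)" using q(1) prime_imp_coprime[of "int q" "l - k"] by simp
      have "qscale (l - k) (rep C) = qscale (int q) w"
        using w unfolding CD by (cases "rep D" rule: prod_cases4, cases w rule: prod_cases4) (simp add: algebra_simps)
      then have "qdvd (int q) (qscale (l - k) (rep C))" unfolding qdvd_def by blast
      then have "qdvd (int q) (rep C)"
        using c by (cases "rep C" rule: prod_cases4) (simp add: qdvd_iff coprime_dvd_mult_right_iff)
      then show False using q_not_dvd_L2 rep h by blast
    qed
    then show "C = D \<and> l = k" using CD by simp
  qed
  have im: "?f ` (V \<times> {1..<int q}) \<subseteq> ?T" using q0 by (auto simp: md_def)
  have finT: "finite ?T" by simp
  have "finite (V \<times> {1..<int q})" using inj im finT by (rule inj_on_finite)
  moreover have "{1..<int q} \<noteq> {}" using q_gt_2 by auto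
  ultimately have fV: "finite V" by (metis finite_cartesian_productD1)
  have "card (V \<times> {1..<int q}) \<le> card ?T" by (rule card_inj_on_le[OF inj im finT])
  moreover have "nat (int q - 1) = q - 1" by simp
  ultimately have "card V * (q - 1) \<le> q * (q * (q * q))" by (simp add: card_cartesian_product del: One_nat_def)
  moreover have "q * (q * (q * q)) \<le> 2 * q ^ 3 * (q - 1)"
  proof -
    have "q \<le> 2 * (q - 1)" using q_gt_2 by simp
    then have "q ^ 3 * q \<le> q ^ 3 * (2 * (q - 1))" by (rule mult_left_mono) simp
    then show ?thesis by (simp add: power3_eq_cube algebra_simps)
  qed
  ultimately have "card V * (q - 1) \<le> 2 * q ^ 3 * (q - 1)" by linarith
  moreover have "q - 1 > 0" using q_gt_2 by simp
  ultimately have "card V \<le> 2 * q ^ 3" by simp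
  then show ?thesis using fV by simp
qed

section \<open>Oriented cycles against closed words\<close>

definition cyc_of :: "quat \<Rightarrow> quat list \<Rightarrow> quat set set list" where
  "cyc_of x ws = butlast (path_of p q x ws)"

lemma length_cyc_of [simp]: "length (cyc_of x ws) = length ws" by (simp add: cyc_of_def)
lemma cyc_of_nth: "i < length ws \<Longrightarrow> cyc_of x ws ! i = path_of p q x ws ! i"
  by (simp add: cyc_of_def nth_butlast)

abbreviation "cycs g \<equiv> {xs. cyc_nb_walk V E xs \<and> length xs = g}"

lemma cycs_subset:
  assumes g: "g \<ge> 1"
  shows "cycs g \<subseteq> (\<lambda>(C,ws). cyc_of (rep C) ws) ` (V \<times> Wq g)"
proof
  fix xs assume "xs \<in> cycs g"
  then have xs: "cyc_nb_walk V E xs" "length xs = g" by auto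
  have ne: "xs \<noteq> []" using xs g by auto
  define us where "us = xs @ [hd xs]"
  have us_nth: "us ! i = xs ! (i mod g)" if "i \<le> g" for i
  proof (cases "i < g")
    case True then show ?thesis using xs by (simp add: us_def nth_append)
  next
    case False
    then have "i = g" using that by simp
    then show ?thesis using xs ne by (simp add: us_def nth_append hd_conv_nth)
  qed
  have hdV: "hd xs \<in> V" using xs ne unfolding cyc_nb_walk_def by (meson hd_in_set subsetD)
  have ed: "E (us ! i) (us ! Suc i)" if "Suc i < length us" for i
  proof -
    have "E (xs ! i) (xs ! ((i + 1) mod g))" using xs that by (simp add: cyc_nb_walk_def us_def)
    then show ?thesis using us_nth[of i] us_nth[of "Suc i"] that xs by (simp add: us_def)
  qed
  have "us \<noteq> []" "hd us = vt (rep (hd xs))" "rep (hd xs) \<in> L2 p"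
    using rep[OF hdV] ne by (auto simp: us_def)
  then obtain bs where bs: "set bs \<subseteq> gens p" "us = path_of p q (rep (hd xs)) bs"
    using walk_lift[OF _ ed] by blast
  have len: "length bs = g" using arg_cong[OF bs(2), of length] xs(2) by (simp add: us_def)
  have "bs ! Suc i \<noteq> qconj (bs ! i)" if "Suc i < length bs" for i
  proof -
    have "length xs \<noteq> 1" using that len xs by auto
    then have "xs ! ((i + 2) mod g) \<noteq> xs ! i" using xs that len by (auto simp: cyc_nb_walk_def)
    then have "us ! Suc (Suc i) \<noteq> us ! i" using us_nth[of i] us_nth[of "Suc (Suc i)"] that len by simp
    then show ?thesis using path_backtrack[OF bs(1), of "rep (hd xs)" i] that bs(2) rep[OF hdV] by simp
  qed
  then have w: "bs \<in> words p g" using bs(1) len by (simp add: words_def successively_conv_nth)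
  have "us ! g = us ! 0" using us_nth[of g] us_nth[of 0] g by simp
  then have "Kq (qprod bs)" using path_closed[OF bs(1), of "rep (hd xs)"] rep[OF hdV] bs(2) len by simp
  then have "bs \<in> Wq g" using w by (simp add: closed_words_def)
  moreover have "xs = cyc_of (rep (hd xs)) bs" by (simp add: cyc_of_def bs(2)[symmetric] us_def)
  ultimately show "xs \<in> (\<lambda>(C,ws). cyc_of (rep C) ws) ` (V \<times> Wq g)" using hdV by force
qed

lemma finite_cycs: "g \<ge> 1 \<Longrightarrow> finite (cycs g)"
  using cycs_subset card_V finite_closed_words by (meson finite_SigmaI finite_imageI finite_subset)

lemma kiss_le:
  assumes "girth V E \<ge> 1"
  shows "kiss V E \<le> card V * card (Wq (girth V E))"
proof -
  have "kiss V E \<le> card (cycs (girth V E))"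
    unfolding kiss_def by (rule card_image_le[OF finite_cycs[OF assms]])
  also have "\<dots> \<le> card ((\<lambda>(C,ws). cyc_of (rep C) ws) ` (V \<times> Wq (girth V E)))"
    using card_V finite_closed_words by (intro card_mono cycs_subset[OF assms] finite_imageI finite_SigmaI) auto
  also have "\<dots> \<le> card (V \<times> Wq (girth V E))" using card_V finite_closed_words by (intro card_image_le finite_SigmaI) auto
  finally show ?thesis by (simp add: card_cartesian_product)
qed

lemma cyc_of_in_cycs:
  assumes ws: "ws \<in> Wq g" and g: "g \<ge> 3" and min: "Wq (g - 2) = {}" and x: "x \<in> L2 p"
  shows "cyc_of x ws \<in> cycs g"
proof -
  have w: "ws \<in> words p g" "Kq (qprod ws)" using ws by (auto simp: closed_words_def)
  have gs: "set ws \<subseteq> gens p" and len: "length ws = g" using w by (auto simp: words_def)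
  have succ: "ws ! Suc i \<noteq> qconj (ws ! i)" if "Suc i < g" for i using w(1) that by (auto simp: words_def successively_conv_nth)
  let ?us = "path_of p q x ws"
  have cl: "?us ! g = ?us ! 0" using path_closed[OF gs x] w(2) len by simp
  have nth: "cyc_of x ws ! (i mod g) = ?us ! i" if "i \<le> g" for i
    using that cl cyc_of_nth[of "i mod g" ws x] len g by (cases "i = g") auto
  have "cyc_nb_walk V E (cyc_of x ws)"
    unfolding cyc_nb_walk_def length_cyc_of len
  proof (intro conjI allI impI)
    show "cyc_of x ws \<noteq> []" using len g by (metis length_cyc_of list.size(3) not_numeral_le_zero)
    show "set (cyc_of x ws) \<subseteq> V"
    proof
      fix u assume "u \<in> set (cyc_of x ws)"
      then obtain i where "i < g" "u = cyc_of x ws ! i" by (auto simp: in_set_conv_nth len)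
      then show "u \<in> V" using path_vertices[OF gs x, of i] cyc_of_nth[of i ws x] len by simp
    qed
    fix i assume i: "i < g"
    show "E (cyc_of x ws ! i) (cyc_of x ws ! ((i + 1) mod g))"
      using path_edge[OF gs x, of i] nth[of "Suc i"] nth[of i] i len by simp
    have "cyc_of x ws ! ((i + 2) mod g) \<noteq> cyc_of x ws ! i"
    proof (cases "i + 2 \<le> g")
      case True
      then have "?us ! Suc (Suc i) \<noteq> ?us ! i" using path_backtrack[OF gs x, of i] succ[of i] len by simp
      then show ?thesis using nth[of "i+2"] nth[of i] i True by simp
    next
      case False
      \<comment> \<open>Backtracking across the base point would identify the vertices 1 and
        \<open>g - 1\<close>; the word without its first and last letter would then be closed, of
        length \<open>g - 2\<close>.\<close>
      then have ig: "i = g - 1" using i by simp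
      then have m: "(i + 2) mod g = 1" using g by (simp add: mod_if)
      obtain b vs where v: "ws = b # vs" using len g by (cases ws) auto
      define ms where "ms = butlast vs"
      have lv: "length vs = g - 1" using len v by simp
      have e1: "g - 1 = Suc (g - 2)" and e2: "length vs - Suc 0 = g - 2" "length vs - 1 = g - 2" using g lv by simp_all
      have msl: "ms = take (g - 2) (drop 1 ws)"
        using e2 by (simp only: v ms_def butlast_conv_take One_nat_def drop_Suc_Cons drop_0)
      have mw: "ms \<in> words p (g - 2)"
        unfolding msl by (rule words_take[OF words_drop[OF w(1)]]) simp
      have tk: "take (g - 1) ws = b # ms"
        unfolding v ms_def butlast_conv_take e2 e1 take_Suc_Cons ..
      have bg: "b \<in> gens p" using gs v by simp
      have "\<not> Kq (qprod ms)" using mw min by (auto simp: closed_words_def)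
      then have "vt (qmul (qmul x b) (qprod ms)) \<noteq> vt (qmul x b)"
        using vt_mul_scalar[OF L2_mul[OF x gens_L2[OF bg]] words_L2[OF mw]] by simp
      moreover have "?us ! (g - 1) = vt (qmul (qmul x b) (qprod ms))" using len g by (simp add: path_of_nth tk qmul_assoc del: One_nat_def)
      moreover have "?us ! 1 = vt (qmul x b)" using len g v by (simp add: path_of_nth)
      ultimately show ?thesis using nth[of i] nth[of 1] ig m g i by simp
    qed
    then show "g = 1 \<or> cyc_of x ws ! ((i + 2) mod g) \<noteq> cyc_of x ws ! i" by simp
  qed
  then show ?thesis using len by simp
qed

lemma cyc_of_inj:
  assumes ws: "ws \<in> Wq g" "vs \<in> Wq g" and x: "x \<in> L2 p" and e: "cyc_of x ws = cyc_of x vs"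
  shows "ws = vs"
proof -
  have w: "ws \<in> words p g" "Kq (qprod ws)" "vs \<in> words p g" "Kq (qprod vs)" using ws by (auto simp: closed_words_def)
  have gs: "set ws \<subseteq> gens p" "set vs \<subseteq> gens p" and len: "length ws = g" "length vs = g" using w by (auto simp: words_def)
  have nth: "path_of p q x ws ! i = path_of p q x vs ! i" if "i \<le> g" for i
  proof (cases "i < g")
    case True
    then show ?thesis using cyc_of_nth[of i ws x] cyc_of_nth[of i vs x] e len by simp
  next
    case False
    then have "i = g" using that by simp
    then show ?thesis using path_closed[OF gs(1) x] path_closed[OF gs(2) x] w len by (simp add: path_of_nth)
  qed
  have "i \<le> g \<Longrightarrow> take i ws = take i vs" for i
  proof (induction i)
    case (Suc i)
    then have IH: "take i ws = take i vs" and i: "i < g" by auto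
    have "vt (qmul (qmul x (qprod (take i ws))) (ws ! i)) = vt (qmul (qmul x (qprod (take i ws))) (vs ! i))"
      using nth[of "Suc i"] i len IH by (simp add: path_of_nth take_Suc_qprod qmul_assoc)
    moreover have "qmul x (qprod (take i ws)) \<in> L2 p" using x words_take_L2[OF w(1)] L2_mul by blast
    moreover have "ws ! i \<in> gens p" "vs ! i \<in> gens p" using gs len i nth_mem by (metis subsetD)+
    ultimately have "ws ! i = vs ! i" using vt_gens_inj by blast
    then show ?case using IH i len by (simp add: take_Suc_conv_app_nth)
  qed simp
  from this[of g] show ?thesis using len by simp
qed

text \<open>Distinct pairs of a vertex and a closed word give distinct cyclic walks, and each
  oriented cycle consists of at most \<open>g\<close> rotations.\<close>

lemma kiss_ge:
  assumes g: "girth V E = g" "g \<ge> 3" and min: "Wq (g - 2) = {}"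
  shows "card V * card (Wq g) \<le> g * kiss V E"
proof -
  have "inj_on (\<lambda>(C,ws). cyc_of (rep C) ws) (V \<times> Wq g)"
  proof (rule inj_onI, clarify)
    fix C ws D vs assume h: "C \<in> V" "ws \<in> Wq g" "D \<in> V" "vs \<in> Wq g" "cyc_of (rep C) ws = cyc_of (rep D) vs"
    have len: "length ws = g" "length vs = g" using h by (auto simp: closed_words_def words_def)
    have "cyc_of (rep C) ws ! 0 = vt (rep C)" "cyc_of (rep D) vs ! 0 = vt (rep D)"
      using len g(2) by (simp_all add: cyc_of_nth path_of_nth)
    then have "C = D" using rep[OF h(1)] rep[OF h(3)] h(5) by simp
    then show "C = D \<and> ws = vs" using cyc_of_inj[OF h(2,4)] rep[OF h(1)] h(5) by metis
  qed
  then have "card V * card (Wq g) = card ((\<lambda>(C,ws). cyc_of (rep C) ws) ` (V \<times> Wq g))"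
    by (simp add: card_image card_cartesian_product)
  also have "\<dots> \<le> card (cycs g)"
  proof (rule card_mono[OF finite_cycs])
    show "(\<lambda>(C,ws). cyc_of (rep C) ws) ` (V \<times> Wq g) \<subseteq> cycs g"
    proof
      fix xs assume "xs \<in> (\<lambda>(C,ws). cyc_of (rep C) ws) ` (V \<times> Wq g)"
      then obtain C ws where "xs = cyc_of (rep C) ws" "C \<in> V" "ws \<in> Wq g" by auto
      then show "xs \<in> cycs g" using cyc_of_in_cycs[OF _ g(2) min, of ws "rep C"] rep[of C] by simp
    qed
  qed (use g in simp)
  also have "\<dots> \<le> g * card (oriented_cycle ` cycs g)"
  proof (rule card_fibers_le(2))
    show "finite (oriented_cycle ` cycs g)" using finite_cycs[of g] g by simp
    show "oriented_cycle ` cycs g \<subseteq> oriented_cycle ` cycs g" by simp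
    fix b assume "b \<in> oriented_cycle ` cycs g"
    then obtain xs where xs: "xs \<in> cycs g" "b = oriented_cycle xs" by blast
    have sub: "{a \<in> cycs g. oriented_cycle a = b} \<subseteq> (\<lambda>k. rotate k xs) ` {..<g}"
    proof
      fix a assume "a \<in> {a \<in> cycs g. oriented_cycle a = b}"
      then have "a \<in> oriented_cycle xs" using xs(2) unfolding oriented_cycle_def by (metis (mono_tags, lifting) mem_Collect_eq rotate0 id_apply)
      then obtain k where "a = rotate k xs" by (auto simp: oriented_cycle_def)
      then have "a = rotate (k mod g) xs" using xs(1) rotate_conv_mod[of k xs] by simp
      then show "a \<in> (\<lambda>k. rotate k xs) ` {..<g}" using g by auto
    qed
    have "card ((\<lambda>k. rotate k xs) ` {..<g}) \<le> g" using card_image_le[of "{..<g}" "\<lambda>k. rotate k xs"] by simp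
    then show "finite {a \<in> cycs g. oriented_cycle a = b} \<and> card {a \<in> cycs g. oriented_cycle a = b} \<le> g"
      using card_mono[OF _ sub] finite_subset[OF sub] by fastforce
  qed
  also have "card (oriented_cycle ` cycs g) = kiss V E" unfolding kiss_def g(1) ..
  finally show ?thesis .
qed

definition Zq :: "nat \<Rightarrow> quat set" where
  "Zq m = {x. oddq x \<and> Kq x \<and> qnorm x = int p ^ (2 * m) \<and> \<not> (qi x = 0 \<and> qj x = 0 \<and> qk x = 0)}"

lemma finite_Zq: "finite (Zq m)"
  by (rule finite_subset[OF _ finite_qnorm[of "int p ^ (2 * m)"]]) (auto simp: Zq_def)

lemma card_closed_words_le: "m \<ge> 1 \<Longrightarrow> card (Wq (2 * m)) \<le> card (Zq m)"
proof (rule card_inj_on_le[OF _ _ finite_Zq])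
  assume m: "m \<ge> 1"
  show "inj_on qprod (Wq (2 * m))"
    by (rule inj_onI) (use words_inj[OF p] in \<open>auto simp: closed_words_def\<close>)
  show "qprod ` Wq (2 * m) \<subseteq> Zq m"
  proof
    fix x assume "x \<in> qprod ` Wq (2 * m)"
    then obtain ws where ws: "ws \<in> words p (2 * m)" "Kq (qprod ws)" "x = qprod ws" by (auto simp: closed_words_def)
    have "set ws \<subseteq> gens p" "length ws = 2 * m" using ws by (auto simp: words_def)
    then show "x \<in> Zq m"
      using ws gens_list_norm[of ws p] gens_list_oddq[of ws p] words_nonscalar[OF ws(1)] m by (auto simp: Zq_def)
  qed
qed

text \<open>The imaginary part divided by \<open>2 q\<close> lies in one of at most
  \<open>p^m / q^2\<close> sets \<open>sumsq3\<close>, one for each \<open>r\<close>. It determines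
  the real part up to sign, whence the factor 2.\<close>

lemma card_Zq_le:
  assumes B: "\<And>r. r \<in> {1..p ^ m div q\<^sup>2} \<Longrightarrow> r * q\<^sup>2 < p ^ m \<Longrightarrow>
     finite (sumsq3 (int (r * (p ^ m - q\<^sup>2 * r)))) \<and> card (sumsq3 (int (r * (p ^ m - q\<^sup>2 * r)))) \<le> B"
  shows "card (Zq m) \<le> 2 * (p ^ m div q\<^sup>2 * B)"
proof -
  let ?R = "{r \<in> {1..p ^ m div q\<^sup>2}. r * q\<^sup>2 < p ^ m}"
  let ?U = "\<Union>r\<in>?R. sumsq3 (int (r * (p ^ m - q\<^sup>2 * r)))"
  let ?f = "\<lambda>x. (qre x > 0, (qi x div (2 * int q), qj x div (2 * int q), qk x div (2 * int q)))"
  have q0: "int q > 0" using q_gt_2 by simp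
  have q20: "q\<^sup>2 > 0" using q_gt_2 by simp
  have finU: "finite ?U" using B by auto
  have "card (Zq m) \<le> card (UNIV \<times> ?U :: (bool \<times> _) set)"
  proof (rule card_inj_on_le)
    show "inj_on ?f (Zq m)"
    proof (rule inj_onI)
      fix x y assume h: "x \<in> Zq m" "y \<in> Zq m" "?f x = ?f y"
      have Kx: "Kq x" and Ky: "Kq y" using h(1,2) by (simp_all add: Zq_def)
      obtain x0 a b c where x: "x = (x0, 2 * int q * a, 2 * int q * b, 2 * int q * c)" using scalar_mod_imag[OF Kx] by blast
      obtain y0 a' b' c' where y: "y = (y0, 2 * int q * a', 2 * int q * b', 2 * int q * c')" using scalar_mod_imag[OF Ky] by blast
      have abc: "a = a'" "b = b'" "c = c'" and sg: "x0 > 0 \<longleftrightarrow> y0 > 0" using h(3) q0 by (auto simp: x y)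
      have "qnorm x = qnorm y" using h by (simp add: Zq_def)
      then have "x0\<^sup>2 = y0\<^sup>2" by (simp add: x y abc)
      then have "x0 = y0 \<or> x0 = - y0" by (simp add: power2_eq_iff)
      moreover have "x0 \<noteq> 0" "y0 \<noteq> 0" using h by (auto simp: Zq_def x y oddq_simp)
      ultimately have "x0 = y0" using sg by auto
      then show "x = y" by (simp add: x y abc)
    qed
    show "?f ` Zq m \<subseteq> UNIV \<times> ?U"
    proof
      fix z assume "z \<in> ?f ` Zq m"
      then obtain x where x: "x \<in> Zq m" "z = ?f x" by blast
      have zx: "oddq x" "Kq x" "qnorm x = int p ^ (2 * m)" using x by (auto simp: Zq_def)
      obtain x0 a b c where f: "x = (x0, 2 * int q * a, 2 * int q * b, 2 * int q * c)" using scalar_mod_imag[OF zx(2)] by blast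
      have "\<not> (a = 0 \<and> b = 0 \<and> c = 0)" using x(1) f by (auto simp: Zq_def)
      then obtain r where r: "r \<ge> 1" "r * (int q)\<^sup>2 < int p ^ m" "a\<^sup>2 + b\<^sup>2 + c\<^sup>2 = r * (int p ^ m - (int q)\<^sup>2 * r)"
        using scalar_elem_structure[OF zx f] by blast
      define k where "k = nat r"
      have k: "r = int k" "k \<ge> 1" using r by (auto simp: k_def)
      have lt: "k * q\<^sup>2 < p ^ m" using r(2) unfolding k by (metis of_nat_less_iff of_nat_mult of_nat_power)
      have "k \<le> p ^ m div q\<^sup>2" using lt q20 by (simp add: less_eq_div_iff_mult_less_eq)
      then have kR: "k \<in> ?R" using k lt by simp
      have "int (k * (p ^ m - q\<^sup>2 * k)) = r * (int p ^ m - (int q)\<^sup>2 * r)"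
        using lt by (simp add: k of_nat_diff mult.commute)
      then have "(a,b,c) \<in> sumsq3 (int (k * (p ^ m - q\<^sup>2 * k)))" using r(3) by (simp add: sumsq3_def)
      moreover have "z = (x0 > 0, (a,b,c))" using x(2) q0 by (simp add: f)
      ultimately show "z \<in> UNIV \<times> ?U" using kR by blast
    qed
    show "finite (UNIV \<times> ?U :: (bool \<times> _) set)" using finU by simp
  qed
  also have "\<dots> = 2 * card ?U" by (simp add: card_cartesian_product)
  also have "card ?U \<le> (\<Sum>r\<in>?R. card (sumsq3 (int (r * (p ^ m - q\<^sup>2 * r)))))" by (rule card_UN_le) simp
  also have "\<dots> \<le> (\<Sum>r\<in>?R. B)" using B by (intro sum_mono) auto
  also have "\<dots> = card ?R * B" by simp
  also have "\<dots> \<le> p ^ m div q\<^sup>2 * B"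
  proof (rule mult_right_mono)
    have "card ?R \<le> card {1..p ^ m div q\<^sup>2}" by (rule card_mono) auto
    then show "card ?R \<le> p ^ m div q\<^sup>2" by simp
  qed simp
  finally show ?thesis by simp
qed

lemma card_Zq_ge:
  assumes r: "r \<ge> 1" "r * q\<^sup>2 < p ^ m"
  shows "card (sumsq3 (int (r * (p ^ m - q\<^sup>2 * r)))) \<le> card (Zq m)"
proof (rule card_inj_on_le[OF _ _ finite_Zq])
  let ?f = "\<lambda>(a,b,c). (int p ^ m - 2 * (int q)\<^sup>2 * int r, 2 * int q * a, 2 * int q * b, 2 * int q * c)"
  have q0: "int q > 0" using q_gt_2 by simp
  show "inj_on ?f (sumsq3 (int (r * (p ^ m - q\<^sup>2 * r))))"
    using q0 by (auto simp: inj_on_def)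
  show "?f ` sumsq3 (int (r * (p ^ m - q\<^sup>2 * r))) \<subseteq> Zq m"
  proof
    fix x assume "x \<in> ?f ` sumsq3 (int (r * (p ^ m - q\<^sup>2 * r)))"
    then obtain a b c where s: "a\<^sup>2 + b\<^sup>2 + c\<^sup>2 = int (r * (p ^ m - q\<^sup>2 * r))"
      and x: "x = (int p ^ m - 2 * (int q)\<^sup>2 * int r, 2 * int q * a, 2 * int q * b, 2 * int q * c)" by (auto simp: sumsq3_def)
    have e: "int (r * (p ^ m - q\<^sup>2 * r)) = int r * (int p ^ m - (int q)\<^sup>2 * int r)"
      using r(2) by (simp add: of_nat_diff mult.commute)
    have "qnorm x = (int p ^ m - 2 * (int q)\<^sup>2 * int r)\<^sup>2 + (2 * int q)\<^sup>2 * (a\<^sup>2 + b\<^sup>2 + c\<^sup>2)"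
      by (simp add: x power_mult_distrib algebra_simps)
    also have "\<dots> = (int p ^ m)\<^sup>2" unfolding s e by (simp add: power2_eq_square algebra_simps)
    finally have n: "qnorm x = int p ^ (2 * m)" by (simp add: power_mult mult.commute)
    have "r * (p ^ m - q\<^sup>2 * r) > 0" using r by (simp add: mult.commute)
    then have "int (r * (p ^ m - q\<^sup>2 * r)) > 0" by (simp only: of_nat_0_less_iff)
    then have "a\<^sup>2 + b\<^sup>2 + c\<^sup>2 > 0" using s by linarith
    then have "\<not> (a = 0 \<and> b = 0 \<and> c = 0)" by auto
    moreover have "oddq x" using p_odd[OF p] by (simp add: x oddq_simp)
    ultimately show "x \<in> Zq m" using n q0 by (auto simp: Zq_def x scalar_mod_simp)
  qed
qed

lemma Zq_primitive_part:
  assumes "x \<in> Zq m"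
  obtains k y where "k \<le> m" "x = qscale (int p ^ k) y" "y \<in> Zq (m - k)" "\<not> qdvd (int p) y" "m - k \<ge> 1"
  using assms
proof (induction m arbitrary: x thesis)
  case 0
  have "qnorm x = 1" "oddq x" using 0(2) by (auto simp: Zq_def)
  then show ?case using norm_one_oddq[of x] 0(2) by (auto simp: Zq_def)
next
  case (Suc m)
  show ?case
  proof (cases "qdvd (int p) x")
    case False
    then show ?thesis using Suc.prems(1)[of 0 x] Suc.prems(2) by simp
  next
    case True
    then obtain y where y: "x = qscale (int p) y" unfolding qdvd_def by blast
    have p0: "int p > 0" using p_gt_2[OF p] by simp
    have "(int p)\<^sup>2 * qnorm y = (int p)\<^sup>2 * int p ^ (2 * m)" using Suc.prems(2) y by (simp add: Zq_def power2_eq_square del: qscale.simps)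
    then have "qnorm y = int p ^ (2 * m)" using p0 by simp
    moreover have "oddq y" using Suc.prems(2) y p_odd[OF p] oddq_scale[of "int p" y] by (simp add: Zq_def del: qscale.simps)
    moreover have "Kq y" using Suc.prems(2) y scalar_mod_scale[OF cop_pow[OF cop, of 1], of y] by (simp add: Zq_def del: qscale.simps)
    moreover have "\<not> (qi y = 0 \<and> qj y = 0 \<and> qk y = 0)" using Suc.prems(2) y by (cases y rule: prod_cases4) (auto simp: Zq_def)
    ultimately have "y \<in> Zq m" by (simp add: Zq_def)
    from Suc.IH[OF _ this] obtain k z where kz: "k \<le> m" "y = qscale (int p ^ k) z" "z \<in> Zq (m - k)" "\<not> qdvd (int p) z" "m - k \<ge> 1" by metis
    have "x = qscale (int p ^ Suc k) z" unfolding y kz(2) by (simp only: qscale_scale power_Suc)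
    then show ?thesis using Suc.prems(1)[of "Suc k" z] kz by simp
  qed
qed

lemma Zq_primitive_word:
  assumes "x \<in> Zq m" "\<not> qdvd (int p) x"
  shows "\<exists>ws\<in>Wq (2 * m). x = qprod ws \<or> x = qscale (-1) (qprod ws)"
proof -
  obtain ws where ws: "ws \<in> words p (2 * m)" "x = qprod ws \<or> x = qscale (-1) (qprod ws)"
    using words_surj[OF p, of x "2 * m"] assms by (auto simp: Zq_def simp del: qscale.simps)
  have "Kq (qprod ws)"
    using assms(1) ws(2) scalar_mod_scale[of "-1" "2 * int q" "qprod ws"] by (auto simp: Zq_def simp del: qscale.simps)
  then show ?thesis using ws by (auto simp: closed_words_def simp del: qscale.simps)
qed

lemma Zq_closed_word:
  assumes "x \<in> Zq m"
  obtains j where "1 \<le> j" "j \<le> m" "Wq (2 * j) \<noteq> {}"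
proof -
  obtain k y where "k \<le> m" "y \<in> Zq (m - k)" "\<not> qdvd (int p) y" "m - k \<ge> 1"
    using Zq_primitive_part[OF assms] by metis
  then show ?thesis using Zq_primitive_word[of y "m - k"] that[of "m - k"] by auto
qed

text \<open>By minimality of \<open>m\<close> no element is divisible by \<open>p\<close>: removing
  the power of \<open>p\<close> would leave a shorter nonempty closed word. The factor 2 is the
  sign.\<close>

lemma card_Zq_le_words:
  assumes min: "\<And>j. 1 \<le> j \<Longrightarrow> j < m \<Longrightarrow> Wq (2 * j) = {}"
  shows "card (Zq m) \<le> 2 * card (Wq (2 * m))"
proof -
  have "Zq m \<subseteq> qprod ` Wq (2 * m) \<union> (\<lambda>ws. qscale (-1) (qprod ws)) ` Wq (2 * m)"
  proof
    fix x assume x: "x \<in> Zq m"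
    obtain k y where ky: "k \<le> m" "x = qscale (int p ^ k) y" "y \<in> Zq (m - k)" "\<not> qdvd (int p) y" "m - k \<ge> 1"
      using Zq_primitive_part[OF x] by metis
    have "Wq (2 * (m - k)) \<noteq> {}" using Zq_primitive_word[OF ky(3,4)] by blast
    then have "k = 0" using min[of "m - k"] ky by (cases "k = 0") auto
    then have "y = x" using ky(2) by simp
    then have "\<not> qdvd (int p) x" using ky(4) by simp
    then show "x \<in> qprod ` Wq (2 * m) \<union> (\<lambda>ws. qscale (-1) (qprod ws)) ` Wq (2 * m)"
      using Zq_primitive_word[OF x] by blast
  qed
  then have "card (Zq m) \<le> card (qprod ` Wq (2 * m) \<union> (\<lambda>ws. qscale (-1) (qprod ws)) ` Wq (2 * m))"
    using finite_closed_words by (intro card_mono) auto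
  also have "\<dots> \<le> card (qprod ` Wq (2 * m)) + card ((\<lambda>ws. qscale (-1) (qprod ws)) ` Wq (2 * m))" by (rule card_Un_le)
  also have "\<dots> \<le> card (Wq (2 * m)) + card (Wq (2 * m))" using finite_closed_words by (intro add_mono card_image_le)
  finally show ?thesis by simp
qed

end

section \<open>Quadratic character sums\<close>

lemma card_square_roots_mod_prime:
  assumes l: "prime l" "l > 2"
  shows "int (card {z \<in> {0..<int l}. int l dvd z\<^sup>2 - y}) = 1 + Legendre y (int l)"
proof -
  let ?A = "{z \<in> {0..<int l}. int l dvd z\<^sup>2 - y}"
  have pl: "prime (int l)" using l by simp
  show ?thesis
  proof (cases "?A = {}")
    case True
    have "\<not> QuadRes (int l) y"
    proof
      assume "QuadRes (int l) y"
      then obtain z where "[z\<^sup>2 = y] (mod int l)" by (auto simp: QuadRes_def)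
      then have "[(z mod int l)\<^sup>2 = y] (mod int l)" by (simp add: cong_def power_mod)
      then have "z mod int l \<in> ?A" using l by (simp add: cong_iff_dvd_diff)
      then show False using True by blast
    qed
    moreover from this have "\<not> [y = 0] (mod int l)"
      unfolding QuadRes_def by (metis cong_sym zero_power2)
    ultimately show ?thesis unfolding True by (simp add: Legendre_def)
  next
    case False
    then obtain z where z: "0 \<le> z" "z < int l" "int l dvd z\<^sup>2 - y" by auto
    have mem: "w \<in> ?A \<longleftrightarrow> w \<in> {0..<int l} \<and> (int l dvd w - z \<or> int l dvd w + z)" for w
    proof -
      have "int l dvd w\<^sup>2 - y \<longleftrightarrow> int l dvd (w\<^sup>2 - y) - (z\<^sup>2 - y)" by (rule dvd_diff_left_iff[OF z(3), symmetric])
      also have "(w\<^sup>2 - y) - (z\<^sup>2 - y) = (w - z) * (w + z)" by (simp add: power2_eq_square algebra_simps)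
      finally show ?thesis using pl by (simp add: prime_dvd_mult_iff)
    qed
    show ?thesis
    proof (cases "z = 0")
      case True
      have "w = 0" if "w \<in> ?A" for w
      proof -
        have "int l dvd w" "0 \<le> w" "w < int l" using mem[of w] that True by auto
        then show ?thesis using zdvd_imp_le[of "int l" w] by linarith
      qed
      then have "?A = {0}" using z True by auto
      moreover have "[y = 0] (mod int l)" using z(3) True by (simp add: cong_0_iff)
      ultimately show ?thesis by (simp only:) (simp add: Legendre_def)
    next
      case False
      have "?A = {z, int l - z}"
      proof (intro equalityI subsetI)
        fix w assume "w \<in> ?A"
        then have w: "0 \<le> w" "w < int l" "int l dvd w - z \<or> int l dvd w + z" using mem[of w] by auto
        from w(3) show "w \<in> {z, int l - z}"
        proof
          assume "int l dvd w - z"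
          moreover have "\<bar>w - z\<bar> < int l" using w z by (simp add: abs_if)
          ultimately show ?thesis using dvd_imp_le_int[of "w - z" "int l"] by (cases "w = z") auto
        next
          assume "int l dvd w + z"
          then obtain k where k: "w + z = int l * k" by blast
          have "0 < w + z" "w + z < int l * 2" using w z False by auto
          then have "0 < k" "k < 2" using k l by (auto simp: zero_less_mult_iff)
          then have "k = 1" by simp
          then show ?thesis using k by simp
        qed
      next
        fix w assume "w \<in> {z, int l - z}"
        then show "w \<in> ?A" using mem[of w] z False by auto
      qed
      moreover have "z \<noteq> int l - z" using l(1,2) prime_odd_nat[of l] by presburger
      ultimately have 2: "card ?A = 2" by simp
      have "\<not> int l dvd z" using z False by (auto dest: zdvd_imp_le)
      then have "\<not> int l dvd z\<^sup>2" using pl by (simp add: prime_dvd_power_iff)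
      moreover have "int l dvd y \<Longrightarrow> int l dvd z\<^sup>2"
        using z(3) by (metis diff_add_cancel dvd_add)
      ultimately have "\<not> [y = 0] (mod int l)" by (auto simp: cong_0_iff)
      moreover have "QuadRes (int l) y" using z(3) by (auto simp: QuadRes_def cong_iff_dvd_diff)
      ultimately show ?thesis unfolding 2 by (simp add: Legendre_def)
    qed
  qed
qed

text \<open>The hyperbola \<open>(ax - z)(ax + z) = B\<close> over the field with \<open>l\<close> elements has \<open>l - 1\<close> points.\<close>
lemma legendre_quadratic_sum:
  fixes a B :: int
  assumes l: "prime l" "l > 2" and ab: "\<not> int l dvd a" "\<not> int l dvd B"
  shows "(\<Sum>x\<in>{0..<int l}. Legendre ((a * x)\<^sup>2 - B) (int l)) = -1"
proof -
  have pl: "prime (int l)" using l by simp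
  have l0: "int l > 0" using l by simp
  have l2: "\<not> int l dvd 2" using l by (auto dest: zdvd_imp_le)
  let ?P = "SIGMA x:{0..<int l}. {z \<in> {0..<int l}. int l dvd z\<^sup>2 - ((a * x)\<^sup>2 - B)}"
  have cancel: "x = y" if "int l dvd k * (x - y)" "\<not> int l dvd k" "x \<in> {0..<int l}" "y \<in> {0..<int l}" for k x y
  proof -
    have "int l dvd x - y" using that(1,2) pl prime_dvd_multD by blast
    moreover have "\<bar>x - y\<bar> < int l" using that(3,4) by (simp add: abs_if)
    ultimately show ?thesis using dvd_imp_le_int[of "x - y" "int l"] by (cases "x = y") auto
  qed
  have inv: "\<exists>j. int l dvd k * j - 1" if "\<not> int l dvd k" for k
  proof -
    have "coprime k (int l)" using prime_imp_coprime[OF pl that] by (simp add: coprime_commute)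
    then obtain j where "[k * j = 1] (mod int l)" using cong_solve_coprime_int by blast
    then show ?thesis by (auto simp: cong_iff_dvd_diff)
  qed
  have "bij_betw (\<lambda>(x,z). (a * x - z) mod int l) ?P {1..<int l}"
    unfolding bij_betw_def
  proof (intro conjI equalityI subsetI)
    have fac: "int l dvd (a * x - z) * (a * x + z) - B" if "(x,z) \<in> ?P" for x z
    proof -
      have "int l dvd - (z\<^sup>2 - ((a * x)\<^sup>2 - B))" using that unfolding dvd_minus_iff by simp
      then show ?thesis by (simp add: power2_eq_square algebra_simps)
    qed
    have nz: "\<not> int l dvd a * x - z" if "(x,z) \<in> ?P" for x z
    proof
      assume "int l dvd a * x - z"
      from dvd_diff[OF dvd_mult2[OF this] fac[OF that]]
      have "int l dvd (a * x - z) * (a * x + z) - ((a * x - z) * (a * x + z) - B)" .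
      then show False using ab by simp
    qed
    show "inj_on (\<lambda>(x,z). (a * x - z) mod int l) ?P"
    proof (rule inj_onI)
      fix s s' assume ss: "s \<in> ?P" "s' \<in> ?P" "(case s of (x,z) \<Rightarrow> (a * x - z) mod int l) = (case s' of (x,z) \<Rightarrow> (a * x - z) mod int l)"
      obtain x z x' z' where sp: "s = (x,z)" "s' = (x',z')" by (cases s, cases s') auto
      have h: "(x,z) \<in> ?P" "(x',z') \<in> ?P" "(a * x - z) mod int l = (a * x' - z') mod int l"
        using ss unfolding sp prod.case .
      have r: "x \<in> {0..<int l}" "x' \<in> {0..<int l}" "z \<in> {0..<int l}" "z' \<in> {0..<int l}" using h by auto
      define u u' w w' where "u = a * x - z" and "u' = a * x' - z'" and "w = a * x + z" and "w' = a * x' + z'"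
      have uu: "int l dvd u - u'" using h(3) by (simp add: u_def u'_def mod_eq_dvd_iff)
      have d1: "int l dvd (u * w - B) - (u' * w' - B)" using dvd_diff[OF fac[OF h(1)] fac[OF h(2)]] by (simp only: u_def u'_def w_def w'_def)
      have "int l dvd ((u * w - B) - (u' * w' - B)) - (u - u') * w'" by (rule dvd_diff[OF d1 dvd_mult2[OF uu]])
      also have "((u * w - B) - (u' * w' - B)) - (u - u') * w' = u * (w - w')" by (simp add: algebra_simps)
      finally have "int l dvd w - w'" using nz[OF h(1)] pl prime_dvd_multD unfolding u_def by blast
      then have s: "int l dvd (u - u') + (w - w')" "int l dvd (w - w') - (u - u')" using uu dvd_add dvd_diff by blast+
      have "(u - u') + (w - w') = (2 * a) * (x - x')" "(w - w') - (u - u') = 2 * (z - z')"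
        by (simp_all add: u_def u'_def w_def w'_def algebra_simps)
      then have "int l dvd (2 * a) * (x - x')" "int l dvd 2 * (z - z')" using s by metis+
      moreover have "\<not> int l dvd 2 * a" using l2 ab(1) pl prime_dvd_multD by blast
      ultimately have "x = x' \<and> z = z'" using cancel[OF _ _ r(1,2)] cancel[OF _ l2 r(3,4)] by blast
      then show "s = s'" using sp by simp
    qed
    show "u \<in> {1..<int l}" if "u \<in> (\<lambda>(x,z). (a * x - z) mod int l) ` ?P" for u
    proof -
      obtain x z where xz: "(x,z) \<in> ?P" "u = (a * x - z) mod int l" using \<open>u \<in> _\<close> by auto
      have "u \<noteq> 0" using nz[OF xz(1)] unfolding xz(2) by (simp add: dvd_eq_mod_eq_0)
      moreover have "0 \<le> u" "u < int l" using l0 unfolding xz(2) by simp_all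
      ultimately show ?thesis by simp
    qed
    fix u assume u: "u \<in> {1..<int l}"
    then have "\<not> int l dvd u" by (auto dest: zdvd_imp_le)
    then obtain i where i: "int l dvd u * i - 1" using inv by blast
    have "\<not> int l dvd 2 * a" using l2 ab(1) pl prime_dvd_multD by blast
    then obtain j where j: "int l dvd (2 * a) * j - 1" using inv by blast
    define w where "w = B * i"
    define x where "x = ((u + w) * j) mod int l"
    define z where "z = (a * x - u) mod int l"
    obtain k1 where k1: "u * i - 1 = int l * k1" using i by blast
    obtain k2 where k2: "(2 * a) * j - 1 = int l * k2" using j by blast
    obtain k3 where k3: "x = (u + w) * j + int l * k3"
      unfolding x_def by (metis add.commute diff_eq_eq minus_mod_eq_mult_div minus_mult_right uminus_add_conv_diff)
    obtain k4 where k4: "z = a * x - u + int l * k4"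
      unfolding z_def by (metis add.commute diff_eq_eq minus_mod_eq_mult_div minus_mult_right uminus_add_conv_diff)
    have "2 * a * x = (u + w) * (int l * k2 + 1) + int l * (2 * a * k3)"
      unfolding k3 k2[symmetric] by (simp add: algebra_simps)
    then have ax: "2 * a * x = u + w + int l * ((u + w) * k2 + 2 * a * k3)" by (simp add: algebra_simps)
    have p1: "a * x - z = u - int l * k4" using k4 by simp
    have p2: "a * x + z = w + int l * ((u + w) * k2 + 2 * a * k3 + k4)" using k4 ax by (simp add: algebra_simps)
    have uw: "u * w = B + int l * (B * k1)" using k1 unfolding w_def by (metis add.commute diff_add_cancel distrib_left mult.assoc mult.left_commute mult_1_right)
    define K where "K = (u + w) * k2 + 2 * a * k3 + k4"
    have "(a * x - z) * (a * x + z) = (u - int l * k4) * (w + int l * K)" unfolding p1 p2 K_def ..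
    also have "\<dots> = u * w + int l * (u * K - k4 * w - int l * k4 * K)" by (simp add: algebra_simps)
    also have "\<dots> = B + int l * (B * k1 + (u * K - k4 * w - int l * k4 * K))" unfolding uw by (simp add: algebra_simps)
    finally have "z\<^sup>2 - ((a * x)\<^sup>2 - B) = - (int l * (B * k1 + (u * K - k4 * w - int l * k4 * K)))"
      by (simp add: power2_eq_square algebra_simps)
    then have "int l dvd z\<^sup>2 - ((a * x)\<^sup>2 - B)" by simp
    moreover have "x \<in> {0..<int l}" "z \<in> {0..<int l}" using l0 by (simp_all add: x_def z_def)
    ultimately have "(x,z) \<in> ?P" by simp
    moreover have "(a * x - z) mod int l = u"
    proof -
      have "(a * x - z) mod int l = u mod int l" unfolding p1 by (simp add: mod_diff_eq[symmetric])
      then show ?thesis using u by simp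
    qed
    ultimately show "u \<in> (\<lambda>(x,z). (a * x - z) mod int l) ` ?P" by force
  qed
  then have "card ?P = card {1..<int l}" by (rule bij_betw_same_card)
  moreover have "int (card ?P) = (\<Sum>x\<in>{0..<int l}. 1 + Legendre ((a * x)\<^sup>2 - B) (int l))"
  proof -
    have f: "\<forall>x\<in>{0..<int l}. finite {z \<in> {0..<int l}. int l dvd z\<^sup>2 - ((a * x)\<^sup>2 - B)}"
      by (rule ballI, rule finite_subset[of _ "{0..<int l}"]) auto
    show ?thesis
      unfolding card_SigmaI[OF finite_atLeastLessThan_int f] of_nat_sum card_square_roots_mod_prime[OF l] ..
  qed
  ultimately show ?thesis using l by (simp add: sum.distrib)
qed

text \<open>Each full period contributes at most 1 in absolute value, and the incomplete one at most
  its length.\<close>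

lemma periodic_sum_bound:
  fixes f :: "nat \<Rightarrow> int"
  assumes per: "\<And>n. f (n + M) = f n" and M: "M > 0" and f1: "\<And>n. \<bar>f n\<bar> \<le> 1" and s: "\<bar>\<Sum>n<M. f n\<bar> \<le> 1"
  shows "real_of_int \<bar>\<Sum>n<X. f n\<bar> \<le> real X / real M + real M"
proof -
  have perk: "f (n + k * M) = f n" for n k
  proof (induction k)
    case (Suc k)
    have "n + Suc k * M = (n + k * M) + M" by simp
    then show ?case by (simp only: per Suc)
  qed simp
  have zk: "\<bar>\<Sum>n<k*M. f n\<bar> \<le> int k" for k
  proof (induction k)
    case (Suc k)
    have e: "{..<Suc k * M} = {..<k*M} \<union> {k*M..<k*M+M}" by auto
    have "(\<Sum>n<Suc k * M. f n) = (\<Sum>n<k*M. f n) + (\<Sum>n=k*M..<k*M+M. f n)"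
      unfolding e by (rule sum.union_disjoint) auto
    also have "(\<Sum>n=k*M..<k*M+M. f n) = (\<Sum>n<M. f (n + k*M))"
      using sum.shift_bounds_nat_ivl[of f 0 "k*M" M] by (simp add: atLeast0LessThan add.commute)
    finally have "(\<Sum>n<Suc k * M. f n) = (\<Sum>n<k*M. f n) + (\<Sum>n<M. f n)" by (simp only: perk)
    then show ?case using Suc s by simp
  qed simp
  define k r where "k = X div M" and "r = X mod M"
  have X: "X = k * M + r" "r < M" using M by (auto simp: k_def r_def)
  have e: "{..<X} = {..<k*M} \<union> {k*M..<k*M+r}" using X by auto
  have "(\<Sum>n<X. f n) = (\<Sum>n<k*M. f n) + (\<Sum>n=k*M..<k*M+r. f n)" unfolding e by (rule sum.union_disjoint) auto
  moreover have "\<bar>\<Sum>n=k*M..<k*M+r. f n\<bar> \<le> (\<Sum>n=k*M..<k*M+r. 1)" by (rule order_trans[OF sum_abs sum_mono]) (rule f1)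
  ultimately have "\<bar>\<Sum>n<X. f n\<bar> \<le> int k + int M" using zk[of k] X(2) by simp
  then have "real_of_int \<bar>\<Sum>n<X. f n\<bar> \<le> real k + real M" by linarith
  moreover have "real k \<le> real X / real M" unfolding k_def by (rule real_div_le)
  ultimately show ?thesis by linarith
qed

lemma sum_crt:
  fixes f g :: "nat \<Rightarrow> int"
  assumes cop: "coprime m n" and m: "m > 0" "n > 0" and f: "\<And>x. f (x mod m) = f x" and g: "\<And>x. g (x mod n) = g x"
  shows "(\<Sum>x<m*n. f x * g x) = (\<Sum>x<m. f x) * (\<Sum>x<n. g x)"
proof -
  let ?h = "\<lambda>x. (x mod m, x mod n)"
  have inj: "inj_on ?h {..<m*n}"
  proof (rule inj_onI)
    fix x y assume xy: "x \<in> {..<m*n}" "y \<in> {..<m*n}" "?h x = ?h y"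
    then have "[x = y] (mod m)" "[x = y] (mod n)" by (auto simp: cong_def)
    then have "[x = y] (mod m * n)" using cop coprime_cong_mult_nat by blast
    then show "x = y" using xy by (simp add: cong_def)
  qed
  have im: "?h ` {..<m*n} = {..<m} \<times> {..<n}"
  proof (rule card_subset_eq)
    show "?h ` {..<m*n} \<subseteq> {..<m} \<times> {..<n}" using m by auto
    show "card (?h ` {..<m*n}) = card ({..<m} \<times> {..<n})" by (simp add: card_image[OF inj] card_cartesian_product)
  qed simp
  have "(\<Sum>x<m. f x) * (\<Sum>x<n. g x) = (\<Sum>(x,y)\<in>{..<m} \<times> {..<n}. f x * g y)"
    by (simp add: sum_product sum.cartesian_product)
  also have "\<dots> = (\<Sum>x<m*n. f (x mod m) * g (x mod n))"
    unfolding im[symmetric] by (subst sum.reindex[OF inj]) simp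
  finally show ?thesis by (simp add: f g)
qed

lemma legendre_quadratic_sum_nat:
  fixes a B :: int
  assumes "prime l" "l > 2" "\<not> int l dvd a" "\<not> int l dvd B"
  shows "(\<Sum>x<l. Legendre ((a * int x)\<^sup>2 - B) (int l)) = -1"
proof -
  have e: "{0..<int l} = int ` {..<l}" by (simp add: image_int_atLeastLessThan lessThan_atLeast0)
  have "(\<Sum>x<l. Legendre ((a * int x)\<^sup>2 - B) (int l)) = (\<Sum>x\<in>{0..<int l}. Legendre ((a * x)\<^sup>2 - B) (int l))"
    unfolding e by (subst sum.reindex) auto
  then show ?thesis using legendre_quadratic_sum[OF assms] by simp
qed

text \<open>Different primes are nearly uncorrelated, since over a full period the symbols sum to \<open>-1\<close>.\<close>
lemma legendre_second_moment:
  fixes a B :: int and L :: "nat set" and x0 M X :: nat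
  assumes L: "L \<subseteq> {x0<..M * x0}" "\<And>l. l \<in> L \<Longrightarrow> prime l \<and> l > 2 \<and> \<not> int l dvd a \<and> \<not> int l dvd B" and x0: "x0 > 0"
  shows "(\<Sum>x<X. (real_of_int (\<Sum>l\<in>L. Legendre ((a * int x)\<^sup>2 - B) (int l)))\<^sup>2)
     \<le> real (card L) * real X + real M ^ 2 * real X + real (card L) ^ 2 * real (M * x0) ^ 2"
proof -
  let ?c = "\<lambda>l x. Legendre ((a * int x)\<^sup>2 - B) (int l)"
  have finL: "finite L" using L(1) finite_subset by blast
  have c1: "\<bar>?c l x\<bar> \<le> 1" for l x using Legendre_cases[of "(a * int x)\<^sup>2 - B" "int l"] by auto
  have cong: "?c l x = ?c l y" if "[x = y] (mod l)" for l x y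
  proof (rule Legendre_cong)
    have "[int x = int y] (mod int l)" using that by (simp add: cong_int_iff)
    then show "[(a * int x)\<^sup>2 - B = (a * int y)\<^sup>2 - B] (mod int l)"
      by (intro cong_diff cong_pow cong_mult cong_refl)
  qed
  have pair: "real_of_int (\<Sum>x<X. ?c l x * ?c k x) \<le> (if l = k then real X else real X / real x0 ^ 2 + real (M * x0) ^ 2)"
    if l: "l \<in> L" and k: "k \<in> L" for l k
  proof (cases "l = k")
    case True
    have "(\<Sum>x<X. ?c l x * ?c k x) \<le> (\<Sum>x<X. 1)"
    proof (rule sum_mono)
      fix x
      show "?c l x * ?c k x \<le> 1" using Legendre_cases[of "(a * int x)\<^sup>2 - B" "int l"] True by auto
    qed
    then have "(\<Sum>x<X. ?c l x * ?c k x) \<le> int X" by simp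
    then have "real_of_int (\<Sum>x<X. ?c l x * ?c k x) \<le> real_of_int (int X)" by (simp only: of_int_le_iff)
    then show ?thesis using True by simp
  next
    case False
    have cop: "coprime l k" using False L(2) l k by (simp add: primes_coprime)
    have pos: "l > 0" "k > 0" using L(2)[OF l] L(2)[OF k] by simp_all
    have "(\<Sum>x<l*k. ?c l x * ?c k x) = (\<Sum>x<l. ?c l x) * (\<Sum>x<k. ?c k x)"
      by (rule sum_crt[OF cop pos]; rule cong; simp add: cong_def)
    \<comment> \<open>By the Chinese remainder theorem the sum over a full period \<open>l k\<close>
      is \<open>(-1) (-1) = 1\<close>, so the correlation of two symbols over an interval is about
      \<open>X / (l k)\<close> instead of \<open>X\<close>.\<close>
    also have "\<dots> = 1" using legendre_quadratic_sum_nat[of l a B] legendre_quadratic_sum_nat[of k a B] L(2)[OF l] L(2)[OF k] by simp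
    finally have s: "\<bar>\<Sum>x<l*k. ?c l x * ?c k x\<bar> \<le> 1" by simp
    have per: "?c l (n + l * k) * ?c k (n + l * k) = ?c l n * ?c k n" for n
    proof -
      have "[n + l * k = n] (mod l)" "[n + l * k = n] (mod k)" by (simp_all add: cong_def)
      from cong[OF this(1)] cong[OF this(2)] show ?thesis by (simp only:)
    qed
    have b1: "\<bar>?c l n * ?c k n\<bar> \<le> 1" for n using mult_mono[OF c1[of n l] c1[of n k]] by (simp add: abs_mult)
    have "real_of_int \<bar>\<Sum>x<X. ?c l x * ?c k x\<bar> \<le> real X / real (l * k) + real (l * k)"
      by (rule periodic_sum_bound[OF per _ b1 s]) (use pos in simp)
    also have "\<dots> \<le> real X / real x0 ^ 2 + real (M * x0) ^ 2"
    proof (rule add_mono)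
      have "x0 * x0 \<le> l * k" using L(1) l k by (intro mult_mono) auto
      then have "real x0 ^ 2 \<le> real (l * k)" unfolding power2_eq_square by (metis of_nat_le_iff of_nat_mult)
      then show "real X / real (l * k) \<le> real X / real x0 ^ 2" using x0 by (intro divide_left_mono) (auto simp: pos)
      have "l * k \<le> (M * x0) * (M * x0)" using L(1) l k by (intro mult_mono) auto
      then show "real (l * k) \<le> real (M * x0) ^ 2" unfolding power2_eq_square by (metis of_nat_le_iff of_nat_mult)
    qed
    finally show ?thesis using False by simp
  qed
  have "(\<Sum>x<X. (real_of_int (\<Sum>l\<in>L. ?c l x))\<^sup>2) = (\<Sum>x<X. \<Sum>l\<in>L. \<Sum>k\<in>L. real_of_int (?c l x * ?c k x))"
    by (simp add: power2_eq_square sum_product)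
  also have "\<dots> = (\<Sum>l\<in>L. \<Sum>x<X. \<Sum>k\<in>L. real_of_int (?c l x * ?c k x))" by (rule sum.swap)
  also have "\<dots> = (\<Sum>l\<in>L. \<Sum>k\<in>L. \<Sum>x<X. real_of_int (?c l x * ?c k x))"
    by (rule sum.cong[OF refl], rule sum.swap)
  also have "\<dots> = (\<Sum>l\<in>L. \<Sum>k\<in>L. real_of_int (\<Sum>x<X. ?c l x * ?c k x))" by simp
  also have "\<dots> \<le> (\<Sum>l\<in>L. \<Sum>k\<in>L. (if l = k then real X else 0) + (real X / real x0 ^ 2 + real (M * x0) ^ 2))"
    proof (intro sum_mono)
    fix l k assume "l \<in> L" "k \<in> L"
    then show "real_of_int (\<Sum>x<X. ?c l x * ?c k x) \<le> (if l = k then real X else 0) + (real X / real x0 ^ 2 + real (M * x0) ^ 2)"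
      using pair[of l k] by (smt (verit) divide_nonneg_nonneg of_nat_0_le_iff zero_le_power)
  qed
  also have "\<dots> = real (card L) * real X + real (card L) ^ 2 * (real X / real x0 ^ 2 + real (M * x0) ^ 2)"
    using finL by (simp add: sum.distrib power2_eq_square algebra_simps)
  also have "\<dots> \<le> real (card L) * real X + real M ^ 2 * real X + real (card L) ^ 2 * real (M * x0) ^ 2"
  proof -
    have "card L \<le> card {x0<..M * x0}" using L(1) by (intro card_mono) auto
    then have "card L \<le> M * x0" by simp
    then have "real (card L) \<le> real (M * x0)" by (simp only: of_nat_le_iff)
    then have "real (card L) ^ 2 \<le> (real M * real x0) ^ 2" by (intro power_mono) auto
    then have "real (card L) ^ 2 * (real X / real x0 ^ 2) \<le> (real M * real x0) ^ 2 * (real X / real x0 ^ 2)"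
      by (intro mult_right_mono) auto
    also have "\<dots> = real M ^ 2 * real X" using x0 by (simp add: power_mult_distrib)
    finally show ?thesis by (simp add: algebra_simps)
  qed
  finally show ?thesis .
qed

section \<open>The number of vertices\<close>

lemma card_words_ge:
  assumes p: "prime p" "p mod 4 = 1"
  shows "(card (gens p) - 1) ^ n \<le> card (words p n)"
proof (induction n)
  case (Suc n)
  let ?T = "card (gens p) - 1"
  \<comment> \<open>For the empty word \<open>hd ws\<close> is unspecified. Excluding its conjugate
    costs at most one generator, so the branching factor \<open>card (gens p) - 1\<close> remains a
    valid lower bound.\<close>
  let ?S = "SIGMA ws:words p n. gens p - {qconj (hd ws)}"
  have "inj_on (\<lambda>(ws,b). b # ws) ?S" by (auto simp: inj_on_def)
  moreover have "(\<lambda>(ws,b). b # ws) ` ?S \<subseteq> words p (Suc n)"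
  proof (rule image_subsetI)
    fix s assume s: "s \<in> ?S"
    obtain ws b where sp: "s = (ws,b)" by (cases s)
    have w: "ws \<in> words p n" "b \<in> gens p" "b \<noteq> qconj (hd ws)" using s sp by auto
    have "hd ws \<noteq> qconj b" using w(3) by auto
    then show "(case s of (ws,b) \<Rightarrow> b # ws) \<in> words p (Suc n)"
      using w(1,2) unfolding sp by (cases ws) (auto simp: words_def)
  qed
  ultimately have "card ?S \<le> card (words p (Suc n))" using finite_words by (intro card_inj_on_le)
  moreover have "?T * card (words p n) \<le> card ?S"
  proof -
    have "?T * card (words p n) = (\<Sum>ws\<in>words p n. ?T)" by simp
    also have "\<dots> \<le> (\<Sum>ws\<in>words p n. card (gens p - {qconj (hd ws)}))"
      by (rule sum_mono, use diff_card_le_card_Diff[of "{_}"] in force)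
    also have "\<dots> = card ?S" by (rule card_SigmaI[symmetric]) (auto simp: finite_words finite_gens)
    finally show ?thesis .
  qed
  moreover have "?T ^ Suc n \<le> ?T * card (words p n)" using Suc.IH by simp
  ultimately show ?case by linarith
next
  case 0
  have "words p 0 = {[]}" by (auto simp: words_def)
  then show ?case by simp
qed

text \<open>Cauchy-Schwarz for the fibre sizes, read off from a nonnegative sum of squared
  differences.\<close>

lemma card_image_pairs_ge:
  assumes A: "finite A" and B: "finite B" "f ` A \<subseteq> B"
  shows "card A ^ 2 \<le> card B * card {(x,y). x \<in> A \<and> y \<in> A \<and> f x = f y}"
proof -
  define c where "c b = real (card {x\<in>A. f x = b})" for b
  have s: "(\<Sum>b\<in>B. c b) = real (card A)"
  proof -
    have "card A = card (\<Union>b\<in>B. {x\<in>A. f x = b})" using B(2) by (intro arg_cong[where f = card]) auto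
    also have "\<dots> = (\<Sum>b\<in>B. card {x\<in>A. f x = b})" using A B by (intro card_UN_disjoint) auto
    finally show ?thesis by (simp add: c_def)
  qed
  have sq: "(\<Sum>b\<in>B. (c b)\<^sup>2) = real (card {(x,y). x \<in> A \<and> y \<in> A \<and> f x = f y})"
  proof -
    have "{(x,y). x \<in> A \<and> y \<in> A \<and> f x = f y} = (\<Union>b\<in>B. {x\<in>A. f x = b} \<times> {x\<in>A. f x = b})" using B(2) by auto
    then have "card {(x,y). x \<in> A \<and> y \<in> A \<and> f x = f y} = card (\<Union>b\<in>B. {x\<in>A. f x = b} \<times> {x\<in>A. f x = b})" by simp
    also have "\<dots> = (\<Sum>b\<in>B. card ({x\<in>A. f x = b} \<times> {x\<in>A. f x = b}))" using A B by (intro card_UN_disjoint) auto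
    finally show ?thesis by (simp add: c_def card_cartesian_product power2_eq_square)
  qed
  have "0 \<le> (\<Sum>b\<in>B. \<Sum>b'\<in>B. (c b - c b')\<^sup>2)" by (intro sum_nonneg) simp
  also have "\<dots> = (\<Sum>b\<in>B. \<Sum>b'\<in>B. (c b)\<^sup>2 + (c b')\<^sup>2 - 2 * (c b * c b'))" by (simp add: power2_eq_square algebra_simps)
  also have "\<dots> = 2 * (real (card B) * (\<Sum>b\<in>B. (c b)\<^sup>2)) - 2 * ((\<Sum>b\<in>B. c b) * (\<Sum>b\<in>B. c b))"
    by (simp only: sum.distrib sum_subtractf sum_distrib_left[symmetric] sum_distrib_right[symmetric])
      (simp add: algebra_simps sum_distrib_left)
  finally have "(real (card A))\<^sup>2 \<le> real (card B) * real (card {(x,y). x \<in> A \<and> y \<in> A \<and> f x = f y})"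
    unfolding s sq by (simp add: power2_eq_square)
  then have "real (card A ^ 2) \<le> real (card B * card {(x,y). x \<in> A \<and> y \<in> A \<and> f x = f y})"
    by (simp only: of_nat_mult of_nat_power)
  then show ?thesis by (simp only: of_nat_le_iff)
qed

context lps_graph
begin

definition coll :: "nat \<Rightarrow> (quat list \<times> quat list) set" where
  "coll m = {(ws,vs). ws \<in> words p m \<and> vs \<in> words p m \<and> vt (qprod ws) = vt (qprod vs)}"

lemma finite_coll: "finite (coll m)"
  by (rule finite_subset[of _ "words p m \<times> words p m"]) (auto simp: coll_def finite_words)

text \<open>If the last letters agree they can be cancelled, otherwise \<open>ws vs^-1\<close> is reduced.\<close>
lemma card_coll_Suc:
  "card (coll (Suc m)) \<le> (if m = 0 then card (gens p) else card (gens p) - 1) * card (coll m) + card (Wq (2 * Suc m))"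
proof -
  let ?T = "if m = 0 then card (gens p) else card (gens p) - 1"
  let ?A = "{(ws,vs). (ws,vs) \<in> coll (Suc m) \<and> last ws = last vs}"
  let ?B = "{(ws,vs). (ws,vs) \<in> coll (Suc m) \<and> last ws \<noteq> last vs}"
  let ?S = "SIGMA s:coll m. (if m = 0 then gens p else gens p - {qconj (last (fst s))})"
  have decomp: "\<exists>us b. ws = us @ [b] \<and> us \<in> words p m \<and> b \<in> gens p \<and> (m \<noteq> 0 \<longrightarrow> b \<noteq> qconj (last us))"
    if "ws \<in> words p (Suc m)" for ws
  proof -
    have ne: "ws \<noteq> []" using that by (auto simp: words_def)
    define us b where "us = butlast ws" and "b = last ws"
    have e: "ws = us @ [b]" using ne by (simp add: us_def b_def)
    have "length us = m" using that e by (simp add: words_def)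
    then show ?thesis using that unfolding e words_def by (auto simp: successively_append_iff)
  qed
  have "?A \<subseteq> (\<lambda>((us,ts),b). (us @ [b], ts @ [b])) ` ?S"
  proof
    fix s assume s: "s \<in> ?A"
    obtain ws vs where sp: "s = (ws,vs)" by (cases s)
    have w: "ws \<in> words p (Suc m)" "vs \<in> words p (Suc m)" "vt (qprod ws) = vt (qprod vs)" "last ws = last vs"
      using s sp by (auto simp: coll_def)
    obtain us b where us: "ws = us @ [b]" "us \<in> words p m" "b \<in> gens p" "m \<noteq> 0 \<longrightarrow> b \<noteq> qconj (last us)" using decomp[OF w(1)] by blast
    obtain ts b' where ts: "vs = ts @ [b']" "ts \<in> words p m" using decomp[OF w(2)] by blast
    have b: "b' = b" using w(4) us ts by simp
    have "vt (qmul (qprod us) b) = vt (qmul (qprod ts) b)" using w(3) us(1) ts(1) b by (simp add: qprod_append)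
    then have "vt (qprod us) = vt (qprod ts)"
      using vert_mul_right[OF cop words_L2[OF us(2)] words_L2[OF ts(2)] gens_L2[OF us(3)]] by blast
    then have "(us,ts) \<in> coll m" using us ts by (simp add: coll_def)
    then have "((us,ts),b) \<in> ?S" using us by auto
    then show "s \<in> (\<lambda>((us,ts),b). (us @ [b], ts @ [b])) ` ?S" unfolding sp us(1) ts(1) b by force
  qed
  moreover have finS: "finite ?S" by (intro finite_SigmaI finite_coll) (simp add: finite_gens)
  ultimately have "card ?A \<le> card ?S" by (rule surj_card_le[rotated])
  also have "\<dots> = (\<Sum>s\<in>coll m. card (if m = 0 then gens p else gens p - {qconj (last (fst s))}))"
    by (rule card_SigmaI) (auto simp: finite_coll finite_gens)
  also have "\<dots> \<le> (\<Sum>s\<in>coll m. ?T)"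
  proof (rule sum_mono)
    fix s assume s: "s \<in> coll m"
    show "card (if m = 0 then gens p else gens p - {qconj (last (fst s))}) \<le> ?T"
    proof (cases "m = 0")
      case False
      obtain ws vs where sp: "s = (ws,vs)" by (cases s)
      have w: "ws \<in> words p m" using s sp by (simp add: coll_def)
      then have "ws \<noteq> []" using False by (auto simp: words_def)
      then have "last ws \<in> gens p" using w by (auto simp: words_def)
      then have "qconj (last (fst s)) \<in> gens p" using sp gens_conj by simp
      then show ?thesis using False by (simp add: finite_gens)
    qed simp
  qed
  finally have cA: "card ?A \<le> ?T * card (coll m)" by (simp add: mult.commute)
  have "card ?B \<le> card (Wq (2 * Suc m))"
  proof (rule card_inj_on_le[OF _ _ finite_closed_words])
    let ?f = "\<lambda>(ws,vs). ws @ map qconj (rev vs)"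
    show "inj_on ?f ?B"
    proof (rule inj_onI)
      fix s s' assume s: "s \<in> ?B" "s' \<in> ?B" "?f s = ?f s'"
      obtain ws vs ws' vs' where sp: "s = (ws,vs)" "s' = (ws',vs')" by (cases s, cases s') auto
      have "length ws = length ws'" using s(1,2) sp by (auto simp: coll_def words_def)
      then have "ws = ws' \<and> map qconj (rev vs) = map qconj (rev vs')" using s(3) sp by simp
      moreover have "inj qconj"
      proof (rule injI)
        fix x y assume "qconj x = qconj y"
        then have "qconj (qconj x) = qconj (qconj y)" by (simp only:)
        then show "x = y" by simp
      qed
      ultimately show "s = s'" using sp by (simp add: inj_map_eq_map)
    qed
    show "?f ` ?B \<subseteq> Wq (2 * Suc m)"
    proof (rule image_subsetI)
      fix s assume s: "s \<in> ?B"
      obtain ws vs where sp: "s = (ws,vs)" by (cases s)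
      have w: "ws \<in> words p (Suc m)" "vs \<in> words p (Suc m)" "vt (qprod ws) = vt (qprod vs)" "last ws \<noteq> last vs"
        using s sp by (auto simp: coll_def)
      have v: "map qconj (rev vs) \<in> words p (Suc m)" by (rule words_rev_conj[OF w(2)])
      have ne: "vs \<noteq> []" using w(2) by (auto simp: words_def)
      have h: "hd (map qconj (rev vs)) = qconj (last vs)" using ne by (simp add: hd_map hd_rev)
      have "qconj (last vs) \<noteq> qconj (last ws)"
      proof
        assume "qconj (last vs) = qconj (last ws)"
        then have "qconj (qconj (last vs)) = qconj (qconj (last ws))" by (simp only:)
        then show False using w(4) by simp
      qed
      then have "ws @ map qconj (rev vs) \<in> words p (2 * Suc m)"
        using w(1) v h unfolding words_def by (auto simp: successively_append_iff)
      moreover have "Kq (qprod (ws @ map qconj (rev vs)))"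
        using vt_eq[OF words_L2[OF w(1)] words_L2[OF w(2)]] w(3) unfolding qprod_append qprod_rev_conj by blast
      ultimately show "?f s \<in> Wq (2 * Suc m)" unfolding sp closed_words_def by simp
    qed
  qed
  moreover have "card (coll (Suc m)) \<le> card ?A + card ?B"
  proof -
    have "coll (Suc m) = ?A \<union> ?B" by auto
    then have "card (coll (Suc m)) = card (?A \<union> ?B)" by (rule arg_cong)
    then show ?thesis using card_Un_le[of ?A ?B] by linarith
  qed
  ultimately show ?thesis using cA by linarith
qed

text \<open>Iteration of the recursion. As \<open>card (gens p) - 1\<close> is at least
  \<open>p\<close>, half of the power \<open>p^(2 i)\<close> is charged to the number of words, so
  each step adds at most \<open>B p^m\<close> per word. The 2 accounts for the one larger branching
  at the first letter.\<close>

lemma card_coll_le: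
  assumes B: "\<And>i. 1 \<le> i \<Longrightarrow> i \<le> m \<Longrightarrow> real (card (Wq (2 * i))) \<le> B * real p ^ (2 * i)"
  shows "real (card (coll m)) \<le> real (card (gens p) - 1) ^ m * (2 + real m * (B * real p ^ m))"
proof -
  define T where "T = card (gens p) - 1"
  have T: "p \<le> T" "card (gens p) = T + 1" using card_gens_ge[OF p] by (auto simp: T_def)
  have Tp: "real T \<ge> real p" "real T \<ge> 1" using T(1) p_gt_2[OF p] by linarith+
  have p1: "real p \<ge> 1" using p_gt_2[OF p] by simp
  have B0: "B \<ge> 0" if "m \<ge> 1"
  proof -
    have "0 \<le> B * real p ^ (2 * 1)" using B[of 1] that by (meson of_nat_0_le_iff order_trans le_refl)
    then show ?thesis using p1 by (simp add: zero_le_mult_iff)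
  qed
  have c0: "card (coll 0) \<le> 1"
  proof -
    have "coll 0 \<subseteq> {([],[])}" by (auto simp: coll_def words_def)
    then show ?thesis using card_mono[of "{([],[])}" "coll 0"] by simp
  qed
  have "real (card (coll i)) \<le> real T ^ i * ((if i = 0 then 1 else 2) + real i * (B * real p ^ i))" if "i \<le> m" for i
    using that
  proof (induction i)
    case 0
    then show ?case using c0 by simp
  next
    case (Suc i)
    have B0': "B \<ge> 0" using B0 Suc.prems by simp
    have m1: "real (card (coll (Suc i))) \<le> real (if i = 0 then T + 1 else T) * real (card (coll i)) + real (card (Wq (2 * Suc i)))"
      using card_coll_Suc[of i] unfolding T(2) by (simp only: add_diff_cancel_right' of_nat_add[symmetric] of_nat_mult[symmetric] of_nat_le_iff)
    have m2: "real (card (Wq (2 * Suc i))) \<le> real T ^ Suc i * (B * real p ^ Suc i)"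
    proof -
      have "real (card (Wq (2 * Suc i))) \<le> B * real p ^ (2 * Suc i)" by (rule B) (use Suc.prems in auto)
      also have "\<dots> = real p ^ Suc i * (B * real p ^ Suc i)" by (simp only: mult_2 power_add mult.assoc mult.left_commute)
      also have "\<dots> \<le> real T ^ Suc i * (B * real p ^ Suc i)" using B0' p1 Tp by (intro mult_right_mono power_mono) auto
      finally show ?thesis .
    qed
    have m3: "real (if i = 0 then T + 1 else T) * real (card (coll i)) \<le> real T ^ Suc i * (2 + real i * (B * real p ^ Suc i))"
    proof (cases "i = 0")
      case True
      have "real (T + 1) * real (card (coll 0)) \<le> real (T + 1) * 1" using c0 by (intro mult_left_mono) auto
      also have "\<dots> \<le> real T * 2" using Tp by simp
      finally show ?thesis using True by simp
    next
      case False
      have "real (card (coll i)) \<le> real T ^ i * (2 + real i * (B * real p ^ i))" using Suc False by simp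
      also have "\<dots> \<le> real T ^ i * (2 + real i * (B * real p ^ Suc i))"
        using B0' p1 by (intro mult_left_mono add_left_mono power_increasing) auto
      finally have "real T * real (card (coll i)) \<le> real T * (real T ^ i * (2 + real i * (B * real p ^ Suc i)))"
        by (rule mult_left_mono) simp
      then show ?thesis using False by (simp add: mult.assoc)
    qed
    have "real (card (coll (Suc i))) \<le> real T ^ Suc i * (2 + real i * (B * real p ^ Suc i)) + real T ^ Suc i * (B * real p ^ Suc i)"
      using m1 m2 m3 by linarith
    also have "\<dots> = real T ^ Suc i * (2 + real (Suc i) * (B * real p ^ Suc i))" by (simp only: of_nat_Suc distrib_left distrib_right add.assoc mult_1_left) 
    finally show ?case by simp
  qed
  from this[of m] have "real (card (coll m)) \<le> real T ^ m * ((if m = 0 then 1 else 2) + real m * (B * real p ^ m))" by simp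
  also have "\<dots> \<le> real T ^ m * (2 + real m * (B * real p ^ m))" by (intro mult_left_mono add_right_mono) auto
  finally show ?thesis unfolding T_def .
qed

text \<open>The square of the number of words is at most \<open>card V\<close> times the number of
  collisions; one factor \<open>T^m\<close> cancels, and \<open>T \<ge> p\<close>.\<close>

lemma card_V_ge_aux:
  assumes B: "\<And>i. 1 \<le> i \<Longrightarrow> i \<le> m \<Longrightarrow> real (card (Wq (2 * i))) \<le> B * real p ^ (2 * i)"
  shows "real p ^ m \<le> real (card V) * (2 + real m * (B * real p ^ m))"
proof -
  define T where "T = card (gens p) - 1"
  have T: "p \<le> T" using card_gens_ge[OF p] by (auto simp: T_def)
  then have T0: "real T ^ m > 0" using p_gt_2[OF p] by simp
  have nn: "0 \<le> 2 + real m * (B * real p ^ m)"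
    proof -
    have "0 \<le> real T ^ m * (2 + real m * (B * real p ^ m))"
      using order_trans[OF of_nat_0_le_iff card_coll_le[OF B, of m]] unfolding T_def by simp
    then show ?thesis using T0 mult_le_cancel_left_pos[OF T0, of 0] by simp
  qed
  have "(\<lambda>ws. vt (qprod ws)) ` words p m \<subseteq> V" unfolding XV_eq[OF cop] using words_L2 by blast
  then have "card (words p m) ^ 2 \<le> card V * card (coll m)"
    using card_image_pairs_ge[OF finite_words conjunct1[OF card_V]] unfolding coll_def by blast
  then have "real (card (words p m)) ^ 2 \<le> real (card V) * real (card (coll m))" by (metis of_nat_le_iff of_nat_mult of_nat_power)
  moreover have "(real T ^ m) ^ 2 \<le> real (card (words p m)) ^ 2"
    using card_words_ge[OF p, of m] unfolding T_def[symmetric] by (intro power_mono) (metis of_nat_le_iff of_nat_power, simp)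
  moreover have "real (card V) * real (card (coll m)) \<le> real (card V) * (real T ^ m * (2 + real m * (B * real p ^ m)))"
    using card_coll_le[OF B] unfolding T_def by (intro mult_left_mono) auto
  ultimately have "(real T ^ m) ^ 2 \<le> real (card V) * (real T ^ m * (2 + real m * (B * real p ^ m)))" by linarith
  then have "real T ^ m * real T ^ m \<le> real T ^ m * (real (card V) * (2 + real m * (B * real p ^ m)))"
    by (simp only: power2_eq_square mult.left_commute mult.assoc)
  then have "real T ^ m \<le> real (card V) * (2 + real m * (B * real p ^ m))" using T0 mult_le_cancel_left_pos by blast
  moreover have "real p ^ m \<le> real T ^ m" using T by (intro power_mono) auto
  ultimately show ?thesis by linarith
qed

end

section \<open>The upper bound\<close>

text \<open>With \<open>P = p^m\<close> there are at most \<open>P / q^2\<close> values of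
  \<open>r\<close>, and \<open>r (P - q^2 r) \<le> (P / q)^2\<close> lets each contribute about
  \<open>P / q\<close> by the bound for three squares; together \<open>P^2 / q^3\<close>.\<close>

lemma card_closed_words_upper:
  fixes p :: nat and \<epsilon> :: real
  assumes e: "\<epsilon> > 0"
  obtains C where "C > 0"
    "\<And>q m. lps_graph p q \<Longrightarrow> m \<ge> 1 \<Longrightarrow> real (card (closed_words p q (2 * m))) \<le> C * real (p ^ m) ^ 2 / real q ^ 3 * (real (p ^ m) / real q) powr \<epsilon>"
proof -
  obtain C where C: "C > 0"
    "\<And>n::nat. n > 0 \<Longrightarrow> finite {(a,b,c). a\<^sup>2 + b\<^sup>2 + c\<^sup>2 = int n}"
    "\<And>n::nat. n > 0 \<Longrightarrow> real (card {(a,b,c). a\<^sup>2 + b\<^sup>2 + c\<^sup>2 = int n}) \<le> C * real n powr (1/2 + \<epsilon>/2)"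
    using card_three_squares_le[of "\<epsilon>/2"] e by auto
  have main: "real (card (closed_words p q (2 * m))) \<le> (2 * C) * real (p ^ m) ^ 2 / real q ^ 3 * (real (p ^ m) / real q) powr \<epsilon>"
    if g: "lps_graph p q" and m: "m \<ge> 1" for q m
  proof -
    interpret lps_graph p q by (rule g)
    define P where "P = p ^ m"
    define B where "B = nat \<lfloor>C * (real P / real q) powr (1 + \<epsilon>)\<rfloor>"
    have P0: "P > 0" using p_gt_2[OF p] by (simp add: P_def)
    have q0: "real q > 0" using q_gt_2 by simp
    have bound: "finite (sumsq3 (int (r * (P - q\<^sup>2 * r)))) \<and> card (sumsq3 (int (r * (P - q\<^sup>2 * r)))) \<le> B"
      if r: "r \<in> {1..P div q\<^sup>2}" "r * q\<^sup>2 < P" for r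
    proof -
      define n where "n = r * (P - q\<^sup>2 * r)"
      have n0: "n > 0" using r by (simp add: n_def mult.commute)
      have "real n = real r * (real P - real q ^ 2 * real r)"
        using r(2) by (simp add: n_def of_nat_diff mult.commute less_imp_le)
      then have "(real P / real q) ^ 2 - real n = (real P / real q) ^ 2 - real r * real P + (real q * real r) ^ 2" by (simp add: power2_eq_square algebra_simps)
      also have "\<dots> \<ge> 0"
      proof -
        have "0 \<le> (real P / real q - real q * real r) ^ 2 + real r * real P" by simp
        also have "(real P / real q - real q * real r) ^ 2 + real r * real P = (real P / real q) ^ 2 - real r * real P + (real q * real r) ^ 2"
          using q0 by (simp add: power2_eq_square field_simps)
        finally show ?thesis .
      qed
      finally have "real n \<le> (real P / real q) ^ 2" by simp
      then have "real n powr (1/2 + \<epsilon>/2) \<le> ((real P / real q) ^ 2) powr (1/2 + \<epsilon>/2)" using e by (intro powr_mono2) auto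
      also have "\<dots> = (real P / real q) powr (1 + \<epsilon>)"
      proof -
        have "(real P / real q) ^ 2 = (real P / real q) powr 2" using P0 q0 by (simp add: powr_numeral)
        then have "((real P / real q) ^ 2) powr (1/2 + \<epsilon>/2) = (real P / real q) powr (2 * (1/2 + \<epsilon>/2))" by (simp only: powr_powr)
        also have "2 * (1/2 + \<epsilon>/2) = 1 + \<epsilon>" by simp
        finally show ?thesis .
      qed
      finally have "C * real n powr (1/2 + \<epsilon>/2) \<le> C * (real P / real q) powr (1 + \<epsilon>)" using C(1) by simp
      then have "real (card (sumsq3 (int n))) \<le> C * (real P / real q) powr (1 + \<epsilon>)"
        using C(3)[OF n0] by (simp add: sumsq3_def)
      then have "card (sumsq3 (int n)) \<le> B" unfolding B_def by (simp add: le_nat_floor)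
      then show ?thesis using C(2)[OF n0] by (simp add: n_def sumsq3_def)
    qed
    have "card (Zq m) \<le> 2 * (P div q\<^sup>2 * B)"
      unfolding P_def by (rule card_Zq_le, rule bound[unfolded P_def])
    then have "card (Wq (2 * m)) \<le> 2 * (P div q\<^sup>2 * B)" using card_closed_words_le[OF m] by linarith
    then have "real (card (Wq (2 * m))) \<le> real (2 * (P div q\<^sup>2 * B))" by (simp only: of_nat_le_iff)
    also have "\<dots> = 2 * (real (P div q\<^sup>2) * real B)" by simp
    also have "\<dots> \<le> 2 * ((real P / real q ^ 2) * (C * (real P / real q) powr (1 + \<epsilon>)))"
    proof -
      have "real (P div q\<^sup>2) \<le> real P / real q ^ 2" using of_nat_div_le_of_nat[of P "q\<^sup>2"] by simp
      moreover have "real B \<le> C * (real P / real q) powr (1 + \<epsilon>)" using C(1) by (simp add: B_def)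
      ultimately show ?thesis by (intro mult_left_mono mult_mono) auto
    qed
    also have "\<dots> = (2 * C) * real P ^ 2 / real q ^ 3 * (real P / real q) powr \<epsilon>"
      using P0 q0 by (simp add: powr_add power2_eq_square power3_eq_cube)
    finally show ?thesis unfolding P_def .
  qed
  show ?thesis by (rule that[of "2 * C"]) (simp add: C(1), rule main)
qed

lemma card_V_lower:
  fixes p :: nat and \<epsilon> :: real
  assumes e: "\<epsilon> > 0"
  obtains Q :: nat where "\<And>q. lps_graph p q \<Longrightarrow> q \<ge> Q \<Longrightarrow> real q powr (3 - \<epsilon>) \<le> real (card (XV p q))"
proof -
  \<comment> \<open>The factor \<open>(p^i / q)^d\<close> costs \<open>3 d\<close>, because
    \<open>p^i \<le> p q^3 \<le> q^4\<close>; the remaining \<open>d\<close> absorbs the constants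
    and the length \<open>m = O(ln q)\<close>.\<close>
  define d where "d = \<epsilon> / 4"
  have d: "d > 0" using e by (simp add: d_def)
  obtain C where C: "C > 0"
    "\<And>q m. lps_graph p q \<Longrightarrow> m \<ge> 1 \<Longrightarrow> real (card (closed_words p q (2 * m))) \<le> C * real (p ^ m) ^ 2 / real q ^ 3 * (real (p ^ m) / real q) powr d"
    using card_closed_words_upper[OF d] by blast
  have "eventually (\<lambda>x::real. 2 + (1 + 3 * ln x / ln 2) * (C * real p * x powr (3 * d)) \<le> x powr (4 * d)) at_top"
    using C(1) d by real_asymp
  then obtain Q0 where Q0: "\<And>x. x \<ge> Q0 \<Longrightarrow> 2 + (1 + 3 * ln x / ln 2) * (C * real p * x powr (3 * d)) \<le> x powr (4 * d)"
    by (auto simp: eventually_at_top_linorder)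
  have "real q powr (3 - \<epsilon>) \<le> real (card (XV p q))" if g: "lps_graph p q" and qQ: "q \<ge> nat \<lceil>Q0\<rceil>" for q
  proof -
    interpret lps_graph p q by (rule g)
    have q0: "real q > 0" "real q \<ge> 1" using q_gt_2 by simp_all
    have p2: "p \<ge> 2" using p_gt_2[OF p] by simp
    define m where "m = (LEAST m. q ^ 3 \<le> p ^ m)"
    have ex: "q ^ 3 \<le> p ^ (q ^ 3)" using less_exp[of "q^3"] power_mono[OF p2, of "q^3"] by linarith
    then have m: "q ^ 3 \<le> p ^ m" unfolding m_def by (rule LeastI)
    have "q ^ 3 > 1" using q_gt_2 by (intro one_less_power) auto
    then have m1: "m \<ge> 1" using m by (cases m) auto
    have "\<not> q ^ 3 \<le> p ^ (m - 1)" using not_less_Least[of "m - 1" "\<lambda>m. q ^ 3 \<le> p ^ m"] m1 unfolding m_def[symmetric] by simp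
    then have mm: "p ^ (m - 1) < q ^ 3" by simp
    then have pm: "p ^ m < p * q ^ 3" using m1 p2 by (cases m) auto
    have mbound: "real m \<le> 1 + 3 * ln (real q) / ln 2"
    proof -
      have "2 ^ (m - 1) \<le> p ^ (m - 1)" using p2 by (rule power_mono) simp
      then have "2 ^ (m - 1) \<le> q ^ 3" using mm by linarith
      then have "real (2 ^ (m - 1)) \<le> real (q ^ 3)" by (simp only: of_nat_le_iff)
      then have "ln (real (2 ^ (m - 1))) \<le> ln (real (q ^ 3))" using q0 by (subst ln_le_cancel_iff) auto
      then have "real (m - 1) * ln 2 \<le> 3 * ln (real q)" using q0 by (simp add: ln_realpow)
      then have "real (m - 1) \<le> 3 * ln (real q) / ln 2" by (simp add: field_simps)
      then show ?thesis using m1 by (simp add: of_nat_diff)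
    qed
    define B where "B = C / real q ^ 3 * real q powr (3 * d)"
    have B0: "B \<ge> 0" using C(1) by (simp add: B_def)
    have B: "real (card (Wq (2 * i))) \<le> B * real p ^ (2 * i)" if i: "1 \<le> i" "i \<le> m" for i
    proof -
      have "p ^ i \<le> p ^ m" using i p2 by (intro power_increasing) auto
      then have "p ^ i \<le> q * q ^ 3" using pm qp mult_le_mono1[of p q "q^3"] by linarith
      then have "real (p ^ i) \<le> real (q * q ^ 3)" by (simp only: of_nat_le_iff)
      then have "real (p ^ i) / real q \<le> real q ^ 3" using q0 by (simp add: field_simps)
      then have "(real (p ^ i) / real q) powr d \<le> (real q ^ 3) powr d" using d q0 by (intro powr_mono2) auto
      also have "\<dots> = (real q powr 3) powr d" using q0 by (simp add: powr_numeral)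
      also have "\<dots> = real q powr (3 * d)" by (simp only: powr_powr)
      finally have "C * real (p ^ i) ^ 2 / real q ^ 3 * (real (p ^ i) / real q) powr d \<le> C * real (p ^ i) ^ 2 / real q ^ 3 * real q powr (3 * d)"
        using C(1) by (intro mult_left_mono) auto
      also have "\<dots> = B * real p ^ (2 * i)" by (simp add: B_def power_mult[symmetric] mult.commute)
      finally show ?thesis using C(2)[OF g i(1)] by linarith
    qed
    have "real q ^ 3 \<le> real p ^ m" using m by (metis of_nat_le_iff of_nat_power)
    also have "\<dots> \<le> real (card V) * (2 + real m * (B * real p ^ m))" by (rule card_V_ge_aux[OF B])
    also have "\<dots> \<le> real (card V) * (2 + (1 + 3 * ln (real q) / ln 2) * (C * real p * real q powr (3 * d)))"
    proof -
      have "real (p ^ m) \<le> real (p * q ^ 3)" using pm by (simp only: of_nat_le_iff less_imp_le)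
      then have "B * real p ^ m \<le> B * (real p * real q ^ 3)" using B0 by (intro mult_left_mono) auto
      also have "\<dots> = C * real p * real q powr (3 * d)" using q0 by (simp add: B_def)
      finally have e: "B * real p ^ m \<le> C * real p * real q powr (3 * d)" .
      have "real m * (B * real p ^ m) \<le> (1 + 3 * ln (real q) / ln 2) * (C * real p * real q powr (3 * d))"
        by (rule mult_mono[OF mbound e]) (use q0 B0 in auto)
      then show ?thesis by (intro mult_left_mono) auto
    qed
    also have "\<dots> \<le> real (card V) * real q powr (4 * d)"
    proof (rule mult_left_mono)
      have "Q0 \<le> real q" using qQ by linarith
      then show "2 + (1 + 3 * ln (real q) / ln 2) * (C * real p * real q powr (3 * d)) \<le> real q powr (4 * d)" by (rule Q0)
    qed simp
    finally have "real q ^ 3 \<le> real (card V) * real q powr (4 * d)" .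
    moreover have "real q ^ 3 = real q powr (3 - \<epsilon>) * real q powr (4 * d)"
      using q0 by (simp add: d_def powr_add[symmetric] powr_numeral)
    ultimately show ?thesis using q0 by simp
  qed
  then show ?thesis using that by blast
qed

lemma finite_sumsq3: "n > 0 \<Longrightarrow> finite (sumsq3 (int n))"
proof -
  assume n: "n > 0"
  obtain C where "C > (0::real)" "\<And>n::nat. n > 0 \<Longrightarrow> finite {(a,b,c). a\<^sup>2 + b\<^sup>2 + c\<^sup>2 = int n}"
    using card_three_squares_le[of 1] by (metis zero_less_one)
  then show ?thesis using n unfolding sumsq3_def by blast
qed

context lps_graph
begin

lemma girth_eqI:
  assumes "m \<ge> 1" "Wq (2 * m) \<noteq> {}" "\<And>j. 1 \<le> j \<Longrightarrow> j < m \<Longrightarrow> Wq (2 * j) = {}"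
  shows "girth V E = 2 * m"
  unfolding girth_eq
proof (rule Least_equality)
  show "2 * m \<ge> 1 \<and> Wq (2 * m) \<noteq> {}" using assms by simp
next
  fix n assume n: "n \<ge> 1 \<and> Wq n \<noteq> {}"
  then obtain ws where "ws \<in> Wq n" by blast
  then obtain k where k: "n = 2 * k" using closed_words_even n by blast
  then show "2 * m \<le> n" using n assms(3)[of k] by (cases "k < m") auto
qed

text \<open>The quaternions \<open>p^m - 4q^2 + 2q(ai + bj + ck)\<close>, with \<open>a^2 + b^2 + c^2 = 2(p^m - 2q^2)\<close>.\<close>
lemma three_squares_r2:
  assumes "2 * q\<^sup>2 < p ^ m"
  obtains a b c where "int (2 * (p ^ m - q\<^sup>2 * 2)) = a\<^sup>2 + b\<^sup>2 + c\<^sup>2" "\<And>d. d dvd a \<Longrightarrow> d dvd b \<Longrightarrow> d dvd c \<Longrightarrow> is_unit d"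
proof -
  have "odd (p ^ m)" using p_odd[OF p] by simp
  then have "odd (p ^ m - q\<^sup>2 * 2)" using assms by simp
  then obtain k where "p ^ m - q\<^sup>2 * 2 = 2 * k + 1" by (rule oddE)
  then have "2 * (p ^ m - q\<^sup>2 * 2) = 4 * k + 2" by simp
  then have "2 * (p ^ m - q\<^sup>2 * 2) mod 4 = 2" by presburger
  then obtain a b c where abc: "int (2 * (p ^ m - q\<^sup>2 * 2)) = a\<^sup>2 + b\<^sup>2 + c\<^sup>2" "\<And>d. d dvd a \<Longrightarrow> d dvd b \<Longrightarrow> d dvd c \<Longrightarrow> is_unit d"
    by (rule three_squares_2mod4) blast
  show ?thesis by (rule that[OF abc(1)]) (rule abc(2); assumption)
qed

lemma girth_bound:
  assumes "2 * q\<^sup>2 < p ^ m1" "m1 \<ge> 1"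
  obtains m where "1 \<le> m" "m \<le> m1" "girth V E = 2 * m" "Wq (2 * m) \<noteq> {}"
    "\<And>j. 1 \<le> j \<Longrightarrow> j < m \<Longrightarrow> Wq (2 * j) = {}"
proof -
  obtain a b c where abc: "int (2 * (p ^ m1 - q\<^sup>2 * 2)) = a\<^sup>2 + b\<^sup>2 + c\<^sup>2" using three_squares_r2[OF assms(1)] by metis
  have "finite (sumsq3 (int (2 * (p ^ m1 - q\<^sup>2 * 2))))" using assms by (intro finite_sumsq3) simp
  moreover have "(a,b,c) \<in> sumsq3 (int (2 * (p ^ m1 - q\<^sup>2 * 2)))" using abc by (simp add: sumsq3_def)
  ultimately have "card (sumsq3 (int (2 * (p ^ m1 - q\<^sup>2 * 2)))) > 0" by (auto simp: card_gt_0_iff)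
  then have "card (Zq m1) > 0" using card_Zq_ge[of 2 m1] assms(1) by simp
  then obtain x where "x \<in> Zq m1" by (auto simp: card_gt_0_iff)
  then obtain j where j: "1 \<le> j" "j \<le> m1" "Wq (2 * j) \<noteq> {}" using Zq_closed_word by blast
  define m where "m = (LEAST j. 1 \<le> j \<and> Wq (2 * j) \<noteq> {})"
  have m: "1 \<le> m \<and> Wq (2 * m) \<noteq> {}" unfolding m_def by (rule LeastI[of _ j]) (use j in simp)
  have le: "m \<le> m1" unfolding m_def by (rule order_trans[OF Least_le j(2)]) (use j in simp)
  have min: "Wq (2 * i) = {}" if "1 \<le> i" "i < m" for i using not_less_Least[of i] that unfolding m_def by blast
  show ?thesis by (rule that[of m]) (use m le min girth_eqI in auto)
qed

end

lemma kiss_upper: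
  fixes p :: nat and \<epsilon> :: real
  assumes e: "\<epsilon> > 0"
  obtains Q :: nat where "\<And>q. lps_graph p q \<Longrightarrow> q \<ge> Q \<Longrightarrow> real (kiss (XV p q) (XE p q)) \<le> real (card (XV p q)) powr (4/3 + \<epsilon>)"
proof -
  \<comment> \<open>The word count is at most \<open>q^(1 + 3 d)\<close> and the number of vertices
    at least \<open>q^(3 - d)\<close>; \<open>d\<close> is chosen to make
    \<open>(1 + 3 d) / (3 - d) \<le> 1/3 + \<epsilon>\<close>.\<close>
  define d where "d = min (\<epsilon> / 2) (1 / 2)"
  have d: "d > 0" "d \<le> \<epsilon> / 2" "d \<le> 1 / 2" using e by (auto simp: d_def)
  obtain C where C: "C > 0"
    "\<And>q m. lps_graph p q \<Longrightarrow> m \<ge> 1 \<Longrightarrow> real (card (closed_words p q (2 * m))) \<le> C * real (p ^ m) ^ 2 / real q ^ 3 * (real (p ^ m) / real q) powr d"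
    using card_closed_words_upper[OF d(1)] by blast
  obtain Q1 where Q1: "\<And>q. lps_graph p q \<Longrightarrow> q \<ge> Q1 \<Longrightarrow> real q powr (3 - d) \<le> real (card (XV p q))"
    using card_V_lower[OF d(1)] by blast
  have "eventually (\<lambda>x::real. C * (2 * real p * x\<^sup>2) ^ 2 / x ^ 3 * (2 * real p * x) powr d \<le> x powr (1 + 3 * d)) at_top"
  proof (cases "p = 0")
    case True
    then show ?thesis by simp
  next
    case False
    then have "real p > 0" by simp
    then show ?thesis using C(1) d(1) by real_asymp
  qed
  then obtain Q0 where Q0: "\<And>x. x \<ge> Q0 \<Longrightarrow> C * (2 * real p * x\<^sup>2) ^ 2 / x ^ 3 * (2 * real p * x) powr d \<le> x powr (1 + 3 * d)"
    by (auto simp: eventually_at_top_linorder)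
  have "real (kiss (XV p q) (XE p q)) \<le> real (card (XV p q)) powr (4/3 + \<epsilon>)"
    if g: "lps_graph p q" and qQ: "q \<ge> max Q1 (nat \<lceil>Q0\<rceil>)" for q
  proof -
    interpret lps_graph p q by (rule g)
    have q0: "real q > 1" using q_gt_2 by simp
    have p2: "p \<ge> 2" using p_gt_2[OF p] by simp
    define m1 where "m1 = (LEAST m. 2 * q\<^sup>2 < p ^ m)"
    have ex: "2 * q\<^sup>2 < p ^ (2 * q\<^sup>2)" using less_exp[of "2 * q\<^sup>2"] power_mono[OF p2, of "2 * q\<^sup>2"] by linarith
    then have m: "2 * q\<^sup>2 < p ^ m1" unfolding m1_def by (rule LeastI)
    have m1: "m1 \<ge> 1" using m q_gt_2 by (cases m1) auto
    have "\<not> 2 * q\<^sup>2 < p ^ (m1 - 1)" using not_less_Least[of "m1 - 1" "\<lambda>m. 2 * q\<^sup>2 < p ^ m"] m1 unfolding m1_def[symmetric] by simp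
    then have pm: "p ^ m1 \<le> p * (2 * q\<^sup>2)" using m1 p2 by (cases m1) auto
    obtain m where m: "1 \<le> m" "m \<le> m1" "girth V E = 2 * m" using girth_bound[OF m m1] by metis
    have "p ^ m \<le> p ^ m1" using m p2 by (intro power_increasing) auto
    then have "p ^ m \<le> 2 * p * q\<^sup>2" using pm by (simp add: mult.left_commute mult.assoc)
    then have "real (p ^ m) \<le> real (2 * p * q\<^sup>2)" by (simp only: of_nat_le_iff)
    then have P: "real (p ^ m) \<le> 2 * real p * real q ^ 2" by simp
    then have P2: "real (p ^ m) / real q \<le> 2 * real p * real q" using q0 by (simp add: field_simps power2_eq_square)
    have "real (card (Wq (2 * m))) \<le> C * real (p ^ m) ^ 2 / real q ^ 3 * (real (p ^ m) / real q) powr d" by (rule C(2)[OF g m(1)])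
    also have "\<dots> \<le> C * (2 * real p * real q ^ 2) ^ 2 / real q ^ 3 * (2 * real p * real q) powr d"
      using C(1) d(1) P P2 q0 by (intro mult_mono divide_right_mono mult_left_mono power_mono powr_mono2) auto
    also have "\<dots> \<le> real q powr (1 + 3 * d)" using qQ by (intro Q0) linarith
    finally have W: "real (card (Wq (2 * m))) \<le> real q powr (1 + 3 * d)" .
    define N where "N = real (card V)"
    have N: "real q powr (3 - d) \<le> N" unfolding N_def using Q1[OF g] qQ by simp
    have N1: "N \<ge> 1"
    proof -
      have "1 \<le> real q powr (3 - d)" using q0 d by (intro ge_one_powr_ge_zero) auto
      then show ?thesis using N by linarith
    qed
    have "real q powr (1 + 3 * d) = (real q powr (3 - d)) powr ((1 + 3 * d) / (3 - d))" using d by (simp add: powr_powr)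
    also have "\<dots> \<le> N powr ((1 + 3 * d) / (3 - d))" using N d by (intro powr_mono2) auto
    also have "\<dots> \<le> N powr (1/3 + \<epsilon>)"
    proof (rule powr_mono[OF _ N1])
      have "d * \<epsilon> \<le> (1/2) * \<epsilon>" using d e by (intro mult_right_mono) auto
      moreover have "(1/3 + \<epsilon>) * (3 - d) = 1 - d / 3 + 3 * \<epsilon> - d * \<epsilon>" by (simp add: field_simps)
      ultimately have "1 + 3 * d \<le> (1/3 + \<epsilon>) * (3 - d)" using d by linarith
      then show "(1 + 3 * d) / (3 - d) \<le> 1/3 + \<epsilon>" using d by (simp add: pos_divide_le_eq)
    qed
    finally have W': "real (card (Wq (2 * m))) \<le> N powr (1/3 + \<epsilon>)" using W by linarith
    have "kiss V E \<le> card V * card (Wq (2 * m))" using kiss_le m by simp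
    then have "real (kiss V E) \<le> N * real (card (Wq (2 * m)))" unfolding N_def by (metis of_nat_le_iff of_nat_mult)
    also have "\<dots> \<le> N * N powr (1/3 + \<epsilon>)" using W' N1 by (intro mult_left_mono) auto
    also have "\<dots> = N powr (4/3 + \<epsilon>)" using N1 by (simp add: powr_mult_base add.commute add.left_commute)
    finally show ?thesis unfolding N_def .
  qed
  then show ?thesis using that by blast
qed

section \<open>The lower bound\<close>

text \<open>Chebyshev's inequality for the second moment. With the threshold
  \<open>card L / 4\<close>, at least about three eighths of the primes split for every other
  \<open>x\<close>, more than the quarter used later.\<close>

lemma card_large_negative_sums:
  fixes a B :: int and L :: "nat set" and x0 M X :: nat
  assumes L: "L \<subseteq> {x0<..M * x0}" "\<And>l. l \<in> L \<Longrightarrow> prime l \<and> l > 2 \<and> \<not> int l dvd a \<and> \<not> int l dvd B" and x0: "x0 > 0" and ne: "L \<noteq> {}"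
  shows "real (card {x. x < X \<and> real_of_int (\<Sum>l\<in>L. Legendre ((a * int x)\<^sup>2 - B) (int l)) < - (real (card L) / 4)})
     \<le> 16 * (real X / real (card L) + real M ^ 2 * real X / real (card L) ^ 2 + real (M * x0) ^ 2)"
proof -
  define f where "f x = real_of_int (\<Sum>l\<in>L. Legendre ((a * int x)\<^sup>2 - B) (int l))" for x
  have finL: "finite L" using L(1) finite_subset by blast
  define c where "c = real (card L)"
  have c0: "c > 0" using finL ne by (simp add: c_def card_gt_0_iff)
  let ?A = "{x. x < X \<and> f x < - (c / 4)}"
  have "real (card ?A) * (c / 4)\<^sup>2 = (\<Sum>x\<in>?A. (c / 4)\<^sup>2)" by simp
  also have "\<dots> \<le> (\<Sum>x\<in>?A. (f x)\<^sup>2)"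
  proof (rule sum_mono)
    fix x assume "x \<in> ?A"
    then have "c / 4 \<le> - f x" by simp
    then have "(c / 4)\<^sup>2 \<le> (- f x)\<^sup>2" using c0 by (intro power_mono) auto
    then show "(c / 4)\<^sup>2 \<le> (f x)\<^sup>2" by simp
  qed
  also have "\<dots> \<le> (\<Sum>x<X. (f x)\<^sup>2)" by (rule sum_mono2) auto
  also have "\<dots> \<le> c * real X + real M ^ 2 * real X + c ^ 2 * real (M * x0) ^ 2"
    unfolding f_def c_def by (rule legendre_second_moment[OF L x0])
  finally have "real (card ?A) \<le> (c * real X + real M ^ 2 * real X + c ^ 2 * real (M * x0) ^ 2) / (c / 4)\<^sup>2"
    using c0 by (simp add: pos_le_divide_eq)
  also have "\<dots> = 16 * (real X / c + real M ^ 2 * real X / c ^ 2 + real (M * x0) ^ 2)"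
    using c0 by (simp add: field_simps power2_eq_square)
  finally show ?thesis unfolding f_def c_def .
qed

lemma two_power_card_prime_factors_le: "n > 0 \<Longrightarrow> 2 ^ card (prime_factors n) \<le> (n::nat)"
proof -
  assume n: "n > 0"
  have "(2::nat) ^ card (prime_factors n) = (\<Prod>l\<in>prime_factors n. 2)" by simp
  also have "\<dots> \<le> (\<Prod>l\<in>prime_factors n. l ^ multiplicity l n)"
  proof (rule prod_mono)
    fix l assume l: "l \<in> prime_factors n"
    then have "2 \<le> l" by (auto simp: prime_factors_multiplicity prime_ge_2_nat)
    moreover have "1 \<le> multiplicity l n" using l by (simp add: prime_factors_multiplicity)
    ultimately show "0 \<le> (2::nat) \<and> 2 \<le> l ^ multiplicity l n"
      using power_increasing[of 1 "multiplicity l n" l] by simp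
  qed
  also have "\<dots> = n" using n prod_prime_factors[of n] by simp
  finally show ?thesis .
qed

text \<open>For each \<open>l\<close> the symbol is at most twice the indicator of splitting, plus
  the indicator of dividing \<open>n\<close>, minus 1. This is summed over \<open>L\<close>; at most
  \<open>log 2 n\<close> primes divide \<open>n\<close>.\<close>

lemma card_split_primes_ge:
  assumes L: "finite L" "\<And>l. l \<in> L \<Longrightarrow> prime l \<and> l > 2" and n: "n > 0"
    and s: "real_of_int (\<Sum>l\<in>L. Legendre (- int n) (int l)) \<ge> - (real (card L) / 4)"
  shows "3 / 4 * real (card L) - log 2 (real n) \<le> 2 * real (card {l \<in> L. split_prime (int n) l})"
proof -
  let ?S = "{l \<in> L. split_prime (int n) l}"
  let ?D = "{l \<in> L. l dvd n}"
  have "Legendre (- int n) (int l) \<le> 2 * (if l \<in> ?S then 1 else 0) + (if l \<in> ?D then 1 else 0) - 1" if l: "l \<in> L" for l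
  proof -
    have pl: "prime l" "l > 2" using L(2)[OF l] by auto
    have zero: "Legendre (- int n) (int l) = 0 \<longleftrightarrow> l dvd n"
      by (simp add: Legendre_def cong_0_iff)
    have one: "split_prime (int n) l" if e: "Legendre (- int n) (int l) = 1"
    proof -
      have "\<not> l dvd n" using zero e by auto
      moreover have "QuadRes (int l) (- int n)" using e by (auto simp: Legendre_def split: if_splits)
      then obtain z where "[z\<^sup>2 = - int n] (mod int l)" by (auto simp: QuadRes_def)
      then have "int l dvd z\<^sup>2 + int n" by (simp add: cong_iff_dvd_diff)
      ultimately show ?thesis using pl by (auto simp: split_prime_def)
    qed
    show ?thesis using zero one l Legendre_cases[of "- int n" "int l"] by auto
  qed
  then have "(\<Sum>l\<in>L. Legendre (- int n) (int l)) \<le> (\<Sum>l\<in>L. 2 * (if l \<in> ?S then 1 else 0) + (if l \<in> ?D then 1 else 0) - 1)"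
    by (rule sum_mono)
  also have "\<dots> = 2 * (\<Sum>l\<in>L. if l \<in> ?S then 1 else 0) + (\<Sum>l\<in>L. if l \<in> ?D then 1 else 0) - int (card L)"
    by (simp only: sum_subtractf sum.distrib sum_distrib_left[symmetric]) simp
  also have "(\<Sum>l\<in>L. if l \<in> ?S then 1 else 0) = int (card ?S)" using L(1) by (simp add: sum.If_cases Int_def)
  also have "(\<Sum>l\<in>L. if l \<in> ?D then 1 else 0) = int (card ?D)" using L(1) by (simp add: sum.If_cases Int_def)
  finally have "real_of_int (\<Sum>l\<in>L. Legendre (- int n) (int l)) \<le> real_of_int (2 * int (card ?S) + int (card ?D) - int (card L))"
    by (simp only: of_int_le_iff)
  moreover have "real (card ?D) \<le> log 2 (real n)"
  proof -
    have "?D \<subseteq> prime_factors n" using L(2) n by (auto simp: prime_factors_dvd)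
    then have "card ?D \<le> card (prime_factors n)" by (intro card_mono) auto
    then have "(2::nat) ^ card ?D \<le> 2 ^ card (prime_factors n)" by (intro power_increasing) auto
    then have "2 ^ card ?D \<le> n" using two_power_card_prime_factors_le[OF n] by linarith
    then have "real (2 ^ card ?D) \<le> real n" by (simp only: of_nat_le_iff)
    then show ?thesis using n by (simp add: le_log_iff powr_realpow)
  qed
  ultimately show ?thesis using s by simp
qed

text \<open>Two such \<open>q\<close> have values \<open>r q^2\<close> less than \<open>D\<close>
  apart, and both exceed \<open>x\<close>, so they differ by at most \<open>D / x\<close>.\<close>

lemma card_near_square_le:
  fixes x r P D :: nat
  assumes x: "x > 0" and r: "r > 0"
  shows "finite {q. x < q \<and> r * q\<^sup>2 < P \<and> P < r * q\<^sup>2 + D} \<and> card {q. x < q \<and> r * q\<^sup>2 < P \<and> P < r * q\<^sup>2 + D} \<le> D div x + 1"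
proof (cases "{q. x < q \<and> r * q\<^sup>2 < P \<and> P < r * q\<^sup>2 + D} = {}")
  case True
  show ?thesis unfolding True by simp
next
  case False
  define A where "A = {q. x < q \<and> r * q\<^sup>2 < P \<and> P < r * q\<^sup>2 + D}"
  define a where "a = (LEAST q. q \<in> A)"
  have aA: "a \<in> A" unfolding a_def using False by (metis A_def LeastI_ex ex_in_conv)
  have "q \<in> {a..a + D div x}" if q: "q \<in> A" for q
  proof -
    have aq: "a \<le> q" unfolding a_def using q by (rule Least_le)
    then obtain k where k: "q = a + k" using le_Suc_ex by blast
    have "1 * (x * k) \<le> r * ((a + q) * k)" using q r by (intro mult_mono) (auto simp: A_def)
    moreover have "r * q\<^sup>2 = r * a\<^sup>2 + r * ((a + q) * k)" unfolding k by (simp add: power2_eq_square algebra_simps)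
    moreover have "r * q\<^sup>2 < P" "P < r * a\<^sup>2 + D" using q aA by (auto simp: A_def)
    ultimately have "x * k \<le> D" by linarith
    then have "k \<le> D div x" using x by (simp add: less_eq_div_iff_mult_less_eq mult.commute)
    then show ?thesis using k by simp
  qed
  then have s: "A \<subseteq> {a..a + D div x}" by blast
  have "card A \<le> card {a..a + D div x}" by (rule card_mono[OF _ s]) simp
  moreover have "finite A" by (rule finite_subset[OF s]) simp
  ultimately show ?thesis unfolding A_def by simp
qed

lemma card_residue_class_le:
  fixes N Y r :: nat
  assumes N: "N > 0"
  shows "card {q. q < Y \<and> q mod N = r} \<le> Y div N + 1"
proof -
  have "card {q. q < Y \<and> q mod N = r} \<le> card {..Y div N}"
  proof (rule card_inj_on_le)
    show "inj_on (\<lambda>q. q div N) {q. q < Y \<and> q mod N = r}" by (rule inj_onI) (metis (mono_tags, lifting) div_mod_decomp mem_Collect_eq)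
    show "(\<lambda>q. q div N) ` {q. q < Y \<and> q mod N = r} \<subseteq> {..Y div N}" by (auto intro: div_le_mono)
  qed simp
  then show ?thesis by simp
qed

text \<open>For \<open>h \<le> H2\<close> we count \<open>q\<close> modulo \<open>h^2\<close>; for \<open>h > H2\<close> the cofactor \<open>(p^g - q^2)/h^2\<close> is small and
  we count representations of \<open>p^g\<close> by binary forms.\<close>
lemma card_square_divisor_le:
  fixes p g Y H H2 :: nat
  assumes p: "prime p" and H2: "H2 > 0"
  defines "A \<equiv> {q. q < Y \<and> prime q \<and> q \<noteq> p \<and> q\<^sup>2 < p ^ g \<and> (\<exists>h>H. h\<^sup>2 dvd p ^ g - q\<^sup>2)}"
  shows "finite A \<and> card A \<le> (\<Sum>h\<in>{H<..H2}. (Y div h\<^sup>2 + 1) * (3 * ndiv (h\<^sup>2))) + (p ^ g div H2\<^sup>2) * (12 * (g + 1))"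
proof -
  define P where "P = p ^ g"
  have P0: "P > 0" using p by (simp add: P_def prime_gt_0_nat)
  define A1 where "A1 h = {q. q < Y \<and> prime q \<and> q \<noteq> p \<and> q\<^sup>2 < P \<and> h\<^sup>2 dvd P - q\<^sup>2}" for h
  define R where "R n = {(a,b). a\<^sup>2 + int n * b\<^sup>2 = int P \<and> coprime b (int P)}" for n :: nat
  \<comment> \<open>As \<open>q\<close> is a prime other than \<open>p\<close>, the number
    \<open>p^g - q^2\<close> is prime to \<open>p\<close>. This supplies the coprimality required
    for counting both the roots modulo \<open>h^2\<close> and the representations of
    \<open>p^g\<close> by binary forms.\<close>
  have cop: "coprime h P \<and> coprime n P" if q: "prime q" "q \<noteq> p" "q\<^sup>2 < P" and e: "P - q\<^sup>2 = h\<^sup>2 * n" for q h n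
  proof -
    have nd: "\<not> p dvd q" using p q primes_dvd_imp_eq by blast
    have "P = q\<^sup>2 + h\<^sup>2 * n" using e q(3) by simp
    moreover have "g \<noteq> 0"
    proof
      assume "g = 0"
      then have "q\<^sup>2 < 1" using q(3) by (simp add: P_def)
      then show False using q(1) by simp
    qed
    then have "p dvd P" by (simp add: P_def)
    ultimately have "\<not> p dvd h\<^sup>2 * n" using nd p by (metis dvd_add_left_iff prime_dvd_power)
    then have "\<not> p dvd h" "\<not> p dvd n" by (auto simp: power2_eq_square)
    then show ?thesis using prime_imp_coprime[OF p] unfolding P_def by (simp add: coprime_commute)
  qed
  have R: "finite (R n) \<and> card (R n) \<le> 12 * (g + 1)" if n: "n > 0" "coprime n P" for n
    using card_binary_reps_le[of P "int n"] n P0 ndiv_prime_power[OF p, of g] unfolding R_def P_def by simp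
  have c1: "finite (A1 h) \<and> card (A1 h) \<le> (Y div h\<^sup>2 + 1) * (3 * ndiv (h\<^sup>2))" if h: "h > 0" for h
  proof (cases "coprime h P")
    case False
    have "A1 h = {}"
    proof (rule ccontr)
      assume "A1 h \<noteq> {}"
      then obtain q where "prime q" "q \<noteq> p" "q\<^sup>2 < P" "h\<^sup>2 dvd P - q\<^sup>2" by (auto simp: A1_def)
      then show False using cop False by (metis dvdE)
    qed
    then show ?thesis by simp
  next
    case True
    let ?B = "{z \<in> {0..<int (h\<^sup>2)}. int (h\<^sup>2) dvd z\<^sup>2 - int P}"
    have h2: "h\<^sup>2 > 0" using h by simp
    have "card ?B \<le> 3 * ndiv (h\<^sup>2)"
      by (rule card_square_roots_le[OF h2]) (use True in \<open>simp add: coprime_commute\<close>)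
    have finB: "finite ?B" by (rule finite_subset[of _ "{0..<int (h\<^sup>2)}"]) auto
    have im: "(\<lambda>q. int (q mod h\<^sup>2)) ` A1 h \<subseteq> ?B"
    proof (rule image_subsetI)
      fix q assume q: "q \<in> A1 h"
      then have "int (h\<^sup>2) dvd int (P - q\<^sup>2)" unfolding A1_def by (simp only: mem_Collect_eq of_nat_dvd_iff)
      moreover have "int (P - q\<^sup>2) = int P - (int q)\<^sup>2" using q by (simp add: A1_def of_nat_diff)
      ultimately have "[int P = (int q)\<^sup>2] (mod int (h\<^sup>2))" by (simp add: cong_iff_dvd_diff)
      moreover have "[(int q mod int (h\<^sup>2))\<^sup>2 = (int q)\<^sup>2] (mod int (h\<^sup>2))" by (intro cong_pow) simp
      ultimately have "[(int q mod int (h\<^sup>2))\<^sup>2 = int P] (mod int (h\<^sup>2))" using cong_sym cong_trans by blast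
      then have "int (h\<^sup>2) dvd (int (q mod h\<^sup>2))\<^sup>2 - int P" unfolding zmod_int cong_iff_dvd_diff .
      moreover have "int (q mod h\<^sup>2) \<in> {0..<int (h\<^sup>2)}" using h2 by (simp only: atLeastLessThan_iff of_nat_0_le_iff of_nat_less_iff mod_less_divisor)
      ultimately show "int (q mod h\<^sup>2) \<in> ?B" by blast
    qed
    have fib: "finite {q \<in> A1 h. int (q mod h\<^sup>2) = b} \<and> card {q \<in> A1 h. int (q mod h\<^sup>2) = b} \<le> Y div h\<^sup>2 + 1" if "b \<in> ?B" for b
    proof -
      have s: "{q \<in> A1 h. int (q mod h\<^sup>2) = b} \<subseteq> {q. q < Y \<and> q mod h\<^sup>2 = nat b}" by (auto simp: A1_def)
      have f: "finite {q. q < Y \<and> q mod h\<^sup>2 = nat b}" by (rule finite_subset[of _ "{..<Y}"]) auto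
      show ?thesis using finite_subset[OF s f] card_mono[OF f s] card_residue_class_le[OF h2, of Y "nat b"] by linarith
    qed
    have "card (A1 h) \<le> (Y div h\<^sup>2 + 1) * card ?B" by (rule card_fibers_le(2)[OF finB im fib])
    also have "\<dots> \<le> (Y div h\<^sup>2 + 1) * (3 * ndiv (h\<^sup>2))" by (rule mult_left_mono) (fact, simp)
    finally show ?thesis using card_fibers_le(1)[OF finB im fib] by blast
  qed
  let ?N = "{n \<in> {1..P div H2\<^sup>2}. coprime n P}"
  have sub: "A \<subseteq> (\<Union>h\<in>{H<..H2}. A1 h) \<union> (\<Union>n\<in>?N. (\<lambda>(a,b). nat a) ` R n)"
  proof
    fix q assume "q \<in> A"
    then obtain h where q: "q < Y" "prime q" "q \<noteq> p" "q\<^sup>2 < P" and h: "h > H" "h\<^sup>2 dvd P - q\<^sup>2"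
      unfolding A_def P_def by blast
    show "q \<in> (\<Union>h\<in>{H<..H2}. A1 h) \<union> (\<Union>n\<in>?N. (\<lambda>(a,b). nat a) ` R n)"
    proof (cases "h \<le> H2")
      case True
      then have "q \<in> A1 h" "h \<in> {H<..H2}" using q h by (auto simp: A1_def)
      then show ?thesis by blast
    next
      case False
      obtain n where n: "P - q\<^sup>2 = h\<^sup>2 * n" using h(2) by (rule dvdE)
      then have Pn: "P = q\<^sup>2 + h\<^sup>2 * n" using q(4) by simp
      have n0: "n > 0" using n q(4) by (cases n) auto
      have "H2\<^sup>2 * n \<le> h\<^sup>2 * n" using False by (intro mult_right_mono power_mono) auto
      then have "n * H2\<^sup>2 \<le> P" unfolding Pn by (simp only: mult.commute[of n])
      then have "n \<le> P div H2\<^sup>2" using H2 by (simp add: less_eq_div_iff_mult_less_eq)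
      moreover have c: "coprime h P" "coprime n P" using cop[OF q(2,3,4) n] by auto
      ultimately have "n \<in> ?N" using n0 by simp
      moreover have "(int q, int h) \<in> R n"
      proof -
        have "int (q\<^sup>2 + n * h\<^sup>2) = int P" unfolding Pn by (simp only: mult.commute)
        then show ?thesis using c(1) by (simp add: R_def)
      qed
      then have "q \<in> (\<lambda>(a,b). nat a) ` R n" by (rule rev_image_eqI) simp
      ultimately show ?thesis by blast
    qed
  qed
  have finN: "finite ?N" by simp
  have f1: "finite (\<Union>h\<in>{H<..H2}. A1 h)" using c1 by (intro finite_UN_I) auto
  have f2: "finite (\<Union>n\<in>?N. (\<lambda>(a,b). nat a) ` R n)" using R by (intro finite_UN_I finN finite_imageI) auto
  have "card A \<le> card ((\<Union>h\<in>{H<..H2}. A1 h) \<union> (\<Union>n\<in>?N. (\<lambda>(a,b). nat a) ` R n))"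
    by (rule card_mono[OF finite_UnI[OF f1 f2] sub])
  also have "\<dots> \<le> card (\<Union>h\<in>{H<..H2}. A1 h) + card (\<Union>n\<in>?N. (\<lambda>(a,b). nat a) ` R n)" by (rule card_Un_le)
  also have "card (\<Union>h\<in>{H<..H2}. A1 h) \<le> (\<Sum>h\<in>{H<..H2}. (Y div h\<^sup>2 + 1) * (3 * ndiv (h\<^sup>2)))"
  proof (rule order_trans[OF card_UN_le])
    show "(\<Sum>h\<in>{H<..H2}. card (A1 h)) \<le> (\<Sum>h\<in>{H<..H2}. (Y div h\<^sup>2 + 1) * (3 * ndiv (h\<^sup>2)))"
      by (rule sum_mono) (use c1 in auto)
  qed simp
  also have "card (\<Union>n\<in>?N. (\<lambda>(a,b). nat a) ` R n) \<le> (p ^ g div H2\<^sup>2) * (12 * (g + 1))"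
  proof (rule order_trans[OF card_UN_le[OF finN]])
    have "(\<Sum>n\<in>?N. card ((\<lambda>(a,b). nat a) ` R n)) \<le> (\<Sum>n\<in>?N. 12 * (g + 1))"
    proof (rule sum_mono)
      fix n assume "n \<in> ?N"
      then have "finite (R n) \<and> card (R n) \<le> 12 * (g + 1)" using R by simp
      then show "card ((\<lambda>(a,b). nat a) ` R n) \<le> 12 * (g + 1)" using card_image_le order_trans by blast
    qed
    also have "\<dots> = card ?N * (12 * (g + 1))" by simp
    also have "\<dots> \<le> (P div H2\<^sup>2) * (12 * (g + 1))"
    proof (rule mult_right_mono)
      have "card ?N \<le> card {1..P div H2\<^sup>2}" by (rule card_mono) auto
      then show "card ?N \<le> P div H2\<^sup>2" by simp
    qed simp
    finally show "(\<Sum>n\<in>?N. card ((\<lambda>(a,b). nat a) ` R n)) \<le> (p ^ g div H2\<^sup>2) * (12 * (g + 1))" unfolding P_def .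
  qed
  finally show ?thesis using finite_subset[OF sub finite_UnI[OF f1 f2]] by simp
qed

context lps_graph
begin

text \<open>If \<open>m\<close> is minimal with \<open>2q^2 < p^m\<close> then \<open>r = 2\<close> gives a primitive representation; for smaller \<open>m\<close> a closed word
  can only come from \<open>r = 1\<close>.\<close>
lemma girth_three_squares:
  obtains m r h a b c where "m \<ge> 1" "girth V E = 2 * m" "\<And>j. 1 \<le> j \<Longrightarrow> j < m \<Longrightarrow> Wq (2 * j) = {}"
    "r \<in> {1,2}" "r * q\<^sup>2 < p ^ m" "p ^ m \<le> 2 * p * q\<^sup>2"
    "int (r * (p ^ m - q\<^sup>2 * r)) = (h * a)\<^sup>2 + (h * b)\<^sup>2 + (h * c)\<^sup>2" "gcd a (gcd b c) = 1" "h > 0" "r = 2 \<Longrightarrow> h = 1"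
proof -
  have p2: "p \<ge> 2" using p_gt_2[OF p] by simp
  define m1 where "m1 = (LEAST m. 2 * q\<^sup>2 < p ^ m)"
  have ex: "2 * q\<^sup>2 < p ^ (2 * q\<^sup>2)" using less_exp[of "2 * q\<^sup>2"] power_mono[OF p2, of "2 * q\<^sup>2"] by linarith
  then have m1: "2 * q\<^sup>2 < p ^ m1" unfolding m1_def by (rule LeastI)
  have m11: "m1 \<ge> 1" using m1 q_gt_2 by (cases m1) auto
  have least: "p ^ m \<le> 2 * q\<^sup>2" if "m < m1" for m using not_less_Least[of m "\<lambda>m. 2 * q\<^sup>2 < p ^ m"] that unfolding m1_def[symmetric] by simp
  then have pm: "p ^ m1 \<le> p * (2 * q\<^sup>2)" using m11 p2 least[of "m1 - 1"] by (cases m1) auto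
  obtain m where m: "1 \<le> m" "m \<le> m1" "girth V E = 2 * m" "Wq (2 * m) \<noteq> {}"
    "\<And>j. 1 \<le> j \<Longrightarrow> j < m \<Longrightarrow> Wq (2 * j) = {}" using girth_bound[OF m1 m11] by blast
  have "p ^ m \<le> p ^ m1" using m p2 by (intro power_increasing) auto
  then have pm: "p ^ m \<le> 2 * p * q\<^sup>2" using pm by (simp add: mult.left_commute mult.assoc)
  show ?thesis
  proof (cases "m = m1")
    case True
    obtain a b c where abc: "int (2 * (p ^ m - q\<^sup>2 * 2)) = a\<^sup>2 + b\<^sup>2 + c\<^sup>2" "\<And>d. d dvd a \<Longrightarrow> d dvd b \<Longrightarrow> d dvd c \<Longrightarrow> is_unit d"
      using three_squares_r2[of m] m1 True by blast
    have "is_unit (gcd a (gcd b c))" by (rule abc(2)) (auto intro: dvd_trans[OF gcd_dvd2])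
    then have "gcd a (gcd b c) = 1" by simp
    then show ?thesis using that[of m 2 1 a b c] m pm m1 True abc(1) by auto
  next
    case False
    then have small: "p ^ m \<le> 2 * q\<^sup>2" using least m(2) by simp
    obtain ws where ws': "ws \<in> Wq (2 * m)" using m(4) by blast
    have ws: "ws \<in> words p (2 * m)" "Kq (qprod ws)" using ws' by (auto simp: closed_words_def)
    obtain x0 a b c where x: "qprod ws = (x0, 2 * int q * a, 2 * int q * b, 2 * int q * c)"
      using scalar_mod_imag[OF ws(2)] by blast
    have ns: "\<not> (a = 0 \<and> b = 0 \<and> c = 0)" using words_nonscalar[OF ws(1)] m(1) x by auto
    have od: "oddq (qprod ws)" using gens_list_oddq ws(1) by (auto simp: words_def)
    have nm: "qnorm (qprod ws) = int p ^ (2 * m)" using gens_list_norm[of ws p] ws(1) by (auto simp: words_def)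
    obtain r where r: "r \<ge> 1" "r * (int q)\<^sup>2 < int p ^ m" "a\<^sup>2 + b\<^sup>2 + c\<^sup>2 = r * (int p ^ m - (int q)\<^sup>2 * r)"
      using scalar_elem_structure[OF od ws(2) nm x ns] by blast
    have "int (p ^ m) \<le> int (2 * q\<^sup>2)" using small by (simp only: of_nat_le_iff)
    then have "r * (int q)\<^sup>2 < 2 * (int q)\<^sup>2" using r(2) by simp
    then have "r < 2" by (rule mult_right_less_imp_less) simp
    then have r1: "r = 1" using r(1) by simp
    then have "int (q\<^sup>2) < int (p ^ m)" using r(2) by simp
    then have lt: "q\<^sup>2 < p ^ m" by (simp only: of_nat_less_iff)
    then have n: "int (p ^ m - q\<^sup>2) = a\<^sup>2 + b\<^sup>2 + c\<^sup>2" using r(3) r1 by (simp add: of_nat_diff)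
    moreover have "int (p ^ m - q\<^sup>2) > 0" using lt by (simp only: of_nat_0_less_iff zero_less_diff)
    ultimately have pos: "a\<^sup>2 + b\<^sup>2 + c\<^sup>2 > 0" by (simp only:)
    obtain h a' b' c' where h: "h > 0" "a = h * a'" "b = h * b'" "c = h * c'" "gcd a' (gcd b' c') = 1"
      using content_decomp[OF pos] by blast
    have "int (1 * (p ^ m - q\<^sup>2 * 1)) = (h * a')\<^sup>2 + (h * b')\<^sup>2 + (h * c')\<^sup>2" using n h by simp
    then show ?thesis using that[of m 1 h a' b' c'] m pm lt h by auto
  qed
qed

text \<open>\<open>near\<close> keeps the represented number large, \<open>content\<close> bounds
  its square factor, and \<open>var\<close> supplies split primes; all range over every candidate
  \<open>m\<close> because the girth is not known beforehand. In \<open>4 * G\<close> one 2 is the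
  sign of a word and \<open>2 * G\<close> bounds the girth, that is, the number of
  rotations.\<close>

lemma kiss_ge_choose:
  fixes L :: "nat set" and y t s D H G :: nat
  assumes near: "\<And>m r. m \<ge> 1 \<Longrightarrow> p ^ m \<le> 2 * p * q\<^sup>2 \<Longrightarrow> r \<in> {1,2} \<Longrightarrow> r * q\<^sup>2 < p ^ m \<Longrightarrow> r * q\<^sup>2 + D \<le> p ^ m"
    and content: "\<And>m h. m \<ge> 1 \<Longrightarrow> p ^ m \<le> 2 * p * q\<^sup>2 \<Longrightarrow> q\<^sup>2 < p ^ m \<Longrightarrow> h\<^sup>2 dvd p ^ m - q\<^sup>2 \<Longrightarrow> h \<le> H"
    and var: "\<And>m r. m \<ge> 1 \<Longrightarrow> p ^ m \<le> 2 * p * q\<^sup>2 \<Longrightarrow> r \<in> {1,2::nat} \<Longrightarrow>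
      real_of_int (\<Sum>l\<in>L. Legendre ((int r * int q)\<^sup>2 - int (r * p ^ m)) (int l)) \<ge> - (real (card L) / 4)"
    and L: "finite L" "\<And>l. l \<in> L \<Longrightarrow> prime l \<and> l > 2 \<and> l \<le> y"
    and s: "2 * real s + log 2 (4 * real p * real q ^ 2) \<le> 3 / 4 * real (card L)"
    and t: "y ^ (2 * t) * H\<^sup>2 < D" and G: "2 * p * q\<^sup>2 < 2 ^ Suc G" and H: "H \<ge> 1"
  shows "card V * (s choose t) \<le> 4 * G * kiss V E"
proof -
  have p2: "p \<ge> 2" using p_gt_2[OF p] by simp
  obtain m r h a b c where m: "m \<ge> 1" "girth V E = 2 * m" "\<And>j. 1 \<le> j \<Longrightarrow> j < m \<Longrightarrow> Wq (2 * j) = {}"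
    and r: "r \<in> {1,2}" "r * q\<^sup>2 < p ^ m" "p ^ m \<le> 2 * p * q\<^sup>2"
    and n: "int (r * (p ^ m - q\<^sup>2 * r)) = (h * a)\<^sup>2 + (h * b)\<^sup>2 + (h * c)\<^sup>2"
    and prim: "gcd a (gcd b c) = 1" and h: "h > 0" "r = 2 \<Longrightarrow> h = 1"
    using girth_three_squares by blast
  define n' where "n' = r * (p ^ m - q\<^sup>2 * r)"
  have rle: "1 \<le> r" "r \<le> 2" using r(1) by auto
  have nD: "n' \<ge> D"
  proof -
    have "D \<le> p ^ m - q\<^sup>2 * r" using near[OF m(1) r(3,1,2)] by (simp add: mult.commute)
    also have "\<dots> \<le> n'" unfolding n'_def using rle(1) by simp
    finally show ?thesis .
  qed
  have n0: "n' > 0" unfolding n'_def using rle r(2) by (simp add: mult.commute)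
  have hH: "h \<le> int H"
  proof (cases "r = 1")
    case True
    have "h\<^sup>2 dvd int (p ^ m - q\<^sup>2)"
    proof -
      have "int (p ^ m - q\<^sup>2) = h\<^sup>2 * (a\<^sup>2 + b\<^sup>2 + c\<^sup>2)" using n True by (simp add: power_mult_distrib distrib_left)
      then show ?thesis by simp
    qed
    moreover have "h\<^sup>2 = int ((nat h)\<^sup>2)" using h(1) by simp
    ultimately have "(nat h)\<^sup>2 dvd p ^ m - q\<^sup>2" by (simp only: of_nat_dvd_iff)
    then have "nat h \<le> H" using content[OF m(1) r(3)] r(2) True by simp
    then show ?thesis by simp
  next
    case False
    then show ?thesis using h(2) r(1) H by simp
  qed
  let ?S = "{l \<in> L. split_prime (int n') l}"
  have sc: "s \<le> card ?S"
  proof -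
    \<comment> \<open>The negative of the represented number is a quadratic polynomial in
      \<open>q\<close> of the shape \<open>(a q)^2 - B\<close>, the shape for which the second
      moment was computed.\<close>
    have "- int n' = (int r * int q)\<^sup>2 - int (r * p ^ m)"
      using r(2) unfolding n'_def by (simp add: of_nat_diff less_imp_le mult.commute power2_eq_square algebra_simps)
    then have "real_of_int (\<Sum>l\<in>L. Legendre (- int n') (int l)) \<ge> - (real (card L) / 4)"
      using var[OF m(1) r(3,1)] by (simp only:)
    then have "3 / 4 * real (card L) - log 2 (real n') \<le> 2 * real (card ?S)"
      by (intro card_split_primes_ge) (use L n0 in auto)
    moreover have "log 2 (real n') \<le> log 2 (4 * real p * real q ^ 2)"
    proof -
      have "n' \<le> 2 * (p ^ m)" unfolding n'_def by (rule mult_mono) (use rle in auto)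
      then have "n' \<le> 4 * p * q\<^sup>2" using r(3) by simp
      then have "real n' \<le> real (4 * p * q\<^sup>2)" by (simp only: of_nat_le_iff)
      then show ?thesis using n0 by (simp add: log_le_cancel_iff)
    qed
    ultimately show ?thesis using s by linarith
  qed
  have small: "int y ^ (2 * t) < a\<^sup>2 + b\<^sup>2 + c\<^sup>2"
  proof -
    have e: "int n' = h\<^sup>2 * (a\<^sup>2 + b\<^sup>2 + c\<^sup>2)" using n unfolding n'_def by (simp add: power_mult_distrib distrib_left)
    have "y ^ (2 * t) * H\<^sup>2 < n'" using t nD by linarith
    then have "int (y ^ (2 * t) * H\<^sup>2) < int n'" by (simp only: of_nat_less_iff)
    then have "int y ^ (2 * t) * (int H)\<^sup>2 < h\<^sup>2 * (a\<^sup>2 + b\<^sup>2 + c\<^sup>2)" unfolding e by simp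
    also have "h\<^sup>2 * (a\<^sup>2 + b\<^sup>2 + c\<^sup>2) \<le> (int H)\<^sup>2 * (a\<^sup>2 + b\<^sup>2 + c\<^sup>2)"
      using h hH by (intro mult_right_mono power_mono) auto
    finally have "(int H)\<^sup>2 * int y ^ (2 * t) < (int H)\<^sup>2 * (a\<^sup>2 + b\<^sup>2 + c\<^sup>2)" by (simp only: mult.commute)
    then show ?thesis by (rule mult_left_less_imp_less) simp
  qed
  have "s choose t \<le> card ?S choose t" by (rule binomial_right_mono[OF sc])
  also have "\<dots> \<le> card (sumsq3 (int n'))"
    by (rule card_sumsq3_ge[of ?S "int n'" y, OF _ _ _ n[folded n'_def] _ prim small])
      (use L h finite_sumsq3[OF n0] in auto)
  also have "\<dots> \<le> card (Zq m)" unfolding n'_def by (rule card_Zq_ge) (use r rle in auto)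
  also have "\<dots> \<le> 2 * card (Wq (2 * m))" by (rule card_Zq_le_words[OF m(3)])
  finally have c: "s choose t \<le> 2 * card (Wq (2 * m))" .
  have "q\<^sup>2 < p ^ m"
  proof -
    have "q\<^sup>2 \<le> r * q\<^sup>2" using rle by simp
    then show ?thesis using r(2) by linarith
  qed
  have m2: "m \<ge> 2"
  proof (rule ccontr)
    assume "\<not> m \<ge> 2"
    then have "m = 1" using m(1) by simp
    then have "q\<^sup>2 < p" using \<open>q\<^sup>2 < p ^ m\<close> by simp
    moreover have "q \<le> q\<^sup>2" by (simp add: power2_eq_square)
    ultimately show False using qp by linarith
  qed
  have "Wq (2 * m - 2) = {}" using m(3)[of "m - 1"] m2 by (simp add: right_diff_distrib')
  then have k: "card V * card (Wq (2 * m)) \<le> 2 * m * kiss V E" using kiss_ge[OF m(2)] m2 by simp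
  have "2 ^ m \<le> p ^ m" using p2 by (rule power_mono) simp
  then have "(2::nat) ^ m < 2 ^ Suc G" using r(3) G by linarith
  then have mG: "m \<le> G" using power_less_imp_less_exp[of "2::nat" m "Suc G"] by simp
  have "card V * (s choose t) \<le> card V * (2 * card (Wq (2 * m)))" using c by (rule mult_left_mono) simp
  also have "\<dots> \<le> 2 * (2 * m * kiss V E)" using k by simp
  also have "\<dots> \<le> 4 * G * kiss V E" using mG by simp
  finally show ?thesis .
qed

end

text \<open>Union bound: \<open>N\<close>, \<open>T\<close> and \<open>U\<close> collect the primes
  that are too near a square, have a large square divisor, or have a very negative character sum,
  and \<open>main\<close> says that over at most \<open>G\<close> exponents they cannot exhaust
  \<open>Qs\<close>. The coefficients 32 and 2 contain the two choices of \<open>r\<close>.\<close>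

lemma exists_good_prime:
  fixes p x Y x0 M D H H2 G :: nat and Qs L :: "nat set"
  assumes p: "prime p" "p > 2" and Qs: "finite Qs" "\<And>q. q \<in> Qs \<Longrightarrow> prime q \<and> q \<noteq> p \<and> x < q \<and> q < Y"
    and L: "L \<subseteq> {x0<..M * x0}" "\<And>l. l \<in> L \<Longrightarrow> prime l \<and> l > 2 \<and> l \<noteq> p" "L \<noteq> {}" and x0: "x0 > 0" and x: "x > 0" and H2: "H2 > 0"
    and G: "2 * p * Y\<^sup>2 < 2 ^ Suc G"
    and main: "real G * (32 * (real Y / real (card L) + real M ^ 2 * real Y / real (card L) ^ 2 + real (M * x0) ^ 2)
       + 2 * real (D div x + 1) + real (\<Sum>h\<in>{H<..H2}. (Y div h\<^sup>2 + 1) * (3 * ndiv (h\<^sup>2))) + real ((2 * p * Y\<^sup>2) div H2\<^sup>2 * (12 * (G + 1)))) < real (card Qs)"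
  obtains q where "q \<in> Qs"
    "\<And>m r. m \<ge> 1 \<Longrightarrow> p ^ m \<le> 2 * p * q\<^sup>2 \<Longrightarrow> r \<in> {1,2} \<Longrightarrow> r * q\<^sup>2 < p ^ m \<Longrightarrow> r * q\<^sup>2 + D \<le> p ^ m"
    "\<And>m h. m \<ge> 1 \<Longrightarrow> p ^ m \<le> 2 * p * q\<^sup>2 \<Longrightarrow> q\<^sup>2 < p ^ m \<Longrightarrow> h\<^sup>2 dvd p ^ m - q\<^sup>2 \<Longrightarrow> h \<le> H"
    "\<And>m r. m \<ge> 1 \<Longrightarrow> p ^ m \<le> 2 * p * q\<^sup>2 \<Longrightarrow> r \<in> {1,2::nat} \<Longrightarrow>
      real_of_int (\<Sum>l\<in>L. Legendre ((int r * int q)\<^sup>2 - int (r * p ^ m)) (int l)) \<ge> - (real (card L) / 4)"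
proof -
  define N where "N r m = {q. x < q \<and> r * q\<^sup>2 < p ^ m \<and> p ^ m < r * q\<^sup>2 + D}" for r m :: nat
  define T where "T m = {q. q < Y \<and> prime q \<and> q \<noteq> p \<and> q\<^sup>2 < p ^ m \<and> (\<exists>h>H. h\<^sup>2 dvd p ^ m - q\<^sup>2)}" for m :: nat
  define U where "U r m = {q. q < Y \<and> real_of_int (\<Sum>l\<in>L. Legendre ((int r * int q)\<^sup>2 - int (r * p ^ m)) (int l)) < - (real (card L) / 4)}" for r m :: nat
  define Ms where "Ms = {m. m \<ge> 1 \<and> p ^ m \<le> 2 * p * Y\<^sup>2}"
  define Bad where "Bad m = N 1 m \<union> N 2 m \<union> T m \<union> U 1 m \<union> U 2 m" for m
  have MsG: "Ms \<subseteq> {1..G}"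
  proof
    fix m assume m: "m \<in> Ms"
    have "2 ^ m \<le> p ^ m" using p by (intro power_mono) auto
    moreover have "p ^ m \<le> 2 * p * Y\<^sup>2" using m by (simp add: Ms_def)
    ultimately have "(2::nat) ^ m < 2 ^ Suc G" using G by linarith
    then show "m \<in> {1..G}" using power_less_imp_less_exp[of "2::nat" m "Suc G"] m by (simp add: Ms_def)
  qed
  then have finMs: "finite Ms" and cMs: "card Ms \<le> G" using finite_subset card_mono[of "{1..G}" Ms] by auto
  define K where "K = 16 * (real Y / real (card L) + real M ^ 2 * real Y / real (card L) ^ 2 + real (M * x0) ^ 2)"
  define W where "W = (\<Sum>h\<in>{H<..H2}. (Y div h\<^sup>2 + 1) * (3 * ndiv (h\<^sup>2)))"
  define Z where "Z = (2 * p * Y\<^sup>2) div H2\<^sup>2 * (12 * (G + 1))"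
  have cU: "finite (U r m)" "real (card (U r m)) \<le> K" if r: "r \<in> {1,2}" for r m
  proof -
    show "finite (U r m)" unfolding U_def by simp
    show "real (card (U r m)) \<le> K" unfolding U_def K_def
    proof (rule card_large_negative_sums[OF L(1) _ x0 L(3)])
      fix l assume l: "l \<in> L"
      have pl: "prime l" "l > 2" "l \<noteq> p" using L(2)[OF l] by auto
      have 1: "\<not> l dvd r" using pl r by (auto dest: dvd_imp_le)
      have 2: "\<not> l dvd p ^ m" using pl p primes_dvd_imp_eq prime_dvd_power by blast
      have "\<not> l dvd r * p ^ m" using 1 2 pl prime_dvd_multD by blast
      then show "prime l \<and> 2 < l \<and> \<not> int l dvd int r \<and> \<not> int l dvd int (r * p ^ m)"
        using pl 1 by (simp only: of_nat_dvd_iff) simp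
    qed
  qed
  have cN: "finite (N r m) \<and> card (N r m) \<le> D div x + 1" if "r \<in> {1,2}" for r m
    unfolding N_def by (rule card_near_square_le[OF x]) (use that in auto)
  have cT: "finite (T m)" "card (T m) \<le> W + Z" if m: "m \<in> Ms" for m
  proof -
    show "finite (T m)" unfolding T_def by simp
    have "card (T m) \<le> W + (p ^ m div H2\<^sup>2) * (12 * (m + 1))"
      unfolding T_def W_def using card_square_divisor_le[OF p(1) H2] by blast
    also have "\<dots> \<le> W + Z" unfolding Z_def
    proof (intro add_left_mono mult_mono div_le_mono)
      show "p ^ m \<le> 2 * p * Y\<^sup>2" using m by (simp add: Ms_def)
      show "m + 1 \<le> G + 1" using MsG m by auto
    qed auto
    finally show "card (T m) \<le> W + Z" .
  qed
  have cBad: "finite (Bad m)" "real (card (Bad m)) \<le> 2 * K + 2 * real (D div x + 1) + real W + real Z" if m: "m \<in> Ms" for m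
  proof -
    show "finite (Bad m)" unfolding Bad_def using cN cT[OF m] cU by simp
    have "card (Bad m) \<le> card (N 1 m) + card (N 2 m) + card (T m) + card (U 1 m) + card (U 2 m)"
      unfolding Bad_def by (meson add_mono card_Un_le order_refl order_trans)
    then have "real (card (Bad m)) \<le> real (card (N 1 m) + card (N 2 m) + card (T m) + card (U 1 m) + card (U 2 m))" by (simp only: of_nat_le_iff)
    moreover have "real (card (N 1 m)) \<le> real (D div x + 1)" "real (card (N 2 m)) \<le> real (D div x + 1)"
      using cN[of 1 m] cN[of 2 m] by (simp_all only: of_nat_le_iff) simp_all
    moreover have "real (card (T m)) \<le> real (W + Z)" using cT(2)[OF m] by (simp only: of_nat_le_iff)
    ultimately show "real (card (Bad m)) \<le> 2 * K + 2 * real (D div x + 1) + real W + real Z"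
      using cU(2)[of 1 m] cU(2)[of 2 m] by simp
  qed
  have "\<not> Qs \<subseteq> (\<Union>m\<in>Ms. Bad m)"
  proof
    assume "Qs \<subseteq> (\<Union>m\<in>Ms. Bad m)"
    then have "card Qs \<le> card (\<Union>m\<in>Ms. Bad m)" using finMs cBad(1) by (intro card_mono finite_UN_I) auto
    also have "\<dots> \<le> (\<Sum>m\<in>Ms. card (Bad m))" by (rule card_UN_le[OF finMs])
    finally have "real (card Qs) \<le> (\<Sum>m\<in>Ms. real (card (Bad m)))" by (simp only: of_nat_sum[symmetric] of_nat_le_iff)
    also have "\<dots> \<le> (\<Sum>m\<in>Ms. 2 * K + 2 * real (D div x + 1) + real W + real Z)" using cBad(2) by (rule sum_mono)
    also have "\<dots> = real (card Ms) * (2 * K + 2 * real (D div x + 1) + real W + real Z)" by simp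
    also have "\<dots> \<le> real G * (2 * K + 2 * real (D div x + 1) + real W + real Z)"
      using cMs by (intro mult_right_mono) (auto simp: K_def)
    also have "\<dots> < real (card Qs)" using main unfolding K_def W_def Z_def by simp
    finally show False by simp
  qed
  then obtain q where q: "q \<in> Qs" "\<And>m. m \<in> Ms \<Longrightarrow> q \<notin> Bad m" by blast
  have qq: "prime q" "q \<noteq> p" "x < q" "q < Y" using Qs(2)[OF q(1)] by auto
  have mem: "m \<in> Ms" if "m \<ge> 1" "p ^ m \<le> 2 * p * q\<^sup>2" for m
  proof -
    have "2 * p * q\<^sup>2 \<le> 2 * p * Y\<^sup>2" using qq(4) by (intro mult_left_mono power_mono) auto
    then show ?thesis unfolding Ms_def using that order_trans by blast
  qed
  show ?thesis
  proof (rule that[OF q(1)])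
    fix m r :: nat assume m: "m \<ge> 1" "p ^ m \<le> 2 * p * q\<^sup>2" and r: "r \<in> {1,2}" and lt: "r * q\<^sup>2 < p ^ m"
    have "q \<notin> N r m" using q(2)[OF mem[OF m]] r unfolding Bad_def by auto
    then show "r * q\<^sup>2 + D \<le> p ^ m" using lt qq unfolding N_def by simp
  next
    fix m h :: nat assume m: "m \<ge> 1" "p ^ m \<le> 2 * p * q\<^sup>2" and lt: "q\<^sup>2 < p ^ m" and h: "h\<^sup>2 dvd p ^ m - q\<^sup>2"
    have "q \<notin> T m" using q(2)[OF mem[OF m]] unfolding Bad_def by blast
    then have "\<not> h > H" using lt h qq unfolding T_def by blast
    then show "h \<le> H" by simp
  next
    fix m r :: nat assume m: "m \<ge> 1" "p ^ m \<le> 2 * p * q\<^sup>2" and r: "r \<in> {1,2}"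
    have "q \<notin> U r m" using q(2)[OF mem[OF m]] r unfolding Bad_def by auto
    then show "real_of_int (\<Sum>l\<in>L. Legendre ((int r * int q)\<^sup>2 - int (r * p ^ m)) (int l)) \<ge> - (real (card L) / 4)"
      using qq unfolding U_def by simp
  qed
qed

section \<open>Supply of primes and choice of parameters\<close>

definition lps_prime :: "nat \<Rightarrow> nat \<Rightarrow> bool" where
  "lps_prime p q \<longleftrightarrow> prime q \<and> q mod 4 = 1 \<and> Legendre (int p) (int q) = -1"

text \<open>For \<open>q = 1\<close> modulo 4 reciprocity turns the symbol of \<open>p\<close>
  modulo \<open>q\<close> into that of \<open>q\<close> modulo \<open>p\<close>, which is a
  character of \<open>q\<close>. The range \<open>x \<ge> p\<close> keeps \<open>q\<close> different
  from \<open>p\<close>, so the value 0 does not occur.\<close>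

lemma lps_primes_density:
  assumes p: "prime p" "p mod 4 = 1"
  obtains M :: nat and c :: real where "M \<ge> 2" "c > 0"
    "\<And>x. x \<ge> p \<Longrightarrow> c * real x / ln (real (M * x)) \<le> real (card {q \<in> {x<..M * x}. lps_prime p q})"
proof -
  have p2: "p > 2" by (rule p_gt_2[OF p])
  have pne: "p \<noteq> 4" "p \<noteq> 8" using p by auto
  define e where "e i = (if i = 4 then 1 else - 1 :: real)" for i :: nat
  have fin: "finite {4, p}" by simp
  have char: "\<And>T. T \<subseteq> {4,p} \<Longrightarrow> T \<noteq> {} \<Longrightarrow> \<exists>B. real_character (\<lambda>n. \<Prod>i\<in>T. rchar i n) B"
    by (rule rchar_product_character) (use p p2 in \<open>auto dest: finite_subset\<close>)
  have e1: "\<And>i. i \<in> {4,p} \<Longrightarrow> \<bar>e i\<bar> = 1" by (auto simp: e_def)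
  obtain M :: nat and c :: real where Mc: "M \<ge> 2" "c > 0"
    "\<And>x. x \<ge> 1 \<Longrightarrow> c * real x / ln (real (M * x)) \<le> real (card {l \<in> {x<..M * x}. prime l \<and> (\<forall>i\<in>{4,p}. e i * rchar i l \<noteq> -1)})"
    by (rule prime_density_real_characters[OF fin char e1]; assumption?) auto
  have "c * real x / ln (real (M * x)) \<le> real (card {q \<in> {x<..M * x}. lps_prime p q})" if x: "x \<ge> p" for x
  proof -
    have "lps_prime p l" if l: "l > x" "prime l" "e 4 * rchar 4 l \<noteq> -1" "e p * rchar p l \<noteq> -1" for l
    proof -
      have lp: "l > p" using l x by simp
      have "odd l" using l(2) lp p2 prime_odd_nat[of l] by simp
      then have l4: "l mod 4 = 1" using l(3) by (simp add: e_def split: if_splits)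
      have "Legendre (int l) (int p) \<noteq> 1" using l(4) pne by (simp add: e_def rchar_prime[OF p(1)])
      moreover have "\<not> int p dvd int l"
        using lp l(2) p(1) primes_dvd_imp_eq[of p l] by auto
      then have "Legendre (int l) (int p) \<noteq> 0" by (simp add: Legendre_def cong_0_iff)
      ultimately have "Legendre (int l) (int p) = -1" using Legendre_cases[of "int l" "int p"] by auto
      then have "Legendre (int p) (int l) = -1" using Legendre_swap[of p l] p p2 l(2) lp l4 by simp
      then show ?thesis using l(2) l4 by (simp add: lps_prime_def)
    qed
    then have "{l \<in> {x<..M * x}. prime l \<and> (\<forall>i\<in>{4,p}. e i * rchar i l \<noteq> -1)} \<subseteq> {q \<in> {x<..M * x}. lps_prime p q}" by auto
    then have "card {l \<in> {x<..M * x}. prime l \<and> (\<forall>i\<in>{4,p}. e i * rchar i l \<noteq> -1)} \<le> card {q \<in> {x<..M * x}. lps_prime p q}"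
      by (rule card_mono[rotated]) simp
    then show ?thesis using Mc(3)[of x] x p2 by linarith
  qed
  then show ?thesis using that Mc(1,2) by blast
qed

lemma primes_density:
  obtains M :: nat and c :: real where "M \<ge> 2" "c > 0"
    "\<And>x. x \<ge> 1 \<Longrightarrow> c * real x / ln (real (M * x)) \<le> real (card {q \<in> {x<..M * x}. prime q})"
proof -
  obtain M :: nat and c :: real where "M \<ge> 2" "c > 0"
    "\<And>x. x \<ge> 1 \<Longrightarrow> c * real x / ln (real (M * x)) \<le> real (card {l \<in> {x<..M * x}. prime l \<and> (\<forall>i\<in>{}::nat set. 1 * rchar i l \<noteq> -1)})"
    by (rule prime_density_real_characters[where I = "{}::nat set" and chi = rchar and e = "\<lambda>_. 1"]) auto
  then show ?thesis using that by simp
qed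

lemma sum_inverse_squares_le:
  assumes H: "H \<ge> 1"
  shows "(\<Sum>h\<in>{H<..N}. 1 / real h ^ 2) \<le> 1 / real H"
proof (cases "H \<le> N")
  case True
  have "(\<Sum>h\<in>{H<..N}. 1 / real h ^ 2) \<le> 1 / real H - 1 / real N"
    using True
  proof (induction N rule: dec_induct)
    case (step n)
    have n: "real n > 0" using step.hyps H by simp
    have "{H<..Suc n} = insert (Suc n) {H<..n}" using step.hyps by auto
    then have "(\<Sum>h\<in>{H<..Suc n}. 1 / real h ^ 2) = 1 / real (Suc n) ^ 2 + (\<Sum>h\<in>{H<..n}. 1 / real h ^ 2)" by simp
    moreover have "1 / real (Suc n) ^ 2 \<le> 1 / real n - 1 / real (Suc n)"
    proof -
      have "1 / real (Suc n) ^ 2 \<le> 1 / (real n * real (Suc n))"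
        using n by (intro divide_left_mono) (auto simp: power2_eq_square)
      also have "\<dots> = 1 / real n - 1 / real (Suc n)" using n by (simp add: field_simps)
      finally show ?thesis .
    qed
    ultimately show ?case using step.IH by linarith
  qed simp
  also have "\<dots> \<le> 1 / real H" by simp
  finally show ?thesis .
qed simp

text \<open>The divisor function of \<open>h^2\<close> is at most \<open>C x^(d/2)\<close> since
  \<open>h \<le> x\<close>; the terms \<open>Y / h^2\<close> beyond \<open>H\<close> sum to
  \<open>Y / H\<close>, and the rounding terms to \<open>H2\<close>.\<close>

lemma sum_square_divisor_bound:
  fixes C d :: real and H H2 x Y :: nat
  assumes C: "C > 0" "\<And>n. n > 0 \<Longrightarrow> real (ndiv n) \<le> C * real n powr (d / 4)" and d: "d > 0"
    and H: "H \<ge> 1" and H2: "H2 \<le> x" and x: "x > 0"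
  shows "real (\<Sum>h\<in>{H<..H2}. (Y div h\<^sup>2 + 1) * (3 * ndiv (h\<^sup>2))) \<le> 3 * C * real x powr (d / 2) * (real Y / real H + real H2)"
proof -
  have "real (\<Sum>h\<in>{H<..H2}. (Y div h\<^sup>2 + 1) * (3 * ndiv (h\<^sup>2))) = (\<Sum>h\<in>{H<..H2}. real ((Y div h\<^sup>2 + 1) * (3 * ndiv (h\<^sup>2))))" by (rule of_nat_sum)
  also have "\<dots> \<le> (\<Sum>h\<in>{H<..H2}. 3 * C * real x powr (d / 2) * (real Y * (1 / real h ^ 2) + 1))"
  proof (rule sum_mono)
    fix h assume h: "h \<in> {H<..H2}"
    have "real (ndiv (h\<^sup>2)) \<le> C * real (h\<^sup>2) powr (d / 4)" by (rule C(2)) (use h in simp)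
    also have "\<dots> \<le> C * (real x ^ 2) powr (d / 4)"
    proof -
      have "real h ^ 2 \<le> real x ^ 2" using h H2 by (intro power_mono) auto
      then show ?thesis using C(1) d by (intro mult_left_mono powr_mono2) auto
    qed
    also have "(real x ^ 2) powr (d / 4) = (real x powr 2) powr (d / 4)" using x by (simp add: powr_numeral)
    also have "\<dots> = real x powr (d / 2)" by (simp only: powr_powr) simp
    finally have n: "real (ndiv (h\<^sup>2)) \<le> C * real x powr (d / 2)" .
    have "real (Y div h\<^sup>2) \<le> real Y / real h ^ 2" using of_nat_div_le_of_nat[of Y "h\<^sup>2"] by simp
    then have "(real (Y div h\<^sup>2) + 1) * (3 * real (ndiv (h\<^sup>2))) \<le> (real Y / real h ^ 2 + 1) * (3 * (C * real x powr (d / 2)))"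
      using n by (intro mult_mono) auto
    then show "real ((Y div h\<^sup>2 + 1) * (3 * ndiv (h\<^sup>2))) \<le> 3 * C * real x powr (d / 2) * (real Y * (1 / real h ^ 2) + 1)"
      by (simp only: of_nat_mult of_nat_add of_nat_1 of_nat_numeral times_divide_eq_right mult_1_right) (simp only: mult_ac)
  qed
  also have "\<dots> = 3 * C * real x powr (d / 2) * (real Y * (\<Sum>h\<in>{H<..H2}. 1 / real h ^ 2) + real (H2 - H))"
    by (simp only: sum_distrib_left[symmetric] sum.distrib) simp
  also have "\<dots> \<le> 3 * C * real x powr (d / 2) * (real Y * (1 / real H) + real H2)"
    using C(1) sum_inverse_squares_le[OF H, of H2] by (intro mult_left_mono add_mono) auto
  finally show ?thesis by simp
qed

text \<open>\<open>s choose t\<close> is at least \<open>(s / t)^t\<close>, and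
  \<open>s / t \<ge> y^(1 - d)\<close> because \<open>t \<le> ln X / ln y\<close>. The floor in
  \<open>t\<close> loses at most a factor \<open>y \<le> X^d\<close>, so \<open>y^t\<close> lies
  between \<open>X^(1 - 3 d)\<close> and \<open>X^(1 - 2 d)\<close>.\<close>

lemma choose_lower_bound:
  fixes d X y :: real and s t :: nat
  assumes d: "0 < d" "d \<le> 1/8" and y: "y > 1" and X: "X > 1" and yX: "y \<le> X powr d"
    and s: "real s \<ge> y powr (1 - d) * (ln X / ln y)"
    and t: "t = nat \<lfloor>(1 - 2 * d) * ln X / ln y\<rfloor>"
  shows "X powr (1 - 4 * d) \<le> real (s choose t)" "y ^ (2 * t) \<le> X powr (2 - 4 * d)"
proof -
  have ly: "ln y > 0" and lX: "ln X > 0" using y X by simp_all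
  define u where "u = (1 - 2 * d) * ln X / ln y"
  have u0: "u \<ge> 0" using d ly lX by (simp add: u_def)
  have tu: "real t \<le> u" "u < real t + 1" using u0 unfolding t u_def[symmetric] by linarith+
  have yu: "y powr u = X powr (1 - 2 * d)" using y X ly by (simp add: powr_def u_def)
  have "y ^ (2 * t) = (y ^ t) ^ 2" by (simp only: power_mult mult.commute)
  also have "y ^ t = y powr (real t)" using y by (simp add: powr_realpow)
  also have "(y powr real t) ^ 2 \<le> (y powr u) ^ 2" using y tu by (intro power_mono powr_mono) auto
  also have "\<dots> = X powr (2 - 4 * d)" unfolding yu power2_eq_square powr_add[symmetric] by (simp add: algebra_simps)
  finally show "y ^ (2 * t) \<le> X powr (2 - 4 * d)" .
  have "real t \<le> ln X / ln y"
  proof -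
    have "u \<le> 1 * (ln X / ln y)" unfolding u_def times_divide_eq_right[symmetric] using d ly lX by (intro mult_right_mono) auto
    then show ?thesis using tu by simp
  qed
  then have st: "y powr (1 - d) * real t \<le> real s"
    using s mult_left_mono[of "real t" "ln X / ln y" "y powr (1 - d)"] by simp
  have y1: "1 \<le> y powr (1 - d)" using y d by (intro ge_one_powr_ge_zero) auto
  have "1 * real t \<le> y powr (1 - d) * real t" using y1 by (rule mult_right_mono) simp
  then have ts: "t \<le> s" using st by simp
  have "X powr (1 - 4 * d) \<le> X powr ((1 - 3 * d) * (1 - d))"
    using X d by (intro powr_mono) (auto simp: algebra_simps)
  also have "\<dots> = (X powr (1 - 3 * d)) powr (1 - d)" by (simp only: powr_powr)
  also have "\<dots> \<le> (y powr real t) powr (1 - d)"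
  proof (rule powr_mono2)
    have "X powr (1 - 3 * d) * y \<le> X powr (1 - 3 * d) * X powr d" using yX by (intro mult_left_mono) auto
    also have "\<dots> = X powr (1 - 2 * d)" by (simp add: powr_add[symmetric])
    also have "\<dots> = y powr u" by (rule yu[symmetric])
    also have "\<dots> \<le> y powr (real t + 1)" using tu y by (intro powr_mono) auto
    also have "\<dots> = y powr real t * y" using y by (simp add: powr_add)
    finally show "X powr (1 - 3 * d) \<le> y powr real t" using y by simp
  qed (use d in auto)
  also have "\<dots> = (y powr (1 - d)) ^ t" using y by (simp add: powr_powr powr_realpow[symmetric] mult.commute)
  also have "\<dots> \<le> real (s choose t)"
  proof (cases "t = 0")
    case False
    have "y powr (1 - d) \<le> real s / real t" using st False by (simp add: pos_le_divide_eq)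
    then have "(y powr (1 - d)) ^ t \<le> (real s / real t) ^ t" using y1 by (intro power_mono) auto
    also have "\<dots> \<le> real (s choose t)" using binomial_ge_n_over_k_pow_k[OF ts, where 'a = real] by simp
    finally show ?thesis .
  qed simp
  finally show "X powr (1 - 4 * d) \<le> real (s choose t)" .
qed

lemma exists_prime_large_kiss:
  fixes p :: nat and d :: real
  assumes p: "prime p" "p mod 4 = 1" and d: "0 < d" "d \<le> 1/8"
  shows "\<exists>q>N. lps_prime p q \<and> real (card (XV p q)) powr (4/3 - 2 * d) \<le> real (kiss (XV p q) (XE p q))"
proof -
  have p2: "p > 2" by (rule p_gt_2[OF p])
  obtain M1 :: nat and c1 :: real where M1: "M1 \<ge> 2" "c1 > 0"
    "\<And>x. x \<ge> p \<Longrightarrow> c1 * real x / ln (real (M1 * x)) \<le> real (card {q \<in> {x<..M1 * x}. lps_prime p q})"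
    using lps_primes_density[OF p] by blast
  obtain M2 :: nat and c2 :: real where M2: "M2 \<ge> 2" "c2 > 0"
    "\<And>x. x \<ge> 1 \<Longrightarrow> c2 * real x / ln (real (M2 * x)) \<le> real (card {q \<in> {x<..M2 * x}. prime q})"
    using primes_density by blast
  obtain C :: real where C: "C > 0" "\<And>n. n > 0 \<Longrightarrow> real (ndiv n) \<le> C * real n powr (d / 4)"
    using ndiv_bound[of "d / 4"] d by auto
  \<comment> \<open>\<open>a \<ge> 6\<close> yields at least \<open>(ln x)^4\<close> conjugating
    primes, enough to beat the number of exponents \<open>m\<close> and the logarithm in the density
    of \<open>q\<close>. \<open>a \<ge> 2 / d\<close> gives \<open>ln x \<le> y^(d/2)\<close>, which
    keeps \<open>s / t\<close> near \<open>y\<close>.\<close>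
  define a where "a = max 6 (2 / d)"
  have a: "a \<ge> 6" "2 / d \<le> a" by (auto simp: a_def)
  \<comment> \<open>An upper bound for the number of exponents \<open>m\<close> with
    \<open>p^m \<le> 2 p Y^2\<close>; the final 1 is for rounding up.\<close>
  define g where "g x = log 2 (2 * real p * (real M1 * x + 1)\<^sup>2) + 1" for x
  have pos: "real p > 0" "real M1 > 0" "real M2 > 0" using p2 M1 M2 by auto
  note hyps = pos M1(2) M2(2) C(1) d a(1)
  have "eventually (\<lambda>x. c2 * ln x powr a / ln (real M2 * (ln x powr a + 1)) \<ge> ln x ^ 4) at_top" using hyps by real_asymp
  moreover have "eventually (\<lambda>x. g x * (32 * ((1 + (real M2)\<^sup>2) * (real M1 * x + 1) / ln x ^ 4)) \<le> c1 / 8 * x / ln (real M1 * x)) at_top"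
    unfolding g_def using hyps by real_asymp
  moreover have "eventually (\<lambda>x. g x * (32 * (real M2 * (ln x powr a + 1))\<^sup>2) \<le> c1 / 8 * x / ln (real M1 * x)) at_top"
    unfolding g_def using hyps by real_asymp
  moreover have "eventually (\<lambda>x. g x * (2 * (x powr (1 - d) + 1)) \<le> c1 / 8 * x / ln (real M1 * x)) at_top"
    unfolding g_def using hyps by real_asymp
  moreover have "eventually (\<lambda>x. g x * (3 * C * x powr (d/2) * ((real M1 * x + 1) / x powr d)) \<le> c1 / 8 * x / ln (real M1 * x)) at_top"
    unfolding g_def using hyps by real_asymp
  moreover have "eventually (\<lambda>x. g x * (3 * C * x powr (d/2) * (x powr (3/4) + 1)) \<le> c1 / 8 * x / ln (real M1 * x)) at_top"
    unfolding g_def using hyps by real_asymp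
  moreover have "eventually (\<lambda>x. g x * (2 * real p * (real M1 * x + 1)\<^sup>2 / x powr (3/2) * (12 * (g x + 1))) \<le> c1 / 8 * x / ln (real M1 * x)) at_top"
    unfolding g_def using hyps by real_asymp
  moreover have "eventually (\<lambda>x. log 2 (4 * real p * (real M1 * x)\<^sup>2) \<le> ln x ^ 4 / 4) at_top" using hyps by real_asymp
  moreover have "eventually (\<lambda>x::real. 4 * x powr (2 - 2 * d) < x powr (2 - d) - 1) at_top" using hyps by real_asymp
  moreover have "eventually (\<lambda>x. 4 * g x \<le> x powr d) at_top" unfolding g_def using hyps by real_asymp
  moreover have "eventually (\<lambda>x. 2 * (real M1 * x) ^ 3 \<le> x powr (3 + 3 * d)) at_top" using hyps by real_asymp
  moreover have "eventually (\<lambda>x. real M2 * (ln x powr a + 1) \<le> x powr d) at_top" using hyps by real_asymp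
  moreover have "eventually (\<lambda>x. real p + 3 \<le> ln x powr a) at_top" using hyps by real_asymp
  moreover have "eventually (\<lambda>x::real. x powr (3/4) + 1 \<le> x) at_top" by real_asymp
  moreover have "eventually (\<lambda>x. ln x > 1 \<and> x > real p + real N + 2 \<and> x powr (1 - d) \<ge> 1 \<and> x powr d \<ge> 1) at_top"
    using hyps by (intro eventually_conj; real_asymp)
  moreover have "eventually (\<lambda>x. \<forall>y. y \<ge> ln x powr a \<longrightarrow> y powr (1 - d/2) + ln y \<le> c2 / (4 * real M2) * y) at_top"
  proof -
    have "eventually (\<lambda>y. y powr (1 - d/2) + ln y \<le> c2 / (4 * real M2) * y) at_top" using hyps by real_asymp
    then obtain y0 where y0: "\<And>y. y \<ge> y0 \<Longrightarrow> y powr (1 - d/2) + ln y \<le> c2 / (4 * real M2) * y"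
      by (auto simp: eventually_at_top_linorder)
    have "eventually (\<lambda>x. y0 \<le> ln x powr a) at_top" using hyps by real_asymp
    then show ?thesis by eventually_elim (use y0 in auto)
  qed
  ultimately have "eventually (\<lambda>x.
      (c2 * ln x powr a / ln (real M2 * (ln x powr a + 1)) \<ge> ln x ^ 4) \<and>
      (g x * (32 * ((1 + (real M2)\<^sup>2) * (real M1 * x + 1) / ln x ^ 4)) \<le> c1 / 8 * x / ln (real M1 * x)) \<and>
      (g x * (32 * (real M2 * (ln x powr a + 1))\<^sup>2) \<le> c1 / 8 * x / ln (real M1 * x)) \<and>
      (g x * (2 * (x powr (1 - d) + 1)) \<le> c1 / 8 * x / ln (real M1 * x)) \<and>
      (g x * (3 * C * x powr (d/2) * ((real M1 * x + 1) / x powr d)) \<le> c1 / 8 * x / ln (real M1 * x)) \<and>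
      (g x * (3 * C * x powr (d/2) * (x powr (3/4) + 1)) \<le> c1 / 8 * x / ln (real M1 * x)) \<and>
      (g x * (2 * real p * (real M1 * x + 1)\<^sup>2 / x powr (3/2) * (12 * (g x + 1))) \<le> c1 / 8 * x / ln (real M1 * x)) \<and>
      (log 2 (4 * real p * (real M1 * x)\<^sup>2) \<le> ln x ^ 4 / 4) \<and>
      (4 * x powr (2 - 2 * d) < x powr (2 - d) - 1) \<and>
      (4 * g x \<le> x powr d) \<and>
      (2 * (real M1 * x) ^ 3 \<le> x powr (3 + 3 * d)) \<and>
      (real M2 * (ln x powr a + 1) \<le> x powr d) \<and>
      (real p + 3 \<le> ln x powr a) \<and>
      (x powr (3/4) + 1 \<le> x) \<and>
      (ln x > 1 \<and> x > real p + real N + 2 \<and> x powr (1 - d) \<ge> 1 \<and> x powr d \<ge> 1) \<and>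
      (\<forall>y. y \<ge> ln x powr a \<longrightarrow> y powr (1 - d/2) + ln y \<le> c2 / (4 * real M2) * y)) at_top"
    by eventually_elim blast
  then obtain X0 where X0: "\<And>x. x \<ge> X0 \<Longrightarrow>
      (c2 * ln x powr a / ln (real M2 * (ln x powr a + 1)) \<ge> ln x ^ 4) \<and>
      (g x * (32 * ((1 + (real M2)\<^sup>2) * (real M1 * x + 1) / ln x ^ 4)) \<le> c1 / 8 * x / ln (real M1 * x)) \<and>
      (g x * (32 * (real M2 * (ln x powr a + 1))\<^sup>2) \<le> c1 / 8 * x / ln (real M1 * x)) \<and>
      (g x * (2 * (x powr (1 - d) + 1)) \<le> c1 / 8 * x / ln (real M1 * x)) \<and>
      (g x * (3 * C * x powr (d/2) * ((real M1 * x + 1) / x powr d)) \<le> c1 / 8 * x / ln (real M1 * x)) \<and>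
      (g x * (3 * C * x powr (d/2) * (x powr (3/4) + 1)) \<le> c1 / 8 * x / ln (real M1 * x)) \<and>
      (g x * (2 * real p * (real M1 * x + 1)\<^sup>2 / x powr (3/2) * (12 * (g x + 1))) \<le> c1 / 8 * x / ln (real M1 * x)) \<and>
      (log 2 (4 * real p * (real M1 * x)\<^sup>2) \<le> ln x ^ 4 / 4) \<and>
      (4 * x powr (2 - 2 * d) < x powr (2 - d) - 1) \<and>
      (4 * g x \<le> x powr d) \<and>
      (2 * (real M1 * x) ^ 3 \<le> x powr (3 + 3 * d)) \<and>
      (real M2 * (ln x powr a + 1) \<le> x powr d) \<and>
      (real p + 3 \<le> ln x powr a) \<and>
      (x powr (3/4) + 1 \<le> x) \<and>
      (ln x > 1 \<and> x > real p + real N + 2 \<and> x powr (1 - d) \<ge> 1 \<and> x powr d \<ge> 1) \<and>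
      (\<forall>y. y \<ge> ln x powr a \<longrightarrow> y powr (1 - d/2) + ln y \<le> c2 / (4 * real M2) * y)"
    unfolding eventually_at_top_linorder by blast
  define x where "x = nat \<lceil>X0\<rceil>"
  define X where "X = real x"
  have "X \<ge> X0" unfolding X_def x_def by linarith
  note E = X0[OF this]
  have E1: "c2 * ln X powr a / ln (real M2 * (ln X powr a + 1)) \<ge> ln X ^ 4" using E by blast
  have E2: "g X * (32 * ((1 + (real M2)\<^sup>2) * (real M1 * X + 1) / ln X ^ 4)) \<le> c1 / 8 * X / ln (real M1 * X)"
    "g X * (32 * (real M2 * (ln X powr a + 1))\<^sup>2) \<le> c1 / 8 * X / ln (real M1 * X)"
    "g X * (2 * (X powr (1 - d) + 1)) \<le> c1 / 8 * X / ln (real M1 * X)"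
    "g X * (3 * C * X powr (d/2) * ((real M1 * X + 1) / X powr d)) \<le> c1 / 8 * X / ln (real M1 * X)"
    "g X * (3 * C * X powr (d/2) * (X powr (3/4) + 1)) \<le> c1 / 8 * X / ln (real M1 * X)"
    "g X * (2 * real p * (real M1 * X + 1)\<^sup>2 / X powr (3/2) * (12 * (g X + 1))) \<le> c1 / 8 * X / ln (real M1 * X)"
    using E by blast+
  have E3: "log 2 (4 * real p * (real M1 * X)\<^sup>2) \<le> ln X ^ 4 / 4" using E by blast
  have E4: "4 * X powr (2 - 2 * d) < X powr (2 - d) - 1" using E by blast
  have E5: "4 * g X \<le> X powr d" using E by blast
  have E6: "2 * (real M1 * X) ^ 3 \<le> X powr (3 + 3 * d)" using E by blast
  have E7: "real M2 * (ln X powr a + 1) \<le> X powr d" using E by blast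
  have E8: "real p + 3 \<le> ln X powr a" using E by blast
  have E9: "X powr (3/4) + 1 \<le> X" using E by blast
  have E10: "ln X > 1" "X > real p + real N + 2" "X powr (1 - d) \<ge> 1" "X powr d \<ge> 1" using E by blast+
  have E11: "\<And>y. y \<ge> ln X powr a \<Longrightarrow> y powr (1 - d/2) + ln y \<le> c2 / (4 * real M2) * y" using E by blast
  have X1: "X > 1" using E10(2) by linarith
  have xp: "x > p + N" "x > 0" using E10(2) unfolding X_def by linarith+
  define s where "s = ln X"
  have s1: "s > 1" using E10(1) by (simp add: s_def)
  define x0 where "x0 = nat \<lceil>s powr a\<rceil>"
  have x0: "s powr a \<le> real x0" "real x0 \<le> s powr a + 1" unfolding x0_def using powr_ge_zero[of s a] by linarith+
  have x0p: "x0 > p" "x0 \<ge> 3" using x0 E8 unfolding s_def[symmetric] by linarith+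
  define y where "y = M2 * x0"
  have yx0: "real y \<ge> s powr a" "real y \<ge> 3"
  proof -
    have "1 * x0 \<le> y" unfolding y_def using M2(1) by (intro mult_right_mono) auto
    then show "real y \<ge> s powr a" "real y \<ge> 3" using x0(1) x0p(2) by linarith+
  qed
  have yX: "real y \<le> X powr d"
  proof -
    have "real y \<le> real M2 * (s powr a + 1)" unfolding y_def of_nat_mult using x0(2) by (intro mult_left_mono) auto
    then show ?thesis using E7 unfolding s_def by linarith
  qed
  define L where "L = {l \<in> {x0<..y}. prime l}"
  have finL: "finite L" by (simp add: L_def)
  define k where "k = real (card L)"
  have kL: "c2 * real x0 / ln (real y) \<le> k" unfolding k_def L_def y_def by (rule M2(3)) (use x0p in simp)
  have ly: "ln (real y) > 0" using yx0 by (intro ln_gt_zero) linarith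
  have k4: "s ^ 4 \<le> k"
  proof -
    have "s ^ 4 \<le> c2 * s powr a / ln (real M2 * (s powr a + 1))" using E1 unfolding s_def .
    also have "\<dots> \<le> c2 * real x0 / ln (real y)"
    proof (rule frac_le)
      have "real y \<le> real M2 * (s powr a + 1)" unfolding y_def of_nat_mult using x0(2) by (intro mult_left_mono) auto
      then show "ln (real y) \<le> ln (real M2 * (s powr a + 1))" using yx0 by (subst ln_le_cancel_iff) linarith+
    qed (use M2(2) x0 ly in auto)
    finally show ?thesis using kL by linarith
  qed
  have s4: "s ^ 4 \<ge> 1" using s1 by (intro one_le_power) auto
  have k1: "k \<ge> 1" using k4 s4 by linarith
  have Lne: "L \<noteq> {}" using k1 unfolding k_def by auto
  define Y where "Y = M1 * x + 1"
  have YX: "real Y = real M1 * X + 1" by (simp add: Y_def X_def)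
  \<comment> \<open>Primes within \<open>D\<close> of a square condition number about
    \<open>X^(1 - d)\<close>, which is negligible, and
    \<open>y^(2 t) H^2 \<le> 4 X^(2 - 2 d)\<close> still stays below \<open>D\<close>.\<close>
  define D where "D = nat \<lfloor>X powr (2 - d)\<rfloor>"
  have D: "real D \<le> X powr (2 - d)" "X powr (2 - d) - 1 < real D"
    unfolding D_def using powr_ge_zero[of X "2 - d"] by linarith+
  define H where "H = nat \<lceil>X powr d\<rceil>"
  have H: "X powr d \<le> real H" "real H \<le> 2 * X powr d" unfolding H_def using E10(4) by linarith+
  have H1: "H \<ge> 1" using H(1) E10(4) by linarith
  \<comment> \<open>With exponent 3/4 the about \<open>X^(3/4)\<close> moduli \<open>h\<close> and
    the about \<open>X^2 / H2^2 = X^(1/2)\<close> cofactors are both negligible against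
    \<open>X / ln X\<close>.\<close>
  define H2 where "H2 = nat \<lceil>X powr (3/4)\<rceil>"
  have H2: "X powr (3/4) \<le> real H2" "real H2 \<le> X powr (3/4) + 1" unfolding H2_def using powr_ge_zero[of X "3/4"] by linarith+
  have H2': "H2 > 0" "H2 \<le> x"
  proof -
    have "X powr (3/4) > 0" using X1 by simp
    then show "H2 > 0" using H2(1) by linarith
    show "H2 \<le> x" using H2(2) E9 unfolding X_def by linarith
  qed
  define z where "z = log 2 (2 * real p * (real M1 * X + 1)\<^sup>2)"
  have zarg: "2 * real p * (real M1 * X + 1)\<^sup>2 = real (2 * p * Y\<^sup>2)" using YX by simp
  have "2 * p * Y\<^sup>2 \<ge> 1" using p2 by (simp add: Y_def)
  then have arg1: "real (2 * p * Y\<^sup>2) \<ge> 1" by linarith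
  have z0: "z \<ge> 0" unfolding z_def zarg using arg1 by (simp add: zero_le_log_cancel_iff)
  define G where "G = nat \<lceil>z\<rceil>"
  have G: "z \<le> real G" "real G \<le> g X" unfolding G_def g_def z_def[symmetric] using z0 by linarith+
  have G2: "2 * p * Y\<^sup>2 < 2 ^ Suc G"
  proof -
    have "real (2 * p * Y\<^sup>2) = 2 powr z" unfolding z_def zarg using arg1 by simp
    also have "\<dots> \<le> 2 powr real G" using G(1) by (intro powr_mono) auto
    also have "\<dots> = real (2 ^ G)" by (simp add: powr_realpow)
    finally have "2 * p * Y\<^sup>2 \<le> 2 ^ G" by (simp only: of_nat_le_iff)
    moreover have "(2::nat) ^ G < 2 ^ Suc G" by simp
    ultimately show ?thesis by linarith
  qed
  define Qs where "Qs = {q \<in> {x<..M1 * x}. lps_prime p q}"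
  have cQ: "c1 * X / ln (real M1 * X) \<le> real (card Qs)" unfolding Qs_def X_def using M1(3)[of x] xp by simp
  have gX0: "0 \<le> g X" using G by linarith
  \<comment> \<open>One eighth of the lower bound for \<open>card Qs\<close>; the bad primes use up
    at most six eighths.\<close>
  define S where "S = c1 / 8 * X / ln (real M1 * X)"
  have S: "S > 0"
  proof -
    have "1 * 1 < real M1 * X" using X1 M1 by (intro mult_strict_mono) auto
    then show ?thesis unfolding S_def using M1(2) X1 by (intro divide_pos_pos mult_pos_pos ln_gt_zero) auto
  qed
  have main: "real G * (32 * (real Y / real (card L) + real M2 ^ 2 * real Y / real (card L) ^ 2 + real (M2 * x0) ^ 2)
       + 2 * real (D div x + 1) + real (\<Sum>h\<in>{H<..H2}. (Y div h\<^sup>2 + 1) * (3 * ndiv (h\<^sup>2))) + real ((2 * p * Y\<^sup>2) div H2\<^sup>2 * (12 * (G + 1)))) < real (card Qs)"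
    (is "real G * (32 * ?A + 2 * ?B + ?W + ?Z) < _")
  proof -
    have scale: "u * (32 * v) \<le> 2 * S" if "u * v \<le> (S + S) / 32" for u v :: real using that by simp
    have total: "u * (v1 + v2 + v3 + v4) \<le> 6 * S"
      if "u * v1 \<le> 2 * S" "u * v2 \<le> S" "u * v3 \<le> 2 * S" "u * v4 \<le> S" for u v1 v2 v3 v4 :: real
      using that by (simp add: distrib_left)
    have "?A \<le> (1 + (real M2)\<^sup>2) * (real M1 * X + 1) / s ^ 4 + (real M2 * (s powr a + 1))\<^sup>2"
    proof -
      have "real Y / k \<le> real Y / s ^ 4" using k4 k1 s1 by (intro divide_left_mono) auto
      moreover have "real M2 ^ 2 * real Y / k ^ 2 \<le> real M2 ^ 2 * real Y / s ^ 4"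
      proof -
        have "1 * k \<le> k * k" using k1 by (intro mult_right_mono) auto
        then have "s ^ 4 \<le> k ^ 2" using k4 by (simp add: power2_eq_square)
        then show ?thesis using s1 k1 by (intro divide_left_mono) auto
      qed
      moreover have "real (M2 * x0) ^ 2 \<le> (real M2 * (s powr a + 1))\<^sup>2"
        unfolding of_nat_mult using x0(2) by (intro power_mono mult_left_mono) auto
      ultimately have "?A \<le> real Y / s ^ 4 + real M2 ^ 2 * real Y / s ^ 4 + (real M2 * (s powr a + 1))\<^sup>2"
        unfolding k_def[symmetric] by linarith
      then show ?thesis unfolding YX[symmetric] by (simp add: add_divide_distrib distrib_right)
    qed
    then have "real G * ?A \<le> g X * ((1 + (real M2)\<^sup>2) * (real M1 * X + 1) / s ^ 4 + (real M2 * (s powr a + 1))\<^sup>2)"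
      using G(2) gX0 by (intro mult_mono) auto
    also have "\<dots> = (g X * (32 * ((1 + (real M2)\<^sup>2) * (real M1 * X + 1) / s ^ 4)) + g X * (32 * (real M2 * (s powr a + 1))\<^sup>2)) / 32"
      by (simp add: field_simps)
    also have "\<dots> \<le> (S + S) / 32"
      using E2(1,2) unfolding S_def[symmetric] s_def[symmetric] by (intro divide_right_mono add_mono) auto
    finally have "real G * ?A \<le> (S + S) / 32" .
    then have t1: "real G * (32 * ?A) \<le> 2 * S" by (rule scale)
    have "?B \<le> X powr (1 - d) + 1"
    proof -
      have "real (D div x) \<le> real D / X" unfolding X_def by (rule of_nat_div_le_of_nat)
      also have "\<dots> \<le> X powr (2 - d) / X" using D(1) X1 by (intro divide_right_mono) auto
      also have "\<dots> = X powr (1 - d)"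
      proof -
        have "X powr (2 - d) = X powr (1 - d) * X" using X1 by (simp add: powr_mult_base mult.commute)
        then show ?thesis using X1 by simp
      qed
      finally show ?thesis by simp
    qed
    then have "real G * (2 * ?B) \<le> g X * (2 * (X powr (1 - d) + 1))" using G(2) gX0 by (intro mult_mono) auto
    then have t2: "real G * (2 * ?B) \<le> S" using E2(3) unfolding S_def by linarith
    have "?W \<le> 3 * C * X powr (d / 2) * (real Y / real H + real H2)"
      unfolding X_def by (rule sum_square_divisor_bound[OF C d(1) H1 H2'(2) xp(2)])
    also have "\<dots> \<le> 3 * C * X powr (d / 2) * ((real M1 * X + 1) / X powr d + (X powr (3/4) + 1))"
    proof -
      have "real Y / real H \<le> (real M1 * X + 1) / X powr d" by (rule frac_le) (use H(1) E10(4) YX in auto)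
      then show ?thesis using C(1) H2(2) by (intro mult_left_mono add_mono) auto
    qed
    finally have "real G * ?W \<le> g X * (3 * C * X powr (d / 2) * ((real M1 * X + 1) / X powr d + (X powr (3/4) + 1)))"
      by (rule mult_mono[OF G(2) _ gX0 of_nat_0_le_iff])
    also have "\<dots> = g X * (3 * C * X powr (d/2) * ((real M1 * X + 1) / X powr d)) + g X * (3 * C * X powr (d/2) * (X powr (3/4) + 1))"
      by (simp only: distrib_left)
    finally have t3: "real G * ?W \<le> 2 * S" using E2(4,5) unfolding S_def by linarith
    have "?Z = real ((2 * p * Y\<^sup>2) div H2\<^sup>2) * (12 * (real G + 1))" by simp
    also have "\<dots> \<le> (2 * real p * (real M1 * X + 1)\<^sup>2 / X powr (3/2)) * (12 * (g X + 1))"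
    proof (intro mult_mono)
      have "real ((2 * p * Y\<^sup>2) div H2\<^sup>2) \<le> real (2 * p * Y\<^sup>2) / real (H2\<^sup>2)" by (rule of_nat_div_le_of_nat)
      also have "\<dots> \<le> real (2 * p * Y\<^sup>2) / X powr (3/2)"
      proof (rule divide_left_mono)
        have "X powr (3/2) = X powr (3/4) * X powr (3/4)" by (simp add: powr_add[symmetric])
        also have "\<dots> \<le> real H2 * real H2" using H2(1) by (intro mult_mono) auto
        finally show "X powr (3/2) \<le> real (H2\<^sup>2)" by (simp add: power2_eq_square)
      qed (use X1 H2' in auto)
      finally show "real ((2 * p * Y\<^sup>2) div H2\<^sup>2) \<le> 2 * real p * (real M1 * X + 1)\<^sup>2 / X powr (3/2)" unfolding zarg .
    qed (use G gX0 in auto)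
    finally have "real G * ?Z \<le> g X * (2 * real p * (real M1 * X + 1)\<^sup>2 / X powr (3/2) * (12 * (g X + 1)))"
      by (rule mult_mono[OF G(2) _ gX0 of_nat_0_le_iff])
    then have t4: "real G * ?Z \<le> S" using E2(6) unfolding S_def by linarith
    have "real G * (32 * ?A + 2 * ?B + ?W + ?Z) \<le> 6 * S" by (rule total[OF t1 t2 t3 t4])
    also have "\<dots> < 8 * S" using S by simp
    also have "8 * S = c1 * X / ln (real M1 * X)" by (simp add: S_def)
    finally show ?thesis using cQ by linarith
  qed
  have Qs1: "finite Qs" by (simp add: Qs_def)
  have Qs2: "prime q \<and> q \<noteq> p \<and> x < q \<and> q < Y" if "q \<in> Qs" for q
    using that xp unfolding Qs_def lps_prime_def Y_def by auto
  have L1: "L \<subseteq> {x0<..M2 * x0}" by (auto simp: L_def y_def)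
  have L2: "prime l \<and> l > 2 \<and> l \<noteq> p" if "l \<in> L" for l using that x0p by (auto simp: L_def)
  have x00: "x0 > 0" using x0p by simp
  obtain q where qQ: "q \<in> Qs"
    and near: "\<And>m r. m \<ge> 1 \<Longrightarrow> p ^ m \<le> 2 * p * q\<^sup>2 \<Longrightarrow> r \<in> {1,2} \<Longrightarrow> r * q\<^sup>2 < p ^ m \<Longrightarrow> r * q\<^sup>2 + D \<le> p ^ m"
    and content: "\<And>m h. m \<ge> 1 \<Longrightarrow> p ^ m \<le> 2 * p * q\<^sup>2 \<Longrightarrow> q\<^sup>2 < p ^ m \<Longrightarrow> h\<^sup>2 dvd p ^ m - q\<^sup>2 \<Longrightarrow> h \<le> H"
    and var: "\<And>m r. m \<ge> 1 \<Longrightarrow> p ^ m \<le> 2 * p * q\<^sup>2 \<Longrightarrow> r \<in> {1,2::nat} \<Longrightarrow>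
      real_of_int (\<Sum>l\<in>L. Legendre ((int r * int q)\<^sup>2 - int (r * p ^ m)) (int l)) \<ge> - (real (card L) / 4)"
    using exists_good_prime[OF p(1) p2 Qs1 Qs2 L1 L2 Lne x00 xp(2) H2'(1) G2 main] by blast
  have qx: "x < q" "q \<le> M1 * x" "lps_prime p q" using qQ by (auto simp: Qs_def)
  interpret lps_graph p q
    by unfold_locales (use p qx xp in \<open>auto simp: lps_prime_def\<close>)
  have qX: "real q \<le> real M1 * X" using qx(2) unfolding X_def by (simp only: of_nat_mult[symmetric] of_nat_le_iff)
  define t where "t = nat \<lfloor>(1 - 2 * d) * ln X / ln (real y)\<rfloor>"
  define w where "w = card L div 4"
  have w: "k / 4 - 1 \<le> real w" "4 * real w \<le> k" unfolding w_def k_def by linarith+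
  have ws: "real w \<ge> real y powr (1 - d) * (ln X / ln (real y))"
  proof -
    have "s \<le> real y powr (d / 2)"
    proof -
      have "1 \<le> a * (d / 2)" using a(2) d(1) by (simp add: field_simps)
      then have "s powr 1 \<le> s powr (a * (d / 2))" using s1 by (intro powr_mono) auto
      also have "\<dots> = (s powr a) powr (d / 2)" by (simp only: powr_powr)
      also have "\<dots> \<le> real y powr (d / 2)" using yx0(1) d by (intro powr_mono2) auto
      finally show ?thesis using s1 by simp
    qed
    then have "real y powr (1 - d) * s \<le> real y powr (1 - d) * real y powr (d / 2)" by (intro mult_left_mono) auto
    also have "\<dots> = real y powr (1 - d / 2)" by (simp add: powr_add[symmetric])
    also have "\<dots> \<le> c2 / (4 * real M2) * real y - ln (real y)" using E11[of "real y"] yx0(1) unfolding s_def by linarith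
    finally have "real y powr (1 - d) * s + ln (real y) \<le> c2 * real x0 / 4" using pos(3) by (simp add: y_def)
    also have "\<dots> \<le> k * ln (real y) / 4" using kL ly by (simp add: pos_divide_le_eq)
    also have "\<dots> = k / 4 * ln (real y)" by simp
    also have "\<dots> \<le> (real w + 1) * ln (real y)" using w(1) ly by (intro mult_right_mono) auto
    finally have "real y powr (1 - d) * s \<le> real w * ln (real y)" by (simp add: algebra_simps)
    then show ?thesis using ly unfolding s_def by (simp add: pos_divide_le_eq)
  qed
  have y1: "real y > 1" using yx0(2) by linarith
  note ch = choose_lower_bound[OF d y1 X1 yX ws t_def]
  have c3: "2 * real w + log 2 (4 * real p * real q ^ 2) \<le> 3 / 4 * real (card L)"
  proof -
    have "log 2 (4 * real p * real q ^ 2) \<le> log 2 (4 * real p * (real M1 * X)\<^sup>2)"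
    proof (subst log_le_cancel_iff)
      show "4 * real p * real q ^ 2 \<le> 4 * real p * (real M1 * X)\<^sup>2" using qX by (intro mult_left_mono power_mono) auto
      show "0 < 4 * real p * real q ^ 2" using pos q_gt_2 by simp
      show "0 < 4 * real p * (real M1 * X)\<^sup>2" using pos X1 by simp
    qed simp
    then have "log 2 (4 * real p * real q ^ 2) \<le> k / 4" using E3 k4 unfolding s_def by linarith
    then show ?thesis using w(2) unfolding k_def by linarith
  qed
  have c4: "y ^ (2 * t) * H\<^sup>2 < D"
  proof -
    have "real (y ^ (2 * t) * H\<^sup>2) = real y ^ (2 * t) * real H ^ 2" by simp
    also have "\<dots> \<le> X powr (2 - 4 * d) * (2 * X powr d) ^ 2" using ch(2) H(2) by (intro mult_mono power_mono) auto
    also have "\<dots> = 4 * X powr (2 - 2 * d)"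
    proof -
      have "X powr (2 - 4 * d) * (X powr d * X powr d) = X powr (2 - 2 * d)" by (simp only: powr_add[symmetric]) simp
      then show ?thesis by (simp add: power2_eq_square)
    qed
    also have "\<dots> < real D" using E4 D(2) by linarith
    finally show ?thesis by (simp only: of_nat_less_iff)
  qed
  have G3: "2 * p * q\<^sup>2 < 2 ^ Suc G"
  proof -
    have "2 * p * q\<^sup>2 \<le> 2 * p * Y\<^sup>2" using Qs2[OF qQ] by (intro mult_left_mono power_mono) auto
    then show ?thesis using G2 by linarith
  qed
  have L3: "prime l \<and> l > 2 \<and> l \<le> y" if "l \<in> L" for l using that L2[OF that] by (simp add: L_def)
  have "card V * (w choose t) \<le> 4 * G * kiss V E"
    by (rule kiss_ge_choose[OF near content var finL L3 c3 c4 G3 H1])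
  then have "real (card V * (w choose t)) \<le> real (4 * G * kiss V E)" by (simp only: of_nat_le_iff)
  then have kk: "real (card V) * real (w choose t) \<le> 4 * real G * real (kiss V E)" by simp
  have "real (card V) * X powr (1 - 4 * d) \<le> real (card V) * real (w choose t)" using ch(1) by (intro mult_left_mono) auto
  also have "\<dots> \<le> 4 * real G * real (kiss V E)" by (rule kk)
  also have "\<dots> \<le> X powr d * real (kiss V E)" using G(2) E5 by (intro mult_right_mono) auto
  finally have "real (card V) * (X powr (1 - 5 * d) * X powr d) \<le> X powr d * real (kiss V E)"
    by (simp add: powr_add[symmetric])
  then have "X powr d * (real (card V) * X powr (1 - 5 * d)) \<le> X powr d * real (kiss V E)" by (simp only: mult_ac)
  then have k5: "real (card V) * X powr (1 - 5 * d) \<le> real (kiss V E)"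
    using E10(4) X1 by (simp add: mult_le_cancel_left)
  have VX: "real (card V) \<le> X powr (3 + 3 * d)"
  proof -
    have "real (card V) \<le> real (2 * q ^ 3)" using card_V by (simp only: of_nat_le_iff)
    also have "\<dots> = 2 * real q ^ 3" by simp
    also have "\<dots> \<le> 2 * (real M1 * X) ^ 3" using qX by (intro mult_left_mono power_mono) auto
    finally show ?thesis using E6 by linarith
  qed
  \<comment> \<open>The exponents are arranged so that
    \<open>(3 + 3 d) (1/3 - 2 d) = 1 - 5 d - 6 d^2\<close>, just below the \<open>1 - 5 d\<close>
    left after paying \<open>4 d\<close> for the choice of subsets and \<open>d\<close> for the
    factor \<open>4 G\<close>.\<close>
  have "real (card V) powr (1/3 - 2 * d) \<le> (X powr (3 + 3 * d)) powr (1/3 - 2 * d)" using VX d by (intro powr_mono2) auto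
  also have "\<dots> = X powr ((3 + 3 * d) * (1/3 - 2 * d))" by (simp only: powr_powr)
  also have "\<dots> \<le> X powr (1 - 5 * d)" using X1 d by (intro powr_mono) (auto simp: algebra_simps)
  finally have v: "real (card V) powr (1/3 - 2 * d) \<le> X powr (1 - 5 * d)" .
  have "real (card V) powr (4/3 - 2 * d) = real (card V) * real (card V) powr (1/3 - 2 * d)"
    by (simp add: powr_mult_base)
  also have "\<dots> \<le> real (card V) * X powr (1 - 5 * d)" using v by (intro mult_left_mono) auto
  also have "\<dots> \<le> real (kiss V E)" by (rule k5)
  finally show ?thesis using qx xp by (intro exI[of _ q]) auto
qed

theorem theorem3p1:
  fixes p :: nat
  assumes "prime p" and "p mod 4 = 1"
  shows "(\<forall>\<epsilon>::real. \<epsilon> > 0 \<longrightarrow>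
            (\<exists>Q::nat. \<forall>q::nat. prime q \<and> q mod 4 = 1 \<and> Legendre (int p) (int q) = -1 \<and> q \<ge> Q
               \<longrightarrow> real (kiss (XV p q) (XE p q)) \<le> real (card (XV p q)) powr (4/3 + \<epsilon>)))
       \<and> (\<exists>qs :: nat \<Rightarrow> nat. strict_mono qs
            \<and> (\<forall>k. prime (qs k) \<and> qs k mod 4 = 1 \<and> Legendre (int p) (int (qs k)) = -1)
            \<and> (\<forall>\<epsilon>::real. \<epsilon> > 0 \<longrightarrow> (\<exists>K. \<forall>k \<ge> K.
                 real (kiss (XV p (qs k)) (XE p (qs k))) \<ge> real (card (XV p (qs k))) powr (4/3 - \<epsilon>))))"
proof (rule conjI)
  note p = assms
  show "\<forall>\<epsilon>::real. \<epsilon> > 0 \<longrightarrow>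
            (\<exists>Q::nat. \<forall>q::nat. prime q \<and> q mod 4 = 1 \<and> Legendre (int p) (int q) = -1 \<and> q \<ge> Q
               \<longrightarrow> real (kiss (XV p q) (XE p q)) \<le> real (card (XV p q)) powr (4/3 + \<epsilon>))"
  proof (intro allI impI)
    fix \<epsilon> :: real assume "\<epsilon> > 0"
    then obtain Q where Q: "\<And>q. lps_graph p q \<Longrightarrow> q \<ge> Q \<Longrightarrow> real (kiss (XV p q) (XE p q)) \<le> real (card (XV p q)) powr (4/3 + \<epsilon>)"
      using kiss_upper by blast
    show "\<exists>Q::nat. \<forall>q::nat. prime q \<and> q mod 4 = 1 \<and> Legendre (int p) (int q) = -1 \<and> q \<ge> Q
               \<longrightarrow> real (kiss (XV p q) (XE p q)) \<le> real (card (XV p q)) powr (4/3 + \<epsilon>)"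
    proof (intro exI[of _ "max Q (p + 1)"] allI impI)
      fix q assume q: "prime q \<and> q mod 4 = 1 \<and> Legendre (int p) (int q) = -1 \<and> q \<ge> max Q (p + 1)"
      have "lps_graph p q" by unfold_locales (use p q in auto)
      then show "real (kiss (XV p q) (XE p q)) \<le> real (card (XV p q)) powr (4/3 + \<epsilon>)" using Q q by simp
    qed
  qed
  \<comment> \<open>Within the admissible range \<open>d \<le> 1/8\<close> and tending to 0, so that
    one sequence serves every \<open>\<epsilon>\<close>.\<close>
  define d where "d k = 1 / real (k + 8)" for k :: nat
  have d: "0 < d k" "d k \<le> 1/8" for k by (auto simp: d_def field_simps)
  define good where "good k q \<longleftrightarrow> lps_prime p q \<and> real (card (XV p q)) powr (4/3 - 2 * d k) \<le> real (kiss (XV p q) (XE p q))" for k q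
  have "\<forall>k N. \<exists>q>N. good k q" unfolding good_def using exists_prime_large_kiss[OF p d] by blast
  then have "\<exists>f. (\<forall>k. good k (f k)) \<and> (\<forall>k. f k < f (Suc k))"
    using dependent_nat_choice[of "good" "\<lambda>_ q q'. q < q'"] by metis
  then obtain qs where qs: "\<And>k. good k (qs k)" "\<And>k. qs k < qs (Suc k)" by blast
  show "\<exists>qs :: nat \<Rightarrow> nat. strict_mono qs
            \<and> (\<forall>k. prime (qs k) \<and> qs k mod 4 = 1 \<and> Legendre (int p) (int (qs k)) = -1)
            \<and> (\<forall>\<epsilon>::real. \<epsilon> > 0 \<longrightarrow> (\<exists>K. \<forall>k \<ge> K.
                 real (kiss (XV p (qs k)) (XE p (qs k))) \<ge> real (card (XV p (qs k))) powr (4/3 - \<epsilon>)))"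
  proof (intro exI[of _ qs] conjI allI impI)
    show "strict_mono qs" using qs(2) by (simp add: strict_mono_Suc_iff)
    show "prime (qs k)" "qs k mod 4 = 1" "Legendre (int p) (int (qs k)) = -1" for k
      using qs(1)[of k] by (auto simp: good_def lps_prime_def)
    fix \<epsilon> :: real assume e: "\<epsilon> > 0"
    \<comment> \<open>Only a vertex count of at least 1 is wanted here, so that lowering the
      exponent lowers the power.\<close>
    obtain Q where Q: "\<And>q. lps_graph p q \<Longrightarrow> q \<ge> Q \<Longrightarrow> real q powr (3 - 1) \<le> real (card (XV p q))"
      using card_V_lower[of 1 p] by auto
    have mono: "k \<le> qs k" for k using qs(2) by (intro strict_mono_imp_increasing) (simp add: strict_mono_Suc_iff)
    show "\<exists>K. \<forall>k \<ge> K. real (kiss (XV p (qs k)) (XE p (qs k))) \<ge> real (card (XV p (qs k))) powr (4/3 - \<epsilon>)"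
    proof (intro exI[of _ "max (p + 1) (max Q (nat \<lceil>2 / \<epsilon>\<rceil>))"] allI impI)
      fix k assume k: "k \<ge> max (p + 1) (max Q (nat \<lceil>2 / \<epsilon>\<rceil>))"
      have g: "lps_graph p (qs k)"
        by unfold_locales (use p qs(1)[of k] mono[of k] k in \<open>auto simp: good_def lps_prime_def\<close>)
      have "1 \<le> real (qs k) powr (3 - 1)"
        using mono[of k] k by (intro ge_one_powr_ge_zero) auto
      then have V1: "1 \<le> real (card (XV p (qs k)))" using Q[OF g] mono[of k] k by linarith
      have "2 / \<epsilon> \<le> real (k + 8)" using k by linarith
      then have "2 * d k \<le> \<epsilon>" using e by (simp add: d_def field_simps)
      then have "real (card (XV p (qs k))) powr (4/3 - \<epsilon>) \<le> real (card (XV p (qs k))) powr (4/3 - 2 * d k)"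
        using V1 by (intro powr_mono) auto
      then show "real (kiss (XV p (qs k)) (XE p (qs k))) \<ge> real (card (XV p (qs k))) powr (4/3 - \<epsilon>)"
        using qs(1)[of k] unfolding good_def by linarith
    qed
  qed
qed

end
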